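(* The canonical morphism of properads $\iota\colon\mathsf{BIB}^!\to\mathsf{uBIB}^!$ (sending each generator $m,\Delta$ to the generator of the same name) is an inclusion, i.e. it is injective.
   Context: Ground field $\Bbbk$ of characteristic $0$; graded modules, Koszul sign rule. A $\Sigma$-bimodule $\mathsf{E}$ is a collection of $(\Sigma_m,\Sigma_n)$-bimodules $\mathsf{E}(m,n)$ ($m$ outputs, $n$ inputs) with $\mathsf{E}(0,n)=0$. A properad is an algebra over the monad $\mathcal{G}$ of connected directed graphs (without directed cycles) with vertices decorated by $\mathsf{E}$; $\mathcal{G}(\mathsf{E})$ is the free properad. Elements are written as composites of operations: $f\circ g$ means that $g$ is applied first, $f\otimes g=(f\otimes\mathrm{id})\circ(\mathrm{id}\otimes g)$, and $\tau$ is the symmetry exchanging two strands (degree $0$; it only permutes labels). $\mathsf{BIB}^!$ is the Koszul dual properad of the properad of balanced infinitesimal bialgebras with coproduct of degree $-1$: it is generated by $m$ of arity $(1,2)$ and degree $-1$, and $\Delta$ of arity $(2,1)$ and degree $0$ (each generating a free $\Sigma_2$-module), with relations generated by $m(\mathrm{id}\otimes m)+m(m\otimes \mathrm{id})$; $(\mathrm{id}\otimes\Delta)\Delta-(\Delta\otimes\mathrm{id})\Delta$; $-\Delta m+(m\otimes \mathrm{id})(\mathrm{id}\otimes\Delta)$; $-\Delta m+(\mathrm{id}\otimes m)(\Delta\otimes\mathrm{id})$; $B+\tau B\tau$; $B+D\tau$; $m\Delta$; $m\tau\Delta$, where $B=(\mathrm{id}\otimes m)(\tau\otimes\mathrm{id})(\mathrm{id}\otimes\Delta)$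 and $D=(m\otimes\mathrm{id})(\mathrm{id}\otimes\tau)(\Delta\otimes\mathrm{id})$. $\mathsf{uBIB}^!$ is its unital extension: the properad generated by $m$ of arity $(1,2)$ and degree $-1$, $\Delta$ of arity $(2,1)$ and degree $0$ (each generating a free $\Sigma_2$-module), and an additional generator $u$ of arity $(1,0)$ and degree $1$, with the relations of $\mathsf{BIB}^!$ together with the unit relations $m(u\otimes\mathrm{id})=-\mathrm{id}$ and $m(\mathrm{id}\otimes u)=\mathrm{id}$. *)

theory Defs
  imports Complex_Main "HOL-Library.Poly_Mapping" "HOL-Combinatorics.Permutations"
begin

section \<open>Decorated directed graphs\<close>

datatype generator = Mult | Comult | Unit

fun n_in :: "generator \<Rightarrow> nat" where
  "n_in Mult = 2" | "n_in Comult = 1" | "n_in Unit = 0"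

fun n_out :: "generator \<Rightarrow> nat" where
  "n_out Mult = 1" | "n_out Comult = 2" | "n_out Unit = 1"

fun deg :: "generator \<Rightarrow> int" where
  "deg Mult = -1" | "deg Comult = 0" | "deg Unit = 1"

text \<open>
  An edge runs from a source port to a target port. As a source, \<open>Ext i\<close> is the \<open>i\<close>-th input of the
  whole graph and \<open>Vtx v j\<close> is the \<open>j\<close>-th output of the vertex \<open>v\<close>; as a target, \<open>Ext i\<close> is the
  \<open>i\<close>-th output of the whole graph and \<open>Vtx v j\<close> is the \<open>j\<close>-th input of \<open>v\<close>.
  The flags at a vertex are numbered, so a vertex carries an element of the standard basis of a free
  bimodule (\<open>\<Sigma>\<^sub>2\<close> acting freely on the inputs of \<open>Mult\<close> and on the outputs of \<open>Comult\<close>).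
  The order of the list of vertices is the order in which the decorations are
  multiplied; it matters only up to the Koszul sign imposed below.
\<close>

datatype port = Ext nat | Vtx nat nat

record graph =
  ins :: nat
  outs :: nat
  verts :: "generator list"
  wire :: "port \<Rightarrow> port"

definition sources :: "graph \<Rightarrow> port set" where
  "sources G = {Ext i | i. i < ins G} \<union>
     {Vtx v j | v j. v < length (verts G) \<and> j < n_out (verts G ! v)}"

definition targets :: "graph \<Rightarrow> port set" where
  "targets G = {Ext i | i. i < outs G} \<union>
     {Vtx v j | v j. v < length (verts G) \<and> j < n_in (verts G ! v)}"

definition vertex_rel :: "graph \<Rightarrow> (nat \<times> nat) set" where
  "vertex_rel G = {(v, w). \<exists>i j. Vtx v i \<in> sources G \<and> wire G (Vtx v i) = Vtx w j}"

definition dag :: "graph \<Rightarrow> bool" where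
  "dag G \<longleftrightarrow> bij_betw (wire G) (sources G) (targets G) \<and> acyclic (vertex_rel G)"

definition incident :: "graph \<Rightarrow> nat \<Rightarrow> port set" where
  "incident G v = {s \<in> sources G. (\<exists>j. s = Vtx v j) \<or> (\<exists>j. wire G s = Vtx v j)}"

definition edge_adj :: "graph \<Rightarrow> (port \<times> port) set" where
  "edge_adj G = (\<Union>v<length (verts G). incident G v \<times> incident G v)"

text \<open>
  Edges are identified with their sources. Every vertex has an output, hence lies on some edge, so
  a graph is connected iff it has an edge and any two edges are linked by a chain of
  edges in which consecutive ones share a vertex. The graph with one edge and no vertices counts as
  connected; the empty graph does not.
\<close>

definition connected_graph :: "graph \<Rightarrow> bool" where
  "connected_graph G \<longleftrightarrow>
     sources G \<noteq> {} \<and> (\<forall>s\<in>sources G. \<forall>t\<in>sources G. (s, t) \<in> (edge_adj G)\<^sup>*)"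

definition cgraphs :: "generator set \<Rightarrow> nat \<Rightarrow> nat \<Rightarrow> graph set" where
  "cgraphs S a b =
     {G. outs G = a \<and> ins G = b \<and> set (verts G) \<subseteq> S \<and> dag G \<and> connected_graph G}"

fun relabel :: "(nat \<Rightarrow> nat) \<Rightarrow> port \<Rightarrow> port" where
  "relabel \<pi> (Ext i) = Ext i"
| "relabel \<pi> (Vtx v j) = Vtx (\<pi> v) j"

definition graph_iso :: "(nat \<Rightarrow> nat) \<Rightarrow> graph \<Rightarrow> graph \<Rightarrow> bool" where
  "graph_iso \<pi> G H \<longleftrightarrow>
     ins H = ins G \<and> outs H = outs G \<and> length (verts H) = length (verts G) \<and>
     \<pi> permutes {..<length (verts G)} \<and>
     (\<forall>v<length (verts G). verts H ! \<pi> v = verts G ! v) \<and>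
     (\<forall>s\<in>sources G. wire H (relabel \<pi> s) = relabel \<pi> (wire G s))"

definition koszul_sign :: "(nat \<Rightarrow> nat) \<Rightarrow> graph \<Rightarrow> 'k::comm_ring_1" where
  "koszul_sign \<pi> G =
     (-1) ^ card {(v, w). v < w \<and> w < length (verts G) \<and> \<pi> w < \<pi> v \<and>
                          odd (deg (verts G ! v)) \<and> odd (deg (verts G ! w))}"

definition graph_deg :: "graph \<Rightarrow> int" where
  "graph_deg G = sum_list (map deg (verts G))"


section \<open>Composites of graphs\<close>

definition perm_graph :: "nat \<Rightarrow> (nat \<Rightarrow> nat) \<Rightarrow> graph" where
  "perm_graph n \<sigma> = \<lparr>ins = n, outs = n, verts = [], wire =
     (\<lambda>s. case s of Ext i \<Rightarrow> Ext (\<sigma> i) | Vtx v j \<Rightarrow> Vtx v j)\<rparr>"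

definition id_graph :: "nat \<Rightarrow> graph" where
  "id_graph n = perm_graph n id"

definition gen_graph :: "generator \<Rightarrow> graph" where
  "gen_graph g = \<lparr>ins = n_in g, outs = n_out g, verts = [g],
     wire = (\<lambda>s. case s of Ext i \<Rightarrow> Vtx 0 i | Vtx v j \<Rightarrow> Ext j)\<rparr>"

text \<open>
  \<open>gcomp G H\<close> plugs the outputs of \<open>H\<close> into the inputs of \<open>G\<close>, and \<open>gtensor G H\<close> puts \<open>G\<close> to the left
  of \<open>H\<close>. In both, the vertices of \<open>G\<close> come first, so that
  \<open>gtensor G H\<close> is \<open>(G \<otimes> id) \<circ> (id \<otimes> H)\<close> including its sign.
\<close>

definition gcomp :: "graph \<Rightarrow> graph \<Rightarrow> graph" where
  "gcomp G H = (let n = length (verts G);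
       through = (\<lambda>t. case t of Ext i \<Rightarrow> wire G (Ext i) | Vtx w j \<Rightarrow> Vtx (w + n) j) in
     \<lparr>ins = ins H, outs = outs G, verts = verts G @ verts H,
      wire = (\<lambda>s. case s of
          Ext i \<Rightarrow> through (wire H (Ext i))
        | Vtx v j \<Rightarrow> if v < n then wire G (Vtx v j) else through (wire H (Vtx (v - n) j)))\<rparr>)"

definition gtensor :: "graph \<Rightarrow> graph \<Rightarrow> graph" where
  "gtensor G H = (let n = length (verts G);
       shift = (\<lambda>t. case t of Ext i \<Rightarrow> Ext (i + outs G) | Vtx w j \<Rightarrow> Vtx (w + n) j) in
     \<lparr>ins = ins G + ins H, outs = outs G + outs H, verts = verts G @ verts H,
      wire = (\<lambda>s. case s of
          Ext i \<Rightarrow> if i < ins G then wire G (Ext i) else shift (wire H (Ext (i - ins G)))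
        | Vtx v j \<Rightarrow> if v < n then wire G (Vtx v j) else shift (wire H (Vtx (v - n) j)))\<rparr>)"

text \<open>
  The composite along \<open>k\<close> edges: the first \<open>k\<close> outputs of \<open>H\<close> are plugged into the last \<open>k\<close> inputs
  of \<open>G\<close>. For \<open>k \<ge> 1\<close> this keeps connectedness, and together with the symmetric
  group actions it yields all composites along connected graphs.
\<close>

definition gjoin :: "nat \<Rightarrow> graph \<Rightarrow> graph \<Rightarrow> graph" where
  "gjoin k G H =
     gcomp (gtensor G (id_graph (outs H - k))) (gtensor (id_graph (ins G - k)) H)"


section \<open>Linear combinations of graphs\<close>

type_synonym 'k lin = "graph \<Rightarrow>\<^sub>0 'k"

definition single1 :: "graph \<Rightarrow> 'k::field_char_0 lin" where
  "single1 G = Poly_Mapping.single G 1"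

definition scale :: "'k::field_char_0 \<Rightarrow> 'k lin \<Rightarrow> 'k lin" where
  "scale c x = Poly_Mapping.map ((*) c) x"

definition bilin :: "(graph \<Rightarrow> graph \<Rightarrow> graph) \<Rightarrow> 'k::field_char_0 lin \<Rightarrow> 'k lin \<Rightarrow> 'k lin" where
  "bilin f x y = (\<Sum>G\<in>Poly_Mapping.keys x. \<Sum>H\<in>Poly_Mapping.keys y.
     Poly_Mapping.single (f G H) (Poly_Mapping.lookup x G * Poly_Mapping.lookup y H))"

definition comp_lin :: "'k::field_char_0 lin \<Rightarrow> 'k lin \<Rightarrow> 'k lin"  (infixr \<open>\<odot>\<close> 70) where
  "x \<odot> y = bilin gcomp x y"

definition tensor_lin :: "'k::field_char_0 lin \<Rightarrow> 'k lin \<Rightarrow> 'k lin"  (infixr \<open>\<otimes>\<close> 75) where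
  "x \<otimes> y = bilin gtensor x y"

definition act_lin :: "nat \<Rightarrow> nat \<Rightarrow> (nat \<Rightarrow> nat) \<Rightarrow> (nat \<Rightarrow> nat) \<Rightarrow> 'k::field_char_0 lin \<Rightarrow> 'k lin" where
  "act_lin a b \<sigma> \<rho> x = single1 (perm_graph a \<sigma>) \<odot> x \<odot> single1 (perm_graph b \<rho>)"

definition free :: "generator set \<Rightarrow> nat \<Rightarrow> nat \<Rightarrow> 'k::field_char_0 lin set" where
  "free S a b = {x. Poly_Mapping.keys x \<subseteq> cgraphs S a b}"


section \<open>Properads presented by generators and relations\<close>

text \<open>
  The underlying graded bimodule of a properad (\<open>elems P a b\<close> with \<open>a\<close> outputs and \<open>b\<close> inputs,
  \<open>homog P a b d\<close> its part of degree \<open>d\<close>) with its actions, unit and composites. The indices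
  \<open>a b c d\<close> are the arities of the arguments.
\<close>

record ('k, 'x) properad =
  elems :: "nat \<Rightarrow> nat \<Rightarrow> 'x set"
  homog :: "nat \<Rightarrow> nat \<Rightarrow> int \<Rightarrow> 'x set"
  padd :: "nat \<Rightarrow> nat \<Rightarrow> 'x \<Rightarrow> 'x \<Rightarrow> 'x"
  pscale :: "nat \<Rightarrow> nat \<Rightarrow> 'k \<Rightarrow> 'x \<Rightarrow> 'x"
  pact :: "nat \<Rightarrow> nat \<Rightarrow> (nat \<Rightarrow> nat) \<Rightarrow> (nat \<Rightarrow> nat) \<Rightarrow> 'x \<Rightarrow> 'x"
  pone :: 'x
  pcomp :: "nat \<Rightarrow> nat \<Rightarrow> nat \<Rightarrow> nat \<Rightarrow> nat \<Rightarrow> 'x \<Rightarrow> 'x \<Rightarrow> 'x"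

definition properad_hom ::
    "('k, 'x) properad \<Rightarrow> ('k, 'y) properad \<Rightarrow> (nat \<Rightarrow> nat \<Rightarrow> 'x \<Rightarrow> 'y) \<Rightarrow> bool" where
  "properad_hom P Q f \<longleftrightarrow>
     (\<forall>a b. \<forall>X\<in>elems P a b. f a b X \<in> elems Q a b) \<and>
     (\<forall>a b d. \<forall>X\<in>homog P a b d. f a b X \<in> homog Q a b d) \<and>
     (\<forall>a b. \<forall>X\<in>elems P a b. \<forall>Y\<in>elems P a b.
        f a b (padd P a b X Y) = padd Q a b (f a b X) (f a b Y)) \<and>
     (\<forall>a b c. \<forall>X\<in>elems P a b. f a b (pscale P a b c X) = pscale Q a b c (f a b X)) \<and>
     (\<forall>a b \<sigma> \<rho>. \<forall>X\<in>elems P a b. \<sigma> permutes {..<a} \<longrightarrow> \<rho> permutes {..<b} \<longrightarrow>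
        f a b (pact P a b \<sigma> \<rho> X) = pact Q a b \<sigma> \<rho> (f a b X)) \<and>
     f 1 1 (pone P) = pone Q \<and>
     (\<forall>a b c d k. \<forall>X\<in>elems P a b. \<forall>Y\<in>elems P c d. 1 \<le> k \<longrightarrow> k \<le> b \<longrightarrow> k \<le> c \<longrightarrow>
        f (a + c - k) (b + d - k) (pcomp P a b c d k X Y) =
          pcomp Q a b c d k (f a b X) (f c d Y))"

text \<open>
  \<open>null S R a b\<close> consists of the combinations of graphs that vanish in arity \<open>(a, b)\<close>: it
  is the smallest family of subspaces that identifies isomorphic graphs up to the Koszul sign
  (giving the free properad on \<open>S\<close>), contains \<open>R\<close>, and is stable under the properad operations.
\<close>

inductive null :: "generator set \<Rightarrow> 'k::field_char_0 lin set \<Rightarrow> nat \<Rightarrow> nat \<Rightarrow> 'k lin \<Rightarrow> bool"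
  for S :: "generator set" and R :: "'k::field_char_0 lin set" where
  null_iso: "G \<in> cgraphs S a b \<Longrightarrow> H \<in> cgraphs S a b \<Longrightarrow> graph_iso \<pi> G H \<Longrightarrow>
     null S R a b (single1 G - scale (koszul_sign \<pi> G) (single1 H))"
| null_rel: "r \<in> R \<Longrightarrow> r \<in> free S a b \<Longrightarrow> null S R a b r"
| null_zero: "null S R a b 0"
| null_add: "null S R a b x \<Longrightarrow> null S R a b y \<Longrightarrow> null S R a b (x + y)"
| null_scale: "null S R a b x \<Longrightarrow> null S R a b (scale c x)"
| null_act: "null S R a b x \<Longrightarrow> \<sigma> permutes {..<a} \<Longrightarrow> \<rho> permutes {..<b} \<Longrightarrow>
     null S R a b (act_lin a b \<sigma> \<rho> x)"
| null_join_left: "null S R a b x \<Longrightarrow> y \<in> free S c d \<Longrightarrow> 1 \<le> k \<Longrightarrow> k \<le> b \<Longrightarrow> k \<le> c \<Longrightarrow>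
     null S R (a + c - k) (b + d - k) (bilin (gjoin k) x y)"
| null_join_right: "x \<in> free S a b \<Longrightarrow> null S R c d y \<Longrightarrow> 1 \<le> k \<Longrightarrow> k \<le> b \<Longrightarrow> k \<le> c \<Longrightarrow>
     null S R (a + c - k) (b + d - k) (bilin (gjoin k) x y)"

definition congr ::
    "generator set \<Rightarrow> 'k::field_char_0 lin set \<Rightarrow> nat \<Rightarrow> nat \<Rightarrow> ('k lin \<times> 'k lin) set" where
  "congr S R a b = {(x, y). x \<in> free S a b \<and> y \<in> free S a b \<and> null S R a b (x - y)}"

definition presented ::
    "generator set \<Rightarrow> 'k::field_char_0 lin set \<Rightarrow> ('k, 'k lin set) properad" where
  "presented S R = \<lparr>
     elems = (\<lambda>a b. free S a b // congr S R a b),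
     homog = (\<lambda>a b d. {x \<in> free S a b. \<forall>G\<in>Poly_Mapping.keys x. graph_deg G = d} // congr S R a b),
     padd = (\<lambda>a b X Y. congr S R a b `` {x + y | x y. x \<in> X \<and> y \<in> Y}),
     pscale = (\<lambda>a b c X. congr S R a b `` (scale c ` X)),
     pact = (\<lambda>a b \<sigma> \<rho> X. congr S R a b `` (act_lin a b \<sigma> \<rho> ` X)),
     pone = congr S R 1 1 `` {single1 (id_graph 1)},
     pcomp = (\<lambda>a b c d k X Y.
       congr S R (a + c - k) (b + d - k) `` {bilin (gjoin k) x y | x y. x \<in> X \<and> y \<in> Y})\<rparr>"

definition gen_class :: "generator set \<Rightarrow> 'k::field_char_0 lin set \<Rightarrow> generator \<Rightarrow> 'k lin set" where
  "gen_class S R g = congr S R (n_out g) (n_in g) `` {single1 (gen_graph g)}"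


section \<open>The two properads and the canonical morphism\<close>

abbreviation mul :: "'k::field_char_0 lin" where "mul \<equiv> single1 (gen_graph Mult)"
abbreviation cop :: "'k::field_char_0 lin" where "cop \<equiv> single1 (gen_graph Comult)"
abbreviation unt :: "'k::field_char_0 lin" where "unt \<equiv> single1 (gen_graph Unit)"
abbreviation idl :: "'k::field_char_0 lin" where "idl \<equiv> single1 (id_graph 1)"
abbreviation swp :: "'k::field_char_0 lin" where
  "swp \<equiv> single1 (perm_graph 2 (Transposition.transpose 0 1))"

definition rel_B :: "'k::field_char_0 lin" where
  "rel_B = (idl \<otimes> mul) \<odot> (swp \<otimes> idl) \<odot> (idl \<otimes> cop)"

definition rel_D :: "'k::field_char_0 lin" where
  "rel_D = (mul \<otimes> idl) \<odot> (idl \<otimes> swp) \<odot> (cop \<otimes> idl)"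

definition bib_rels :: "'k::field_char_0 lin set" where
  "bib_rels = {
     mul \<odot> (idl \<otimes> mul) + mul \<odot> (mul \<otimes> idl),
     (idl \<otimes> cop) \<odot> cop - (cop \<otimes> idl) \<odot> cop,
     - (cop \<odot> mul) + (mul \<otimes> idl) \<odot> (idl \<otimes> cop),
     - (cop \<odot> mul) + (idl \<otimes> mul) \<odot> (cop \<otimes> idl),
     rel_B + swp \<odot> rel_B \<odot> swp,
     rel_B + rel_D \<odot> swp,
     mul \<odot> cop,
     mul \<odot> swp \<odot> cop}"

definition unit_rels :: "'k::field_char_0 lin set" where
  "unit_rels = {
     mul \<odot> (unt \<otimes> idl) + idl,
     mul \<odot> (idl \<otimes> unt) - idl}"

definition bib_gens :: "generator set" where "bib_gens = {Mult, Comult}"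
definition ubib_gens :: "generator set" where "ubib_gens = {Mult, Comult, Unit}"

definition BIB :: "('k::field_char_0, 'k lin set) properad" where
  "BIB = presented bib_gens bib_rels"

definition uBIB :: "('k::field_char_0, 'k lin set) properad" where
  "uBIB = presented ubib_gens (bib_rels \<union> unit_rels)"

text \<open>The class of a combination of graphs is sent to the class of the same combination.\<close>

definition iota :: "nat \<Rightarrow> nat \<Rightarrow> 'k::field_char_0 lin set \<Rightarrow> 'k lin set" where
  "iota a b X = congr ubib_gens (bib_rels \<union> unit_rels) a b `` X"


section \<open>The operations preserve connected directed acyclic graphs\<close>

lemma sources_iff [simp]:
  "Ext i \<in> sources G \<longleftrightarrow> i < ins G"
  "Vtx v j \<in> sources G \<longleftrightarrow> v < length (verts G) \<and> j < n_out (verts G ! v)"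
  by (auto simp: sources_def)

lemma targets_iff [simp]:
  "Ext i \<in> targets G \<longleftrightarrow> i < outs G"
  "Vtx v j \<in> targets G \<longleftrightarrow> v < length (verts G) \<and> j < n_in (verts G ! v)"
  by (auto simp: targets_def)

lemma gcomp_simps [simp]:
  "ins (gcomp G H) = ins H" "outs (gcomp G H) = outs G"
  "verts (gcomp G H) = verts G @ verts H"
  by (simp_all add: gcomp_def Let_def)

lemma gtensor_simps [simp]:
  "ins (gtensor G H) = ins G + ins H" "outs (gtensor G H) = outs G + outs H"
  "verts (gtensor G H) = verts G @ verts H"
  by (simp_all add: gtensor_def Let_def)

lemma perm_graph_simps [simp]:
  "ins (perm_graph n \<sigma>) = n" "outs (perm_graph n \<sigma>) = n" "verts (perm_graph n \<sigma>) = []"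
  "wire (perm_graph n \<sigma>) (Ext i) = Ext (\<sigma> i)"
  by (simp_all add: perm_graph_def)

lemma id_graph_simps [simp]:
  "ins (id_graph n) = n" "outs (id_graph n) = n" "verts (id_graph n) = []"
  "wire (id_graph n) (Ext i) = Ext i"
  by (simp_all add: id_graph_def)

fun shift :: "nat \<Rightarrow> nat \<Rightarrow> port \<Rightarrow> port" where
  "shift n e (Ext i) = Ext (i + e)"
| "shift n e (Vtx v j) = Vtx (v + n) j"

lemma shift_inj [simp]: "shift n e s = shift n e t \<longleftrightarrow> s = t"
  by (cases s; cases t) auto

definition through :: "graph \<Rightarrow> port \<Rightarrow> port" where
  "through G t = (case t of Ext i \<Rightarrow> wire G (Ext i) | Vtx w j \<Rightarrow> Vtx (w + length (verts G)) j)"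

lemma through_simps [simp]:
  "through G (Ext i) = wire G (Ext i)"
  "through G (Vtx w j) = Vtx (w + length (verts G)) j"
  by (simp_all add: through_def)

lemma wire_gcomp_left [simp]:
  "v < length (verts G) \<Longrightarrow> wire (gcomp G H) (Vtx v j) = wire G (Vtx v j)"
  by (simp add: gcomp_def Let_def)

lemma wire_gcomp_right [simp]:
  "wire (gcomp G H) (shift (length (verts G)) 0 s) = through G (wire H s)"
  by (cases s) (simp_all add: gcomp_def Let_def through_def)

lemma wire_gtensor_left [simp]:
  "s \<in> sources G \<Longrightarrow> wire (gtensor G H) s = wire G s"
  by (cases s) (simp_all add: gtensor_def Let_def)

lemma wire_gtensor_right [simp]:
  "wire (gtensor G H) (shift (length (verts G)) (ins G) s) =
     shift (length (verts G)) (outs G) (wire H s)"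
  by (cases s; cases "wire H s") (simp_all add: gtensor_def Let_def)

lemma sources_gcomp_cases:
  assumes "s \<in> sources (gcomp G H)"
  obtains (left) v j where "s = Vtx v j" "Vtx v j \<in> sources G"
  | (right) t where "s = shift (length (verts G)) 0 t" "t \<in> sources H"
proof (cases s)
  case (Ext i)
  then show ?thesis using assms right[of "Ext i"] by auto
next
  case (Vtx v j)
  show ?thesis
  proof (cases "v < length (verts G)")
    case True
    then show ?thesis using assms Vtx left[of v j] by (auto simp: nth_append)
  next
    case False
    then show ?thesis using assms Vtx right[of "Vtx (v - length (verts G)) j"]
      by (auto simp: nth_append)
  qed
qed

lemma sources_gcompI:
  "Vtx v j \<in> sources G \<Longrightarrow> Vtx v j \<in> sources (gcomp G H)"
  "t \<in> sources H \<Longrightarrow> shift (length (verts G)) 0 t \<in> sources (gcomp G H)"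
  by (auto simp: nth_append) (cases t, auto simp: nth_append)

lemma sources_gtensor_cases:
  assumes "s \<in> sources (gtensor G H)"
  obtains (left) "s \<in> sources G"
  | (right) t where "s = shift (length (verts G)) (ins G) t" "t \<in> sources H"
proof (cases s)
  case (Ext i)
  then show ?thesis using assms left right[of "Ext (i - ins G)"] by (cases "i < ins G") auto
next
  case (Vtx v j)
  show ?thesis
  proof (cases "v < length (verts G)")
    case True
    then show ?thesis using assms Vtx left by (auto simp: nth_append)
  next
    case False
    then show ?thesis using assms Vtx right[of "Vtx (v - length (verts G)) j"]
      by (auto simp: nth_append)
  qed
qed

lemma sources_gtensorI:
  "s \<in> sources G \<Longrightarrow> s \<in> sources (gtensor G H)"
  "t \<in> sources H \<Longrightarrow> shift (length (verts G)) (ins G) t \<in> sources (gtensor G H)"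
  by (cases s; auto simp: nth_append) (cases t; auto simp: nth_append)

lemma dagD:
  assumes "dag G"
  shows "s \<in> sources G \<Longrightarrow> wire G s \<in> targets G"
    "s \<in> sources G \<Longrightarrow> t \<in> sources G \<Longrightarrow> wire G s = wire G t \<longleftrightarrow> s = t"
    "u \<in> targets G \<Longrightarrow> \<exists>s\<in>sources G. wire G s = u"
    "acyclic (vertex_rel G)"
proof -
  have b: "bij_betw (wire G) (sources G) (targets G)" using assms by (simp add: dag_def)
  show "s \<in> sources G \<Longrightarrow> wire G s \<in> targets G" using b bij_betwE by blast
  show "s \<in> sources G \<Longrightarrow> t \<in> sources G \<Longrightarrow> wire G s = wire G t \<longleftrightarrow> s = t"
    using b by (auto simp: bij_betw_def inj_on_def)
  show "u \<in> targets G \<Longrightarrow> \<exists>s\<in>sources G. wire G s = u"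
    using b by (force simp: bij_betw_def)
  show "acyclic (vertex_rel G)" using assms by (simp add: dag_def)
qed

lemma dagI:
  assumes "\<And>s. s \<in> sources G \<Longrightarrow> wire G s \<in> targets G"
    "\<And>s t. s \<in> sources G \<Longrightarrow> t \<in> sources G \<Longrightarrow> wire G s = wire G t \<Longrightarrow> s = t"
    "\<And>u. u \<in> targets G \<Longrightarrow> \<exists>s\<in>sources G. wire G s = u"
    "acyclic (vertex_rel G)"
  shows "dag G"
  unfolding dag_def bij_betw_def inj_on_def using assms by blast

lemma through_inj:
  assumes "dag G" "t \<in> targets H" "t' \<in> targets H" "outs H = ins G"
    "through G t = through G t'"
  shows "t = t'"
proof -
  have *: "wire G (Ext i) \<noteq> Vtx (w + length (verts G)) j" if "i < ins G" for i w j
    using dagD(1)[OF assms(1), of "Ext i"] that by auto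
  have "i = i'" if "wire G (Ext i) = wire G (Ext i')" "i < ins G" "i' < ins G" for i i'
    using dagD(2)[OF assms(1), of "Ext i" "Ext i'"] that by auto
  then show ?thesis
    using assms(2-5) * *[THEN not_sym] by (cases t; cases t') auto
qed

lemma vertex_rel_lt:
  assumes "dag G" "(v, w) \<in> vertex_rel G"
  shows "v < length (verts G)" "w < length (verts G)"
proof -
  obtain i j where *: "Vtx v i \<in> sources G" "wire G (Vtx v i) = Vtx w j"
    using assms by (auto simp: vertex_rel_def simp del: sources_iff)
  show "v < length (verts G)" using * by simp
  show "w < length (verts G)" using dagD(1)[OF assms(1) *(1)] * by simp
qed

lemma acyclic_block:
  assumes "acyclic A" "acyclic B"
    and *: "\<And>v w. (v, w) \<in> E \<Longrightarrow> (v < n \<and> w < n \<and> (v, w) \<in> A) \<or>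
       (v \<ge> n \<and> w \<ge> n \<and> (v - n, w - n) \<in> B) \<or> (v \<ge> n \<and> w < (n::nat))"
  shows "acyclic E"
proof -
  have "(v < n \<and> w < n \<and> (v, w) \<in> A\<^sup>+) \<or>
       (v \<ge> n \<and> w \<ge> n \<and> (v - n, w - n) \<in> B\<^sup>+) \<or> (v \<ge> n \<and> w < n)"
    if "(v, w) \<in> E\<^sup>+" for v w
    using that
  proof (induction rule: trancl_induct)
    case (base y)
    then show ?case using * by blast
  next
    case (step y z)
    show ?case using *[OF step(2)] step(3)
      by (meson leD trancl.trancl_into_trancl)
  qed
  then show ?thesis using assms(1,2) unfolding acyclic_def by (meson leD)
qed

lemma dag_gcomp:
  assumes G: "dag G" and H: "dag H" and e: "outs H = ins G"
  shows "dag (gcomp G H)"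
proof -
  let ?n = "length (verts G)" and ?K = "gcomp G H"
  note dG = dagD[OF G] and dH = dagD[OF H]
  have tt: "wire ?K s \<in> targets ?K" if "s \<in> sources ?K" for s
    using that
  proof (cases rule: sources_gcomp_cases)
    case (left v j)
    then show ?thesis using dG(1)[of s] by (cases "wire G s") (auto simp: nth_append)
  next
    case (right t)
    show ?thesis
    proof (cases "wire H t")
      case (Ext i)
      then have "Ext i \<in> sources G" using dH(1)[OF right(2)] e by simp
      then show ?thesis using dG(1)[of "Ext i"] right Ext
        by (cases "wire G (Ext i)") (auto simp: nth_append)
    next
      case (Vtx v j)
      then show ?thesis using dH(1)[OF right(2)] right by (auto simp: nth_append)
    qed
  qed
  have LR: "wire G (Vtx v j) \<noteq> through G (wire H t)"
    if "Vtx v j \<in> sources G" "t \<in> sources H" for v j t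
  proof (cases "wire H t")
    case (Ext i)
    then have "Ext i \<in> sources G" using dH(1)[OF that(2)] e by simp
    then show ?thesis using dG(2)[OF that(1)] Ext by auto
  next
    case (Vtx w k)
    then show ?thesis using dG(1)[OF that(1)] by auto
  qed
  have inj: "s = t" if "s \<in> sources ?K" "t \<in> sources ?K" "wire ?K s = wire ?K t" for s t
    using that(1)
  proof (cases rule: sources_gcomp_cases)
    case l: (left v j)
    show ?thesis using that(2)
    proof (cases rule: sources_gcomp_cases)
      case (left v' j')
      then show ?thesis using l that(3) dG(2)[of s t] by auto
    next
      case (right t')
      then show ?thesis using l that(3) LR[of v j t'] by auto
    qed
  next
    case r: (right s')
    show ?thesis using that(2)
    proof (cases rule: sources_gcomp_cases)
      case (left v' j')
      then show ?thesis using r that(3) LR[of v' j' s'] by auto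
    next
      case (right t')
      then have "wire H s' = wire H t'"
        using r that(3) through_inj[OF G dH(1) dH(1) e] by simp
      then show ?thesis using right r dH(2) by simp
    qed
  qed
  have surG: "\<exists>s\<in>sources ?K. wire ?K s = u" if u: "u \<in> targets G" for u
  proof -
    obtain s where s: "s \<in> sources G" "wire G s = u" using dG(3)[OF u] by blast
    show ?thesis
    proof (cases s)
      case (Ext i)
      then have "Ext i \<in> targets H" using s e by simp
      then obtain t where "t \<in> sources H" "wire H t = Ext i" using dH(3) by blast
      then show ?thesis using Ext s sources_gcompI(2)[of t H G]
        by (intro bexI[of _ "shift ?n 0 t"]) auto
    next
      case (Vtx v j)
      then show ?thesis using s sources_gcompI(1)[of v j G H] by (intro bexI[of _ s]) auto
    qed
  qed
  have sur: "\<exists>s\<in>sources ?K. wire ?K s = u" if "u \<in> targets ?K" for u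
  proof (cases "u \<in> targets G")
    case True
    then show ?thesis using surG by blast
  next
    case False
    have "\<exists>v j. u = Vtx (v + ?n) j \<and> Vtx v j \<in> targets H"
    proof (cases u)
      case (Ext i)
      then show ?thesis using that False by simp
    next
      case (Vtx v j)
      then show ?thesis using that False
        by (intro exI[of _ "v - ?n"] exI[of _ j]) (auto simp: nth_append split: if_splits)
    qed
    then obtain v j where u: "u = Vtx (v + ?n) j" "Vtx v j \<in> targets H" by blast
    then obtain t where "t \<in> sources H" "wire H t = Vtx v j" using dH(3) by blast
    then show ?thesis using u sources_gcompI(2)[of t H G]
      by (intro bexI[of _ "shift ?n 0 t"]) auto
  qed
  have "acyclic (vertex_rel ?K)"
  proof (rule acyclic_block[OF dG(4) dH(4), where n = ?n])
    fix v w assume "(v, w) \<in> vertex_rel ?K"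
    then obtain i j where *: "Vtx v i \<in> sources ?K" "wire ?K (Vtx v i) = Vtx w j"
      by (auto simp: vertex_rel_def simp del: sources_iff)
    from *(1) show "(v < ?n \<and> w < ?n \<and> (v, w) \<in> vertex_rel G) \<or>
       (v \<ge> ?n \<and> w \<ge> ?n \<and> (v - ?n, w - ?n) \<in> vertex_rel H) \<or> (v \<ge> ?n \<and> w < ?n)"
    proof (cases rule: sources_gcomp_cases)
      case (left v' j')
      then have "(v, w) \<in> vertex_rel G" using * by (auto simp: vertex_rel_def)
      then show ?thesis using vertex_rel_lt[OF G] by blast
    next
      case (right t)
      then obtain v' where t: "t = Vtx v' i" "v = v' + ?n" by (cases t) auto
      show ?thesis
      proof (cases "wire H t")
        case (Ext m)
        then have "Ext m \<in> sources G" using dH(1)[OF right(2)] e by simp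
        then have "w < ?n" using dG(1)[of "Ext m"] *(2) right Ext by auto
        then show ?thesis using t by simp
      next
        case (Vtx w' k)
        then have "w = w' + ?n" using *(2) right by auto
        moreover have "(v', w') \<in> vertex_rel H"
          using Vtx t right(2) by (auto simp: vertex_rel_def)
        ultimately show ?thesis using t by simp
      qed
    qed
  qed
  then show ?thesis using tt inj sur by (intro dagI) blast+
qed

lemma dag_gtensor:
  assumes G: "dag G" and H: "dag H"
  shows "dag (gtensor G H)"
proof -
  let ?n = "length (verts G)" and ?K = "gtensor G H"
  note dG = dagD[OF G] and dH = dagD[OF H]
  have tt: "wire ?K s \<in> targets ?K" if "s \<in> sources ?K" for s
    using that
  proof (cases rule: sources_gtensor_cases)
    case left
    then show ?thesis using dG(1)[of s] by (cases "wire G s") (auto simp: nth_append)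
  next
    case (right t)
    then show ?thesis using dH(1)[of t] by (cases "wire H t") (auto simp: nth_append)
  qed
  have LR: "wire G s \<noteq> shift ?n (outs G) (wire H t)" if "s \<in> sources G" for s t
    using dG(1)[OF that] by (cases "wire G s"; cases "wire H t") auto
  have inj: "s = t" if "s \<in> sources ?K" "t \<in> sources ?K" "wire ?K s = wire ?K t" for s t
    using that(1)
  proof (cases rule: sources_gtensor_cases)
    case l: left
    show ?thesis using that(2)
    proof (cases rule: sources_gtensor_cases)
      case left
      then show ?thesis using l that(3) dG(2)[of s t] by auto
    next
      case (right t')
      then show ?thesis using l that(3) LR[of s t'] by auto
    qed
  next
    case r: (right s')
    show ?thesis using that(2)
    proof (cases rule: sources_gtensor_cases)
      case left
      then show ?thesis using r that(3) LR[of t s'] by auto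
    next
      case (right t')
      then show ?thesis using r that(3) dH(2)[of s' t'] by auto
    qed
  qed
  have sur: "\<exists>s\<in>sources ?K. wire ?K s = u" if "u \<in> targets ?K" for u
  proof (cases "u \<in> targets G")
    case True
    then obtain s where "s \<in> sources G" "wire G s = u" using dG(3)[OF True] by blast
    then show ?thesis using sources_gtensorI(1) by (intro bexI[of _ s]) auto
  next
    case False
    have "\<exists>t. u = shift ?n (outs G) t \<and> t \<in> targets H"
    proof (cases u)
      case (Ext i)
      then show ?thesis using that False by (intro exI[of _ "Ext (i - outs G)"]) auto
    next
      case (Vtx v j)
      then show ?thesis using that False
        by (intro exI[of _ "Vtx (v - ?n) j"]) (auto simp: nth_append split: if_splits)
    qed
    then obtain t where u: "u = shift ?n (outs G) t" "t \<in> targets H" by blast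
    then obtain s where "s \<in> sources H" "wire H s = t" using dH(3) by blast
    then show ?thesis using u sources_gtensorI(2)[of s H G]
      by (intro bexI[of _ "shift ?n (ins G) s"]) auto
  qed
  have "acyclic (vertex_rel ?K)"
  proof (rule acyclic_block[OF dG(4) dH(4), where n = ?n])
    fix v w assume "(v, w) \<in> vertex_rel ?K"
    then obtain i j where *: "Vtx v i \<in> sources ?K" "wire ?K (Vtx v i) = Vtx w j"
      by (auto simp: vertex_rel_def simp del: sources_iff)
    from *(1) show "(v < ?n \<and> w < ?n \<and> (v, w) \<in> vertex_rel G) \<or>
       (v \<ge> ?n \<and> w \<ge> ?n \<and> (v - ?n, w - ?n) \<in> vertex_rel H) \<or> (v \<ge> ?n \<and> w < ?n)"
    proof (cases rule: sources_gtensor_cases)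
      case left
      then have "(v, w) \<in> vertex_rel G" using * by (auto simp: vertex_rel_def)
      then show ?thesis using vertex_rel_lt[OF G] by blast
    next
      case (right t)
      then obtain v' where t: "t = Vtx v' i" "v = v' + ?n" by (cases t) auto
      have "shift ?n (outs G) (wire H t) = Vtx w j"
        using *(2) right(1) wire_gtensor_right[of G H t] by simp
      then obtain w' where "w = w' + ?n" "wire H t = Vtx w' j"
        by (cases "wire H t") auto
      then show ?thesis using t right by (auto simp: vertex_rel_def)
    qed
  qed
  then show ?thesis using tt inj sur by (intro dagI) blast+
qed

lemma dag_perm:
  assumes "\<sigma> permutes {..<n}"
  shows "dag (perm_graph n \<sigma>)"
proof (rule dagI)
  show "wire (perm_graph n \<sigma>) s \<in> targets (perm_graph n \<sigma>)" if "s \<in> sources (perm_graph n \<sigma>)" for s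
    using that permutes_in_image[OF assms] by (cases s) auto
  show "s = t" if "s \<in> sources (perm_graph n \<sigma>)" "t \<in> sources (perm_graph n \<sigma>)"
    "wire (perm_graph n \<sigma>) s = wire (perm_graph n \<sigma>) t" for s t
    using that permutes_inj[OF assms] by (cases s; cases t) (auto dest: injD)
  show "\<exists>s\<in>sources (perm_graph n \<sigma>). wire (perm_graph n \<sigma>) s = u"
    if "u \<in> targets (perm_graph n \<sigma>)" for u
  proof (cases u)
    case (Ext i)
    then have "Hilbert_Choice.inv \<sigma> i < n"
      using that permutes_in_image[OF permutes_inv[OF assms], of i] by simp
    then show ?thesis using Ext permutes_inverses(1)[OF assms]
      by (intro bexI[of _ "Ext (Hilbert_Choice.inv \<sigma> i)"]) auto
  qed (use that in auto)
  show "acyclic (vertex_rel (perm_graph n \<sigma>))"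
    by (auto simp: vertex_rel_def acyclic_def)
qed

lemma dag_id: "dag (id_graph n)"
  by (simp add: id_graph_def dag_perm permutes_id)

lemma incident_iff:
  "s \<in> incident G v \<longleftrightarrow> s \<in> sources G \<and> ((\<exists>j. s = Vtx v j) \<or> (\<exists>j. wire G s = Vtx v j))"
  by (auto simp: incident_def)

lemma path_transport:
  assumes "\<And>v s. v < length (verts G) \<Longrightarrow> s \<in> incident G v \<Longrightarrow>
      h v < length (verts K) \<and> f s \<in> incident K (h v)"
    and "(s, t) \<in> (edge_adj G)\<^sup>*"
  shows "(f s, f t) \<in> (edge_adj K)\<^sup>*"
  using assms(2)
proof (induction rule: rtrancl_induct)
  case (step y z)
  then obtain v where "v < length (verts G)" "y \<in> incident G v" "z \<in> incident G v"
    by (auto simp: edge_adj_def)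
  then have "(f y, f z) \<in> edge_adj K" using assms(1) by (force simp: edge_adj_def)
  then show ?case using step.IH by (rule rtrancl_into_rtrancl[rotated])
qed simp

definition lift_left :: "graph \<Rightarrow> graph \<Rightarrow> port \<Rightarrow> port" where
  "lift_left G H s = (case s of
     Ext i \<Rightarrow> shift (length (verts G)) 0 (inv_into (sources H) (wire H) (Ext i))
   | Vtx v j \<Rightarrow> Vtx v j)"

lemma lift_left:
  assumes "dag H" "outs H = ins G" "s \<in> sources G"
  shows "lift_left G H s \<in> sources (gcomp G H)"
    "wire (gcomp G H) (lift_left G H s) = wire G s"
proof -
  have "lift_left G H s \<in> sources (gcomp G H) \<and>
    wire (gcomp G H) (lift_left G H s) = wire G s"
  proof (cases s)
    case (Ext i)
    let ?t = "inv_into (sources H) (wire H) (Ext i)"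
    have "Ext i \<in> wire H ` sources H"
      using dagD(3)[OF assms(1), of "Ext i"] assms Ext by force
    then have "?t \<in> sources H" "wire H ?t = Ext i"
      by (auto intro: inv_into_into f_inv_into_f)
    then show ?thesis using Ext sources_gcompI(2) by (simp add: lift_left_def)
  next
    case (Vtx v j)
    then show ?thesis using assms sources_gcompI(1)[of v j G H]
      by (simp add: lift_left_def del: sources_iff) simp
  qed
  then show "lift_left G H s \<in> sources (gcomp G H)"
    "wire (gcomp G H) (lift_left G H s) = wire G s" by auto
qed

lemma lift_left_Vtx [simp]: "lift_left G H (Vtx v j) = Vtx v j"
  by (simp add: lift_left_def)

lemma lift_left_Ext:
  assumes "dag H" "t \<in> sources H" "wire H t = Ext i"
  shows "lift_left G H (Ext i) = shift (length (verts G)) 0 t"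
proof -
  have "inv_into (sources H) (wire H) (wire H t) = t"
    using assms by (intro inv_into_f_f) (auto simp: dag_def bij_betw_def)
  then show ?thesis using assms by (simp add: lift_left_def)
qed

lemma path_gcomp_left:
  assumes "dag H" "outs H = ins G" "(s, t) \<in> (edge_adj G)\<^sup>*"
  shows "(lift_left G H s, lift_left G H t) \<in> (edge_adj (gcomp G H))\<^sup>*"
proof (rule path_transport[OF _ assms(3), where h = "\<lambda>v. v"])
  fix v s assume *: "v < length (verts G)" "s \<in> incident G v"
  then have "s \<in> sources G" by (simp add: incident_iff)
  from lift_left[OF assms(1,2) this] * 
  show "v < length (verts (gcomp G H)) \<and> lift_left G H s \<in> incident (gcomp G H) v"
    by (auto simp: incident_iff)
qed

lemma path_gcomp_right:
  assumes "(s, t) \<in> (edge_adj H)\<^sup>*"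
  shows "(shift (length (verts G)) 0 s, shift (length (verts G)) 0 t) \<in> (edge_adj (gcomp G H))\<^sup>*"
proof (rule path_transport[OF _ assms, where h = "\<lambda>v. v + length (verts G)"])
  fix v s assume *: "v < length (verts H)" "s \<in> incident H v"
  then show "v + length (verts G) < length (verts (gcomp G H)) \<and>
      shift (length (verts G)) 0 s \<in> incident (gcomp G H) (v + length (verts G))"
    using sources_gcompI(2)[of s H G] by (auto simp: incident_iff)
qed

lemma path_gtensor_left:
  assumes "(s, t) \<in> (edge_adj G)\<^sup>*"
  shows "(s, t) \<in> (edge_adj (gtensor G H))\<^sup>*"
proof (rule path_transport[OF _ assms, where h = "\<lambda>v. v" and f = "\<lambda>s. s"])
  fix v s assume *: "v < length (verts G)" "s \<in> incident G v"
  then show "v < length (verts (gtensor G H)) \<and> s \<in> incident (gtensor G H) v"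
    using sources_gtensorI(1)[of s G H] by (auto simp: incident_iff)
qed

lemma path_gtensor_right:
  assumes "(s, t) \<in> (edge_adj H)\<^sup>*"
  shows "(shift (length (verts G)) (ins G) s, shift (length (verts G)) (ins G) t)
    \<in> (edge_adj (gtensor G H))\<^sup>*"
proof (rule path_transport[OF _ assms, where h = "\<lambda>v. v + length (verts G)"])
  fix v s assume *: "v < length (verts H)" "s \<in> incident H v"
  then show "v + length (verts G) < length (verts (gtensor G H)) \<and>
      shift (length (verts G)) (ins G) s \<in> incident (gtensor G H) (v + length (verts G))"
    using sources_gtensorI(2)[of s H G] by (auto simp: incident_iff)
qed

lemma sym_edge_adj:
  assumes "(s, t) \<in> (edge_adj G)\<^sup>*"
  shows "(t, s) \<in> (edge_adj G)\<^sup>*"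
proof -
  have "sym (edge_adj G)" unfolding edge_adj_def by (rule symI) blast
  then show ?thesis using assms by (metis sym_rtrancl symD)
qed

lemma connected_graphI:
  assumes "s0 \<in> sources G" "\<And>s. s \<in> sources G \<Longrightarrow> (s0, s) \<in> (edge_adj G)\<^sup>*"
  shows "connected_graph G"
  unfolding connected_graph_def
proof (intro conjI ballI)
  show "sources G \<noteq> {}" using assms(1) by blast
  fix s t assume "s \<in> sources G" "t \<in> sources G"
  then show "(s, t) \<in> (edge_adj G)\<^sup>*"
    using rtrancl_trans[OF sym_edge_adj[OF assms(2)] assms(2)] by blast
qed

lemma connected_graphD:
  "connected_graph G \<Longrightarrow> s \<in> sources G \<Longrightarrow> t \<in> sources G \<Longrightarrow> (s, t) \<in> (edge_adj G)\<^sup>*"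
  by (simp add: connected_graph_def)

lemma cgraphsD:
  assumes "G \<in> cgraphs S a b"
  shows "outs G = a" "ins G = b" "set (verts G) \<subseteq> S" "dag G" "connected_graph G"
  using assms by (auto simp: cgraphs_def)

lemma gjoin_simps [simp]:
  "verts (gjoin k G H) = verts G @ verts H"
  "outs (gjoin k G H) = outs G + (outs H - k)"
  "ins (gjoin k G H) = ins G - k + ins H"
  by (simp_all add: gjoin_def)

lemma dag_gjoin:
  assumes "dag G" "dag H" "k \<le> ins G" "k \<le> outs H"
  shows "dag (gjoin k G H)"
  unfolding gjoin_def using assms by (intro dag_gcomp dag_gtensor dag_id) auto

lemma connected_gjoin:
  assumes G: "dag G" "connected_graph G" and H: "dag H" "connected_graph H"
    and k: "1 \<le> k" "k \<le> ins G" "k \<le> outs H"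
  shows "connected_graph (gjoin k G H)"
proof -
  define G' where "G' = gtensor G (id_graph (outs H - k))"
  define H' where "H' = gtensor (id_graph (ins G - k)) H"
  have K: "gjoin k G H = gcomp G' H'" by (simp add: gjoin_def G'_def H'_def)
  have dH': "dag H'" unfolding H'_def by (intro dag_gtensor dag_id H)
  have e: "outs H' = ins G'" using k by (simp add: G'_def H'_def)
  let ?n = "length (verts G')" and ?m = "ins G - k"
  let ?f = "lift_left G' H'" and ?g = "\<lambda>t. shift ?n 0 (shift 0 ?m t)"
  have pG: "(?f s, ?f t) \<in> (edge_adj (gcomp G' H'))\<^sup>*" if "s \<in> sources G" "t \<in> sources G" for s t
    using path_gcomp_left[OF dH' e] path_gtensor_left connected_graphD[OF G(2) that]
    unfolding G'_def by blast
  have pH: "(?g s, ?g t) \<in> (edge_adj (gcomp G' H'))\<^sup>*" if "s \<in> sources H" "t \<in> sources H" for s t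
    using path_gcomp_right[OF path_gtensor_right[OF connected_graphD[OF H(2) that], of "id_graph ?m"], of G']
    by (simp add: H'_def)
  obtain t0 where t0: "t0 \<in> sources H" "wire H t0 = Ext 0"
    using dagD(3)[OF H(1), of "Ext 0"] k by auto
  have s0: "Ext ?m \<in> sources G" using k by simp
  have wH': "wire H' (shift 0 ?m t) = shift 0 ?m (wire H t)" for t
    using wire_gtensor_right[of "id_graph ?m" H t] by (simp add: H'_def)
  have sH': "shift 0 ?m t \<in> sources H'" if "t \<in> sources H" for t
    using sources_gtensorI(2)[OF that, of "id_graph ?m"] by (simp add: H'_def)
  have joint: "?f (Ext ?m) = ?g t0"
    using lift_left_Ext[OF dH' sH'[OF t0(1)], of ?m G'] wH'[of t0] t0 by simp
  show ?thesis unfolding K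
  proof (rule connected_graphI[of "?g t0"])
    show "?g t0 \<in> sources (gcomp G' H')"
      by (rule sources_gcompI(2)[OF sH'[OF t0(1)]])
    fix s assume "s \<in> sources (gcomp G' H')"
    then show "(?g t0, s) \<in> (edge_adj (gcomp G' H'))\<^sup>*"
    proof (cases rule: sources_gcomp_cases)
      case (left v j)
      then have "Vtx v j \<in> sources G" by (simp add: G'_def)
      from pG[OF s0 this] show ?thesis using left joint by simp
    next
      case (right t)
      from right(2)[unfolded H'_def] show ?thesis
      proof (cases rule: sources_gtensor_cases)
        case left
        then obtain i where i: "t = Ext i" "i < ?m" by (cases t) auto
        have "wire H' t = Ext i"
          unfolding H'_def using left i by simp
        then have "s = ?f (Ext i)"
          using lift_left_Ext[OF dH' right(2), of i G'] right(1) by simp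
        moreover have "Ext i \<in> sources G" using i by simp
        ultimately show ?thesis using pG[OF s0, of "Ext i"] joint by simp
      next
        case (right t')
        then show ?thesis using pH[OF t0(1) right(2)] \<open>s = shift ?n 0 t\<close> by simp
      qed
    qed
  qed
qed

lemma cgraphs_gjoin:
  assumes "G \<in> cgraphs S a b" "H \<in> cgraphs S c d" "1 \<le> k" "k \<le> b" "k \<le> c"
  shows "gjoin k G H \<in> cgraphs S (a + c - k) (b + d - k)"
proof -
  note G = cgraphsD[OF assms(1)] and H = cgraphsD[OF assms(2)]
  have "dag (gjoin k G H)" "connected_graph (gjoin k G H)"
    using G H assms(3-) by (intro dag_gjoin connected_gjoin; simp)+
  then show ?thesis using G(1-3) H(1-3) assms(3-) by (simp add: cgraphs_def)
qed

lemma cgraphs_perm_left: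
  assumes "G \<in> cgraphs S a b" "\<sigma> permutes {..<a}"
  shows "gcomp (perm_graph a \<sigma>) G \<in> cgraphs S a b"
proof -
  let ?P = "perm_graph a \<sigma>"
  note G = cgraphsD[OF assms(1)]
  have d: "dag (gcomp ?P G)" using G assms by (intro dag_gcomp dag_perm) auto
  have sh: "shift 0 0 t = t" for t by (cases t) auto
  have eq: "sources (gcomp ?P G) = sources G"
    using sources_gcomp_cases[of _ ?P G] sources_gcompI(2)[of _ G ?P]
    by (auto simp: sh)
  have "connected_graph (gcomp ?P G)"
    using path_gcomp_right[of _ _ G ?P] G(5) unfolding connected_graph_def eq by (simp add: sh)
  then show ?thesis using d G by (simp add: cgraphs_def)
qed

lemma cgraphs_perm_right:
  assumes "G \<in> cgraphs S a b" "\<rho> permutes {..<b}"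
  shows "gcomp G (perm_graph b \<rho>) \<in> cgraphs S a b"
proof -
  let ?P = "perm_graph b \<rho>" and ?f = "lift_left G (perm_graph b \<rho>)"
  note G = cgraphsD[OF assms(1)]
  have dP: "dag ?P" using assms by (intro dag_perm)
  have e: "outs ?P = ins G" using G by simp
  have d: "dag (gcomp G ?P)" using G assms by (intro dag_gcomp dag_perm) auto
  obtain s0 where s0: "s0 \<in> sources G" using G(5) by (auto simp: connected_graph_def)
  have "connected_graph (gcomp G ?P)"
  proof (rule connected_graphI[of "?f s0"])
    show "?f s0 \<in> sources (gcomp G ?P)" by (rule lift_left[OF dP e s0])
    fix s assume "s \<in> sources (gcomp G ?P)"
    then have "\<exists>t\<in>sources G. s = ?f t"
    proof (cases rule: sources_gcomp_cases)
      case (left v j)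
      then show ?thesis by (intro bexI[of _ s]) auto
    next
      case (right t)
      then obtain i where i: "t = Ext i" "i < b" by (cases t) auto
      then show ?thesis
        using lift_left_Ext[OF dP right(2), of "\<rho> i" G] right(1) G(2) 
          permutes_in_image[OF assms(2), of i]
        by (intro bexI[of _ "Ext (\<rho> i)"]) auto
    qed
    then show "(?f s0, s) \<in> (edge_adj (gcomp G ?P))\<^sup>*"
      using path_gcomp_left[OF dP e connected_graphD[OF G(5) s0]] by blast
  qed
  then show ?thesis using d G by (simp add: cgraphs_def)
qed


section \<open>The operations descend to classes\<close>

lemma lookup_scale [simp]: "Poly_Mapping.lookup (scale c x) G = c * Poly_Mapping.lookup x G"
  by (simp add: scale_def map.rep_eq when_def)

lemma keys_scale: "Poly_Mapping.keys (scale c x) \<subseteq> Poly_Mapping.keys x"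
  by (auto simp: in_keys_iff)

lemma scale_minus: "scale (-1) x = - x"
  by (intro poly_mapping_eqI) simp

lemma scale_diff: "scale c (x - y) = scale c x - scale c y"
  by (intro poly_mapping_eqI) (simp add: lookup_minus algebra_simps)

lemma bilin_superset:
  assumes "finite A" "finite B" "Poly_Mapping.keys x \<subseteq> A" "Poly_Mapping.keys y \<subseteq> B"
  shows "bilin f x y = (\<Sum>G\<in>A. \<Sum>H\<in>B.
     Poly_Mapping.single (f G H) (Poly_Mapping.lookup x G * Poly_Mapping.lookup y H))"
proof -
  have "(\<Sum>H\<in>Poly_Mapping.keys y. Poly_Mapping.single (f G H) (Poly_Mapping.lookup x G * Poly_Mapping.lookup y H))
      = (\<Sum>H\<in>B. Poly_Mapping.single (f G H) (Poly_Mapping.lookup x G * Poly_Mapping.lookup y H))" for G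
    using assms by (intro sum.mono_neutral_left) (auto simp: in_keys_iff)
  moreover have "(\<Sum>G\<in>Poly_Mapping.keys x. \<Sum>H\<in>B. Poly_Mapping.single (f G H) (Poly_Mapping.lookup x G * Poly_Mapping.lookup y H))
      = (\<Sum>G\<in>A. \<Sum>H\<in>B. Poly_Mapping.single (f G H) (Poly_Mapping.lookup x G * Poly_Mapping.lookup y H))"
    using assms by (intro sum.mono_neutral_left) (auto simp: in_keys_iff)
  ultimately show ?thesis by (simp add: bilin_def)
qed

lemma bilin_diff_left: "bilin f (x - x') y = bilin f x y - bilin f x' y"
proof -
  let ?A = "Poly_Mapping.keys x \<union> Poly_Mapping.keys x'"
  have "Poly_Mapping.keys (x - x') \<subseteq> ?A" by (auto simp: in_keys_iff lookup_minus)
  then have "bilin f z y = (\<Sum>G\<in>?A. \<Sum>H\<in>Poly_Mapping.keys y.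
     Poly_Mapping.single (f G H) (Poly_Mapping.lookup z G * Poly_Mapping.lookup y H))"
    if "z \<in> {x, x', x - x'}" for z
    using that by (intro bilin_superset) auto
  then show ?thesis
    by (simp add: lookup_minus left_diff_distrib single_diff sum_subtractf)
qed

lemma bilin_diff_right: "bilin f x (y - y') = bilin f x y - bilin f x y'"
proof -
  let ?B = "Poly_Mapping.keys y \<union> Poly_Mapping.keys y'"
  have "Poly_Mapping.keys (y - y') \<subseteq> ?B" by (auto simp: in_keys_iff lookup_minus)
  then have "bilin f x z = (\<Sum>G\<in>Poly_Mapping.keys x. \<Sum>H\<in>?B.
     Poly_Mapping.single (f G H) (Poly_Mapping.lookup x G * Poly_Mapping.lookup z H))"
    if "z \<in> {y, y', y - y'}" for z
    using that by (intro bilin_superset) auto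
  then show ?thesis
    by (simp add: lookup_minus right_diff_distrib single_diff sum_subtractf)
qed

lemma bilin_single1: "bilin f (single1 G) (single1 H) = (single1 (f G H) :: 'k::field_char_0 lin)"
  by (simp add: bilin_def single1_def)

lemma keys_bilin:
  "Poly_Mapping.keys (bilin f x y) \<subseteq> (\<lambda>(G, H). f G H) ` (Poly_Mapping.keys x \<times> Poly_Mapping.keys y)"
  unfolding bilin_def by (rule order.trans[OF keys_sum]) (fastforce dest: subsetD[OF keys_sum] split: if_splits)

lemma act_lin_diff: "act_lin a b \<sigma> \<rho> (x - y) = act_lin a b \<sigma> \<rho> x - act_lin a b \<sigma> \<rho> y"
  by (simp add: act_lin_def comp_lin_def bilin_diff_left bilin_diff_right)

lemma free_iff: "x \<in> free S a b \<longleftrightarrow> (\<forall>G. Poly_Mapping.lookup x G \<noteq> 0 \<longrightarrow> G \<in> cgraphs S a b)"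
  by (auto simp: free_def in_keys_iff)

lemma free_zero: "0 \<in> free S a b"
  by (simp add: free_iff)

lemma free_add: "x \<in> free S a b \<Longrightarrow> y \<in> free S a b \<Longrightarrow> x + y \<in> free S a b"
  unfolding free_iff lookup_add by (metis add_0)

lemma free_minus: "x \<in> free S a b \<Longrightarrow> y \<in> free S a b \<Longrightarrow> x - y \<in> free S a b"
  unfolding free_iff lookup_minus by (metis diff_0_right)

lemma free_scale: "x \<in> free S a b \<Longrightarrow> scale c x \<in> free S a b"
  by (auto simp: free_iff)

lemma free_single1: "G \<in> cgraphs S a b \<Longrightarrow> single1 G \<in> free S a b"
  by (auto simp: free_iff single1_def lookup_single when_def split: if_splits)

lemma free_join:
  assumes "x \<in> free S a b" "y \<in> free S c d" "1 \<le> k" "k \<le> b" "k \<le> c"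
  shows "bilin (gjoin k) x y \<in> free S (a + c - k) (b + d - k)"
  using assms keys_bilin[of "gjoin k" x y] cgraphs_gjoin[of _ S a b _ c d k] unfolding free_def
  by fastforce

lemma free_act:
  assumes "x \<in> free S a b" "\<sigma> permutes {..<a}" "\<rho> permutes {..<b}"
  shows "act_lin a b \<sigma> \<rho> x \<in> free S a b"
proof -
  have "Poly_Mapping.keys (x \<odot> single1 (perm_graph b \<rho>)) \<subseteq> cgraphs S a b"
    using keys_bilin[of gcomp x "single1 (perm_graph b \<rho>)"] assms cgraphs_perm_right[of _ S a b \<rho>]
    by (fastforce simp: comp_lin_def free_def single1_def)
  then show ?thesis
    using keys_bilin[of gcomp "single1 (perm_graph a \<sigma>)" "x \<odot> single1 (perm_graph b \<rho>)"]
      assms cgraphs_perm_left[of _ S a b \<sigma>]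
    by (fastforce simp: act_lin_def comp_lin_def free_def single1_def)
qed

lemma null_free: "null S R a b x \<Longrightarrow> x \<in> free S a b"
proof (induction rule: null.induct)
  case (null_iso G a b H \<pi>)
  then show ?case by (intro free_minus free_scale free_single1)
next
  case (null_act a b x \<sigma> \<rho>)
  then show ?case by (intro free_act)
next
  case (null_join_left a b x y c d k)
  then show ?case by (intro free_join)
next
  case (null_join_right x a b c d y k)
  then show ?case by (intro free_join)
qed (simp_all add: free_zero free_add free_scale)

lemma null_minus: "null S R a b x \<Longrightarrow> null S R a b y \<Longrightarrow> null S R a b (x - y)"
  using null_add[of S R a b x "- y"] null_scale[of S R a b y "-1"] by (simp add: scale_minus)

lemma cgraphs_mono: "S \<subseteq> S' \<Longrightarrow> cgraphs S a b \<subseteq> cgraphs S' a b"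
  by (auto simp: cgraphs_def)

lemma free_mono: "S \<subseteq> S' \<Longrightarrow> free S a b \<subseteq> free S' a b"
  using cgraphs_mono[of S S' a b] by (auto simp: free_def)

lemma null_mono:
  assumes "null S R a b x" "S \<subseteq> S'" "R \<subseteq> R'"
  shows "null S' R' a b x"
  using assms(1)
proof (induction rule: null.induct)
  case (null_iso G a b H \<pi>)
  then show ?case using cgraphs_mono[OF assms(2)] by (blast intro: null.null_iso)
next
  case (null_rel r a b)
  then show ?case using free_mono[OF assms(2)] assms(3) by (blast intro: null.null_rel)
next
  case (null_join_left a b x y c d k)
  then show ?case using free_mono[OF assms(2)] by (blast intro: null.null_join_left)
next
  case (null_join_right x a b c d y k)
  then show ?case using free_mono[OF assms(2)] by (blast intro: null.null_join_right)
qed (simp_all add: null_zero null_add null_scale null_act)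

lemma congr_iff:
  "(x, y) \<in> congr S R a b \<longleftrightarrow> x \<in> free S a b \<and> y \<in> free S a b \<and> null S R a b (x - y)"
  by (simp add: congr_def)

lemma equiv_congr: "equiv (free S a b) (congr S R a b)"
proof (rule equivI)
  show "congr S R a b \<subseteq> free S a b \<times> free S a b" by (auto simp: congr_def)
  show "refl_on (free S a b) (congr S R a b)"
    by (auto simp: refl_on_def congr_def null_zero)
  show "sym (congr S R a b)"
  proof (rule symI)
    fix x y assume *: "(x, y) \<in> congr S R a b"
    then have "null S R a b (0 - (x - y))" unfolding congr_iff by (blast intro: null_minus null_zero)
    then show "(y, x) \<in> congr S R a b" using * by (simp add: congr_iff)
  qed
  show "trans (congr S R a b)"
  proof (rule transI)
    fix x y z assume *: "(x, y) \<in> congr S R a b" "(y, z) \<in> congr S R a b"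
    then have "null S R a b ((x - y) + (y - z))" unfolding congr_iff by (blast intro: null_add)
    then show "(x, z) \<in> congr S R a b" using * by (simp add: congr_iff)
  qed
qed

lemmas class_eq = equiv_class_eq[OF equiv_congr]

lemma class_self: "x \<in> free S a b \<Longrightarrow> x \<in> congr S R a b `` {x}"
  by (simp add: congr_iff null_zero)

text \<open>Operations on classes can be computed on representatives.\<close>

lemma image_class:
  assumes "x \<in> A" "x \<in> free S a b" "\<And>y. y \<in> A \<Longrightarrow> (x, y) \<in> congr S R a b"
  shows "congr S R a b `` A = congr S R a b `` {x}"
proof -
  have "congr S R a b `` {y} = congr S R a b `` {x}" if "y \<in> A" for y
    using class_eq[OF assms(3)[OF that]] by simp
  then show ?thesis using assms(1) by blast
qed


lemma padd_class:
  assumes "x \<in> free S a b" "y \<in> free S a b"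
  shows "padd (presented S R) a b (congr S R a b `` {x}) (congr S R a b `` {y}) =
    congr S R a b `` {x + y}"
proof -
  have "congr S R a b `` {x' + y' | x' y'. x' \<in> congr S R a b `` {x} \<and> y' \<in> congr S R a b `` {y}} =
    congr S R a b `` {x + y}"
  proof (rule image_class)
    fix z assume "z \<in> {x' + y' | x' y'. x' \<in> congr S R a b `` {x} \<and> y' \<in> congr S R a b `` {y}}"
    then obtain x' y' where z: "z = x' + y'" "(x, x') \<in> congr S R a b" "(y, y') \<in> congr S R a b"
      by blast
    then have "null S R a b ((x - x') + (y - y'))" unfolding congr_iff by (blast intro: null_add)
    then show "(x + y, z) \<in> congr S R a b"
      using z by (simp add: congr_iff free_add algebra_simps)
  qed (use assms class_self free_add in blast)+
  then show ?thesis by (simp add: presented_def)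
qed

lemma pscale_class:
  assumes "x \<in> free S a b"
  shows "pscale (presented S R) a b c (congr S R a b `` {x}) = congr S R a b `` {scale c x}"
proof -
  have "congr S R a b `` (scale c ` (congr S R a b `` {x})) = congr S R a b `` {scale c x}"
  proof (rule image_class)
    fix z assume "z \<in> scale c ` (congr S R a b `` {x})"
    then obtain x' where z: "z = scale c x'" "(x, x') \<in> congr S R a b" by blast
    then have "null S R a b (scale c (x - x'))" unfolding congr_iff by (blast intro: null_scale)
    then show "(scale c x, z) \<in> congr S R a b"
      using z by (simp add: congr_iff free_scale scale_diff)
  qed (use assms class_self free_scale in blast)+
  then show ?thesis by (simp add: presented_def)
qed

lemma pact_class:
  assumes "x \<in> free S a b" "\<sigma> permutes {..<a}" "\<rho> permutes {..<b}"
  shows "pact (presented S R) a b \<sigma> \<rho> (congr S R a b `` {x}) =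
    congr S R a b `` {act_lin a b \<sigma> \<rho> x}"
proof -
  have "congr S R a b `` (act_lin a b \<sigma> \<rho> ` (congr S R a b `` {x})) =
    congr S R a b `` {act_lin a b \<sigma> \<rho> x}"
  proof (rule image_class)
    fix z assume "z \<in> act_lin a b \<sigma> \<rho> ` (congr S R a b `` {x})"
    then obtain x' where z: "z = act_lin a b \<sigma> \<rho> x'" "(x, x') \<in> congr S R a b" by blast
    then have "null S R a b (act_lin a b \<sigma> \<rho> (x - x'))"
      using assms unfolding congr_iff by (blast intro: null_act)
    then show "(act_lin a b \<sigma> \<rho> x, z) \<in> congr S R a b"
      using z assms by (simp add: congr_iff free_act act_lin_diff)
  qed (use assms class_self free_act in blast)+
  then show ?thesis by (simp add: presented_def)
qed

lemma pcomp_class: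
  assumes "x \<in> free S a b" "y \<in> free S c d" and k: "1 \<le> k" "k \<le> b" "k \<le> c"
  shows "pcomp (presented S R) a b c d k (congr S R a b `` {x}) (congr S R c d `` {y}) =
    congr S R (a + c - k) (b + d - k) `` {bilin (gjoin k) x y}"
proof -
  let ?C = "congr S R (a + c - k) (b + d - k)"
  have "?C `` {bilin (gjoin k) x' y' | x' y'. x' \<in> congr S R a b `` {x} \<and> y' \<in> congr S R c d `` {y}} =
    ?C `` {bilin (gjoin k) x y}"
  proof (rule image_class)
    fix z assume "z \<in> {bilin (gjoin k) x' y' | x' y'.
      x' \<in> congr S R a b `` {x} \<and> y' \<in> congr S R c d `` {y}}"
    then obtain x' y' where z: "z = bilin (gjoin k) x' y'"
      "(x, x') \<in> congr S R a b" "(y, y') \<in> congr S R c d" by blast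
    have "null S R (a + c - k) (b + d - k) (bilin (gjoin k) (x - x') y)"
      using z assms unfolding congr_iff by (intro null_join_left) auto
    moreover have "null S R (a + c - k) (b + d - k) (bilin (gjoin k) x' (y - y'))"
      using z k unfolding congr_iff by (intro null_join_right) auto
    ultimately have "null S R (a + c - k) (b + d - k)
        (bilin (gjoin k) (x - x') y + bilin (gjoin k) x' (y - y'))"
      by (rule null_add)
    then have "null S R (a + c - k) (b + d - k) (bilin (gjoin k) x y - z)"
      by (simp add: bilin_diff_left bilin_diff_right z)
    then show "(bilin (gjoin k) x y, z) \<in> ?C"
      using z assms by (simp add: congr_iff free_join)
  next
    show "bilin (gjoin k) x y \<in> {bilin (gjoin k) x' y' | x' y'.
        x' \<in> congr S R a b `` {x} \<and> y' \<in> congr S R c d `` {y}}"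
      using class_self[OF assms(1)] class_self[OF assms(2)] by blast
    show "bilin (gjoin k) x y \<in> free S (a + c - k) (b + d - k)"
      using assms by (rule free_join)
  qed
  then show ?thesis by (simp add: presented_def)
qed


section \<open>The canonical morphism is a morphism of properads\<close>

lemma gens_mono: "bib_gens \<subseteq> ubib_gens"
  by (auto simp: bib_gens_def ubib_gens_def)

lemma iota_class:
  assumes "x \<in> free bib_gens a b"
  shows "iota a b (congr bib_gens bib_rels a b `` {x}) =
    congr ubib_gens (bib_rels \<union> unit_rels) a b `` {x}"
  unfolding iota_def
proof (rule image_class)
  show "x \<in> congr bib_gens bib_rels a b `` {x}" using assms by (rule class_self)
  show "x \<in> free ubib_gens a b" using assms free_mono[OF gens_mono] by blast
  fix y assume "y \<in> congr bib_gens bib_rels a b `` {x}"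
  then show "(x, y) \<in> congr ubib_gens (bib_rels \<union> unit_rels) a b"
    using null_mono[OF _ gens_mono, of bib_rels a b "x - y" "bib_rels \<union> unit_rels"]
    by (simp add: congr_iff subsetD[OF free_mono[OF gens_mono]])
qed

lemma elems_presented: "elems (presented S R) a b = (\<lambda>x. congr S R a b `` {x}) ` free S a b"
  by (auto simp: presented_def quotient_def)

lemma homog_presented: "homog (presented S R) a b d =
    (\<lambda>x. congr S R a b `` {x}) ` {x \<in> free S a b. \<forall>G\<in>Poly_Mapping.keys x. graph_deg G = d}"
  by (auto simp: presented_def quotient_def)

lemma id_graph_cgraphs: "id_graph 1 \<in> cgraphs S 1 1"
proof -
  have "s = Ext 0" if "s \<in> sources (id_graph 1)" for s
    using that by (cases s) auto
  then have "connected_graph (id_graph 1)"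
    by (intro connected_graphI[of "Ext 0"]) auto
  then show ?thesis using dag_id by (auto simp: cgraphs_def)
qed

lemma gen_graph_simps [simp]:
  "ins (gen_graph g) = n_in g" "outs (gen_graph g) = n_out g" "verts (gen_graph g) = [g]"
  "wire (gen_graph g) (Ext i) = Vtx 0 i" "wire (gen_graph g) (Vtx v j) = Ext j"
  by (simp_all add: gen_graph_def)

lemma dag_gen: "dag (gen_graph g)"
proof (rule dagI)
  show "wire (gen_graph g) s \<in> targets (gen_graph g)" if "s \<in> sources (gen_graph g)" for s
    using that by (cases s) auto
  show "s = t" if "s \<in> sources (gen_graph g)" "t \<in> sources (gen_graph g)"
    "wire (gen_graph g) s = wire (gen_graph g) t" for s t
    using that by (cases s; cases t) auto
  show "\<exists>s\<in>sources (gen_graph g). wire (gen_graph g) s = u" if "u \<in> targets (gen_graph g)" for u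
  proof (cases u)
    case (Ext i)
    then show ?thesis using that by (intro bexI[of _ "Vtx 0 i"]) auto
  next
    case (Vtx v j)
    then show ?thesis using that by (intro bexI[of _ "Ext j"]) auto
  qed
  have "vertex_rel (gen_graph g) = {}" by (auto simp: vertex_rel_def)
  then show "acyclic (vertex_rel (gen_graph g))" by (simp add: acyclic_def)
qed

lemma gen_graph_cgraphs:
  assumes "g \<in> S"
  shows "gen_graph g \<in> cgraphs S (n_out g) (n_in g)"
proof -
  have "s \<in> incident (gen_graph g) 0" if "s \<in> sources (gen_graph g)" for s
    using that by (cases s) (auto simp: incident_iff)
  moreover have "Vtx 0 0 \<in> sources (gen_graph g)" by (cases g) auto
  ultimately have "connected_graph (gen_graph g)"
    by (intro connected_graphI[of "Vtx 0 0"]) (auto simp: edge_adj_def)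
  then show ?thesis using dag_gen assms by (auto simp: cgraphs_def)
qed

lemma iota_gen_class:
  assumes "g \<in> bib_gens"
  shows "iota (n_out g) (n_in g) (gen_class bib_gens bib_rels g) =
    gen_class ubib_gens (bib_rels \<union> unit_rels) g"
  unfolding gen_class_def by (intro iota_class free_single1 gen_graph_cgraphs assms)

lemma iota_hom: "properad_hom BIB uBIB iota"
  unfolding properad_hom_def BIB_def uBIB_def
proof (intro conjI allI impI ballI)
  note fm = subsetD[OF free_mono[OF gens_mono]]
  let ?P = "presented bib_gens bib_rels" and ?Q = "presented ubib_gens (bib_rels \<union> unit_rels)"
  fix a b
  show "iota a b X \<in> elems ?Q a b" if "X \<in> elems ?P a b" for X
    using that unfolding elems_presented by (auto simp: fm iota_class)
  show "iota a b X \<in> homog ?Q a b d" if "X \<in> homog ?P a b d" for X d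
    using that unfolding homog_presented by (auto simp: fm iota_class)
  show "iota a b (padd ?P a b X Y) = padd ?Q a b (iota a b X) (iota a b Y)"
    if "X \<in> elems ?P a b" "Y \<in> elems ?P a b" for X Y
    using that unfolding elems_presented by (auto simp: fm iota_class padd_class free_add)
  show "iota a b (pscale ?P a b c X) = pscale ?Q a b c (iota a b X)"
    if "X \<in> elems ?P a b" for X c
    using that unfolding elems_presented by (auto simp: fm iota_class pscale_class free_scale)
  show "iota a b (pact ?P a b \<sigma> \<rho> X) = pact ?Q a b \<sigma> \<rho> (iota a b X)"
    if "X \<in> elems ?P a b" "\<sigma> permutes {..<a}" "\<rho> permutes {..<b}" for X \<sigma> \<rho>
    using that unfolding elems_presented by (auto simp: fm iota_class pact_class free_act)
  show "iota (a + c - k) (b + d - k) (pcomp ?P a b c d k X Y) =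
      pcomp ?Q a b c d k (iota a b X) (iota c d Y)"
    if "X \<in> elems ?P a b" "Y \<in> elems ?P c d" "1 \<le> k" "k \<le> b" "k \<le> c" for X Y c d k
  proof -
    from that(1,2) obtain x y where "x \<in> free bib_gens a b" "y \<in> free bib_gens c d"
      "X = congr bib_gens bib_rels a b `` {x}" "Y = congr bib_gens bib_rels c d `` {y}"
      unfolding elems_presented by blast
    then show ?thesis using that(3-)
      by (simp add: fm iota_class pcomp_class free_join del: One_nat_def)
  qed
next
  show "iota 1 1 (pone (presented bib_gens bib_rels)) =
      pone (presented ubib_gens (bib_rels \<union> unit_rels))"
    using iota_class[OF free_single1[OF id_graph_cgraphs]] by (simp add: presented_def)
qed


section \<open>The relations are combinations of connected graphs of one arity\<close>

text \<open>Hence none of them is discarded by the side condition of \<open>null_rel\<close>.\<close>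

lemma connected_two_vertices:
  assumes "length (verts G) = 2"
    and "\<And>s. s \<in> sources G \<Longrightarrow> s \<in> incident G 0 \<or> s \<in> incident G 1"
    and "s0 \<in> incident G 0" "s0 \<in> incident G 1"
  shows "connected_graph G"
proof (rule connected_graphI[of s0])
  show "s0 \<in> sources G" using assms(3) by (simp add: incident_iff)
  show "(s0, s) \<in> (edge_adj G)\<^sup>*" if "s \<in> sources G" for s
    using assms(2)[OF that] assms(1,3,4) by (intro r_into_rtrancl) (auto simp: edge_adj_def)
qed

lemma wire_gcomp_Ext: "wire (gcomp G H) (Ext i) = through G (wire H (Ext i))"
  by (simp add: gcomp_def through_def Let_def)

lemma wire_gcomp_Vtx: "wire (gcomp G H) (Vtx v j) =
    (if v < length (verts G) then wire G (Vtx v j) else through G (wire H (Vtx (v - length (verts G)) j)))"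
  by (simp add: gcomp_def through_def Let_def)

lemma wire_gtensor_Ext: "wire (gtensor G H) (Ext i) =
    (if i < ins G then wire G (Ext i) else shift (length (verts G)) (outs G) (wire H (Ext (i - ins G))))"
  using wire_gtensor_right[of G H "Ext (i - ins G)"] by (cases "i < ins G") simp_all

lemma wire_gtensor_Vtx: "wire (gtensor G H) (Vtx v j) =
    (if v < length (verts G) then wire G (Vtx v j)
     else shift (length (verts G)) (outs G) (wire H (Vtx (v - length (verts G)) j)))"
  by (cases "wire H (Vtx (v - length (verts G)) j)") (simp_all add: gtensor_def Let_def)

lemmas wire_eval = wire_gcomp_Ext wire_gcomp_Vtx wire_gtensor_Ext wire_gtensor_Vtx
  Transposition.transpose_def

lemma swap_permutes: "Transposition.transpose 0 1 permutes {..<2::nat}"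
  by (rule permutes_swap_id) auto

lemma port_all: "(\<forall>s. P s) \<longleftrightarrow> (\<forall>i. P (Ext i)) \<and> (\<forall>v j. P (Vtx v j))"
  by (metis port.exhaust)

abbreviation (input) "mulG \<equiv> gen_graph Mult"
abbreviation (input) "copG \<equiv> gen_graph Comult"
abbreviation (input) "idG \<equiv> id_graph 1"
abbreviation (input) "swpG \<equiv> perm_graph 2 (Transposition.transpose 0 1)"
abbreviation (input) "BG \<equiv> gcomp (gtensor idG mulG) (gcomp (gtensor swpG idG) (gtensor idG copG))"
abbreviation (input) "DG \<equiv> gcomp (gtensor mulG idG) (gcomp (gtensor idG swpG) (gtensor copG idG))"

lemma two_vertex_cgraph:
  assumes "dag G" "outs G = a" "ins G = b" "length (verts G) = 2" "set (verts G) \<subseteq> S"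
    and "\<forall>s. s \<in> sources G \<longrightarrow> s \<in> incident G 0 \<or> s \<in> incident G 1"
    and "s0 \<in> incident G 0" "s0 \<in> incident G 1"
  shows "G \<in> cgraphs S a b"
  using assms connected_two_vertices[of G s0] by (simp add: cgraphs_def)

lemma less_two_three:
  "i < (2::nat) \<longleftrightarrow> i = 0 \<or> i = 1" "i < (3::nat) \<longleftrightarrow> i = 0 \<or> i = 1 \<or> i = 2"
  by auto

lemma relation_graphs:
  assumes "{Mult, Comult} \<subseteq> S"
  shows
    "gcomp mulG (gtensor idG mulG) \<in> cgraphs S 1 3"
    "gcomp mulG (gtensor mulG idG) \<in> cgraphs S 1 3"
    "gcomp (gtensor idG copG) copG \<in> cgraphs S 3 1"
    "gcomp (gtensor copG idG) copG \<in> cgraphs S 3 1"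
    "gcomp copG mulG \<in> cgraphs S 2 2"
    "gcomp (gtensor mulG idG) (gtensor idG copG) \<in> cgraphs S 2 2"
    "gcomp (gtensor idG mulG) (gtensor copG idG) \<in> cgraphs S 2 2"
    "BG \<in> cgraphs S 2 2"
    "gcomp swpG (gcomp BG swpG) \<in> cgraphs S 2 2"
    "gcomp DG swpG \<in> cgraphs S 2 2"
    "gcomp mulG copG \<in> cgraphs S 1 1"
    "gcomp mulG (gcomp swpG copG) \<in> cgraphs S 1 1"
proof -
  show "gcomp mulG (gtensor idG mulG) \<in> cgraphs S 1 3"
    by (rule two_vertex_cgraph[of _ _ _ _ "Vtx 1 0"], (intro dag_gcomp dag_gtensor dag_gen dag_id dag_perm swap_permutes; simp))
      (use assms in \<open>auto simp: port_all incident_iff wire_eval less_two_three less_Suc_eq nth_append\<close>)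
  show "gcomp mulG (gtensor mulG idG) \<in> cgraphs S 1 3"
    by (rule two_vertex_cgraph[of _ _ _ _ "Vtx 1 0"], (intro dag_gcomp dag_gtensor dag_gen dag_id dag_perm swap_permutes; simp))
      (use assms in \<open>auto simp: port_all incident_iff wire_eval less_two_three less_Suc_eq nth_append\<close>)
  show "gcomp (gtensor idG copG) copG \<in> cgraphs S 3 1"
    by (rule two_vertex_cgraph[of _ _ _ _ "Vtx 1 1"], (intro dag_gcomp dag_gtensor dag_gen dag_id dag_perm swap_permutes; simp))
      (use assms in \<open>auto simp: port_all incident_iff wire_eval less_two_three less_Suc_eq nth_append\<close>)
  show "gcomp (gtensor copG idG) copG \<in> cgraphs S 3 1"
    by (rule two_vertex_cgraph[of _ _ _ _ "Vtx 1 0"], (intro dag_gcomp dag_gtensor dag_gen dag_id dag_perm swap_permutes; simp))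
      (use assms in \<open>auto simp: port_all incident_iff wire_eval less_two_three less_Suc_eq nth_append\<close>)
  show "gcomp copG mulG \<in> cgraphs S 2 2"
    by (rule two_vertex_cgraph[of _ _ _ _ "Vtx 1 0"], (intro dag_gcomp dag_gtensor dag_gen dag_id dag_perm swap_permutes; simp))
      (use assms in \<open>auto simp: port_all incident_iff wire_eval less_two_three less_Suc_eq nth_append\<close>)
  show "gcomp (gtensor mulG idG) (gtensor idG copG) \<in> cgraphs S 2 2"
    by (rule two_vertex_cgraph[of _ _ _ _ "Vtx 1 0"], (intro dag_gcomp dag_gtensor dag_gen dag_id dag_perm swap_permutes; simp))
      (use assms in \<open>auto simp: port_all incident_iff wire_eval less_two_three less_Suc_eq nth_append\<close>)
  show "gcomp (gtensor idG mulG) (gtensor copG idG) \<in> cgraphs S 2 2"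
    by (rule two_vertex_cgraph[of _ _ _ _ "Vtx 1 1"], (intro dag_gcomp dag_gtensor dag_gen dag_id dag_perm swap_permutes; simp))
      (use assms in \<open>auto simp: port_all incident_iff wire_eval less_two_three less_Suc_eq nth_append\<close>)
  show "BG \<in> cgraphs S 2 2"
    by (rule two_vertex_cgraph[of _ _ _ _ "Vtx 1 1"], (intro dag_gcomp dag_gtensor dag_gen dag_id dag_perm swap_permutes; simp))
      (use assms in \<open>auto simp: port_all incident_iff wire_eval less_two_three less_Suc_eq nth_append\<close>)
  show "gcomp swpG (gcomp BG swpG) \<in> cgraphs S 2 2"
    by (rule two_vertex_cgraph[of _ _ _ _ "Vtx 1 1"], (intro dag_gcomp dag_gtensor dag_gen dag_id dag_perm swap_permutes; simp))
      (use assms in \<open>auto simp: port_all incident_iff wire_eval less_two_three less_Suc_eq nth_append\<close>)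
  show "gcomp DG swpG \<in> cgraphs S 2 2"
    by (rule two_vertex_cgraph[of _ _ _ _ "Vtx 1 0"], (intro dag_gcomp dag_gtensor dag_gen dag_id dag_perm swap_permutes; simp))
      (use assms in \<open>auto simp: port_all incident_iff wire_eval less_two_three less_Suc_eq nth_append\<close>)
  show "gcomp mulG copG \<in> cgraphs S 1 1"
    by (rule two_vertex_cgraph[of _ _ _ _ "Vtx 1 0"], (intro dag_gcomp dag_gtensor dag_gen dag_id dag_perm swap_permutes; simp))
      (use assms in \<open>auto simp: port_all incident_iff wire_eval less_two_three less_Suc_eq nth_append\<close>)
  show "gcomp mulG (gcomp swpG copG) \<in> cgraphs S 1 1"
    by (rule two_vertex_cgraph[of _ _ _ _ "Vtx 1 0"], (intro dag_gcomp dag_gtensor dag_gen dag_id dag_perm swap_permutes; simp))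
      (use assms in \<open>auto simp: port_all incident_iff wire_eval less_two_three less_Suc_eq nth_append\<close>)
qed

lemma unit_relation_graphs:
  assumes "{Mult, Comult, Unit} \<subseteq> S"
  shows
    "gcomp mulG (gtensor (gen_graph Unit) idG) \<in> cgraphs S 1 1"
    "gcomp mulG (gtensor idG (gen_graph Unit)) \<in> cgraphs S 1 1"
proof -
  show "gcomp mulG (gtensor (gen_graph Unit) idG) \<in> cgraphs S 1 1"
    by (rule two_vertex_cgraph[of _ _ _ _ "Vtx 1 0"], (intro dag_gcomp dag_gtensor dag_gen dag_id dag_perm swap_permutes; simp))
      (use assms in \<open>auto simp: port_all incident_iff wire_eval less_two_three less_Suc_eq nth_append\<close>)
  show "gcomp mulG (gtensor idG (gen_graph Unit)) \<in> cgraphs S 1 1"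
    by (rule two_vertex_cgraph[of _ _ _ _ "Vtx 1 0"], (intro dag_gcomp dag_gtensor dag_gen dag_id dag_perm swap_permutes; simp))
      (use assms in \<open>auto simp: port_all incident_iff wire_eval less_two_three less_Suc_eq nth_append\<close>)
qed

lemma free_uminus: "x \<in> free S a b \<Longrightarrow> - x \<in> free S a b"
  using free_minus[OF free_zero] by fastforce

lemma bib_rels_arities:
  assumes "{Mult, Comult} \<subseteq> S"
  shows "(bib_rels :: 'k::field_char_0 lin set) \<subseteq>
    free S 1 3 \<union> free S 3 1 \<union> free S 2 2 \<union> free S 1 1"
proof -
  note R = relation_graphs[OF assms, THEN free_single1]
  show ?thesis
    unfolding bib_rels_def rel_B_def rel_D_def comp_lin_def tensor_lin_def bilin_single1
      bilin_diff_left bilin_diff_right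
    by (simp add: R free_add free_minus free_uminus del: One_nat_def)
qed

lemma unit_rels_arities:
  assumes "{Mult, Comult, Unit} \<subseteq> S"
  shows "(unit_rels :: 'k::field_char_0 lin set) \<subseteq> free S 1 1"
  unfolding unit_rels_def comp_lin_def tensor_lin_def bilin_single1
  by (simp add: free_add free_minus free_single1 id_graph_cgraphs unit_relation_graphs[OF assms] del: One_nat_def)

end

theory Submission
  imports Defs "HOL-Library.Countable" "HOL-Library.FuncSet"
begin

text \<open>
  The two properads are compared by means of certain graphs without unit vertices, the combs:
  they span the properad without unit, and they are linearly independent in the unital one.

  Combs span. The Frobenius and (co)associativity relations let a vertex slide along a path of
  the graph. Building up a graph of \<open>bib_gens\<close> from its inputs, one can therefore
  keep it in the form of disjoint strands: a strand enters at one input, absorbs further inputs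
  by the product, emits outputs by the coproduct and leaves as an output. A coproduct prolongs a
  strand, a product of outputs of two strands merges them (this uses the balance relations), and
  a product of two outputs of the same strand vanishes (this rests on \<open>m \<Delta> =
  0\<close> and \<open>m \<tau> \<Delta> = 0\<close>). A connected graph thus vanishes or is, up
  to a nonzero scalar, a single strand, called a comb; it is recorded by the word of its legs
  (\<open>net_to_comb\<close>, \<open>cgraph_comb\<close>). The balance relations also rotate
  this word (\<open>strand_rotate\<close>), so one comb for each word up to rotation suffices
  (\<open>spanned\<close>).

  Combs stay independent. The unital properad acts on the space of \<open>N \<times> N\<close>
  matrices with entries in the span of an even and an odd basis vector. With the basis indexed
  by triples \<open>(i, j, p)\<close> (a matrix position and a parity), the matrix coefficients
  of the action of a graph are the integers \<open>Z N G y x\<close>: a sum over all colourings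
  of the edges by basis vectors of a product of vertex weights and of a sign, which counts the
  crossings of the odd edges. These numbers turn composition into matrix multiplication and
  tensor products into products up to a sign that depends on the states only
  (\<open>Z_gcomp\<close>, \<open>Z_gtensor\<close>), they see the order of the vertices through
  the Koszul sign (\<open>Z_iso\<close>), and they satisfy all the relations, those of the unit
  included (\<open>Z_relations\<close>). Hence they annihilate every null combination of the
  unital properad (\<open>null_state_sum\<close>).

  Given a word of length \<open>n\<close>, take \<open>N = n\<close> and colour its
  \<open>t\<close>-th leg by the matrix position with indices \<open>t\<close> and \<open>t +
  1\<close> modulo \<open>n\<close>. As the indices must match along a strand, the coefficient
  of a comb at this state vanishes unless its word is a rotation of the given one, and it does
  not vanish for the given word itself (\<open>word_sum_rotation\<close>,
  \<open>word_sum_nonzero\<close>). So if a combination of graphs without unit vertices is null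
  in the unital properad, all coefficients of its expression by combs are zero, and it was null
  before (\<open>unital_null\<close>).
\<close>

section \<open>Nets: graphs whose edges carry names\<close>

text \<open>
  A vertex is written with the names of its incoming and outgoing edges. Equal names express
  that two ends belong to the same edge, so that the moves below become rewriting of lists of
  cells, without any bookkeeping of ports.
\<close>

type_synonym cell = "generator \<times> nat list \<times> nat list"

abbreviation cin :: "cell \<Rightarrow> nat list" where "cin c \<equiv> fst (snd c)"
abbreviation cout :: "cell \<Rightarrow> nat list" where "cout c \<equiv> snd (snd c)"

definition inl :: "cell list \<Rightarrow> nat list" where "inl cs = concat (map cin cs)"
definition outl :: "cell list \<Rightarrow> nat list" where "outl cs = concat (map cout cs)"

lemma inl_simps [simp]: "inl [] = []" "inl (c # cs) = cin c @ inl cs" "inl (cs @ ds) = inl cs @ inl ds"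
  by (simp_all add: inl_def)

lemma outl_simps [simp]: "outl [] = []" "outl (c # cs) = cout c @ outl cs" "outl (cs @ ds) = outl cs @ outl ds"
  by (simp_all add: outl_def)

text \<open>
  Cells are listed with the last applied one first, as in a composite: an input of a cell is a
  global input or an output of a cell further down the list. This makes the vertex relation
  acyclic.
\<close>

fun ordered :: "nat set \<Rightarrow> cell list \<Rightarrow> bool" where
  "ordered A [] = True"
| "ordered A (c # cs) = (set (cin c) \<subseteq> A \<union> set (outl cs) \<and> ordered A cs)"

definition wf_cell :: "cell \<Rightarrow> bool" where
  "wf_cell c \<longleftrightarrow> fst c \<in> bib_gens \<and> length (cin c) = n_in (fst c) \<and> length (cout c) = n_out (fst c)"

definition net :: "nat list \<Rightarrow> nat list \<Rightarrow> cell list \<Rightarrow> bool" where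
  "net I J cs \<longleftrightarrow> (\<forall>c\<in>set cs. wf_cell c) \<and> distinct (I @ outl cs) \<and> distinct (J @ inl cs) \<and>
     set I \<union> set (outl cs) = set J \<union> set (inl cs) \<and> ordered (set I) cs"

fun sname :: "nat list \<Rightarrow> cell list \<Rightarrow> port \<Rightarrow> nat" where
  "sname I cs (Ext i) = I ! i"
| "sname I cs (Vtx v j) = cout (cs ! v) ! j"

fun tname :: "nat list \<Rightarrow> cell list \<Rightarrow> port \<Rightarrow> nat" where
  "tname J cs (Ext i) = J ! i"
| "tname J cs (Vtx v j) = cin (cs ! v) ! j"

definition lab :: "graph \<Rightarrow> nat list \<Rightarrow> nat list \<Rightarrow> cell list \<Rightarrow> bool" where
  "lab G I J cs \<longleftrightarrow> ins G = length I \<and> outs G = length J \<and> verts G = map fst cs \<and>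
     (\<forall>c\<in>set cs. length (cin c) = n_in (fst c) \<and> length (cout c) = n_out (fst c)) \<and>
     (\<forall>s\<in>sources G. wire G s \<in> targets G \<and> tname J cs (wire G s) = sname I cs s)"

text \<open>
  Connectedness by closed sets: a nonempty set of edges that contains all or none of the edges
  at each cell contains all edges. This form avoids paths.
\<close>

definition net_connected :: "nat list \<Rightarrow> cell list \<Rightarrow> bool" where
  "net_connected I cs \<longleftrightarrow> set I \<union> set (outl cs) \<noteq> {} \<and>
     (\<forall>A. (\<forall>c\<in>set cs. set (cin c) \<union> set (cout c) \<subseteq> A \<or> (set (cin c) \<union> set (cout c)) \<inter> A = {}) \<longrightarrow>
        A \<inter> (set I \<union> set (outl cs)) \<noteq> {} \<longrightarrow> set I \<union> set (outl cs) \<subseteq> A)"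

lemma distinct_concat_nth:
  assumes "distinct (concat (map f xs))" "v < length xs" "w < length xs"
    "j < length (f (xs ! v))" "k < length (f (xs ! w))" "f (xs ! v) ! j = f (xs ! w) ! k"
  shows "v = w \<and> j = k"
  using assms
proof (induction xs arbitrary: v w)
  case (Cons x xs)
  have m: "f (xs ! u) ! l \<in> set (concat (map f xs))" if "u < length xs" "l < length (f (xs ! u))" for u l
    using that by (auto intro!: bexI[of _ "xs ! u"])
  show ?case
  proof (cases v)
    case 0
    then show ?thesis using Cons.prems m[of "w - 1" k]
      by (cases w) (force simp: nth_eq_iff_index_eq dest: nth_mem)+
  next
    case v: (Suc v')
    show ?thesis
    proof (cases w)
      case 0
      then show ?thesis using Cons.prems m[of v' j] v by (force dest: nth_mem)
    next
      case (Suc w')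
      then show ?thesis using Cons.IH[of v' w'] Cons.prems v by auto
    qed
  qed
qed simp

lemma in_outl: "x \<in> set (outl cs) \<longleftrightarrow> (\<exists>v j. v < length cs \<and> j < length (cout (cs ! v)) \<and> x = cout (cs ! v) ! j)"
proof -
  have "x \<in> set (outl cs) \<longleftrightarrow> (\<exists>c\<in>set cs. x \<in> set (cout c))" by (simp add: outl_def)
  then show ?thesis by (metis in_set_conv_nth)
qed

lemma in_inl: "x \<in> set (inl cs) \<longleftrightarrow> (\<exists>v j. v < length cs \<and> j < length (cin (cs ! v)) \<and> x = cin (cs ! v) ! j)"
proof -
  have "x \<in> set (inl cs) \<longleftrightarrow> (\<exists>c\<in>set cs. x \<in> set (cin c))" by (simp add: inl_def)
  then show ?thesis by (metis in_set_conv_nth)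
qed

lemma lab_simps:
  assumes "lab G I J cs"
  shows "ins G = length I" "outs G = length J" "verts G = map fst cs"
    "v < length cs \<Longrightarrow> length (cin (cs ! v)) = n_in (fst (cs ! v))"
    "v < length cs \<Longrightarrow> length (cout (cs ! v)) = n_out (fst (cs ! v))"
    "s \<in> sources G \<Longrightarrow> wire G s \<in> targets G"
    "s \<in> sources G \<Longrightarrow> tname J cs (wire G s) = sname I cs s"
  using assms unfolding lab_def by (auto dest: nth_mem)

lemma lab_sources:
  assumes "lab G I J cs"
  shows "Ext i \<in> sources G \<longleftrightarrow> i < length I"
    "Vtx v j \<in> sources G \<longleftrightarrow> v < length cs \<and> j < length (cout (cs ! v))"
    "Ext i \<in> targets G \<longleftrightarrow> i < length J"
    "Vtx v j \<in> targets G \<longleftrightarrow> v < length cs \<and> j < length (cin (cs ! v))"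
  using lab_simps[OF assms] by auto

lemma sname_inj:
  assumes "net I J cs" "lab G I J cs" "s \<in> sources G" "t \<in> sources G" "sname I cs s = sname I cs t"
  shows "s = t"
proof -
  have d: "distinct I" "distinct (concat (map cout cs))" "set I \<inter> set (outl cs) = {}"
    using assms(1) by (auto simp: net_def outl_def)
  have o: "I ! i \<noteq> cout (cs ! v) ! j" if "v < length cs" "j < length (cout (cs ! v))" "i < length I" for v j i
    using that d(3) in_outl by (metis disjoint_iff nth_mem)
  show ?thesis
    using assms(3-5) d(1) o o[symmetric] distinct_concat_nth[OF d(2)]
    by (cases s; cases t) (auto simp: lab_sources[OF assms(2)] nth_eq_iff_index_eq simp del: sources_iff dest: nth_mem)
qed

lemma tname_inj:
  assumes "net I J cs" "lab G I J cs" "s \<in> targets G" "t \<in> targets G" "tname J cs s = tname J cs t"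
  shows "s = t"
proof -
  have d: "distinct J" "distinct (concat (map cin cs))" "set J \<inter> set (inl cs) = {}"
    using assms(1) by (auto simp: net_def inl_def)
  have o: "J ! i \<noteq> cin (cs ! v) ! j" if "v < length cs" "j < length (cin (cs ! v))" "i < length J" for v j i
    using that d(3) in_inl by (metis disjoint_iff nth_mem)
  show ?thesis
    using assms(3-5) d(1) o o[symmetric] distinct_concat_nth[OF d(2)]
    by (cases s; cases t) (auto simp: lab_sources[OF assms(2)] nth_eq_iff_index_eq simp del: targets_iff dest: nth_mem)
qed

lemma sname_image:
  assumes "lab G I J cs"
  shows "sname I cs ` sources G = set I \<union> set (outl cs)"
proof (intro equalityI subsetI)
  fix x assume "x \<in> sname I cs ` sources G"
  then obtain s where s: "s \<in> sources G" "x = sname I cs s" by blast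
  then show "x \<in> set I \<union> set (outl cs)"
    by (cases s) (auto simp: lab_sources[OF assms] in_outl simp del: sources_iff)
next
  fix x assume "x \<in> set I \<union> set (outl cs)"
  then consider i where "i < length I" "x = I ! i"
    | v j where "v < length cs" "j < length (cout (cs ! v))" "x = cout (cs ! v) ! j"
    by (auto simp: in_outl in_set_conv_nth[of x I])
  then show "x \<in> sname I cs ` sources G"
  proof cases
    case 1
    then show ?thesis by (intro image_eqI[of _ _ "Ext i"]) (auto simp: lab_sources[OF assms] simp del: sources_iff)
  next
    case 2
    then show ?thesis by (intro image_eqI[of _ _ "Vtx v j"]) (auto simp: lab_sources[OF assms] simp del: sources_iff)
  qed
qed

lemma tname_image:
  assumes "lab G I J cs"
  shows "tname J cs ` targets G = set J \<union> set (inl cs)"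
proof (intro equalityI subsetI)
  fix x assume "x \<in> tname J cs ` targets G"
  then obtain s where s: "s \<in> targets G" "x = tname J cs s" by blast
  then show "x \<in> set J \<union> set (inl cs)"
    by (cases s) (auto simp: lab_sources[OF assms] in_inl simp del: targets_iff)
next
  fix x assume "x \<in> set J \<union> set (inl cs)"
  then consider i where "i < length J" "x = J ! i"
    | v j where "v < length cs" "j < length (cin (cs ! v))" "x = cin (cs ! v) ! j"
    by (auto simp: in_inl in_set_conv_nth[of x J])
  then show "x \<in> tname J cs ` targets G"
  proof cases
    case 1
    then show ?thesis by (intro image_eqI[of _ _ "Ext i"]) (auto simp: lab_sources[OF assms] simp del: targets_iff)
  next
    case 2
    then show ?thesis by (intro image_eqI[of _ _ "Vtx v j"]) (auto simp: lab_sources[OF assms] simp del: targets_iff)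
  qed
qed

lemma ordered_nth:
  "ordered A cs \<Longrightarrow> w < length cs \<Longrightarrow> x \<in> set (cin (cs ! w)) \<Longrightarrow>
    x \<in> A \<or> (\<exists>v>w. v < length cs \<and> x \<in> set (cout (cs ! v)))"
proof (induction cs arbitrary: w)
  case (Cons c cs)
  show ?case
  proof (cases w)
    case 0
    then have "x \<in> A \<or> x \<in> set (outl cs)" using Cons.prems by auto
    then show ?thesis using 0 by (fastforce simp: in_outl)
  next
    case (Suc w')
    then show ?thesis using Cons.IH[of w'] Cons.prems by fastforce
  qed
qed simp

text \<open>
  Along an edge the position in the list of cells decreases, so there is no directed cycle.
\<close>

lemma dag_lab:
  assumes "net I J cs" "lab G I J cs"
  shows "dag G"
proof (rule dagI)
  note n = lab_simps[OF assms(2)]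
  show "wire G s \<in> targets G" if "s \<in> sources G" for s using n(6)[OF that] .
  show "s = t" if "s \<in> sources G" "t \<in> sources G" "wire G s = wire G t" for s t
    using sname_inj[OF assms that(1,2)] that n(7) by metis
  show "\<exists>s\<in>sources G. wire G s = u" if "u \<in> targets G" for u
  proof -
    have "tname J cs u \<in> set I \<union> set (outl cs)"
      using that tname_image[OF assms(2)] assms(1) by (auto simp: net_def)
    then obtain s where s: "s \<in> sources G" "sname I cs s = tname J cs u"
      using sname_image[OF assms(2)] by (metis imageE)
    then have "wire G s = u" using tname_inj[OF assms n(6)[OF s(1)] that] n(7) by simp
    then show ?thesis using s by blast
  qed
  have "w < v" if "(v, w) \<in> vertex_rel G" for v w
  proof -
    obtain i j where *: "Vtx v i \<in> sources G" "wire G (Vtx v i) = Vtx w j"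
      using \<open>(v, w) \<in> vertex_rel G\<close> by (auto simp: vertex_rel_def simp del: sources_iff)
    have t: "w < length cs" "j < length (cin (cs ! w))"
      using n(6)[OF *(1)] *(2) lab_sources[OF assms(2)] by auto
    have x: "cin (cs ! w) ! j = cout (cs ! v) ! i" using n(7)[OF *(1)] *(2) by simp
    have vi: "v < length cs" "i < length (cout (cs ! v))" using *(1) lab_sources[OF assms(2)] by auto
    have "cin (cs ! w) ! j \<in> set (cin (cs ! w))" using t by simp
    from ordered_nth[OF _ t(1) this, of "set I"] assms(1)
    consider "cin (cs ! w) ! j \<in> set I" | v' where "v' > w" "v' < length cs" "cin (cs ! w) ! j \<in> set (cout (cs ! v'))"
      by (auto simp: net_def)
    then show ?thesis
    proof cases
      case 1
      moreover have "cin (cs ! w) ! j \<in> set (outl cs)" using x vi in_outl by metis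
      ultimately show ?thesis using assms(1) by (auto simp: net_def)
    next
      case 2
      then obtain k where "k < length (cout (cs ! v'))" "cout (cs ! v') ! k = cout (cs ! v) ! i"
        using x by (metis in_set_conv_nth)
      then show ?thesis using distinct_concat_nth[of cout cs v v' i k] vi 2 assms(1)
        by (auto simp: net_def outl_def)
    qed
  qed
  then have "vertex_rel G \<subseteq> (measure (\<lambda>x. x))\<inverse>" by auto
  moreover have "acyclic ((measure (\<lambda>x::nat. x))\<inverse>)"
    using wf_acyclic[OF wf_measure] by (simp only: acyclic_converse)
  ultimately show "acyclic (vertex_rel G)" by (rule acyclic_subset[rotated])
qed

lemma incident_lab:
  assumes "net I J cs" "lab G I J cs" "v < length cs"
  shows "s \<in> incident G v \<longleftrightarrow> s \<in> sources G \<and> sname I cs s \<in> set (cin (cs ! v)) \<union> set (cout (cs ! v))"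
proof
  note n = lab_simps[OF assms(2)]
  assume s: "s \<in> incident G v"
  then have ss: "s \<in> sources G" by (simp add: incident_iff)
  from s consider j where "s = Vtx v j" | j where "wire G s = Vtx v j" by (auto simp: incident_iff)
  then have "sname I cs s \<in> set (cin (cs ! v)) \<union> set (cout (cs ! v))"
  proof cases
    case 1
    then show ?thesis using ss lab_sources[OF assms(2)] by auto
  next
    case 2
    then have "j < length (cin (cs ! v))" "tname J cs (Vtx v j) = sname I cs s"
      using n(6,7)[OF ss] lab_sources[OF assms(2)] by auto
    then show ?thesis by (metis UnI1 nth_mem tname.simps(2))
  qed
  with ss show "s \<in> sources G \<and> sname I cs s \<in> set (cin (cs ! v)) \<union> set (cout (cs ! v))" by blast
next
  note n = lab_simps[OF assms(2)]
  assume *: "s \<in> sources G \<and> sname I cs s \<in> set (cin (cs ! v)) \<union> set (cout (cs ! v))"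
  then consider j where "j < length (cin (cs ! v))" "sname I cs s = cin (cs ! v) ! j"
    | j where "j < length (cout (cs ! v))" "sname I cs s = cout (cs ! v) ! j"
    by (metis UnE in_set_conv_nth)
  then show "s \<in> incident G v"
  proof cases
    case 1
    then have "wire G s = Vtx v j"
      using n(6,7) * lab_sources(4)[OF assms(2)] assms(3)
      by (intro tname_inj[OF assms(1,2)]) auto
    then show ?thesis using * by (simp add: incident_iff)
  next
    case 2
    then have "s = Vtx v j"
      using * lab_sources(2)[OF assms(2)] assms(3)
      by (intro sname_inj[OF assms(1,2)]) auto
    then show ?thesis using * by (simp add: incident_iff)
  qed
qed

text \<open>
  Edge names are in bijection with sources, and the edges at a vertex are the names in its cell;
  closed sets of names correspond to unions of connected components.
\<close>

lemma connected_lab: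
  assumes "net I J cs" "lab G I J cs"
  shows "connected_graph G \<longleftrightarrow> net_connected I cs"
proof
  note len = lab_simps(3)[OF assms(2)] and img = sname_image[OF assms(2)]
  assume c: "connected_graph G"
  show "net_connected I cs" unfolding net_connected_def
  proof (intro conjI allI impI subsetI)
    show "set I \<union> set (outl cs) \<noteq> {}" using c img by (auto simp: connected_graph_def)
    fix A x
    assume A: "\<forall>c\<in>set cs. set (cin c) \<union> set (cout c) \<subseteq> A \<or> (set (cin c) \<union> set (cout c)) \<inter> A = {}"
      and ne: "A \<inter> (set I \<union> set (outl cs)) \<noteq> {}" and x: "x \<in> set I \<union> set (outl cs)"
    from ne obtain s where s: "s \<in> sources G" "sname I cs s \<in> A" unfolding img[symmetric] by auto
    from x obtain t where t: "t \<in> sources G" "x = sname I cs t" unfolding img[symmetric] by auto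
    have "(s, t) \<in> (edge_adj G)\<^sup>*" using connected_graphD[OF c s(1) t(1)] .
    then have "sname I cs t \<in> A"
    proof (induction rule: rtrancl_induct)
      case base
      then show ?case using s by simp
    next
      case (step y z)
      from step(2) obtain v where v: "v < length cs" "y \<in> incident G v" "z \<in> incident G v"
        by (auto simp: edge_adj_def len)
      have "sname I cs y \<in> set (cin (cs ! v)) \<union> set (cout (cs ! v))"
        "sname I cs z \<in> set (cin (cs ! v)) \<union> set (cout (cs ! v))"
        using v(2,3) unfolding incident_lab[OF assms v(1)] by blast+
      moreover have "cs ! v \<in> set cs" using v(1) by simp
      ultimately show ?case using A[rule_format, of "cs ! v"] step(3) by blast
    qed
    then show "x \<in> A" using t by simp
  qed
next
  note len = lab_simps(3)[OF assms(2)] and img = sname_image[OF assms(2)]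
  assume c: "net_connected I cs"
  then have "sources G \<noteq> {}" unfolding net_connected_def img[symmetric] by blast
  then obtain s0 where s0: "s0 \<in> sources G" by blast
  show "connected_graph G"
  proof (rule connected_graphI[OF s0])
    fix s assume s: "s \<in> sources G"
    let ?A = "sname I cs ` {t \<in> sources G. (s0, t) \<in> (edge_adj G)\<^sup>*}"
    have "set (cin c) \<union> set (cout c) \<subseteq> ?A \<or> (set (cin c) \<union> set (cout c)) \<inter> ?A = {}" if "c \<in> set cs" for c
    proof (rule disjCI)
      assume "\<not> (set (cin c) \<union> set (cout c)) \<inter> ?A = {}"
      then obtain t where t: "t \<in> sources G" "(s0, t) \<in> (edge_adj G)\<^sup>*" "sname I cs t \<in> set (cin c) \<union> set (cout c)"
        unfolding disjoint_iff by blast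
      obtain v where v: "v < length cs" "c = cs ! v" using \<open>c \<in> set cs\<close> by (metis in_set_conv_nth)
      have tv: "t \<in> incident G v" unfolding incident_lab[OF assms v(1)] using t v(2) by simp
      show "set (cin c) \<union> set (cout c) \<subseteq> ?A"
      proof
        fix x assume x: "x \<in> set (cin c) \<union> set (cout c)"
        then have "x \<in> set (inl cs) \<union> set (outl cs)" using \<open>c \<in> set cs\<close> by (auto simp: inl_def outl_def)
        then have "x \<in> set I \<union> set (outl cs)" using assms(1) by (auto simp: net_def)
        then obtain u where u: "u \<in> sources G" "x = sname I cs u" unfolding img[symmetric] by auto
        then have "u \<in> incident G v" unfolding incident_lab[OF assms v(1)] using x v(2) by simp
        then have "(t, u) \<in> edge_adj G" using tv v(1) len unfolding edge_adj_def by auto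
        then have "(s0, u) \<in> (edge_adj G)\<^sup>*" using t(2) by (rule rtrancl_into_rtrancl[rotated])
        then show "x \<in> ?A" using u by blast
      qed
    qed
    moreover have "sname I cs s0 \<in> ?A \<inter> (set I \<union> set (outl cs))" using s0 unfolding img[symmetric] by blast
    then have "?A \<inter> (set I \<union> set (outl cs)) \<noteq> {}" by blast
    ultimately have "set I \<union> set (outl cs) \<subseteq> ?A"
      using c[unfolded net_connected_def, THEN conjunct2, THEN spec[of _ ?A]] by simp
    then have "sname I cs s \<in> ?A" using s img by blast
    then obtain t where "t \<in> sources G" "(s0, t) \<in> (edge_adj G)\<^sup>*" "sname I cs s = sname I cs t" by blast
    then show "(s0, s) \<in> (edge_adj G)\<^sup>*" using sname_inj[OF assms s] by simp
  qed
qed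

lemma cgraphs_lab:
  assumes "net I J cs" "lab G I J cs"
  shows "G \<in> cgraphs bib_gens (length J) (length I) \<longleftrightarrow> net_connected I cs"
proof -
  have "set (verts G) \<subseteq> bib_gens"
    using assms lab_simps(3)[OF assms(2)] by (auto simp: net_def wf_cell_def)
  then show ?thesis
    using dag_lab[OF assms] connected_lab[OF assms] lab_simps[OF assms(2)] by (auto simp: cgraphs_def)
qed

text \<open>
  Every name is the name of exactly one source and of exactly one target; the wiring sends the
  former to the latter.
\<close>

lemma lab_exists:
  assumes "net I J cs"
  obtains G where "lab G I J cs"
proof -
  define G0 where "G0 = \<lparr>ins = length I, outs = length J, verts = map fst cs, wire = (\<lambda>s. s)\<rparr>"
  define G where "G = G0\<lparr>wire := \<lambda>s. SOME t. t \<in> targets G0 \<and> tname J cs t = sname I cs s\<rparr>"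
  have st: "sources G = sources G0" "targets G = targets G0" by (auto simp: G_def sources_def targets_def)
  have len: "length (cin c) = n_in (fst c) \<and> length (cout c) = n_out (fst c)" if "c \<in> set cs" for c
    using assms that by (auto simp: net_def wf_cell_def)
  have ex: "\<exists>t. t \<in> targets G0 \<and> tname J cs t = sname I cs s" if s: "s \<in> sources G0" for s
  proof -
    have "sname I cs s \<in> set I \<union> set (outl cs)"
    proof (cases s)
      case (Ext i)
      then show ?thesis using s by (simp add: G0_def)
    next
      case (Vtx v j)
      then have "v < length cs" "j < length (cout (cs ! v))" using s len by (auto simp: G0_def)
      then show ?thesis using Vtx in_outl by auto
    qed
    then have "sname I cs s \<in> set J \<union> set (inl cs)" using assms unfolding net_def by (elim conjE) simp
    then consider i where "i < length J" "sname I cs s = J ! i"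
      | v j where "v < length cs" "j < length (cin (cs ! v))" "sname I cs s = cin (cs ! v) ! j"
      by (elim UnE) (metis in_set_conv_nth, metis in_inl)
    then show ?thesis
    proof cases
      case 1
      then show ?thesis by (intro exI[of _ "Ext i"]) (auto simp: G0_def)
    next
      case 2
      then show ?thesis using len by (intro exI[of _ "Vtx v j"]) (auto simp: G0_def)
    qed
  qed
  have w: "wire G s \<in> targets G0 \<and> tname J cs (wire G s) = sname I cs s" if "s \<in> sources G0" for s
  proof -
    have e: "wire G s = (SOME t. t \<in> targets G0 \<and> tname J cs t = sname I cs s)" by (simp add: G_def)
    show ?thesis unfolding e by (rule someI_ex) (rule ex[OF that])
  qed
  have "lab G I J cs" unfolding lab_def st
  proof (intro conjI ballI)
    show "ins G = length I" "outs G = length J" "verts G = map fst cs" by (simp_all add: G_def G0_def)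
  qed (use len w in blast)+
  then show ?thesis by (rule that)
qed

text \<open>
  Only the order of the cells distinguishes the two graphs. The first list of cells may be in
  any order; this is used to sort an arbitrary graph topologically.
\<close>

lemma lab_iso:
  assumes "net I J ds" "mset cs = mset ds" "lab G I J cs" "lab H I J ds"
  obtains \<pi> where "graph_iso \<pi> G H"
proof -
  obtain p where p: "p permutes {..<length ds}" "permute_list p ds = cs"
    using mset_eq_permutation[OF assms(2)] by blast
  have len: "length cs = length ds" using assms(2) by (metis size_mset)
  have nth: "ds ! p v = cs ! v" if "v < length cs" for v
    using permute_list_nth[OF p(1), of v] p(2) that len by simp
  have pin: "p v < length ds" if "v < length cs" for v
    using that len permutes_in_image[OF p(1), of v] by simp
  have t: "relabel p u \<in> targets H \<and> tname J ds (relabel p u) = tname J cs u" if "u \<in> targets G" for u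
  proof (cases u)
    case (Ext i)
    then show ?thesis using that by (simp add: lab_sources[OF assms(3)] lab_sources[OF assms(4)] del: targets_iff)
  next
    case (Vtx v j)
    then have "v < length cs" "j < length (cin (cs ! v))"
      using that by (simp_all add: lab_sources[OF assms(3)] del: targets_iff)
    then show ?thesis using Vtx nth pin by (simp add: lab_sources[OF assms(4)] del: targets_iff)
  qed
  have s: "relabel p u \<in> sources H \<and> sname I ds (relabel p u) = sname I cs u" if "u \<in> sources G" for u
  proof (cases u)
    case (Ext i)
    then show ?thesis using that by (simp add: lab_sources[OF assms(3)] lab_sources[OF assms(4)] del: sources_iff)
  next
    case (Vtx v j)
    then have "v < length cs" "j < length (cout (cs ! v))"
      using that by (simp_all add: lab_sources[OF assms(3)] del: sources_iff)
    then show ?thesis using Vtx nth pin by (simp add: lab_sources[OF assms(4)] del: sources_iff)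
  qed
  note nG = lab_simps[OF assms(3)] and nH = lab_simps[OF assms(4)]
  have "wire H (relabel p u) = relabel p (wire G u)" if u: "u \<in> sources G" for u
  proof (rule tname_inj[OF assms(1,4)])
    show "wire H (relabel p u) \<in> targets H" by (rule nH(6)[OF conjunct1[OF s[OF u]]])
    show "relabel p (wire G u) \<in> targets H" by (rule conjunct1[OF t[OF nG(6)[OF u]]])
    show "tname J ds (wire H (relabel p u)) = tname J ds (relabel p (wire G u))"
      using s[OF u] t[OF nG(6)[OF u]] nH(7)[OF conjunct1[OF s[OF u]]] nG(7)[OF u] by argo
  qed
  moreover have "p permutes {..<length (verts G)}" using p(1) by (simp add: nG(3) len)
  moreover have "\<forall>v<length (verts G). verts H ! p v = verts G ! v"
    using nth pin by (simp add: nG(3) nH(3))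
  ultimately have "graph_iso p G H"
    unfolding graph_iso_def by (simp add: nG(1,2) nH(1,2)) (simp add: nG(3) nH(3) len)
  then show ?thesis by (rule that)
qed

section \<open>Names in composites; proportional graphs\<close>

lemma labI:
  assumes "ins G = length I" "outs G = length J" "verts G = map fst cs"
    "\<And>c. c \<in> set cs \<Longrightarrow> length (cin c) = n_in (fst c) \<and> length (cout c) = n_out (fst c)"
    "\<And>s. s \<in> sources G \<Longrightarrow> wire G s \<in> targets G"
    "\<And>s. s \<in> sources G \<Longrightarrow> tname J cs (wire G s) = sname I cs s"
  shows "lab G I J cs"
  using assms by (simp add: lab_def)

lemma lab_gen:
  assumes "length I = n_in g" "length J = n_out g"
  shows "lab (gen_graph g) I J [(g, I, J)]"
proof (rule labI)
  fix s assume s: "s \<in> sources (gen_graph g)"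
  then show "wire (gen_graph g) s \<in> targets (gen_graph g)"
    "tname J [(g, I, J)] (wire (gen_graph g) s) = sname I [(g, I, J)] s"
    using assms by (cases s; auto)+
qed (use assms in auto)

lemma lab_perm:
  assumes "\<sigma> permutes {..<length I}" "length J = length I" "\<And>i. i < length I \<Longrightarrow> J ! (\<sigma> i) = I ! i"
  shows "lab (perm_graph (length I) \<sigma>) I J []"
proof (rule labI)
  fix s assume s: "s \<in> sources (perm_graph (length I) \<sigma>)"
  then obtain i where i: "s = Ext i" "i < length I" by (cases s) auto
  have "\<sigma> i < length I" using permutes_in_image[OF assms(1), of i] i(2) by simp
  then show "wire (perm_graph (length I) \<sigma>) s \<in> targets (perm_graph (length I) \<sigma>)"
    "tname J [] (wire (perm_graph (length I) \<sigma>) s) = sname I [] s"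
    using assms i by simp_all
qed (use assms in auto)

lemma lab_id: "lab (id_graph (length I)) I I []"
  unfolding id_graph_def by (rule lab_perm) (simp_all add: permutes_id)

text \<open>
  Composition of graphs is concatenation of lists of cells that agree on the names of the edges
  in between.
\<close>

lemma lab_gcomp:
  assumes G: "lab G M J cs" and H: "lab H I M ds"
  shows "lab (gcomp G H) I J (cs @ ds)"
proof (rule labI)
  note nG = lab_simps[OF G] and nH = lab_simps[OF H]
  show "length (cin c) = n_in (fst c) \<and> length (cout c) = n_out (fst c)" if "c \<in> set (cs @ ds)" for c
    using that G H by (auto simp: lab_def)
  fix s assume "s \<in> sources (gcomp G H)"
  then have "wire (gcomp G H) s \<in> targets (gcomp G H) \<and> tname J (cs @ ds) (wire (gcomp G H) s) = sname I (cs @ ds) s"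
  proof (cases rule: sources_gcomp_cases)
    case (left v j)
    have v: "v < length cs" "j < n_out (fst (cs ! v))" using left(2) by (auto simp: nG(3))
    have w: "wire G s \<in> targets G" "tname J cs (wire G s) = sname M cs s"
      using nG(6,7) left by blast+
    show ?thesis using w left v by (cases "wire G s") (auto simp: nth_append nG(2,3) nH(3))
  next
    case (right t)
    have w: "wire H t \<in> targets H" "tname M ds (wire H t) = sname I ds t"
      using nH(6,7) right by blast+
    have ss: "sname I (cs @ ds) s = sname I ds t" using right by (cases t) (auto simp: nG(3) nth_append)
    have gs: "wire (gcomp G H) s = through G (wire H t)" using right by simp
    show ?thesis
    proof (cases "wire H t")
      case (Ext i)
      then have i: "Ext i \<in> sources G" using w(1) by (simp add: nG(1) nH(2))
      then have w': "wire G (Ext i) \<in> targets G" "tname J cs (wire G (Ext i)) = sname M cs (Ext i)"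
        using nG(6,7) by blast+
      then show ?thesis unfolding gs using Ext w ss
        by (cases "wire G (Ext i)") (auto simp: nth_append nG(2,3) nH(3))
    next
      case (Vtx v j)
      then show ?thesis unfolding gs using w ss by (auto simp: nth_append nG(2,3) nH(3))
    qed
  qed
  then show "wire (gcomp G H) s \<in> targets (gcomp G H)" "tname J (cs @ ds) (wire (gcomp G H) s) = sname I (cs @ ds) s"
    by blast+
qed (simp_all add: lab_simps[OF G] lab_simps[OF H])

lemma lab_gtensor:
  assumes G: "lab G I J cs" and H: "lab H I' J' ds"
  shows "lab (gtensor G H) (I @ I') (J @ J') (cs @ ds)"
proof (rule labI)
  note nG = lab_simps[OF G] and nH = lab_simps[OF H]
  show "length (cin c) = n_in (fst c) \<and> length (cout c) = n_out (fst c)" if "c \<in> set (cs @ ds)" for c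
    using that G H by (auto simp: lab_def)
  fix s assume "s \<in> sources (gtensor G H)"
  then have "wire (gtensor G H) s \<in> targets (gtensor G H) \<and>
    tname (J @ J') (cs @ ds) (wire (gtensor G H) s) = sname (I @ I') (cs @ ds) s"
  proof (cases rule: sources_gtensor_cases)
    case left
    have w: "wire G s \<in> targets G" "tname J cs (wire G s) = sname I cs s"
      using nG(6,7) left by blast+
    have ss: "sname (I @ I') (cs @ ds) s = sname I cs s"
      using left by (cases s) (auto simp: nG(1,3) nth_append)
    show ?thesis using w left ss by (cases "wire G s") (auto simp: nth_append nG(2,3) nH(2,3))
  next
    case (right t)
    have w: "wire H t \<in> targets H" "tname J' ds (wire H t) = sname I' ds t"
      using nH(6,7) right by blast+
    have ss: "sname (I @ I') (cs @ ds) s = sname I' ds t"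
      using right by (cases t) (auto simp: nG(1,3) nth_append)
    have "wire (gtensor G H) s = shift (length (verts G)) (outs G) (wire H t)" using right by simp
    then show ?thesis using w right ss by (cases "wire H t") (auto simp: nth_append nG(2,3) nH(2,3))
  qed
  then show "wire (gtensor G H) s \<in> targets (gtensor G H)"
    "tname (J @ J') (cs @ ds) (wire (gtensor G H) s) = sname (I @ I') (cs @ ds) s"
    by blast+
qed (simp_all add: lab_simps[OF G] lab_simps[OF H])

lemma lab_gjoin:
  assumes "lab G (A @ M) J cs" "lab H I (M @ B) ds"
  shows "lab (gjoin (length M) G H) (A @ I) (J @ B) (cs @ ds)"
proof -
  have "lab (gtensor G (id_graph (length B))) ((A @ M) @ B) (J @ B) (cs @ [])"
    by (rule lab_gtensor[OF assms(1) lab_id])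
  moreover have "lab (gtensor (id_graph (length A)) H) (A @ I) (A @ (M @ B)) ([] @ ds)"
    by (rule lab_gtensor[OF lab_id assms(2)])
  ultimately have "lab (gcomp (gtensor G (id_graph (length B))) (gtensor (id_graph (length A)) H)) (A @ I) (J @ B) (cs @ ds)"
    using lab_gcomp[of _ "A @ M @ B" "J @ B" cs] by simp
  then show ?thesis using lab_simps(1)[OF assms(1)] lab_simps(2)[OF assms(2)] by (simp add: gjoin_def)
qed

text \<open>
  Signs and scalars never matter in the spanning part, only whether they vanish. The flag
  \<open>z\<close> records that the scalar is zero, that is, that \<open>G\<close> itself is
  null; this treats rewriting and vanishing uniformly.
\<close>

definition prop_to :: "'k::field_char_0 lin set \<Rightarrow> bool \<Rightarrow> nat \<Rightarrow> nat \<Rightarrow> graph \<Rightarrow> graph \<Rightarrow> bool" where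
  "prop_to R z a b G H \<longleftrightarrow>
     (\<exists>c. (c = 0 \<longleftrightarrow> z) \<and> null bib_gens R a b (single1 G - scale c (single1 H)))"

lemma scale_zero [simp]: "scale 0 x = 0" and scale_one [simp]: "scale 1 x = x"
  and scale_scale [simp]: "scale c (scale d x) = scale (c * d) x"
  by (intro poly_mapping_eqI; simp)+

lemma prop_to_zero: "prop_to R True a b G H \<longleftrightarrow> null bib_gens R a b (single1 G)"
  by (auto simp: prop_to_def)

lemma prop_to_refl: "prop_to R False a b G G"
  unfolding prop_to_def by (rule exI[of _ 1]) (simp add: null_zero)

lemma prop_to_trans:
  assumes "prop_to R z a b G H" "prop_to R z' a b H K"
  shows "prop_to R (z \<or> z') a b G K"
proof -
  obtain c where c: "c = 0 \<longleftrightarrow> z" "null bib_gens R a b (single1 G - scale c (single1 H))"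
    using assms(1) by (auto simp: prop_to_def)
  obtain d where d: "d = 0 \<longleftrightarrow> z'" "null bib_gens R a b (single1 H - scale d (single1 K))"
    using assms(2) by (auto simp: prop_to_def)
  have "null bib_gens R a b (single1 G - scale c (single1 H) + scale c (single1 H - scale d (single1 K)))"
    by (intro null_add c null_scale d)
  then have "null bib_gens R a b (single1 G - scale (c * d) (single1 K))" by (simp add: scale_diff)
  moreover have "c * d = 0 \<longleftrightarrow> z \<or> z'" using c d by simp
  ultimately show ?thesis unfolding prop_to_def by blast
qed

lemma prop_to_sym:
  assumes "prop_to R False a b G H"
  shows "prop_to R False a b H G"
proof -
  obtain c where c: "c \<noteq> 0" "null bib_gens R a b (single1 G - scale c (single1 H))"
    using assms by (auto simp: prop_to_def)
  have "null bib_gens R a b (scale (- inverse c) (single1 G - scale c (single1 H)))"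
    by (rule null_scale) (rule c)
  also have "scale (- inverse c) (single1 G - scale c (single1 H)) = single1 H - scale (inverse c) (single1 G)"
    using c(1) by (intro poly_mapping_eqI) (simp add: lookup_minus algebra_simps)
  finally show ?thesis using c(1) unfolding prop_to_def by (intro exI[of _ "inverse c"]) simp
qed

lemma prop_to_iso:
  assumes "G \<in> cgraphs bib_gens a b" "H \<in> cgraphs bib_gens a b" "graph_iso \<pi> G H"
  shows "prop_to R False a b G H"
  unfolding prop_to_def using null_iso[OF assms]
  by (intro exI[of _ "koszul_sign \<pi> G"]) (simp add: koszul_sign_def)

text \<open>
  A null combination involves only connected graphs of its arity, and \<open>H\<close> occurs in
  this one unless it is \<open>G\<close>.
\<close>

lemma prop_to_cgraphs:
  assumes "prop_to R False a b G H" "G \<in> cgraphs bib_gens a b"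
  shows "H \<in> cgraphs bib_gens a b"
proof (cases "G = H")
  case False
  obtain c where c: "c \<noteq> 0" "null bib_gens R a b (single1 G - scale c (single1 H))"
    using assms(1) by (auto simp: prop_to_def)
  have "Poly_Mapping.lookup (single1 G - scale c (single1 H)) H \<noteq> 0"
    using False c(1) by (simp add: lookup_minus single1_def lookup_single)
  then show ?thesis using null_free[OF c(2)] by (simp add: free_iff)
qed (use assms in simp)

lemma scale_sum: "scale c (sum f A) = (\<Sum>a\<in>A. scale c (f a))"
proof (induction A rule: infinite_finite_induct)
  case (insert a A)
  have "scale c (x + y) = scale c x + scale c y" for x y :: "'a lin"
    by (intro poly_mapping_eqI) (simp add: lookup_add algebra_simps)
  then show ?case using insert by simp
qed (auto intro!: poly_mapping_eqI)

lemma scale_single: "scale c (Poly_Mapping.single G d) = Poly_Mapping.single G (c * d)"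
  by (intro poly_mapping_eqI) (simp add: lookup_single when_def)

lemma bilin_scale_left: "bilin f (scale c x) y = scale c (bilin f x y)"
  unfolding bilin_superset[OF finite_keys finite_keys keys_scale order_refl, of f c x y]
  by (simp add: bilin_def scale_sum scale_single mult.assoc)

lemma bilin_scale_right: "bilin f x (scale c y) = scale c (bilin f x y)"
  unfolding bilin_superset[OF finite_keys finite_keys order_refl keys_scale, of f x c y]
  by (simp add: bilin_def scale_sum scale_single mult.left_commute)

lemma prop_to_gjoin_right:
  assumes "F \<in> cgraphs bib_gens a b" "prop_to R z c d G H" "1 \<le> k" "k \<le> b" "k \<le> c"
  shows "prop_to R z (a + c - k) (b + d - k) (gjoin k F G) (gjoin k F H)"
proof -
  obtain e where e: "e = 0 \<longleftrightarrow> z" "null bib_gens R c d (single1 G - scale e (single1 H))"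
    using assms(2) by (auto simp: prop_to_def)
  have "null bib_gens R (a + c - k) (b + d - k) (bilin (gjoin k) (single1 F) (single1 G - scale e (single1 H)))"
    by (rule null_join_right[OF free_single1[OF assms(1)] e(2) assms(3-5)])
  then show ?thesis using e(1)
    by (auto simp: prop_to_def bilin_diff_right bilin_scale_right bilin_single1)
qed

lemma prop_to_gjoin_left:
  assumes "prop_to R z a b G H" "F \<in> cgraphs bib_gens c d" "1 \<le> k" "k \<le> b" "k \<le> c"
  shows "prop_to R z (a + c - k) (b + d - k) (gjoin k G F) (gjoin k H F)"
proof -
  obtain e where e: "e = 0 \<longleftrightarrow> z" "null bib_gens R a b (single1 G - scale e (single1 H))"
    using assms(1) by (auto simp: prop_to_def)
  have "null bib_gens R (a + c - k) (b + d - k) (bilin (gjoin k) (single1 G - scale e (single1 H)) (single1 F))"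
    by (rule null_join_left[OF e(2) free_single1[OF assms(2)] assms(3-5)])
  then show ?thesis using e(1)
    by (auto simp: prop_to_def bilin_diff_left bilin_scale_left bilin_single1)
qed

lemma prop_to_act:
  assumes "prop_to R z a b G H" "\<sigma> permutes {..<a}" "\<rho> permutes {..<b}"
  shows "prop_to R z a b (gcomp (perm_graph a \<sigma>) (gcomp G (perm_graph b \<rho>)))
    (gcomp (perm_graph a \<sigma>) (gcomp H (perm_graph b \<rho>)))"
proof -
  obtain e where e: "e = 0 \<longleftrightarrow> z" "null bib_gens R a b (single1 G - scale e (single1 H))"
    using assms(1) by (auto simp: prop_to_def)
  have "null bib_gens R a b (act_lin a b \<sigma> \<rho> (single1 G - scale e (single1 H)))"
    by (rule null_act[OF e(2) assms(2,3)])
  then show ?thesis using e(1)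
    by (auto simp: prop_to_def act_lin_def comp_lin_def bilin_diff_left bilin_diff_right
        bilin_scale_left bilin_scale_right bilin_single1)
qed

section \<open>Replacing a subnet\<close>

lemma ordered_append: "ordered A (xs @ ys) \<longleftrightarrow> ordered A ys \<and> ordered (A \<union> set (outl ys)) xs"
  by (induction xs) auto

lemma ordered_mono: "ordered A xs \<Longrightarrow> A \<subseteq> B \<Longrightarrow> ordered B xs"
  by (induction xs) auto

lemma ordered_weaken: "ordered B xs \<Longrightarrow> B \<inter> set (inl xs) \<subseteq> A \<Longrightarrow> ordered A xs"
  by (induction xs) auto

lemma mset_inl_outl:
  assumes "mset cs = mset ds"
  shows "mset (inl cs) = mset (inl ds)" "mset (outl cs) = mset (outl ds)"
proof -
  have "mset (map f cs) = mset (map f ds)" for f :: "cell \<Rightarrow> nat multiset" using assms by simp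
  then have "sum_list (map f cs) = sum_list (map f ds)" for f :: "cell \<Rightarrow> nat multiset"
    by (metis sum_mset_sum_list)
  then show "mset (inl cs) = mset (inl ds)" "mset (outl cs) = mset (outl ds)"
    by (simp_all add: inl_def outl_def mset_concat comp_def)
qed

lemma net_perm:
  assumes "net I J cs" "mset ds = mset cs" "ordered (set I) ds"
  shows "net I J ds"
proof -
  note m = mset_inl_outl[OF assms(2)]
  have "set ds = set cs" using assms(2) by (metis set_mset_mset)
  moreover have "set (inl ds) = set (inl cs)" "set (outl ds) = set (outl cs)" using m by (metis set_mset_mset)+
  moreover have "distinct (inl ds) = distinct (inl cs)" "distinct (outl ds) = distinct (outl cs)"
    using m mset_eq_imp_distinct_iff by blast+
  ultimately show ?thesis using assms(1,3) by (simp add: net_def)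
qed

lemma net_connected_perm:
  assumes "mset cs = mset ds"
  shows "net_connected I cs \<longleftrightarrow> net_connected I ds"
proof -
  have "set ds = set cs" using assms by (metis set_mset_mset)
  moreover have "set (outl ds) = set (outl cs)" using mset_inl_outl[OF assms] by (metis set_mset_mset)
  ultimately show ?thesis by (simp add: net_connected_def)
qed

lemma prop_to_change_right:
  assumes "prop_to R z a b G H" "\<not> z \<Longrightarrow> prop_to R False a b H K"
  shows "prop_to R z a b G K"
proof (cases z)
  case True
  then show ?thesis using assms(1) by (simp add: prop_to_zero)
next
  case False
  then show ?thesis using prop_to_trans[OF assms(1) assms(2)[OF False]] by simp
qed

text \<open>
  A net determines its graph up to isomorphism, so nothing depends on the choice of
  \<open>G\<close> and \<open>H\<close>.
\<close>

definition pnet :: "'k::field_char_0 lin set \<Rightarrow> bool \<Rightarrow> nat list \<Rightarrow> nat list \<Rightarrow> cell list \<Rightarrow> cell list \<Rightarrow> bool" where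
  "pnet R z I J cs ds \<longleftrightarrow>
     (\<forall>G H. lab G I J cs \<longrightarrow> lab H I J ds \<longrightarrow> prop_to R z (length J) (length I) G H)"

lemma pnetD:
  "pnet R z I J cs ds \<Longrightarrow> lab G I J cs \<Longrightarrow> lab H I J ds \<Longrightarrow> prop_to R z (length J) (length I) G H"
  by (simp add: pnet_def)

lemma pnet_perm:
  assumes "net I J cs" "net I J ds" "mset cs = mset ds" "net_connected I cs"
  shows "pnet R False I J cs ds"
  unfolding pnet_def
proof (intro allI impI)
  fix G H assume l: "lab G I J cs" "lab H I J ds"
  obtain \<pi> where "graph_iso \<pi> G H" using lab_iso[OF assms(2,3) l] .
  moreover have "net_connected I ds" using assms(3,4) net_connected_perm by blast
  ultimately show "prop_to R False (length J) (length I) G H"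
    using cgraphs_lab[OF assms(1) l(1)] cgraphs_lab[OF assms(2) l(2)] assms(4) by (blast intro: prop_to_iso)
qed

lemma pnet_trans:
  assumes "pnet R z I J cs ds" "pnet R z' I J ds es" "net I J ds"
  shows "pnet R (z \<or> z') I J cs es"
  using assms prop_to_trans lab_exists[OF assms(3)] unfolding pnet_def by metis

text \<open>
  An edge that runs from an input to an output without meeting a vertex is a component of its
  own.
\<close>

lemma no_pass:
  assumes "net I J cs" "net_connected I cs" "cs \<noteq> []"
  shows "set I \<inter> set J = {}"
proof (rule ccontr)
  assume "set I \<inter> set J \<noteq> {}"
  then obtain x where x: "x \<in> set I" "x \<in> set J" by blast
  then have "x \<notin> set (inl cs)" "x \<notin> set (outl cs)" using assms(1) by (auto simp: net_def)
  then have "\<forall>c\<in>set cs. (set (cin c) \<union> set (cout c)) \<inter> {x} = {}" by (auto simp: inl_def outl_def)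
  then have s: "set I \<union> set (outl cs) \<subseteq> {x}"
    using assms(2)[unfolded net_connected_def, THEN conjunct2, THEN spec[of _ "{x}"]] x by blast
  obtain c where c: "c \<in> set cs" using assms(3) by (cases cs) auto
  then have "cout c \<noteq> []" using assms(1) by (cases "fst c") (auto simp: net_def wf_cell_def bib_gens_def)
  then have "\<exists>y. y \<in> set (cout c)" by (cases "cout c") auto
  then have "x \<in> set (outl cs)" using s c by (auto simp: outl_def)
  then show False using \<open>x \<notin> set (outl cs)\<close> by blast
qed

lemma net_interface:
  assumes "net I J cs" "set I \<inter> set J = {}"
  shows "set I = set (inl cs) - set (outl cs)" "set J = set (outl cs) - set (inl cs)"
  using assms unfolding net_def by auto

lemma pnetI:
  assumes "net I J X" "net I J Y" "net_connected I X" "lab G I J X" "lab H I J Y"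
    and p: "prop_to R z (length J) (length I) G H"
  shows "pnet R z I J X Y"
  unfolding pnet_def
proof (intro allI impI)
  fix G' H' assume l: "lab G' I J X" "lab H' I J Y"
  have "prop_to R False (length J) (length I) G' G"
    by (rule pnetD[OF pnet_perm[OF assms(1,1) refl assms(3)] l(1) assms(4)])
  from prop_to_trans[OF this p] have q: "prop_to R z (length J) (length I) G' H" by simp
  then show "prop_to R z (length J) (length I) G' H'"
  proof (rule prop_to_change_right)
    assume "\<not> z"
    then have "H \<in> cgraphs bib_gens (length J) (length I)"
      using q prop_to_cgraphs cgraphs_lab[OF assms(1) l(1)] assms(3) by metis
    then have c: "net_connected I Y" using cgraphs_lab[OF assms(2,5)] by simp
    show "prop_to R False (length J) (length I) H H'"
      by (rule pnetD[OF pnet_perm[OF assms(2,2) refl c] assms(5) l(2)])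
  qed
qed

text \<open>
  Reordering inputs and outputs is the action of permutations, which preserves null
  combinations.
\<close>

lemma pnet_reorder:
  assumes "pnet R z I J X Y" "net I J X" "net I J Y" "net_connected I X"
    "net I' J' X" "net I' J' Y" "set I' = set I" "set J' = set J"
  shows "pnet R z I' J' X Y"
proof -
  have d: "distinct I" "distinct J" "distinct I'" "distinct J'" using assms(2,5) by (auto simp: net_def)
  have len: "length I' = length I" "length J' = length J" using d assms(7,8) by (metis distinct_card)+
  have mI: "mset I' = mset I" and mJ: "mset J = mset J'"
    using d assms(7,8) by (metis set_eq_iff_mset_eq_distinct)+
  obtain \<rho> where r: "\<rho> permutes {..<length I}" "permute_list \<rho> I = I'" using mset_eq_permutation[OF mI] .
  obtain \<sigma> where s: "\<sigma> permutes {..<length J'}" "permute_list \<sigma> J' = J" using mset_eq_permutation[OF mJ] .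
  have P: "lab (perm_graph (length I) \<rho>) I' I []"
    unfolding len(1)[symmetric]
    by (rule lab_perm) (use r len permute_list_nth[OF r(1)] in auto)
  have Q: "lab (perm_graph (length J) \<sigma>) J J' []"
    by (rule lab_perm) (use s len permute_list_nth[OF s(1)] in auto)
  let ?a = "\<lambda>K. gcomp (perm_graph (length J) \<sigma>) (gcomp K (perm_graph (length I) \<rho>))"
  have L: "lab (?a K) I' J' Z" if "lab K I J Z" for K Z
    using lab_gcomp[OF Q lab_gcomp[OF that P]] by simp
  obtain G0 where G0: "lab G0 I J X" using lab_exists[OF assms(2)] .
  obtain H0 where H0: "lab H0 I J Y" using lab_exists[OF assms(3)] .
  have "prop_to R z (length J) (length I) G0 H0" using assms(1) G0 H0 by (auto simp: pnet_def)
  then have p: "prop_to R z (length J') (length I') (?a G0) (?a H0)"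
    unfolding len by (rule prop_to_act) (use r s len in auto)
  have "net_connected I' X" using assms(4,7) by (simp add: net_connected_def)
  then show ?thesis by (rule pnetI[OF assms(5,6) _ L[OF G0] L[OF H0] p])
qed

lemma pnet_mset:
  assumes "pnet R z I J cs ds" "net I J cs" "net I J ds" "net I J cs'" "net I J ds'"
    "mset cs' = mset cs" "mset ds' = mset ds" "net_connected I cs"
  shows "pnet R z I J cs' ds'"
proof -
  have c': "net_connected I cs'" using assms(6,8) net_connected_perm by blast
  show ?thesis unfolding pnet_def
  proof (intro allI impI)
    fix G' H' assume l: "lab G' I J cs'" "lab H' I J ds'"
    obtain G where G: "lab G I J cs" using lab_exists[OF assms(2)] .
    obtain H where H: "lab H I J ds" using lab_exists[OF assms(3)] .
    have gg: "prop_to R False (length J) (length I) G' G"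
      by (rule pnetD[OF pnet_perm[OF assms(4,2,6) c'] l(1) G])
    have "prop_to R z (length J) (length I) G H" using assms(1) G H by (simp add: pnet_def)
    from prop_to_trans[OF gg this] have p: "prop_to R z (length J) (length I) G' H" by simp
    then show "prop_to R z (length J) (length I) G' H'"
    proof (rule prop_to_change_right)
      assume "\<not> z"
      then have "H \<in> cgraphs bib_gens (length J) (length I)"
        using p prop_to_cgraphs cgraphs_lab[OF assms(4) l(1)] c' by metis
      then have "net_connected I ds" using cgraphs_lab[OF assms(3) H] by simp
      show "prop_to R False (length J) (length I) H H'"
        by (rule pnetD[OF pnet_perm[OF assms(3,5) assms(7)[symmetric] \<open>net_connected I ds\<close>] H l(2)])
    qed
  qed
qed

lemma net_singleton:
  assumes "wf_cell c" "distinct I" "distinct J" "set I = set (cin c)" "set J = set (cout c)"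
    "distinct (cin c)" "distinct (cout c)" "set (cin c) \<inter> set (cout c) = {}"
  shows "net I J [c]" "net_connected I [c]"
proof -
  show "net I J [c]" using assms by (auto simp: net_def)
  have "cout c \<noteq> []" using assms(1) by (cases "fst c") (auto simp: wf_cell_def bib_gens_def)
  then show "net_connected I [c]" using assms by (auto simp: net_connected_def)
qed

text \<open>
  One more cell \<open>v\<close> is applied after the net, consuming its outputs
  \<open>M\<close>. Up to a permutation of the legs this is a join along the edges
  \<open>M\<close>, and there is at least one of them.
\<close>

lemma pnet_snoc_top:
  assumes "pnet R z I J X Y" "net I J X" "net I J Y" "net_connected I X"
    and v: "net (A @ M) K [v]" "set (A @ M) = set (cin v)" and M: "M \<noteq> []" "set M \<subseteq> set J"
    and B: "B = filter (\<lambda>x. x \<notin> set M) J"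
    and n: "net (A @ I) (K @ B) (v # X)" "net (A @ I) (K @ B) (v # Y)"
  shows "pnet R z (A @ I) (K @ B) (v # X) (v # Y)" "net_connected (A @ I) (v # X)"
proof -
  have d: "distinct J" "distinct M" using assms(2) v(1) by (auto simp: net_def)
  have MB: "distinct (M @ B)" "set (M @ B) = set J" using d M(2) B by auto
  have nX: "net I (M @ B) X" and nY: "net I (M @ B) Y"
    using assms(2,3) MB unfolding net_def by auto
  have pXY: "pnet R z I (M @ B) X Y"
    by (rule pnet_reorder[OF assms(1-4) nX nY]) (use MB in auto)
  have wf: "wf_cell v" "distinct (cin v)" "distinct (cout v)" "set (cin v) \<inter> set (cout v) = {}"
    "set (A @ M) = set (cin v)" using v M by (auto simp: net_def)
  have "net_connected (A @ M) [v]"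
    by (rule net_singleton(2)[OF wf(1) _ wf(3) wf(5) refl wf(2-4)]) (use v in \<open>auto simp: net_def\<close>)
  obtain F where F: "lab F (A @ M) K [v]" using lab_exists[OF v(1)] .
  have Fc: "F \<in> cgraphs bib_gens (length K) (length A + length M)"
    using cgraphs_lab[OF v(1) F] \<open>net_connected (A @ M) [v]\<close> by simp
  have k: "1 \<le> length M" using M(1) by (cases M) auto
  obtain G0 where G0: "lab G0 I (M @ B) X" using lab_exists[OF nX] .
  obtain H0 where H0: "lab H0 I (M @ B) Y" using lab_exists[OF nY] .
  have LG: "lab (gjoin (length M) F G0) (A @ I) (K @ B) (v # X)" using lab_gjoin[OF F G0] by simp
  have LH: "lab (gjoin (length M) F H0) (A @ I) (K @ B) (v # Y)" using lab_gjoin[OF F H0] by simp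
  have G0c: "G0 \<in> cgraphs bib_gens (length M + length B) (length I)"
    using cgraphs_lab[OF nX G0] assms(4) by simp
  have ar: "length K + (length M + length B) - length M = length (K @ B)"
    "length A + length M + length I - length M = length (A @ I)" by auto
  have "gjoin (length M) F G0 \<in> cgraphs bib_gens (length (K @ B)) (length (A @ I))"
    using cgraphs_gjoin[OF Fc G0c k] ar by simp
  then show c: "net_connected (A @ I) (v # X)" using cgraphs_lab[OF n(1) LG] by simp
  have "prop_to R z (length M + length B) (length I) G0 H0" using pXY G0 H0 by (auto simp: pnet_def)
  from prop_to_gjoin_right[OF Fc this k]
  have p: "prop_to R z (length (K @ B)) (length (A @ I)) (gjoin (length M) F G0) (gjoin (length M) F H0)"
    using ar by simp
  show "pnet R z (A @ I) (K @ B) (v # X) (v # Y)" by (rule pnetI[OF n c LG LH p])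
qed

text \<open>
  The mirror image of the preceding lemma: the cell \<open>v\<close> is applied before the net
  and feeds its inputs \<open>M\<close>.
\<close>

lemma pnet_snoc_bot:
  assumes "pnet R z I J X Y" "net I J X" "net I J Y" "net_connected I X"
    and v: "net K (M @ B) [v]" "set K = set (cin v)" and M: "M \<noteq> []" "set M \<subseteq> set I"
    and A: "A = filter (\<lambda>x. x \<notin> set M) I"
    and n: "net (A @ K) (J @ B) (X @ [v])" "net (A @ K) (J @ B) (Y @ [v])"
  shows "pnet R z (A @ K) (J @ B) (X @ [v]) (Y @ [v])" "net_connected (A @ K) (X @ [v])"
proof -
  have d: "distinct I" "distinct M" using assms(2) v(1) by (auto simp: net_def)
  have MB: "distinct (A @ M)" "set (A @ M) = set I" using d M(2) A by auto
  have nX: "net (A @ M) J X" and nY: "net (A @ M) J Y"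
    using assms(2,3) MB unfolding net_def by auto
  have cX: "net_connected (A @ M) X" using assms(4) MB(2) by (simp add: net_connected_def)
  have pXY: "pnet R z (A @ M) J X Y"
    by (rule pnet_reorder[OF assms(1-4) nX nY]) (use MB in auto)
  have wf: "wf_cell v" "distinct (cin v)" "distinct (cout v)" "set (cin v) \<inter> set (cout v) = {}"
    "set K = set (cin v)" using v M by (auto simp: net_def)
  have "net_connected K [v]"
    by (rule net_singleton(2)[OF wf(1) _ wf(3) wf(5) refl wf(2-4)]) (use v in \<open>auto simp: net_def\<close>)
  obtain F where F: "lab F K (M @ B) [v]" using lab_exists[OF v(1)] .
  have Fc: "F \<in> cgraphs bib_gens (length M + length B) (length K)"
    using cgraphs_lab[OF v(1) F] \<open>net_connected K [v]\<close> by simp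
  have k: "1 \<le> length M" using M(1) by (cases M) auto
  obtain G0 where G0: "lab G0 (A @ M) J X" using lab_exists[OF nX] .
  obtain H0 where H0: "lab H0 (A @ M) J Y" using lab_exists[OF nY] .
  have LG: "lab (gjoin (length M) G0 F) (A @ K) (J @ B) (X @ [v])" using lab_gjoin[OF G0 F] by simp
  have LH: "lab (gjoin (length M) H0 F) (A @ K) (J @ B) (Y @ [v])" using lab_gjoin[OF H0 F] by simp
  have G0c: "G0 \<in> cgraphs bib_gens (length J) (length A + length M)"
    using cgraphs_lab[OF nX G0] cX by simp
  have ar: "length J + (length M + length B) - length M = length (J @ B)"
    "length A + length M + length K - length M = length (A @ K)" by auto
  have "gjoin (length M) G0 F \<in> cgraphs bib_gens (length (J @ B)) (length (A @ K))"
    using cgraphs_gjoin[OF G0c Fc k] ar by simp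
  then show c: "net_connected (A @ K) (X @ [v])" using cgraphs_lab[OF n(1) LG] by simp
  have "prop_to R z (length J) (length A + length M) G0 H0" using pXY G0 H0 by (auto simp: pnet_def)
  from prop_to_gjoin_left[OF this Fc k]
  have p: "prop_to R z (length (J @ B)) (length (A @ K)) (gjoin (length M) G0 F) (gjoin (length M) H0 F)"
    using ar by simp
  show "pnet R z (A @ K) (J @ B) (X @ [v]) (Y @ [v])" by (rule pnetI[OF n c LG LH p])
qed


lemma netD:
  assumes "net I J cs"
  shows "distinct I" "distinct J" "distinct (inl cs)" "distinct (outl cs)" "set I \<inter> set (outl cs) = {}"
    "set J \<inter> set (inl cs) = {}" "set I \<union> set (outl cs) = set J \<union> set (inl cs)" "ordered (set I) cs"
    "c \<in> set cs \<Longrightarrow> wf_cell c"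
  using assms by (auto simp: net_def)

lemma ordered_inl: "ordered A cs \<Longrightarrow> set (inl cs) \<subseteq> A \<union> set (outl cs)"
  by (induction cs) auto

lemma in_cells: "c \<in> set cs \<Longrightarrow> set (cin c) \<subseteq> set (inl cs) \<and> set (cout c) \<subseteq> set (outl cs)"
  by (auto simp: inl_def outl_def)

text \<open>
  A relation may be applied inside any larger connected graph. The cells around the subnet are
  absorbed into it one at a time, choosing one that shares an edge with it: null combinations
  are only closed under joins along at least one edge. If no cell is adjacent any more,
  connectedness forces the subnet to be everything.
\<close>

lemma pnet_context:
  assumes "pnet R z I J X Y" "net I J X" "net I J Y" "net_connected I X" "X \<noteq> []" "Y \<noteq> []"
    "set I \<inter> set J = {}"
    and W: "net I' J' (post @ X @ pre)" "net I' J' (post @ Y @ pre)" "net_connected I' (post @ X @ pre)"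
  shows "pnet R z I' J' (post @ X @ pre) (post @ Y @ pre)"
  using assms
proof (induction "length post + length pre" arbitrary: I J X Y post pre)
  case 0
  then have e: "post = []" "pre = []" by auto
  have c: "net_connected I' X" "net I' J' X" "net I' J' Y" using 0 e by auto
  note i = net_interface[OF 0(3,8)] net_interface[OF c(2) no_pass[OF c(2,1) 0(6)]]
  have "pnet R z I' J' X Y"
    by (rule pnet_reorder[OF 0(2,3,4,5) c(2,3)]) (use i in auto)
  then show ?case using e by simp
next
  case (Suc n)
  note IH = Suc(1) and p = Suc(3) and nX = Suc(4) and nY = Suc(5) and cX = Suc(6) and ne = Suc(7,8)
    and IJ = Suc(9) and WX = Suc(10) and WY = Suc(11) and WC = Suc(12)
  note iX = net_interface[OF nX IJ] and iY = net_interface[OF nY IJ]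
  note dX = netD[OF WX, simplified] and dY = netD[OF WY, simplified]
  note oX = dX(8)[simplified ordered_append] and oY = dY(8)[simplified ordered_append]
  have inX: "set (inl X) \<subseteq> set I \<union> set (outl X)" using ordered_inl[OF netD(8)[OF nX]] .
  consider (post) "\<exists>v\<in>set post. set (cin v) \<inter> set J \<noteq> {}"
    | (pre) "\<exists>v\<in>set pre. set (cout v) \<inter> set I \<noteq> {}"
    | (none) "\<forall>v\<in>set post. set (cin v) \<inter> set J = {}" "\<forall>v\<in>set pre. set (cout v) \<inter> set I = {}"
    by blast
  then show ?case
  proof cases
    case post
    obtain p1 v p2 where v: "post = p1 @ v # p2" "set (cin v) \<inter> set J \<noteq> {}"
      "\<forall>c\<in>set p2. \<not> (set (cin c) \<inter> set J \<noteq> {})"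
      using split_list_last_prop[OF post] by blast
    define M where "M = filter (\<lambda>x. x \<in> set J) (cin v)"
    define A where "A = filter (\<lambda>x. x \<notin> set J) (cin v)"
    define B where "B = filter (\<lambda>x. x \<notin> set M) J"
    have p2J: "set (inl p2) \<inter> set J = {}" using v(3) by (auto simp: inl_def)
    have reord: "net I' J' (p1 @ (v # Z) @ (p2 @ pre))"
      if "net I' J' (post @ Z @ pre)" "set (outl Z) \<subseteq> set J \<union> set (inl Z)" for Z
    proof (rule net_perm[OF that(1)])
      show "mset (p1 @ (v # Z) @ p2 @ pre) = mset (post @ Z @ pre)" using v(1) by simp
      note d = netD[OF that(1), simplified v(1), simplified]
      note o = d(8)[simplified ordered_append, simplified]
      have "ordered (set I' \<union> set (outl pre)) p2"
        by (rule ordered_weaken[of "set I' \<union> (set (outl Z) \<union> set (outl pre))"])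
          (use o d(3) p2J that(2) in \<open>auto simp: ordered_append\<close>)
      moreover have "ordered (set I' \<union> (set (outl p2) \<union> set (outl pre))) Z"
        by (rule ordered_mono[of "set I' \<union> set (outl pre)"]) (use o in \<open>auto simp: ordered_append\<close>)
      ultimately show "ordered (set I') (p1 @ (v # Z) @ p2 @ pre)"
        using o by (auto simp: ordered_append Un_ac)
    qed
    have disj: "set (cin v) \<inter> set (cout v) = {}" "distinct (cin v)" "distinct (cout v)" "wf_cell v"
    proof -
      note d = netD[OF WX, simplified v(1), simplified]
      have "set (cin v) \<subseteq> set I' \<union> set (outl p2) \<union> set (outl X) \<union> set (outl pre)" using d(8) by (simp add: ordered_append Un_assoc)
      then show "set (cin v) \<inter> set (cout v) = {}" using d(4,5) by blast
      show "distinct (cin v)" "distinct (cout v)" using d(3,4) by simp_all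
      show "wf_cell v" using netD(9)[OF WX, of v] v(1) by simp
    qed
    have nv: "net (A @ I) (cout v @ B) (v # Z)"
      if Z: "net I J Z" "net I' J' (post @ Z @ pre)" for Z
    proof -
      note d = netD[OF Z(2), simplified v(1), simplified] and z = netD[OF Z(1)]
      note o = d(8)[simplified ordered_append, simplified]
      have a: "set (cin v) \<inter> set (inl Z) = {}" "set (cout v) \<inter> set (outl Z) = {}" using d(3,4) by auto
      have "ordered (set I' \<union> set (outl pre)) Z" using o by (simp add: ordered_append)
      from ordered_inl[OF this] have iz: "set (inl Z) \<subseteq> set I' \<union> set (outl pre) \<union> set (outl Z)" .
      then have b: "set (inl Z) \<inter> set (cout v) = {}" using d(4,5) by auto
      have I: "set I \<subseteq> set (inl Z)" and J: "set J \<subseteq> set (outl Z)" "set (outl Z) \<subseteq> set J \<union> set (inl Z)"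
        using net_interface[OF Z(1) IJ] by auto
      show ?thesis unfolding net_def
      proof (intro conjI)
        show "distinct ((A @ I) @ outl (v # Z))"
          using z a b I J disj unfolding A_def by auto
        show "distinct ((cout v @ B) @ inl (v # Z))"
          using z a b I J disj unfolding B_def M_def by auto
        show "set (A @ I) \<union> set (outl (v # Z)) = set (cout v @ B) \<union> set (inl (v # Z))"
          using z(7) unfolding A_def B_def M_def by auto
        show "ordered (set (A @ I)) (v # Z)"
          using z(8) J unfolding A_def by (auto intro: ordered_mono)
        show "\<forall>c\<in>set (v # Z). wf_cell c" using disj(4) z(9) by auto
      qed
    qed
    have F: "net (A @ M) (cout v) [v]"
      by (rule net_singleton(1)) (use disj in \<open>auto simp: A_def M_def\<close>)
    have M: "M \<noteq> []" "set M \<subseteq> set J" "set (A @ M) = set (cin v)"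
      using v(2) by (auto simp: A_def M_def filter_empty_conv)
    note st = pnet_snoc_top[OF p nX nY cX F M(3) M(1,2) B_def nv[OF nX WX] nv[OF nY WY]]
    have oZ: "set (outl X) \<subseteq> set J \<union> set (inl X)" "set (outl Y) \<subseteq> set J \<union> set (inl Y)" using iX iY by auto
    have ab: "set (A @ I) \<inter> set (cout v @ B) = {}"
      using netD(5)[OF nv[OF nX WX]] netD(6)[OF nv[OF nX WX]] netD(5)[OF nX] iX IJ
      by (auto simp: A_def B_def)
    note RX = reord[OF WX oZ(1)] and RY = reord[OF WY oZ(2)]
    have len: "n = length p1 + length (p2 @ pre)" using Suc(2) v(1) by simp
    have m: "mset (post @ Z @ pre) = mset (p1 @ (v # Z) @ (p2 @ pre))" for Z using v(1) by simp
    have C: "net_connected I' (p1 @ (v # X) @ (p2 @ pre))" using WC net_connected_perm[OF m] by blast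
    have "pnet R z I' J' (p1 @ (v # X) @ (p2 @ pre)) (p1 @ (v # Y) @ (p2 @ pre))"
      by (rule IH[OF len st(1) nv[OF nX WX] nv[OF nY WY] st(2) _ _ ab RX RY C]) simp_all
    then show ?thesis by (rule pnet_mset[OF _ RX RY WX WY m m C])
  next
    case pre
    obtain p1 v p2 where v: "pre = p1 @ v # p2" "set (cout v) \<inter> set I \<noteq> {}"
      "\<forall>c\<in>set p1. \<not> (set (cout c) \<inter> set I \<noteq> {})"
      using split_list_first_prop[OF pre] by blast
    define M where "M = filter (\<lambda>x. x \<in> set I) (cout v)"
    define B where "B = filter (\<lambda>x. x \<notin> set I) (cout v)"
    define A where "A = filter (\<lambda>x. x \<notin> set M) I"
    have p1I: "set (outl p1) \<inter> set I = {}" using v(3) by (auto simp: outl_def)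
    have reord: "net I' J' ((post @ p1) @ (Z @ [v]) @ p2)"
      if Z: "net I' J' (post @ Z @ pre)" "net I J Z" for Z
    proof (rule net_perm[OF Z(1)])
      show "mset ((post @ p1) @ (Z @ [v]) @ p2) = mset (post @ Z @ pre)" using v(1) by simp
      note d = netD[OF Z(1), simplified v(1), simplified]
      note o = d(8)[simplified ordered_append, simplified]
      have "set (inl Z) \<subseteq> set I \<union> set (outl Z)" using ordered_inl[OF netD(8)[OF Z(2)]] .
      then have "set (inl Z) \<inter> set (outl p1) = {}" using p1I d(4) by auto
      moreover have "ordered (set I' \<union> (set (outl p1) \<union> (set (cout v) \<union> set (outl p2)))) Z"
        using o by (simp add: ordered_append)
      ultimately have "ordered (set I' \<union> set (cout v) \<union> set (outl p2)) Z"
        by (elim ordered_weaken) blast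
      moreover have "ordered (set I' \<union> (set (outl Z) \<union> (set (cout v) \<union> set (outl p2)))) p1"
        by (rule ordered_mono[of "set I' \<union> (set (cout v) \<union> set (outl p2))"])
          (use o in \<open>auto simp: ordered_append Un_ac\<close>)
      ultimately show "ordered (set I') ((post @ p1) @ (Z @ [v]) @ p2)"
        using o by (auto simp: ordered_append Un_ac)
    qed
    have disj: "set (cin v) \<inter> set (cout v) = {}" "distinct (cin v)" "distinct (cout v)" "wf_cell v"
    proof -
      note d = netD[OF WX, simplified v(1), simplified]
      have "set (cin v) \<subseteq> set I' \<union> set (outl p2)" using d(8) by (simp add: ordered_append Un_assoc)
      then show "set (cin v) \<inter> set (cout v) = {}" using d(4,5) by blast
      show "distinct (cin v)" "distinct (cout v)" using d(3,4) by simp_all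
      show "wf_cell v" using netD(9)[OF WX, of v] v(1) by simp
    qed
    have nv: "net (A @ cin v) (J @ B) (Z @ [v])"
      if Z: "net I J Z" "net I' J' (post @ Z @ pre)" for Z
    proof -
      note d = netD[OF Z(2), simplified v(1), simplified] and z = netD[OF Z(1)]
      note o = d(8)[simplified ordered_append, simplified]
      have a: "set (cin v) \<inter> set (inl Z) = {}" "set (cout v) \<inter> set (outl Z) = {}" using d(3,4) by auto
      have "set (cin v) \<subseteq> set I' \<union> set (outl p2)" using o by (auto simp: ordered_append)
      then have b: "set (outl Z) \<inter> set (cin v) = {}" using d(4,5) by auto
      have I: "set I \<subseteq> set (inl Z)" "set (inl Z) \<subseteq> set I \<union> set (outl Z)" and J: "set J \<subseteq> set (outl Z)"
        using net_interface[OF Z(1) IJ] by auto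
      show ?thesis unfolding net_def
      proof (intro conjI)
        show "distinct ((A @ cin v) @ outl (Z @ [v]))"
          using z a b I J disj unfolding A_def M_def by auto
        show "distinct ((J @ B) @ inl (Z @ [v]))"
          using z a b I J disj unfolding B_def by auto
        show "set (A @ cin v) \<union> set (outl (Z @ [v])) = set (J @ B) \<union> set (inl (Z @ [v]))"
          using z(7) unfolding A_def B_def M_def by auto
        have "ordered (set (A @ cin v) \<union> set (cout v)) Z"
          by (rule ordered_mono[OF z(8)]) (auto simp: A_def M_def)
        then show "ordered (set (A @ cin v)) (Z @ [v])" by (simp add: ordered_append)
        show "\<forall>c\<in>set (Z @ [v]). wf_cell c" using disj(4) z(9) by auto
      qed
    qed
    have F: "net (cin v) (M @ B) [v]"
      by (rule net_singleton(1)) (use disj in \<open>auto simp: B_def M_def\<close>)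
    have M: "M \<noteq> []" "set M \<subseteq> set I"
      using v(2) by (auto simp: M_def filter_empty_conv)
    note st = pnet_snoc_bot[OF p nX nY cX F refl M(1,2) A_def nv[OF nX WX] nv[OF nY WY]]
    have ab: "set (A @ cin v) \<inter> set (J @ B) = {}"
      using netD(5)[OF nv[OF nX WX]] netD(6)[OF nv[OF nX WX]] netD(5)[OF nX] iX IJ disj(1)
      by (auto simp: A_def B_def)
    note RX = reord[OF WX nX] and RY = reord[OF WY nY]
    have len: "n = length (post @ p1) + length p2" using Suc(2) v(1) by simp
    have m: "mset (post @ Z @ pre) = mset ((post @ p1) @ (Z @ [v]) @ p2)" for Z using v(1) by simp
    have C: "net_connected I' ((post @ p1) @ (X @ [v]) @ p2)" using WC net_connected_perm[OF m] by blast
    have "pnet R z I' J' ((post @ p1) @ (X @ [v]) @ p2) ((post @ p1) @ (Y @ [v]) @ p2)"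
      by (rule IH[OF len st(1) nv[OF nX WX] nv[OF nY WY] st(2) _ _ ab RX RY C]) simp_all
    then show ?thesis by (rule pnet_mset[OF _ RX RY WX WY m m C])
  next
    case none
    let ?A = "set I \<union> set (outl X)"
    have IX: "set I \<subseteq> set (inl X)" and JX: "set J \<subseteq> set (outl X)" "set (outl X) \<subseteq> set J \<union> set (inl X)"
      using iX by auto
    have avail: "set (inl X) \<subseteq> set I' \<union> set (outl pre) \<union> set (outl X)"
      using oX ordered_inl by blast
    have post: "(set (cin c) \<union> set (cout c)) \<inter> ?A = {}" if c: "c \<in> set post" for c
    proof -
      have "set (cin c) \<inter> set (inl X) = {}" "set (cout c) \<inter> set (outl X) = {}"
        "set (cout c) \<inter> (set I' \<union> set (outl pre)) = {}"
        using in_cells[OF c] dX(3-5) by auto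
      moreover have "set (cin c) \<inter> set J = {}" using none(1) c by blast
      ultimately show ?thesis using IX JX avail by blast
    qed
    have pre: "(set (cin c) \<union> set (cout c)) \<inter> ?A = {}" if c: "c \<in> set pre" for c
    proof -
      have "set (cin c) \<inter> set (inl X) = {}" "set (cout c) \<inter> set (outl X) = {}"
        using in_cells[OF c] dX(3-5) by auto
      moreover have "set (cin c) \<subseteq> set I' \<union> set (outl pre)"
        using oX ordered_inl[of "set I'" pre] in_cells[OF c] by auto
      then have "set (cin c) \<inter> set (outl X) = {}" using dX(4,5) by auto
      moreover have "set (cout c) \<inter> set I = {}" using none(2) c by blast
      ultimately show ?thesis using IX JX by blast
    qed
    have "\<forall>c\<in>set (post @ X @ pre). set (cin c) \<union> set (cout c) \<subseteq> ?A \<or> (set (cin c) \<union> set (cout c)) \<inter> ?A = {}"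
    proof
      fix c assume "c \<in> set (post @ X @ pre)"
      then consider "c \<in> set post" | "c \<in> set X" | "c \<in> set pre" by auto
      then show "set (cin c) \<union> set (cout c) \<subseteq> ?A \<or> (set (cin c) \<union> set (cout c)) \<inter> ?A = {}"
      proof cases
        case 2
        then show ?thesis using in_cells[OF 2] inX by blast
      qed (use post pre in blast)+
    qed
    moreover obtain x where x: "x \<in> ?A" "x \<in> set (outl X)"
    proof -
      obtain c where c: "c \<in> set X" using ne(1) by (cases X) auto
      then have "cout c \<noteq> []" using netD(9)[OF nX c] by (cases "fst c") (auto simp: wf_cell_def bib_gens_def)
      then show ?thesis using that in_cells[OF c] by (cases "cout c") auto
    qed
    ultimately have sub: "set I' \<union> set (outl (post @ X @ pre)) \<subseteq> ?A"
      using WC[unfolded net_connected_def, THEN conjunct2, THEN spec[of _ ?A]] by auto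
    obtain c where c: "c \<in> set post \<union> set pre" using Suc(2) by (cases post; cases pre) auto
    then have "cout c \<noteq> []" using netD(9)[OF WX, of c]
      by (cases "fst c") (auto simp: wf_cell_def bib_gens_def)
    then obtain y where "y \<in> set (cout c)" by (cases "cout c") auto
    moreover have "set (cout c) \<subseteq> set (outl (post @ X @ pre))" using c in_cells[of c post] in_cells[of c pre] by auto
    ultimately have "y \<in> ?A" "y \<in> set (cout c)" using sub by blast+
    then show ?thesis using post pre c by blast
  qed
qed

section \<open>The relations as local moves\<close>

abbreviation Mc :: "nat \<Rightarrow> nat \<Rightarrow> nat \<Rightarrow> cell" where "Mc x y z \<equiv> (Mult, [x, y], [z])"
abbreviation Dc :: "nat \<Rightarrow> nat \<Rightarrow> nat \<Rightarrow> cell" where "Dc x y z \<equiv> (Comult, [x], [y, z])"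

lemma wf_cell_iff: "wf_cell c \<longleftrightarrow> (\<exists>x y z. c = Mc x y z) \<or> (\<exists>x y z. c = Dc x y z)"
proof
  assume w: "wf_cell c"
  obtain g xs ys where c: "c = (g, xs, ys)" by (metis surj_pair)
  show "(\<exists>x y z. c = Mc x y z) \<or> (\<exists>x y z. c = Dc x y z)"
    using w by (cases g) (auto simp: c wf_cell_def bib_gens_def length_Suc_conv numeral_2_eq_2)
qed (auto simp: wf_cell_def bib_gens_def)

lemma wf_Mc [simp]: "wf_cell (Mc x y z)" and wf_Dc [simp]: "wf_cell (Dc x y z)"
  by (auto simp: wf_cell_iff)

text \<open>
  A local move: both sides are connected and have the same legs, and they are proportional with
  a nonzero factor.
\<close>

definition rule :: "'k::field_char_0 lin set \<Rightarrow> nat list \<Rightarrow> nat list \<Rightarrow> cell list \<Rightarrow> cell list \<Rightarrow> bool" where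
  "rule R I J X Y \<longleftrightarrow> net I J X \<and> net I J Y \<and> net_connected I X \<and> net_connected I Y \<and>
     X \<noteq> [] \<and> Y \<noteq> [] \<and> set I \<inter> set J = {} \<and> pnet R False I J X Y"

text \<open>
  Proportionality with a nonzero factor of whole nets. Nets that are not connected have no
  counterpart in the properad; for these the relation only states that the interface is kept, so
  that moves can be chained before connectedness is known.
\<close>

definition cong :: "'k::field_char_0 lin set \<Rightarrow> nat list \<Rightarrow> nat list \<Rightarrow> cell list \<Rightarrow> cell list \<Rightarrow> bool" where
  "cong R I J cs ds \<longleftrightarrow> net I J cs \<and> net I J ds \<and> (net_connected I cs \<longleftrightarrow> net_connected I ds) \<and>
     (net_connected I cs \<longrightarrow> pnet R False I J cs ds)"

definition vanishes :: "'k::field_char_0 lin set \<Rightarrow> nat list \<Rightarrow> nat list \<Rightarrow> cell list \<Rightarrow> bool" where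
  "vanishes R I J cs \<longleftrightarrow> net I J cs \<and> (net_connected I cs \<longrightarrow> pnet R True I J cs cs)"

lemma cong_net: "cong R I J cs ds \<Longrightarrow> net I J cs" "cong R I J cs ds \<Longrightarrow> net I J ds"
  by (simp_all add: cong_def)

lemma cong_refl: "net I J cs \<Longrightarrow> cong R I J cs cs"
  by (simp add: cong_def pnet_perm)

lemma pnet_sym:
  assumes "pnet R False I J cs ds"
  shows "pnet R False I J ds cs"
  using assms prop_to_sym unfolding pnet_def by blast

lemma pnet_connected:
  assumes "pnet R False I J cs ds" "net I J cs" "net I J ds" "net_connected I cs"
  shows "net_connected I ds"
proof -
  obtain G where G: "lab G I J cs" using lab_exists[OF assms(2)] .
  obtain H where H: "lab H I J ds" using lab_exists[OF assms(3)] .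
  show ?thesis
    using prop_to_cgraphs[OF pnetD[OF assms(1) G H]] cgraphs_lab[OF assms(2) G] cgraphs_lab[OF assms(3) H] assms(4)
    by blast
qed

lemma cong_trans [trans]: "cong R I J cs ds \<Longrightarrow> cong R I J ds es \<Longrightarrow> cong R I J cs es"
  using pnet_trans[of R False I J cs ds False es] by (auto simp: cong_def)

lemma cong_perm:
  assumes "net I J cs" "mset ds = mset cs" "ordered (set I) ds"
  shows "cong R I J cs ds"
  unfolding cong_def
  using net_perm[OF assms] assms(1) net_connected_perm[OF assms(2)] pnet_perm[OF assms(1) net_perm[OF assms] assms(2)[symmetric]]
  by blast

lemma pnet_TrueD:
  assumes "pnet R True I J cs ds" "net I J ds" "lab G I J cs"
  shows "null bib_gens R (length J) (length I) (single1 G)"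
proof -
  obtain H where "lab H I J ds" using lab_exists[OF assms(2)] .
  then show ?thesis using pnetD[OF assms(1,3)] by (simp add: prop_to_zero)
qed

lemma vanishes_cong:
  assumes "cong R I J cs ds" "vanishes R I J ds"
  shows "vanishes R I J cs"
proof -
  have n: "net I J cs" "net I J ds" using cong_net[OF assms(1)] by auto
  have "pnet R True I J cs cs" if c: "net_connected I cs"
  proof -
    have "pnet R False I J cs ds" "net_connected I ds" using assms(1) c by (auto simp: cong_def)
    moreover then have "pnet R True I J ds ds" using assms(2) by (simp add: vanishes_def)
    ultimately have "pnet R True I J cs ds" using pnet_trans n by fastforce
    from pnet_TrueD[OF this n(2)] show ?thesis by (simp add: pnet_def prop_to_zero)
  qed
  then show ?thesis using n by (simp add: vanishes_def)
qed

text \<open>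
  The internal edges of the new subnet must be fresh. In the moves used below its names are
  among those of the old one.
\<close>

lemma net_replace:
  assumes nX: "net I J X" and nY: "net I J Y" and IJ: "set I \<inter> set J = {}"
    and W: "net I' J' (post @ X @ pre)"
    and fresh: "(set (outl Y) - set J) \<inter> (set I' \<union> set (outl post) \<union> set (outl pre)) = {}"
      "(set (outl Y) - set J) \<inter> (set (outl X) \<inter> set J) = {}"
  shows "net I' J' (post @ Y @ pre)"
proof -
  note d = netD[OF W, simplified] and x = netD[OF nX] and y = netD[OF nY]
  note o = d(8)[simplified ordered_append]
  note iX = net_interface[OF nX IJ] and iY = net_interface[OF nY IJ]
  have oX: "ordered (set I' \<union> set (outl pre)) X" "ordered (set I') pre"
    "ordered (set I' \<union> set (outl X) \<union> set (outl pre)) post"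
    using d(8) by (simp_all add: ordered_append Un_ac)
  have IX: "set (inl X) \<subseteq> set I' \<union> set (outl pre) \<union> set (outl X)" using ordered_inl[OF oX(1)] .
  have post: "set (inl post) \<subseteq> set I' \<union> (set (outl X) \<union> set (outl pre)) \<union> set (outl post)"
    using ordered_inl[OF oX(3)] by blast
  have pre: "set (inl pre) \<subseteq> set I' \<union> set (outl pre)" using ordered_inl[OF oX(2)] .
  have Ia: "set I \<subseteq> set I' \<union> set (outl pre)" using iX IX by blast
  show ?thesis unfolding net_def
  proof (intro conjI)
    show "\<forall>c\<in>set (post @ Y @ pre). wf_cell c" using netD(9)[OF W] y(9) by auto
    show "distinct (I' @ outl (post @ Y @ pre))"
      using d(1,4,5) y(4) fresh iX iY by auto
    have inY: "set (inl Y) \<subseteq> set I \<union> (set (outl Y) - set J)" using iY(1,2) y(7) by blast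
    have usd: "set J' \<union> set (inl post) \<union> set (inl pre) \<subseteq> (set I' \<union> set (outl post) \<union> set (outl pre)) \<union> (set (outl X) \<inter> set J)"
      using post pre d(3,6,7) iX by auto
    have "(set (outl Y) - set J) \<inter> (set J' \<union> set (inl post) \<union> set (inl pre)) = {}" using usd fresh by blast
    moreover have "set I \<inter> (set J' \<union> set (inl post) \<union> set (inl pre)) = {}"
      using d(3,6) iX(1) by auto
    ultimately have "set (inl Y) \<inter> (set J' \<union> set (inl post) \<union> set (inl pre)) = {}"
      using inY by blast
    then show "distinct (J' @ inl (post @ Y @ pre))"
      using d(2,3,6) y(3) by (simp add: Int_Un_distrib Int_Un_distrib2 Int_commute)
    show "set I' \<union> set (outl (post @ Y @ pre)) = set J' \<union> set (inl (post @ Y @ pre))"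
    proof -
      have "set I' \<union> set (outl post) \<union> set (outl pre) \<subseteq> set J' \<union> set (inl post) \<union> set (inl pre) \<union> set I"
        using d(4,5,7) iX(1) by auto
      moreover have "set J \<subseteq> set J' \<union> set (inl post) \<union> set (inl pre)"
        using d(7) iX(2) by auto
      moreover have "set I \<subseteq> set (inl Y)" "set J \<subseteq> set (outl Y)" using iY by auto
      ultimately show ?thesis using usd Ia y(7) by simp blast
    qed
    have "ordered (set I' \<union> set (outl pre)) Y" using ordered_mono[OF y(8) Ia] .
    moreover have "ordered (set I' \<union> (set (outl Y) \<union> set (outl pre))) post"
      by (rule ordered_weaken[OF oX(3)]) (use d(3) iX iY in auto)
    ultimately show "ordered (set I') (post @ Y @ pre)" using oX(2) by (simp add: ordered_append Un_ac)
  qed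
qed

lemma cong_rule:
  assumes r: "rule R I J X Y" and W: "net I' J' (post @ X @ pre)" and o: "set (outl Y) \<subseteq> set (outl X)"
  shows "cong R I' J' (post @ X @ pre) (post @ Y @ pre)"
proof -
  have r': "net I J X" "net I J Y" "net_connected I X" "net_connected I Y" "X \<noteq> []" "Y \<noteq> []"
    "set I \<inter> set J = {}" "pnet R False I J X Y" using r by (auto simp: rule_def)
  have W': "net I' J' (post @ Y @ pre)"
    by (rule net_replace[OF r'(1,2,7) W]) (use o netD(4,5)[OF W] in auto)
  have c: "net_connected I' (post @ X @ pre) \<Longrightarrow> pnet R False I' J' (post @ X @ pre) (post @ Y @ pre)"
    by (rule pnet_context[OF r'(8,1,2,3,5,6,7) W W'])
  have c': "net_connected I' (post @ Y @ pre) \<Longrightarrow> pnet R False I' J' (post @ Y @ pre) (post @ X @ pre)"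
    by (rule pnet_context[OF pnet_sym[OF r'(8)] r'(2,1,4,6,5,7) W' W])
  show ?thesis unfolding cong_def
    using c c' pnet_connected[OF c W W'] pnet_connected[OF c' W' W] W W' by blast
qed

lemma vanishes_rule:
  assumes "net I J X" "net_connected I X" "X \<noteq> []" "set I \<inter> set J = {}" "pnet R True I J X X"
    and W: "net I' J' (post @ X @ pre)"
  shows "vanishes R I' J' (post @ X @ pre)"
  unfolding vanishes_def by (intro conjI impI W pnet_context[OF assms(5,1,1,2,3,3,4) W W])

lemma rule_sym: "rule R I J X Y \<Longrightarrow> rule R I J Y X"
  by (auto simp: rule_def intro: pnet_sym)

lemma ruleI:
  assumes "lab G I J X" "lab H I J Y"
    and G: "G \<in> cgraphs bib_gens a b" and H: "H \<in> cgraphs bib_gens a b"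
    and r: "c \<noteq> 0" "single1 G - scale c (single1 H) \<in> R"
    and n: "net I J X" "net I J Y" "set I \<inter> set J = {}" "X \<noteq> []" "Y \<noteq> []"
  shows "rule R I J X Y"
proof -
  have ab: "a = length J" "b = length I"
    using cgraphsD(1,2)[OF G] lab_simps(1,2)[OF assms(1)] by auto
  have "null bib_gens R a b (single1 G - scale c (single1 H))"
    by (rule null_rel[OF r(2)]) (intro free_minus free_scale free_single1 G H)
  then have p: "prop_to R False (length J) (length I) G H" using r(1) ab by (auto simp: prop_to_def)
  have c: "net_connected I X" "net_connected I Y"
    using cgraphs_lab[OF n(1) assms(1)] cgraphs_lab[OF n(2) assms(2)] G H ab by blast+
  show ?thesis unfolding rule_def
    using n c pnetI[OF n(1,2) c(1) assms(1,2) p] by blast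
qed

lemma bib_subset: "{Mult, Comult} \<subseteq> bib_gens" by (simp add: bib_gens_def)

lemmas relation_cgraphs = relation_graphs[OF bib_subset]

lemma lab_gen1 [intro]: "lab (gen_graph Mult) [x, y] [z] [Mc x y z]" "lab (gen_graph Comult) [x] [y, z] [Dc x y z]"
  by (rule lab_gen; simp)+

lemma lab_id1: "lab (id_graph 1) [x] [x] []"
  using lab_id[of "[x]"] by simp

lemma lab_swap: "lab (perm_graph 2 (Transposition.transpose 0 1)) [x, y] [y, x] []"
proof -
  have "lab (perm_graph (length [x, y]) (Transposition.transpose 0 1)) [x, y] [y, x] []"
  proof (rule lab_perm)
    show "Transposition.transpose 0 1 permutes {..<length [x, y]}"
      using swap_permutes by (simp add: numeral_2_eq_2)
    fix i assume "i < length [x, y]"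
    then have "i = 0 \<or> i = 1" by auto
    then show "[y, x] ! Transposition.transpose 0 1 i = [x, y] ! i" by auto
  qed simp
  then show ?thesis by (simp add: numeral_2_eq_2)
qed

lemma lab_mul_id: "lab (gtensor mulG idG) [x, y, w] [z, w] [Mc x y z]"
  using lab_gtensor[OF lab_gen1(1) lab_id1] by simp
lemma lab_id_mul: "lab (gtensor idG mulG) [w, x, y] [w, z] [Mc x y z]"
  using lab_gtensor[OF lab_id1 lab_gen1(1)] by simp
lemma lab_cop_id: "lab (gtensor copG idG) [x, w] [y, z, w] [Dc x y z]"
  using lab_gtensor[OF lab_gen1(2) lab_id1] by simp
lemma lab_id_cop: "lab (gtensor idG copG) [w, x] [w, y, z] [Dc x y z]"
  using lab_gtensor[OF lab_id1 lab_gen1(2)] by simp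
lemma lab_swap_id: "lab (gtensor swpG idG) [x, y, z] [y, x, z] []"
  using lab_gtensor[OF lab_swap lab_id1] by simp
lemma lab_id_swap: "lab (gtensor idG swpG) [x, y, z] [x, z, y] []"
  using lab_gtensor[OF lab_id1 lab_swap] by simp

lemma lab_BG: "lab BG [x, y] [c, d] [Mc x t d, Dc y c t]"
  using lab_gcomp[OF lab_id_mul lab_gcomp[OF lab_swap_id lab_id_cop]] by simp

lemma lab_swap_BG: "lab (gcomp swpG (gcomp BG swpG)) [x, y] [c, d] [Mc y t c, Dc x d t]"
  using lab_gcomp[OF lab_swap lab_gcomp[OF lab_BG lab_swap]] by simp

lemma lab_DG_swap: "lab (gcomp DG swpG) [x, y] [c, d] [Mc t x c, Dc y t d]"
  using lab_gcomp[OF lab_gcomp[OF lab_mul_id lab_gcomp[OF lab_id_swap lab_cop_id]] lab_swap] by simp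

lemma net_two:
  assumes "wf_cell c" "wf_cell d" "distinct (I @ cout c @ cout d)" "distinct (J @ cin c @ cin d)"
    "set I \<union> set (cout c) \<union> set (cout d) = set J \<union> set (cin c) \<union> set (cin d)"
    "set (cin d) \<subseteq> set I" "set (cin c) \<subseteq> set I \<union> set (cout d)"
  shows "net I J [c, d]"
  using assms by (auto simp: net_def)

lemmas lin_simps = comp_lin_def tensor_lin_def bilin_single1 rel_B_def rel_D_def

text \<open>
  From here on, one move for each relation. Both sides use the same single internal name, so
  that no fresh names are ever needed.
\<close>

lemma rule_assoc:
  assumes "distinct [x, y, z, t, w]"
  shows "rule bib_rels [x, y, z] [w] [Mc x t w, Mc y z t] [Mc t z w, Mc x y t]"
proof (rule ruleI[OF _ _ relation_cgraphs(1) relation_cgraphs(2), where c = "-1"])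
  show "lab (gcomp mulG (gtensor idG mulG)) [x, y, z] [w] [Mc x t w, Mc y z t]"
    using lab_gcomp[OF lab_gen1(1) lab_id_mul] by simp
  show "lab (gcomp mulG (gtensor mulG idG)) [x, y, z] [w] [Mc t z w, Mc x y t]"
    using lab_gcomp[OF lab_gen1(1) lab_mul_id] by simp
  show "single1 (gcomp mulG (gtensor idG mulG)) - scale (-1) (single1 (gcomp mulG (gtensor mulG idG))) \<in> bib_rels"
    by (simp add: scale_minus bib_rels_def lin_simps)
qed (use assms in \<open>auto intro!: net_two\<close>)

lemma rule_coassoc:
  assumes "distinct [a, b, c, t, p]"
  shows "rule bib_rels [p] [a, b, c] [Dc t b c, Dc p a t] [Dc t a b, Dc p t c]"
proof (rule ruleI[OF _ _ relation_cgraphs(3) relation_cgraphs(4), where c = "1"])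
  show "lab (gcomp (gtensor idG copG) copG) [p] [a, b, c] [Dc t b c, Dc p a t]"
    using lab_gcomp[OF lab_id_cop lab_gen1(2)] by simp
  show "lab (gcomp (gtensor copG idG) copG) [p] [a, b, c] [Dc t a b, Dc p t c]"
    using lab_gcomp[OF lab_cop_id lab_gen1(2)] by simp
  show "single1 (gcomp (gtensor idG copG) copG) - scale (1) (single1 (gcomp (gtensor copG idG) copG)) \<in> bib_rels"
    by (simp add: scale_minus bib_rels_def lin_simps)
qed (use assms in \<open>auto intro!: net_two\<close>)

lemma rule_frob_right:
  assumes "distinct [x, y, c, d, t]"
  shows "rule bib_rels [x, y] [c, d] [Mc x t c, Dc y t d] [Dc t c d, Mc x y t]"
proof (rule ruleI[OF _ _ relation_cgraphs(6) relation_cgraphs(5), where c = "1"])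
  show "lab (gcomp (gtensor mulG idG) (gtensor idG copG)) [x, y] [c, d] [Mc x t c, Dc y t d]"
    using lab_gcomp[OF lab_mul_id lab_id_cop] by simp
  show "lab (gcomp copG mulG) [x, y] [c, d] [Dc t c d, Mc x y t]"
    using lab_gcomp[OF lab_gen1(2) lab_gen1(1)] by simp
  show "single1 (gcomp (gtensor mulG idG) (gtensor idG copG)) - scale (1) (single1 (gcomp copG mulG)) \<in> bib_rels"
    by (simp add: scale_minus bib_rels_def lin_simps)
qed (use assms in \<open>auto intro!: net_two\<close>)

lemma rule_frob_left:
  assumes "distinct [x, y, c, d, t]"
  shows "rule bib_rels [x, y] [c, d] [Mc t y d, Dc x c t] [Dc t c d, Mc x y t]"
proof (rule ruleI[OF _ _ relation_cgraphs(7) relation_cgraphs(5), where c = "1"])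
  show "lab (gcomp (gtensor idG mulG) (gtensor copG idG)) [x, y] [c, d] [Mc t y d, Dc x c t]"
    using lab_gcomp[OF lab_id_mul lab_cop_id] by simp
  show "lab (gcomp copG mulG) [x, y] [c, d] [Dc t c d, Mc x y t]"
    using lab_gcomp[OF lab_gen1(2) lab_gen1(1)] by simp
  show "single1 (gcomp (gtensor idG mulG) (gtensor copG idG)) - scale (1) (single1 (gcomp copG mulG)) \<in> bib_rels"
    by (simp add: scale_minus bib_rels_def lin_simps)
qed (use assms in \<open>auto intro!: net_two\<close>)

text \<open>
  The relation between \<open>B\<close> and its conjugate by the flip, read as exchanging the
  roles of the two factors.
\<close>

lemma rule_balance_swap:
  assumes "distinct [x, y, c, d, t]"
  shows "rule bib_rels [x, y] [c, d] [Mc x t d, Dc y c t] [Mc y t c, Dc x d t]"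
proof (rule ruleI[OF _ _ relation_cgraphs(8) relation_cgraphs(9), where c = "-1"])
  show "lab BG [x, y] [c, d] [Mc x t d, Dc y c t]"
    using lab_BG by simp
  show "lab (gcomp swpG (gcomp BG swpG)) [x, y] [c, d] [Mc y t c, Dc x d t]"
    using lab_swap_BG by simp
  show "single1 BG - scale (-1) (single1 (gcomp swpG (gcomp BG swpG))) \<in> bib_rels"
    by (simp add: scale_minus bib_rels_def lin_simps)
qed (use assms in \<open>auto intro!: net_two\<close>)

text \<open>
  The relation between \<open>B\<close> and the flipped \<open>D\<close>: \<open>x\<close> is
  multiplied onto the other output of the coproduct, from the other side.
\<close>

lemma rule_balance_mirror:
  assumes "distinct [x, y, c, d, t]"
  shows "rule bib_rels [x, y] [c, d] [Mc x t d, Dc y c t] [Mc t x c, Dc y t d]"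
proof (rule ruleI[OF _ _ relation_cgraphs(8) relation_cgraphs(10), where c = "-1"])
  show "lab BG [x, y] [c, d] [Mc x t d, Dc y c t]"
    using lab_BG by simp
  show "lab (gcomp DG swpG) [x, y] [c, d] [Mc t x c, Dc y t d]"
    using lab_DG_swap by simp
  show "single1 BG - scale (-1) (single1 (gcomp DG swpG)) \<in> bib_rels"
    by (simp add: scale_minus bib_rels_def lin_simps)
qed (use assms in \<open>auto intro!: net_two\<close>)

lemma rule_mul_cop:
  assumes "distinct [x, p, q, c]"
  shows "net [x] [c] [Mc p q c, Dc x p q]" "net_connected [x] [Mc p q c, Dc x p q]"
    "pnet bib_rels True [x] [c] [Mc p q c, Dc x p q] [Mc p q c, Dc x p q]"
proof -
  let ?G = "gcomp mulG copG" and ?X = "[Mc p q c, Dc x p q]"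
  show n: "net [x] [c] ?X" by (use assms in \<open>auto intro!: net_two\<close>)
  have l: "lab ?G [x] [c] ?X" using lab_gcomp[OF lab_gen1(1) lab_gen1(2)] by simp
  have G: "?G \<in> cgraphs bib_gens (length [c]) (length [x])" using relation_cgraphs(11) by simp
  show c: "net_connected [x] ?X" using cgraphs_lab[OF n l] G by blast
  have "single1 ?G \<in> bib_rels" by (simp add: bib_rels_def lin_simps)
  then have "null bib_gens bib_rels (length [c]) (length [x]) (single1 ?G)"
    by (rule null_rel) (rule free_single1[OF G])
  then have "prop_to bib_rels True (length [c]) (length [x]) ?G ?G" by (simp add: prop_to_zero)
  then show "pnet bib_rels True [x] [c] ?X ?X" by (rule pnetI[OF n n c l l])
qed

lemma rule_mul_swap_cop:
  assumes "distinct [x, p, q, c]"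
  shows "net [x] [c] [Mc q p c, Dc x p q]" "net_connected [x] [Mc q p c, Dc x p q]"
    "pnet bib_rels True [x] [c] [Mc q p c, Dc x p q] [Mc q p c, Dc x p q]"
proof -
  let ?G = "gcomp mulG (gcomp swpG copG)" and ?X = "[Mc q p c, Dc x p q]"
  show n: "net [x] [c] ?X" by (use assms in \<open>auto intro!: net_two\<close>)
  have l: "lab ?G [x] [c] ?X" using lab_gcomp[OF lab_gen1(1) lab_gcomp[OF lab_swap lab_gen1(2)]] by simp
  have G: "?G \<in> cgraphs bib_gens (length [c]) (length [x])" using relation_cgraphs(12) by simp
  show c: "net_connected [x] ?X" using cgraphs_lab[OF n l] G by blast
  have "single1 ?G \<in> bib_rels" by (simp add: bib_rels_def lin_simps)
  then have "null bib_gens bib_rels (length [c]) (length [x]) (single1 ?G)"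
    by (rule null_rel) (rule free_single1[OF G])
  then have "prop_to bib_rels True (length [c]) (length [x]) ?G ?G" by (simp add: prop_to_zero)
  then show "pnet bib_rels True [x] [c] ?X ?X" by (rule pnetI[OF n n c l l])
qed

section \<open>Strands\<close>

lemma two_cells_distinct:
  assumes "net I J (post @ c # d # pre)"
  shows "distinct (cin c @ cin d)" "distinct (cout c @ cout d)" "set (cin d) \<inter> set (cout d) = {}"
    "set (cin d) \<inter> set (cout c) = {}" "set (cin c) \<inter> set (cout c) = {}"
proof -
  note n = netD[OF assms, simplified]
  show "distinct (cin c @ cin d)" "distinct (cout c @ cout d)" using n(3,4) by auto
  have "set (cin c) \<subseteq> set I \<union> (set (cout d) \<union> set (outl pre))" "set (cin d) \<subseteq> set I \<union> set (outl pre)"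
    using n(8) by (simp_all add: ordered_append)
  then show "set (cin d) \<inter> set (cout d) = {}" "set (cin d) \<inter> set (cout c) = {}" "set (cin c) \<inter> set (cout c) = {}"
    using n(4,5) by auto
qed

text \<open>
  Cells that are not connected by an edge may be applied in any order.
\<close>

lemma cong_swap_blocks:
  assumes "net I J (post @ A @ B @ pre)" "set (inl A) \<inter> set (outl B) = {}"
  shows "cong R I J (post @ A @ B @ pre) (post @ B @ A @ pre)"
proof (rule cong_perm[OF assms(1)])
  note o = netD(8)[OF assms(1), simplified ordered_append, simplified]
  have "ordered (set I \<union> set (outl pre)) A"
    by (rule ordered_weaken[of "set I \<union> (set (outl B) \<union> set (outl pre))"])
      (use o assms(2) in \<open>auto simp: ordered_append\<close>)
  moreover have "ordered (set I \<union> (set (outl A) \<union> set (outl pre))) B"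
    by (rule ordered_mono[of "set I \<union> set (outl pre)"]) (use o in \<open>auto simp: ordered_append\<close>)
  ultimately show "ordered (set I) (post @ B @ A @ pre)" using o by (simp add: ordered_append Un_ac)
qed simp

context
  fixes R :: "'k::field_char_0 lin set"
  assumes R: "R = bib_rels"
begin

lemma cong_assoc:
  assumes "net I J (post @ Mc x t w # Mc y z t # pre)"
  shows "cong R I J (post @ Mc x t w # Mc y z t # pre) (post @ Mc t z w # Mc x y t # pre)"
proof -
  have d: "distinct [x, y, z, t, w]" using two_cells_distinct[OF assms] by auto
  show ?thesis using cong_rule[OF rule_assoc[OF d], of I J post pre] assms by (simp add: R insert_commute)
qed

lemma cong_assoc_rev:
  assumes "net I J (post @ Mc t z w # Mc x y t # pre)"
  shows "cong R I J (post @ Mc t z w # Mc x y t # pre) (post @ Mc x t w # Mc y z t # pre)"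
proof -
  have d: "distinct [x, y, z, t, w]" using two_cells_distinct[OF assms] by auto
  show ?thesis using cong_rule[OF rule_sym[OF rule_assoc[OF d]], of I J post pre] assms by (simp add: R insert_commute)
qed

lemma cong_coassoc:
  assumes "net I J (post @ Dc t b c # Dc p a t # pre)"
  shows "cong R I J (post @ Dc t b c # Dc p a t # pre) (post @ Dc t a b # Dc p t c # pre)"
proof -
  have d: "distinct [a, b, c, t, p]" using two_cells_distinct[OF assms] by auto
  show ?thesis using cong_rule[OF rule_coassoc[OF d], of I J post pre] assms by (simp add: R insert_commute)
qed

lemma cong_coassoc_rev:
  assumes "net I J (post @ Dc t a b # Dc p t c # pre)"
  shows "cong R I J (post @ Dc t a b # Dc p t c # pre) (post @ Dc t b c # Dc p a t # pre)"
proof -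
  have d: "distinct [a, b, c, t, p]" using two_cells_distinct[OF assms] by auto
  show ?thesis using cong_rule[OF rule_sym[OF rule_coassoc[OF d]], of I J post pre] assms by (simp add: R insert_commute)
qed

lemma cong_frob_right:
  assumes "net I J (post @ Mc x t c # Dc y t d # pre)" "x \<noteq> d"
  shows "cong R I J (post @ Mc x t c # Dc y t d # pre) (post @ Dc t c d # Mc x y t # pre)"
proof -
  have d: "distinct [x, y, c, d, t]" using two_cells_distinct[OF assms(1)] assms(2) by auto
  show ?thesis using cong_rule[OF rule_frob_right[OF d], of I J post pre] assms(1) by (simp add: R insert_commute)
qed

lemma cong_frob_right_rev:
  assumes "net I J (post @ Dc t c d # Mc x y t # pre)"
  shows "cong R I J (post @ Dc t c d # Mc x y t # pre) (post @ Mc x t c # Dc y t d # pre)"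
proof -
  have d: "distinct [x, y, c, d, t]" using two_cells_distinct[OF assms] by auto
  show ?thesis using cong_rule[OF rule_sym[OF rule_frob_right[OF d]], of I J post pre] assms by (simp add: R insert_commute)
qed

lemma cong_frob_left:
  assumes "net I J (post @ Mc t y d # Dc x c t # pre)" "y \<noteq> c"
  shows "cong R I J (post @ Mc t y d # Dc x c t # pre) (post @ Dc t c d # Mc x y t # pre)"
proof -
  have d: "distinct [x, y, c, d, t]" using two_cells_distinct[OF assms(1)] assms(2) by auto
  show ?thesis using cong_rule[OF rule_frob_left[OF d], of I J post pre] assms(1) by (simp add: R insert_commute)
qed

lemma cong_frob_left_rev:
  assumes "net I J (post @ Dc t c d # Mc x y t # pre)"
  shows "cong R I J (post @ Dc t c d # Mc x y t # pre) (post @ Mc t y d # Dc x c t # pre)"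
proof -
  have d: "distinct [x, y, c, d, t]" using two_cells_distinct[OF assms] by auto
  show ?thesis using cong_rule[OF rule_sym[OF rule_frob_left[OF d]], of I J post pre] assms by (simp add: R insert_commute)
qed

lemma cong_balance_swap:
  assumes "net I J (post @ Mc x t d # Dc y c t # pre)" "x \<noteq> c"
  shows "cong R I J (post @ Mc x t d # Dc y c t # pre) (post @ Mc y t c # Dc x d t # pre)"
proof -
  have d: "distinct [x, y, c, d, t]" using two_cells_distinct[OF assms(1)] assms(2) by auto
  show ?thesis using cong_rule[OF rule_balance_swap[OF d], of I J post pre] assms(1) by (simp add: R insert_commute)
qed

lemma cong_balance_mirror:
  assumes "net I J (post @ Mc x t d # Dc y c t # pre)" "x \<noteq> c"
  shows "cong R I J (post @ Mc x t d # Dc y c t # pre) (post @ Mc t x c # Dc y t d # pre)"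
proof -
  have d: "distinct [x, y, c, d, t]" using two_cells_distinct[OF assms(1)] assms(2) by auto
  show ?thesis using cong_rule[OF rule_balance_mirror[OF d], of I J post pre] assms(1) by (simp add: R insert_commute)
qed

lemma cong_balance_mirror_rev:
  assumes "net I J (post @ Mc t x c # Dc y t d # pre)" "x \<noteq> d"
  shows "cong R I J (post @ Mc t x c # Dc y t d # pre) (post @ Mc x t d # Dc y c t # pre)"
proof -
  have d: "distinct [x, y, c, d, t]" using two_cells_distinct[OF assms(1)] assms(2) by auto
  show ?thesis using cong_rule[OF rule_sym[OF rule_balance_mirror[OF d]], of I J post pre] assms(1) by (simp add: R insert_commute)
qed

text \<open>
  Together the two balance relations identify all four graphs of this shape, so they give a move
  between any two of them.
\<close>

lemma cong_balance_turn:
  assumes "net I J (post @ Mc x t d # Dc y c t # pre)" "x \<noteq> c"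
  shows "cong R I J (post @ Mc x t d # Dc y c t # pre) (post @ Mc t y d # Dc x t c # pre)"
proof -
  have s: "cong R I J (post @ Mc x t d # Dc y c t # pre) (post @ Mc y t c # Dc x d t # pre)"
    by (rule cong_balance_swap[OF assms])
  have "y \<noteq> d" using two_cells_distinct[OF assms(1)] by auto
  from cong_trans[OF s cong_balance_mirror[OF cong_net(2)[OF s] this]] show ?thesis .
qed

lemma cong_balance_swap':
  assumes "net I J (post @ Mc t x c # Dc y t d # pre)" "x \<noteq> d"
  shows "cong R I J (post @ Mc t x c # Dc y t d # pre) (post @ Mc y t c # Dc x d t # pre)"
proof -
  have s: "cong R I J (post @ Mc t x c # Dc y t d # pre) (post @ Mc x t d # Dc y c t # pre)"
    by (rule cong_balance_mirror_rev[OF assms])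
  have "x \<noteq> c" using two_cells_distinct[OF assms(1)] by auto
  from cong_trans[OF s cong_balance_swap[OF cong_net(2)[OF s] this]] show ?thesis .
qed

lemma cong_balance_turn':
  assumes "net I J (post @ Mc t x c # Dc y t d # pre)" "x \<noteq> d"
  shows "cong R I J (post @ Mc t x c # Dc y t d # pre) (post @ Mc t y d # Dc x t c # pre)"
proof -
  have s: "cong R I J (post @ Mc t x c # Dc y t d # pre) (post @ Mc x t d # Dc y c t # pre)"
    by (rule cong_balance_mirror_rev[OF assms])
  have "x \<noteq> c" using two_cells_distinct[OF assms(1)] by auto
  from cong_trans[OF s cong_balance_turn[OF cong_net(2)[OF s] this]] show ?thesis .
qed

lemma vanishes_mul_cop:
  assumes "net I J (post @ Mc p q c # Dc x p q # pre)"
  shows "vanishes R I J (post @ Mc p q c # Dc x p q # pre)"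
proof -
  have d: "distinct [x, p, q, c]" using two_cells_distinct[OF assms] by auto
  show ?thesis using vanishes_rule[OF rule_mul_cop(1,2)[OF d] _ _ rule_mul_cop(3)[OF d], of I J post pre] d assms
    by (simp add: R)
qed

lemma vanishes_mul_swap_cop:
  assumes "net I J (post @ Mc q p c # Dc x p q # pre)"
  shows "vanishes R I J (post @ Mc q p c # Dc x p q # pre)"
proof -
  have d: "distinct [x, p, q, c]" using two_cells_distinct[OF assms] by auto
  show ?thesis using vanishes_rule[OF rule_mul_swap_cop(1,2)[OF d] _ _ rule_mul_swap_cop(3)[OF d], of I J post pre] d assms
    by (simp add: R)
qed


end

text \<open>
  What happens along a strand: a further input \<open>y\<close> is absorbed by \<open>m(e,
  y)\<close>, or an output \<open>y\<close> is split off by \<open>\<Delta>(e) = (e',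
  y)\<close>.
\<close>

datatype letter = In nat | Out nat

fun lcell :: "nat \<Rightarrow> letter \<Rightarrow> nat \<Rightarrow> cell" where
  "lcell e (In y) f = Mc e y f"
| "lcell e (Out y) f = Dc e f y"

fun strand :: "nat \<Rightarrow> letter list \<Rightarrow> nat \<Rightarrow> cell list \<Rightarrow> bool" where
  "strand s [] f cs \<longleftrightarrow> f = s \<and> cs = []"
| "strand s (l # w) f cs \<longleftrightarrow> (\<exists>e ds. cs = ds @ [lcell s l e] \<and> strand e w f ds)"

fun wins :: "letter list \<Rightarrow> nat list" where
  "wins [] = []" | "wins (In y # w) = y # wins w" | "wins (Out y # w) = wins w"
fun wouts :: "letter list \<Rightarrow> nat list" where
  "wouts [] = []" | "wouts (In y # w) = wouts w" | "wouts (Out y # w) = y # wouts w"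

lemma wins_append [simp]: "wins (u @ v) = wins u @ wins v"
  by (induction u rule: wins.induct) auto
lemma wouts_append [simp]: "wouts (u @ v) = wouts u @ wouts v"
  by (induction u rule: wouts.induct) auto

lemma strand_append:
  "strand s (u @ v) f cs \<longleftrightarrow> (\<exists>e cu cv. cs = cv @ cu \<and> strand s u e cu \<and> strand e v f cv)"
proof (induction u arbitrary: s cs)
  case (Cons l u)
  show ?case
  proof
    assume "strand s ((l # u) @ v) f cs"
    then obtain e ds where "cs = ds @ [lcell s l e]" "strand e (u @ v) f ds" by auto
    then obtain e' cu cv where "ds = cv @ cu" "strand e u e' cu" "strand e' v f cv" using Cons by blast
    then show "\<exists>e cu cv. cs = cv @ cu \<and> strand s (l # u) e cu \<and> strand e v f cv"
      using \<open>cs = _\<close> by (intro exI[of _ e'] exI[of _ "cu @ [lcell s l e]"] exI[of _ cv]) auto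
  next
    assume "\<exists>e cu cv. cs = cv @ cu \<and> strand s (l # u) e cu \<and> strand e v f cv"
    then show "strand s ((l # u) @ v) f cs" using Cons by fastforce
  qed
qed auto

lemma strandI: "strand s u e cu \<Longrightarrow> strand e v f cv \<Longrightarrow> strand s (u @ v) f (cv @ cu)"
  unfolding strand_append by blast

lemma strand_names:
  assumes "strand s w f cs"
  shows "set (inl cs) \<subseteq> {s} \<union> set (wins w) \<union> set (outl cs)"
    "f \<in> {s} \<union> set (outl cs)" "set (wouts w) \<subseteq> set (outl cs)" "set (wins w) \<subseteq> set (inl cs)"
    "set (outl cs) \<subseteq> set (inl cs) \<union> set (wouts w) \<union> {f}" "s \<in> {f} \<union> set (inl cs)"
proof -
  have "set (inl cs) \<subseteq> {s} \<union> set (wins w) \<union> set (outl cs) \<and>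
    f \<in> {s} \<union> set (outl cs) \<and> set (wouts w) \<subseteq> set (outl cs) \<and> set (wins w) \<subseteq> set (inl cs) \<and>
    set (outl cs) \<subseteq> set (inl cs) \<union> set (wouts w) \<union> {f} \<and> s \<in> {f} \<union> set (inl cs)"
    using assms
  proof (induction w arbitrary: s cs)
    case (Cons l w)
    then obtain e ds where "cs = ds @ [lcell s l e]" "strand e w f ds" by auto
    then show ?case using Cons.IH[of e ds] by (cases l) auto
  qed simp
  then show "set (inl cs) \<subseteq> {s} \<union> set (wins w) \<union> set (outl cs)"
    "f \<in> {s} \<union> set (outl cs)" "set (wouts w) \<subseteq> set (outl cs)" "set (wins w) \<subseteq> set (inl cs)"
    "set (outl cs) \<subseteq> set (inl cs) \<union> set (wouts w) \<union> {f}" "s \<in> {f} \<union> set (inl cs)"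
    by blast+
qed

lemma strand_snoc:
  "strand s (w @ [l]) f cs \<longleftrightarrow> (\<exists>e ds. cs = lcell e l f # ds \<and> strand s w e ds)"
  unfolding strand_append by auto

lemma lcell_net: "wf_cell (lcell e l f)"
  by (cases l) simp_all

section \<open>Moving a strand through a cell, and rotating it\<close>

context
  fixes R :: "'k::field_char_0 lin set"
  assumes R: "R = bib_rels"
begin

text \<open>
  Multiplying a strand from the left by \<open>e\<close> is the strand that starts at
  \<open>e\<close> and first absorbs the former start: the product slides down past each letter
  by associativity or by the Frobenius relation.
\<close>

lemma mult_strand:
  assumes "strand s w g cs" "net I J (post @ Mc e g z # cs @ pre)" "e \<notin> set (outl cs)"
  shows "\<exists>ds. strand e (In s # w) z ds \<and> cong R I J (post @ Mc e g z # cs @ pre) (post @ ds @ pre)"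
  using assms
proof (induction w arbitrary: g cs z post rule: rev_induct)
  case Nil
  then show ?case by (intro exI[of _ "[Mc e s z]"]) (auto intro: cong_refl)
next
  case (snoc l w)
  obtain h ds where ds: "cs = lcell h l g # ds" "strand s w h ds"
    using snoc.prems(1) by (auto simp: strand_snoc)
  show ?case
  proof (cases l)
    case (In y)
    have c1: "cong R I J (post @ Mc e g z # Mc h y g # ds @ pre) (post @ Mc g y z # Mc e h g # ds @ pre)"
      using cong_assoc[OF R, of I J post e g z h y "ds @ pre"] snoc.prems(2) ds In by simp
    obtain ds' where s: "strand e (In s # w) g ds'"
      and c2: "cong R I J ((post @ [Mc g y z]) @ Mc e h g # ds @ pre) ((post @ [Mc g y z]) @ ds' @ pre)"
      using snoc.IH[OF ds(2), of "post @ [Mc g y z]" g] cong_net(2)[OF c1] snoc.prems(3) ds(1) by auto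
    have "strand e (In s # w @ [l]) z (Mc g y z # ds')"
      using s strand_snoc[of e "In s # w" l z] In by fastforce
    moreover have "cong R I J (post @ Mc e g z # cs @ pre) (post @ (Mc g y z # ds') @ pre)"
      using cong_trans[OF c1, of "post @ (Mc g y z # ds') @ pre"] c2 ds In by simp
    ultimately show ?thesis by blast
  next
    case (Out y)
    have "e \<noteq> y" using snoc.prems(3) ds Out by auto
    then have c1: "cong R I J (post @ Mc e g z # Dc h g y # ds @ pre) (post @ Dc g z y # Mc e h g # ds @ pre)"
      using cong_frob_right[OF R, of I J post e g z h y "ds @ pre"] snoc.prems(2) ds Out by simp
    obtain ds' where s: "strand e (In s # w) g ds'"
      and c2: "cong R I J ((post @ [Dc g z y]) @ Mc e h g # ds @ pre) ((post @ [Dc g z y]) @ ds' @ pre)"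
      using snoc.IH[OF ds(2), of "post @ [Dc g z y]" g] cong_net(2)[OF c1] snoc.prems(3) ds(1) by auto
    have "strand e (In s # w @ [l]) z (Dc g z y # ds')"
      using s strand_snoc[of e "In s # w" l z] Out by fastforce
    moreover have "cong R I J (post @ Mc e g z # cs @ pre) (post @ (Dc g z y # ds') @ pre)"
      using cong_trans[OF c1, of "post @ (Dc g z y # ds') @ pre"] c2 ds Out by simp
    ultimately show ?thesis by blast
  qed
qed

text \<open>
  The same slides in the opposite direction.
\<close>

lemma mult_strand_rev:
  assumes "strand e (In s # w) z cs" "net I J (post @ cs @ pre)"
  shows "\<exists>g ds. strand s w g ds \<and> cong R I J (post @ cs @ pre) (post @ Mc e g z # ds @ pre)"
  using assms
proof (induction w arbitrary: cs z post rule: rev_induct)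
  case Nil
  then show ?case by (intro exI[of _ s] exI[of _ "[]"]) (auto intro: cong_refl)
next
  case (snoc l w)
  obtain h ds where ds: "cs = lcell h l z # ds" "strand e (In s # w) h ds"
    using snoc.prems(1) strand_snoc[of e "In s # w" l z cs] by auto
  obtain g ds' where s: "strand s w g ds'"
    and c1: "cong R I J ((post @ [lcell h l z]) @ ds @ pre) ((post @ [lcell h l z]) @ Mc e g h # ds' @ pre)"
    using snoc.IH[OF ds(2), of "post @ [lcell h l z]"] snoc.prems(2) ds(1) by auto
  note n = cong_net(2)[OF c1]
  have s': "strand s (w @ [l]) h (lcell g l h # ds')" using s by (auto simp: strand_snoc)
  have c2: "cong R I J (post @ lcell h l z # Mc e g h # ds' @ pre) (post @ Mc e h z # lcell g l h # ds' @ pre)"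
  proof (cases l)
    case (In y)
    then show ?thesis using cong_assoc_rev[OF R, of I J post h y z e g "ds' @ pre"] n by simp
  next
    case (Out y)
    then show ?thesis using cong_frob_right_rev[OF R, of I J post h z y e g "ds' @ pre"] n by simp
  qed
  have "cong R I J (post @ cs @ pre) (post @ Mc e h z # (lcell g l h # ds') @ pre)"
    using cong_trans[of R I J _ "post @ lcell h l z # Mc e g h # ds' @ pre", OF _ c2] c1 ds(1) by simp
  then show ?case using s' by blast
qed

text \<open>
  A coproduct whose second output starts a strand slides up through it, by the mirrored
  Frobenius relation at an absorbed input and by coassociativity at an emitted output.
\<close>

lemma strand_cop:
  assumes "strand h S f cs" "net I J (post @ cs @ Dc e p h # pre)" "p \<notin> set (wins S)"
  shows "\<exists>g ds. strand e S g ds \<and> cong R I J (post @ cs @ Dc e p h # pre) (post @ Dc g p f # ds @ pre)"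
  using assms
proof (induction S arbitrary: h e cs pre)
  case Nil
  then show ?case by (intro exI[of _ e] exI[of _ "[]"]) (auto intro: cong_refl)
next
  case (Cons l S)
  obtain h' cs' where cs: "cs = cs' @ [lcell h l h']" "strand h' S f cs'" using Cons.prems(1) by auto
  have c1: "cong R I J (post @ cs @ Dc e p h # pre) ((post @ cs') @ Dc h p h' # lcell e l h # pre)"
  proof (cases l)
    case (In y)
    then have "y \<noteq> p" using Cons.prems(3) by auto
    then show ?thesis
      using cong_frob_left[OF R, of I J "post @ cs'" h y h' e p pre] Cons.prems(2) cs In by simp
  next
    case (Out y)
    then show ?thesis
      using cong_coassoc[OF R, of I J "post @ cs'" h h' y e p pre] Cons.prems(2) cs by simp
  qed
  have "p \<notin> set (wins S)" using Cons.prems(3) by (cases l) auto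
  then obtain g ds where s: "strand h S g ds"
    and c2: "cong R I J (post @ cs' @ Dc h p h' # lcell e l h # pre) (post @ Dc g p f # ds @ lcell e l h # pre)"
    using Cons.IH[OF cs(2), of h "lcell e l h # pre"] cong_net(2)[OF c1] by auto
  have "strand e (l # S) g (ds @ [lcell e l h])" using s by auto
  moreover have "cong R I J (post @ cs @ Dc e p h # pre) (post @ Dc g p f # (ds @ [lcell e l h]) @ pre)"
    using cong_trans[OF c1] c2 by simp
  ultimately show ?case by blast
qed

text \<open>
  The product of an output \<open>x\<close> with an output \<open>y\<close> that the strand
  emits later (or with its end, if \<open>Dl\<close> is empty) vanishes: each letter between the
  two is moved out of the way, until the product sits on top of a coproduct in the flipped
  order.
\<close>

lemma mul_earlier_later_vanishes:
  assumes "strand f Q h cQ" "Dl = [] \<and> y = h \<or> (\<exists>h'. Dl = [Dc h h' y])" "set (wins Q) \<subseteq> set I"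
    "net I J (post @ Mc x y z # Dl @ cQ @ Dc e f x # pre)"
  shows "vanishes R I J (post @ Mc x y z # Dl @ cQ @ Dc e f x # pre)"
  using assms
proof (induction Q arbitrary: e f x z cQ post pre)
  case Nil
  then have cQ: "cQ = []" "f = h" by auto
  show ?case
  proof (cases "Dl = []")
    case True
    then show ?thesis using vanishes_mul_swap_cop[OF R, of I J post x y z e pre] Nil cQ by auto
  next
    case False
    then obtain h' where D: "Dl = [Dc h h' y]" using Nil by blast
    have c: "cong R I J ((post @ [Mc x y z]) @ Dc h h' y # Dc e h x # pre)
      ((post @ [Mc x y z]) @ Dc h y x # Dc e h' h # pre)"
      using cong_coassoc_rev[OF R, of I J "post @ [Mc x y z]" h h' y e x pre] Nil.prems(4) D cQ by simp
    have "vanishes R I J (post @ Mc x y z # Dc h y x # Dc e h' h # pre)"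
      using vanishes_mul_swap_cop[OF R, of I J post x y z h "Dc e h' h # pre"] cong_net(2)[OF c] by simp
    then show ?thesis using vanishes_cong[OF c] D cQ by simp
  qed
next
  case (Cons l Q)
  obtain f' cs where cs: "cQ = cs @ [lcell f l f']" "strand f' Q h cs" using Cons.prems(1) by auto
  note n = Cons.prems(4)[unfolded cs(1), simplified]
  have xc: "x \<notin> set (inl (Dl @ cs))" using netD(3)[OF n] by auto
  have wQ: "set (wins Q) \<subseteq> set I" using Cons.prems(3) by (cases l) auto
  have dl: "set (inl Dl) \<subseteq> {h}" "set (outl Dl) \<union> {h} \<supseteq> {y}" using Cons.prems(2) by auto
  show ?case
  proof (cases l)
    case (In u)
    have u: "u \<in> set I" using Cons.prems(3) In by simp
    have "u \<noteq> x" using netD(5)[OF n] u by auto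
    then have c1: "cong R I J ((post @ Mc x y z # Dl @ cs) @ Mc f u f' # Dc e f x # pre)
      ((post @ Mc x y z # Dl @ cs) @ Mc u f x # Dc e f' f # pre)"
      using cong_balance_mirror_rev[OF R, of I J "post @ Mc x y z # Dl @ cs" f u f' e x pre] n In by simp
    have c2: "cong R I J ((post @ [Mc x y z]) @ (Dl @ cs) @ [Mc u f x] @ Dc e f' f # pre)
      ((post @ [Mc x y z]) @ [Mc u f x] @ (Dl @ cs) @ Dc e f' f # pre)"
      by (rule cong_swap_blocks) (use cong_net(2)[OF c1] xc in auto)
    have c3: "cong R I J (post @ Mc x y z # Mc u f x # Dl @ cs @ Dc e f' f # pre)
      (post @ Mc u x z # Mc f y x # Dl @ cs @ Dc e f' f # pre)"
      using cong_assoc_rev[OF R, of I J post x y z u f "Dl @ cs @ Dc e f' f # pre"] cong_net(2)[OF c2] by simp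
    have v: "vanishes R I J ((post @ [Mc u x z]) @ Mc f y x # Dl @ cs @ Dc e f' f # pre)"
      by (rule Cons.IH[OF cs(2) Cons.prems(2) wQ]) (use cong_net(2)[OF c3] in simp)
    show ?thesis
      using vanishes_cong[OF c1] vanishes_cong[OF c2] vanishes_cong[OF c3] v In cs(1) by simp
  next
    case (Out u)
    have c1: "cong R I J ((post @ Mc x y z # Dl @ cs) @ Dc f f' u # Dc e f x # pre)
      ((post @ Mc x y z # Dl @ cs) @ Dc f u x # Dc e f' f # pre)"
      using cong_coassoc_rev[OF R, of I J "post @ Mc x y z # Dl @ cs" f f' u e x pre] n Out by simp
    have "u \<notin> set (inl (Dl @ cs))"
      using strand_names(1,2)[OF cs(2)] dl wQ netD(4,5)[OF n] Out by auto
    then have c2: "cong R I J ((post @ [Mc x y z]) @ (Dl @ cs) @ [Dc f u x] @ Dc e f' f # pre)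
      ((post @ [Mc x y z]) @ [Dc f u x] @ (Dl @ cs) @ Dc e f' f # pre)"
      by (intro cong_swap_blocks) (use cong_net(2)[OF c1] xc in auto)
    have "y \<noteq> u" using strand_names(2)[OF cs(2)] dl netD(4)[OF n] Out by auto
    then have c3: "cong R I J (post @ Mc x y z # Dc f u x # Dl @ cs @ Dc e f' f # pre)
      (post @ Dc x u z # Mc f y x # Dl @ cs @ Dc e f' f # pre)"
      using cong_frob_left[OF R, of I J post x y z f u "Dl @ cs @ Dc e f' f # pre"] cong_net(2)[OF c2] by simp
    have v: "vanishes R I J ((post @ [Dc x u z]) @ Mc f y x # Dl @ cs @ Dc e f' f # pre)"
      by (rule Cons.IH[OF cs(2) Cons.prems(2) wQ]) (use cong_net(2)[OF c3] in simp)
    show ?thesis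
      using vanishes_cong[OF c1] vanishes_cong[OF c2] vanishes_cong[OF c3] v Out cs(1) by simp
  qed
qed

text \<open>
  The product of the end \<open>x\<close> of a strand with an output \<open>y\<close> emitted
  earlier vanishes. The letters \<open>P\<close> before the emission are first moved above the
  product. What remains is a loop at the start of the strand. Without letters inside it is
  \<open>m \<Delta>\<close>; otherwise, depending on the first letter inside, a balance move
  leads to \<open>m \<tau> \<Delta>\<close> or to the situation of the preceding lemma.
\<close>

lemma mul_final_vanishes:
  assumes "strand s P e cP" "strand f Q x cQ" "set (wins Q) \<subseteq> set I" "set (wins P) \<subseteq> set I" "s \<in> set I"
    "net I J (post @ Mc x y z # cQ @ Dc e f y # cP @ pre)"
  shows "vanishes R I J (post @ Mc x y z # cQ @ Dc e f y # cP @ pre)"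
  using assms
proof (induction P arbitrary: e f cP y z post rule: rev_induct)
  case Nil
  then have e: "cP = []" "e = s" by auto
  note n = Nil.prems(6)[unfolded e, simplified]
  show ?case
  proof (cases Q)
    case Nil
    then show ?thesis
      using vanishes_mul_cop[OF R, of I J post f y z s pre] n \<open>strand f Q x cQ\<close> e by auto
  next
    case (Cons l Q')
    then obtain h cs where cs: "cQ = cs @ [lcell f l h]" "strand h Q' x cs" using Nil.prems(2) by auto
    note m = n[unfolded cs(1), simplified]
    have yc: "y \<notin> set (inl cs)" using netD(3)[OF m] by auto
    have wQ: "set (wins Q') \<subseteq> set I" using Nil.prems(3) Cons by (cases l) auto
    show ?thesis
    proof (cases l)
      case (In u)
      have u: "u \<in> set I" using Nil.prems(3) In Cons by simp
      have "u \<noteq> y" using netD(5)[OF m] u by auto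
      then have c1: "cong R I J ((post @ Mc x y z # cs) @ Mc f u h # Dc s f y # pre)
        ((post @ Mc x y z # cs) @ Mc s f h # Dc u y f # pre)"
        using cong_balance_swap'[OF R, of I J "post @ Mc x y z # cs" f u h s y pre] m In by simp
      have st: "strand s (In f # Q') x (cs @ [Mc s f h])" using cs(2) by auto
      obtain g ds where ds: "strand f Q' g ds"
        and c2: "cong R I J ((post @ [Mc x y z]) @ (cs @ [Mc s f h]) @ Dc u y f # pre)
          ((post @ [Mc x y z]) @ Mc s g x # ds @ Dc u y f # pre)"
        using mult_strand_rev[OF st, of I J "post @ [Mc x y z]" "Dc u y f # pre"] cong_net(2)[OF c1] by auto
      have c3: "cong R I J (post @ Mc x y z # Mc s g x # ds @ Dc u y f # pre)
        (post @ Mc s x z # Mc g y x # ds @ Dc u y f # pre)"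
        using cong_assoc_rev[OF R, of I J post x y z s g "ds @ Dc u y f # pre"] cong_net(2)[OF c2] by simp
      have "y \<notin> set (wins Q')" using wQ netD(5)[OF m] by auto
      then obtain k es where
        c4: "cong R I J ((post @ [Mc s x z, Mc g y x]) @ ds @ Dc u y f # pre)
          ((post @ [Mc s x z, Mc g y x]) @ Dc k y g # es @ pre)"
        using strand_cop[OF ds, of I J "post @ [Mc s x z, Mc g y x]" u y pre] cong_net(2)[OF c3] by auto
      have v: "vanishes R I J ((post @ [Mc s x z]) @ Mc g y x # Dc k y g # es @ pre)"
        by (rule vanishes_mul_swap_cop[OF R]) (use cong_net(2)[OF c4] in simp)
      show ?thesis
        using vanishes_cong[OF c1] vanishes_cong[OF c2] vanishes_cong[OF c3] vanishes_cong[OF c4] v In cs(1) e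
        by simp
    next
      case (Out u)
      have c1: "cong R I J ((post @ Mc x y z # cs) @ Dc f h u # Dc s f y # pre)
        ((post @ Mc x y z # cs) @ Dc f u y # Dc s h f # pre)"
        using cong_coassoc_rev[OF R, of I J "post @ Mc x y z # cs" f h u s y pre] m Out by simp
      have uc: "u \<notin> set (inl cs)"
        using strand_names(1)[OF cs(2)] wQ netD(4,5)[OF m] Out by auto
      then have c2: "cong R I J ((post @ [Mc x y z]) @ cs @ [Dc f u y] @ Dc s h f # pre)
        ((post @ [Mc x y z]) @ [Dc f u y] @ cs @ Dc s h f # pre)"
        by (intro cong_swap_blocks) (use cong_net(2)[OF c1] yc in auto)
      have "x \<noteq> u" using strand_names(2)[OF cs(2)] netD(4)[OF m] Out by auto
      then have c3: "cong R I J (post @ Mc x y z # Dc f u y # cs @ Dc s h f # pre)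
        (post @ Mc y x u # Dc f y z # cs @ Dc s h f # pre)"
        using cong_balance_mirror[OF R, of I J post x y z f u "cs @ Dc s h f # pre"] cong_net(2)[OF c2] by simp
      have "f \<notin> set (outl cs)" using netD(4)[OF m] by auto
      then have c4: "cong R I J ((post @ [Mc y x u]) @ [Dc f y z] @ cs @ Dc s h f # pre)
        ((post @ [Mc y x u]) @ cs @ [Dc f y z] @ Dc s h f # pre)"
        by (intro cong_swap_blocks) (use cong_net(2)[OF c3] in auto)
      have c5: "cong R I J ((post @ Mc y x u # cs) @ Dc f y z # Dc s h f # pre)
        ((post @ Mc y x u # cs) @ Dc f h y # Dc s f z # pre)"
        using cong_coassoc[OF R, of I J "post @ Mc y x u # cs" f y z s h pre] cong_net(2)[OF c4] by simp
      have v: "vanishes R I J (post @ Mc y x u # [] @ cs @ Dc f h y # Dc s f z # pre)"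
        by (rule mul_earlier_later_vanishes[OF cs(2) _ wQ]) (use cong_net(2)[OF c5] in simp_all)
      show ?thesis
        using vanishes_cong[OF c1] vanishes_cong[OF c2] vanishes_cong[OF c3] vanishes_cong[OF c4]
          vanishes_cong[OF c5] v Out cs(1) e
        by simp
    qed
  qed
next
  case (snoc l P)
  obtain k ds where ds: "cP = lcell k l e # ds" "strand s P k ds"
    using snoc.prems(1) by (auto simp: strand_snoc)
  note n = snoc.prems(6)[unfolded ds(1), simplified]
  have wP: "set (wins P) \<subseteq> set I" using snoc.prems(4) by auto
  have yc: "y \<notin> set (inl cQ)" using netD(3)[OF n] by auto
  show ?case
  proof (cases l)
    case (In u)
    have c1: "cong R I J ((post @ Mc x y z # cQ) @ Dc e f y # Mc k u e # ds @ pre)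
      ((post @ Mc x y z # cQ) @ Mc e u y # Dc k f e # ds @ pre)"
      using cong_frob_left_rev[OF R, of I J "post @ Mc x y z # cQ" e f y k u "ds @ pre"] n In by simp
    have c2: "cong R I J ((post @ [Mc x y z]) @ cQ @ [Mc e u y] @ Dc k f e # ds @ pre)
      ((post @ [Mc x y z]) @ [Mc e u y] @ cQ @ Dc k f e # ds @ pre)"
      by (rule cong_swap_blocks) (use cong_net(2)[OF c1] yc in auto)
    have c3: "cong R I J (post @ Mc x y z # Mc e u y # cQ @ Dc k f e # ds @ pre)
      (post @ Mc y u z # Mc x e y # cQ @ Dc k f e # ds @ pre)"
      using cong_assoc[OF R, of I J post x y z e u "cQ @ Dc k f e # ds @ pre"] cong_net(2)[OF c2] by simp
    have v: "vanishes R I J ((post @ [Mc y u z]) @ Mc x e y # cQ @ Dc k f e # ds @ pre)"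
      by (rule snoc.IH[OF ds(2) snoc.prems(2,3) wP snoc.prems(5)]) (use cong_net(2)[OF c3] in simp)
    show ?thesis
      using vanishes_cong[OF c1] vanishes_cong[OF c2] vanishes_cong[OF c3] v In ds(1) by simp
  next
    case (Out u)
    have c1: "cong R I J ((post @ Mc x y z # cQ) @ Dc e f y # Dc k e u # ds @ pre)
      ((post @ Mc x y z # cQ) @ Dc e y u # Dc k f e # ds @ pre)"
      using cong_coassoc_rev[OF R, of I J "post @ Mc x y z # cQ" e f y k u "ds @ pre"] n Out by simp
    have uc: "u \<notin> set (inl cQ)"
      using strand_names(1)[OF snoc.prems(2)] snoc.prems(3) netD(4,5)[OF n] Out by auto
    have c2: "cong R I J ((post @ [Mc x y z]) @ cQ @ [Dc e y u] @ Dc k f e # ds @ pre)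
      ((post @ [Mc x y z]) @ [Dc e y u] @ cQ @ Dc k f e # ds @ pre)"
      by (rule cong_swap_blocks) (use cong_net(2)[OF c1] yc uc in auto)
    have "x \<noteq> u" using strand_names(2)[OF snoc.prems(2)] netD(4)[OF n] Out by auto
    then have c3: "cong R I J (post @ Mc x y z # Dc e y u # cQ @ Dc k f e # ds @ pre)
      (post @ Dc y z u # Mc x e y # cQ @ Dc k f e # ds @ pre)"
      using cong_frob_right[OF R, of I J post x y z e u "cQ @ Dc k f e # ds @ pre"] cong_net(2)[OF c2] by simp
    have v: "vanishes R I J ((post @ [Dc y z u]) @ Mc x e y # cQ @ Dc k f e # ds @ pre)"
      by (rule snoc.IH[OF ds(2) snoc.prems(2,3) wP snoc.prems(5)]) (use cong_net(2)[OF c3] in simp)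
    show ?thesis
      using vanishes_cong[OF c1] vanishes_cong[OF c2] vanishes_cong[OF c3] v Out ds(1) by simp
  qed
qed

text \<open>
  The strand is cut after the emission of \<open>f'\<close>. Its second part is the product of
  the cut edge with the strand starting at \<open>s'\<close>, so a balance move exchanges the
  roles of the cut edge and of that strand; the first part then ends up above the second.
\<close>

lemma strand_rotate:
  assumes "strand s (P @ [Out f', In s'] @ Q) f cs" "set (wins (P @ [Out f', In s'] @ Q)) \<subseteq> set I" "s \<in> set I"
    "net I J (post @ cs @ pre)"
  shows "\<exists>ds. strand s' (Q @ [Out f, In s] @ P) f' ds \<and> cong R I J (post @ cs @ pre) (post @ ds @ pre)"
proof -
  obtain e cP e1 cR where cs: "cs = cR @ Dc e e1 f' # cP" "strand s P e cP" "strand e1 (In s' # Q) f cR"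
  proof -
    have "strand s (P @ Out f' # In s' # Q) f cs" using assms(1) by simp
    then obtain e cP cv where 1: "cs = cv @ cP" "strand s P e cP" "strand e (Out f' # In s' # Q) f cv"
      unfolding strand_append by blast
    from 1(3) obtain e1 cR where "cv = cR @ [Dc e e1 f']" "strand e1 (In s' # Q) f cR"
      unfolding strand.simps(2)[of e "Out f'"] lcell.simps by blast
    then show ?thesis using that 1 by simp
  qed
  have w: "set (wins P) \<subseteq> set I" "set (wins Q) \<subseteq> set I" "s' \<in> set I" using assms(2) by auto
  obtain g cg where g: "strand s' Q g cg"
    and c1: "cong R I J (post @ cR @ Dc e e1 f' # cP @ pre) (post @ Mc e1 g f # cg @ Dc e e1 f' # cP @ pre)"
    using mult_strand_rev[OF cs(3), of I J post "Dc e e1 f' # cP @ pre"] assms(4) cs(1) by auto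
  note n = cong_net(2)[OF c1]
  have "e1 \<notin> set (inl cg)" using netD(3)[OF n] by auto
  moreover have "f' \<notin> set (inl cg)" using strand_names(1)[OF g] w netD(4,5)[OF n] by auto
  ultimately have c2: "cong R I J ((post @ [Mc e1 g f]) @ cg @ [Dc e e1 f'] @ cP @ pre)
    ((post @ [Mc e1 g f]) @ [Dc e e1 f'] @ cg @ cP @ pre)"
    by (intro cong_swap_blocks) (use n in auto)
  have "g \<noteq> f'" using strand_names(2)[OF g] w netD(4,5)[OF n] by auto
  then have c3: "cong R I J (post @ Mc e1 g f # Dc e e1 f' # cg @ cP @ pre)
    (post @ Mc e1 e f' # Dc g e1 f # cg @ cP @ pre)"
    using cong_balance_turn'[OF R, of I J post e1 g f e f' "cg @ cP @ pre"] cong_net(2)[OF c2] by simp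
  note n3 = cong_net(2)[OF c3]
  have "set (inl (Dc g e1 f # cg)) \<subseteq> set I \<union> set (outl cg)"
    using strand_names(1,2)[OF g] w by auto
  moreover have "(set I \<union> set (outl cg)) \<inter> set (outl cP) = {}" using netD(4,5)[OF n3] by auto
  ultimately have "set (inl (Dc g e1 f # cg)) \<inter> set (outl cP) = {}" by blast
  then have c4: "cong R I J ((post @ [Mc e1 e f']) @ (Dc g e1 f # cg) @ cP @ pre)
    ((post @ [Mc e1 e f']) @ cP @ (Dc g e1 f # cg) @ pre)"
    by (intro cong_swap_blocks) (use n3 in auto)
  note n4 = cong_net(2)[OF c4]
  have "e1 \<notin> set (outl cP)" using netD(4)[OF n4] by auto
  then obtain cL where L: "strand e1 (In s # P) f' cL"
    and c5: "cong R I J (post @ Mc e1 e f' # cP @ (Dc g e1 f # cg @ pre)) (post @ cL @ (Dc g e1 f # cg @ pre))"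
    using mult_strand[OF cs(2), of I J post e1 f' "Dc g e1 f # cg @ pre"] n4 by auto
  have "strand s' (Q @ [Out f] @ In s # P) f' (cL @ ([Dc g e1 f] @ cg))"
    by (rule strandI[OF g, of _ _ "cL @ [Dc g e1 f]", simplified append_assoc]) (use L in auto)
  moreover have "cong R I J (post @ cs @ pre) (post @ (cL @ Dc g e1 f # cg) @ pre)"
    using cong_trans[OF c1, of "post @ cL @ Dc g e1 f # cg @ pre"]
      cong_trans[OF c2, of "post @ cL @ Dc g e1 f # cg @ pre"]
      cong_trans[OF c3, of "post @ cL @ Dc g e1 f # cg @ pre"]
      cong_trans[OF c4, of "post @ cL @ Dc g e1 f # cg @ pre"] c5 cs(1) by simp
  ultimately show ?thesis by auto
qed

end

section \<open>Products and coproducts on strands\<close>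

abbreviation outs_of :: "letter list \<Rightarrow> nat \<Rightarrow> nat set" where "outs_of w f \<equiv> insert f (set (wouts w))"

lemma wouts_split: "x \<in> set (wouts w) \<Longrightarrow> \<exists>P Q. w = P @ Out x # Q"
proof (induction w rule: wouts.induct)
  case (2 y w)
  then show ?case by (metis append_Cons wouts.simps(2))
next
  case (3 y w)
  then show ?case by (metis append_Cons append_Nil set_ConsD wouts.simps(3))
qed simp

lemma strand_split_out:
  assumes "strand s (P @ Out x # Q) f cs"
  obtains e e' cP cQ where "cs = cQ @ Dc e e' x # cP" "strand s P e cP" "strand e' Q f cQ"
proof -
  from assms obtain e cP cv where 1: "cs = cv @ cP" "strand s P e cP" "strand e (Out x # Q) f cv"
    unfolding strand_append by blast
  from 1(3) obtain e' cQ where "cv = cQ @ [Dc e e' x]" "strand e' Q f cQ"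
    unfolding strand.simps(2)[of e "Out x"] lcell.simps by blast
  then show ?thesis using that 1 by simp
qed

lemma strand_outs:
  assumes "strand s w f cs" "distinct (outl cs)" "s \<notin> set (outl cs)"
  shows "distinct (f # wouts w)" "outs_of w f \<inter> (set (inl cs) - set (wins w)) = {}"
proof -
  have "distinct (f # wouts w) \<and> outs_of w f \<inter> (set (inl cs) - set (wins w)) = {}"
    using assms
  proof (induction w arbitrary: s cs)
    case (Cons l w)
    then obtain e ds where ds: "cs = ds @ [lcell s l e]" "strand e w f ds" by auto
    have d: "distinct (outl ds)" "e \<notin> set (outl ds)" "s \<noteq> e" "s \<notin> set (outl ds)"
      using Cons.prems ds by (cases l; auto)+
    note IH = Cons.IH[OF ds(2) d(1,2)] and o = strand_names(1-3)[OF ds(2)]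
    show ?case using IH o d ds(1) Cons.prems(2,3) by (cases l) auto
  qed simp
  then show "distinct (f # wouts w)" "outs_of w f \<inter> (set (inl cs) - set (wins w)) = {}" by blast+
qed

context
  fixes R :: "'k::field_char_0 lin set"
  assumes R: "R = bib_rels"
begin

text \<open>
  Splitting the end of a strand prolongs it; splitting an emitted output is, by coassociativity,
  the emission of two outputs in a row.
\<close>

lemma cop_on_strand:
  assumes "strand s w f cs" "x \<in> outs_of w f" "net I J (post @ Dc x p q # cs @ pre)"
  shows "\<exists>w' f' ds. strand s w' f' ds \<and> wins w' = wins w \<and>
    cong R I J (post @ Dc x p q # cs @ pre) (post @ ds @ pre)"
proof (cases "x = f")
  case True
  then have "strand s (w @ [Out q]) p (Dc x p q # cs)" using assms(1) by (auto simp: strand_snoc)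
  then show ?thesis using cong_refl[OF assms(3)]
    by (intro exI[of _ "w @ [Out q]"] exI[of _ p] exI[of _ "Dc x p q # cs"]) simp
next
  case False
  then obtain P Q where w: "w = P @ Out x # Q" using assms(2) wouts_split by blast
  obtain e e' cP cQ where cs: "cs = cQ @ Dc e e' x # cP" "strand s P e cP" "strand e' Q f cQ"
    using strand_split_out[OF assms(1)[unfolded w]] .
  note n = assms(3)[unfolded cs(1), simplified]
  have "x \<notin> set (outl cQ)" using netD(4)[OF n] by auto
  then have c1: "cong R I J (post @ [Dc x p q] @ cQ @ Dc e e' x # cP @ pre)
    (post @ cQ @ [Dc x p q] @ Dc e e' x # cP @ pre)"
    by (intro cong_swap_blocks) (use n in auto)
  have c2: "cong R I J ((post @ cQ) @ Dc x p q # Dc e e' x # cP @ pre) ((post @ cQ) @ Dc x e' p # Dc e x q # cP @ pre)"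
    by (rule cong_coassoc[OF R]) (use cong_net(2)[OF c1] in simp)
  have "strand s (P @ Out q # Out p # Q) f (cQ @ Dc x e' p # Dc e x q # cP)"
    unfolding strand_append
    by (rule exI[of _ e], rule exI[of _ cP], rule exI[of _ "cQ @ [Dc x e' p, Dc e x q]"]) (use cs in auto)
  moreover have "cong R I J (post @ Dc x p q # cs @ pre) (post @ (cQ @ Dc x e' p # Dc e x q # cP) @ pre)"
    using cong_trans[OF c1, of "(post @ cQ) @ Dc x e' p # Dc e x q # cP @ pre"] c2 cs(1) by simp
  ultimately show ?thesis
    by (intro exI[of _ "P @ Out q # Out p # Q"] exI[of _ f] exI[of _ "cQ @ Dc x e' p # Dc e x q # cP"])
      (simp add: w)
qed

text \<open>
  The cases are which of the two outputs comes first on the strand and whether the other one is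
  its end. When \<open>y\<close> comes first and both are emitted, the Frobenius relation
  replaces the factor \<open>x\<close> by the edge of the strand just before its emission, which
  is the end of a shorter strand.
\<close>

lemma mul_same_strand_vanishes:
  assumes "strand s w f cs" "x \<in> outs_of w f" "y \<in> outs_of w f" "s \<in> set I" "set (wins w) \<subseteq> set I"
    "net I J (post @ Mc x y z # cs @ pre)"
  shows "vanishes R I J (post @ Mc x y z # cs @ pre)"
proof -
  have xy: "x \<noteq> y" using netD(3)[OF assms(6)] by auto
  have emission: ?thesis if w: "w = P @ Out x # Q" and y: "y \<in> outs_of Q f" for P Q
  proof -
    obtain e e' cP cQ where cs: "cs = cQ @ Dc e e' x # cP" "strand s P e cP" "strand e' Q f cQ"
      using strand_split_out[OF assms(1)[unfolded w]] .
    have wQ: "set (wins Q) \<subseteq> set I" using assms(5) w by auto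
    show ?thesis
    proof (cases "y = f")
      case True
      then show ?thesis
        using mul_earlier_later_vanishes[OF R cs(3) _ wQ, of "[]" y J post x z e "cP @ pre"] assms(6) cs(1) by simp
    next
      case False
      then obtain Q1 T where Q: "Q = Q1 @ Out y # T" using y wouts_split by blast
      obtain h h' c1 cT where cQ: "cQ = cT @ Dc h h' y # c1" "strand e' Q1 h c1" "strand h' T f cT"
        using strand_split_out[OF cs(3)[unfolded Q]] .
      note n = assms(6)[unfolded cs(1) cQ(1), simplified]
      have "x \<notin> set (outl cT)" "y \<notin> set (outl cT)" using netD(4)[OF n] by auto
      then have c: "cong R I J (post @ [Mc x y z] @ cT @ Dc h h' y # c1 @ Dc e e' x # cP @ pre)
        (post @ cT @ [Mc x y z] @ Dc h h' y # c1 @ Dc e e' x # cP @ pre)"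
        by (intro cong_swap_blocks) (use n in auto)
      have wQ1: "set (wins Q1) \<subseteq> set I" using wQ Q by auto
      have "vanishes R I J ((post @ cT) @ Mc x y z # [Dc h h' y] @ c1 @ Dc e e' x # cP @ pre)"
        by (rule mul_earlier_later_vanishes[OF R cQ(2) _ wQ1]) (use cong_net(2)[OF c] in auto)
      then show ?thesis using vanishes_cong[OF c] cs(1) cQ(1) by simp
    qed
  qed
  show ?thesis
  proof (cases "y = f")
    case True
    then obtain P Q where "w = P @ Out x # Q" using assms(2) xy wouts_split by blast
    then show ?thesis using emission True by blast
  next
    case False
    then obtain P Q where w: "w = P @ Out y # Q" using assms(3) wouts_split by blast
    obtain e e' cP cQ where cs: "cs = cQ @ Dc e e' y # cP" "strand s P e cP" "strand e' Q f cQ"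
      using strand_split_out[OF assms(1)[unfolded w]] .
    have wPQ: "set (wins Q) \<subseteq> set I" "set (wins P) \<subseteq> set I" using assms(5) w by auto
    consider "x = f" | "x \<noteq> f" "x \<in> set (wouts Q)" | "x \<noteq> f" "x \<in> set (wouts P)"
      using assms(2) w xy by auto
    then show ?thesis
    proof cases
      case 1
      then show ?thesis
        using mul_final_vanishes[OF R cs(2) _ wPQ assms(4), of e' x cQ J post y z pre] cs assms(6) by simp
    next
      case 2
      obtain Q1 T where Q: "Q = Q1 @ Out x # T" using 2(2) wouts_split by blast
      obtain h h' c1 cT where cQ: "cQ = cT @ Dc h h' x # c1" "strand e' Q1 h c1" "strand h' T f cT"
        using strand_split_out[OF cs(3)[unfolded Q]] .
      note n = assms(6)[unfolded cs(1) cQ(1), simplified]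
      have "x \<notin> set (outl cT)" "y \<notin> set (outl cT)" using netD(4)[OF n] by auto
      then have c: "cong R I J (post @ [Mc x y z] @ cT @ Dc h h' x # c1 @ Dc e e' y # cP @ pre)
        (post @ cT @ [Mc x y z] @ Dc h h' x # c1 @ Dc e e' y # cP @ pre)"
        by (intro cong_swap_blocks) (use n in auto)
      have "y \<noteq> h'" using netD(4)[OF n] by auto
      then have c2: "cong R I J ((post @ cT) @ Mc x y z # Dc h h' x # c1 @ Dc e e' y # cP @ pre)
        ((post @ cT) @ Dc x h' z # Mc h y x # c1 @ Dc e e' y # cP @ pre)"
        by (intro cong_frob_left[OF R]) (use cong_net(2)[OF c] in simp_all)
      have wQ1: "set (wins Q1) \<subseteq> set I" using wPQ Q by auto
      have "vanishes R I J ((post @ cT @ [Dc x h' z]) @ Mc h y x # c1 @ Dc e e' y # cP @ pre)"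
        by (rule mul_final_vanishes[OF R cs(2) cQ(2) wQ1 wPQ(2) assms(4)]) (use cong_net(2)[OF c2] in simp)
      then show ?thesis using vanishes_cong[OF c] vanishes_cong[OF c2] cs(1) cQ(1) by simp
    next
      case 3
      then obtain P1 Q1 where "P = P1 @ Out x # Q1" using wouts_split by blast
      then show ?thesis using emission[of P1 "Q1 @ Out y # Q"] w by simp
    qed
  qed
qed

text \<open>
  A product with an output \<open>x\<close> of a strand is moved onto the strand itself by the
  Frobenius relation: the strand absorbs \<open>y\<close> at the place where it emitted
  \<open>x\<close>, and emits the result.
\<close>

lemma mul_attach:
  assumes "strand s w f cs" "x \<in> outs_of w f" "y \<noteq> x" "y \<notin> set (outl cs)"
    "net I J (post @ Mc x y z # cs @ pre)"
  shows "\<exists>P e cP t T f' cT. strand s P e cP \<and> strand t T f' cT \<and> wins P @ wins T = wins w \<and>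
    cong R I J (post @ Mc x y z # cs @ pre) (post @ cT @ Mc e y t # cP @ pre)"
proof (cases "x = f")
  case True
  then show ?thesis using assms(1) cong_refl[OF assms(5)]
    by (intro exI[of _ w] exI[of _ x] exI[of _ cs] exI[of _ z] exI[of _ "[]"]) simp
next
  case False
  then obtain P Q where w: "w = P @ Out x # Q" using assms(2) wouts_split by blast
  obtain e e' cP cQ where cs: "cs = cQ @ Dc e e' x # cP" "strand s P e cP" "strand e' Q f cQ"
    using strand_split_out[OF assms(1)[unfolded w]] .
  note n = assms(5)[unfolded cs(1), simplified]
  have "x \<notin> set (outl cQ)" using netD(4)[OF n] by auto
  then have c1: "cong R I J (post @ [Mc x y z] @ cQ @ Dc e e' x # cP @ pre)
    (post @ cQ @ [Mc x y z] @ Dc e e' x # cP @ pre)"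
    by (intro cong_swap_blocks) (use n assms(4) cs(1) in auto)
  have "y \<noteq> e'" using assms(4) cs(1) by auto
  then have c2: "cong R I J ((post @ cQ) @ Mc x y z # Dc e e' x # cP @ pre)
    ((post @ cQ) @ Dc x e' z # Mc e y x # cP @ pre)"
    by (intro cong_frob_left[OF R]) (use cong_net(2)[OF c1] in simp_all)
  have "strand x (Out z # Q) f (cQ @ [Dc x e' z])" using cs(3) by auto
  moreover have "cong R I J (post @ Mc x y z # cs @ pre) (post @ (cQ @ [Dc x e' z]) @ Mc e y x # cP @ pre)"
    using cong_trans[OF c1, of "(post @ cQ) @ Dc x e' z # Mc e y x # cP @ pre"] c2 cs(1) by simp
  ultimately show ?thesis using cs(2) w
    by (intro exI[of _ P] exI[of _ e] exI[of _ cP] exI[of _ x] exI[of _ "Out z # Q"] exI[of _ f]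
        exI[of _ "cQ @ [Dc x e' z]"]) simp
qed

text \<open>
  After moving the product onto the first strand, this strand absorbs an output of the second
  one. If that output is the end, the second strand is inserted as it stands. Otherwise a
  balance move opens the second strand at the place of the emission, and its parts are inserted
  in cyclic order, starting from that place.
\<close>

lemma merge_strands:
  assumes "strand s1 w1 f1 c1" "strand s2 w2 f2 c2" "x \<in> outs_of w1 f1" "y \<in> outs_of w2 f2"
    and I: "s1 \<in> set I" "s2 \<in> set I" "set (wins w1) \<subseteq> set I" "set (wins w2) \<subseteq> set I"
    and n0: "net I J (post @ Mc x y z # c1 @ c2 @ pre)"
  shows "\<exists>w f ds. strand s1 w f ds \<and> mset (wins w) = mset (s2 # wins w1 @ wins w2) \<and>
    cong R I J (post @ Mc x y z # c1 @ c2 @ pre) (post @ ds @ pre)"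
proof -
  have y2: "y \<in> {s2} \<union> set (outl c2)" using assms(4) strand_names(2,3)[OF assms(2)] by auto
  have yn: "y \<notin> set (outl c1)" using y2 I(2) netD(4,5)[OF n0] by auto
  have xy: "y \<noteq> x" using netD(3)[OF n0] by auto
  obtain P e cP t T f cT where a: "strand s1 P e cP" "strand t T f cT" "wins P @ wins T = wins w1"
    and c1: "cong R I J (post @ Mc x y z # c1 @ c2 @ pre) (post @ cT @ Mc e y t # cP @ c2 @ pre)"
    using mul_attach[OF assms(1,3) xy yn, of I J post z "c2 @ pre"] n0 by auto
  note n1 = cong_net(2)[OF c1]
  have wPT: "set (wins P) \<subseteq> set I" "set (wins T) \<subseteq> set I" using a(3) I(3) by (metis Un_subset_iff set_append)+
  have "set (inl cP) \<subseteq> set I \<union> set (outl cP)" using strand_names(1)[OF a(1)] wPT(1) I(1) by auto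
  moreover have "(set I \<union> set (outl cP)) \<inter> set (outl c2) = {}" using netD(4,5)[OF n1] by auto
  ultimately have c2: "cong R I J ((post @ cT @ [Mc e y t]) @ cP @ c2 @ pre) ((post @ cT @ [Mc e y t]) @ c2 @ cP @ pre)"
    by (intro cong_swap_blocks) (use n1 in auto)
  note n2 = cong_net(2)[OF c2]
  have eo: "e \<in> set I \<union> set (outl cP)" using strand_names(2)[OF a(1)] I(1) by auto
  then have en: "e \<notin> set (outl c2)" using netD(4,5)[OF n2] by auto
  show ?thesis
  proof (cases "y = f2")
    case True
    obtain ds where ds: "strand e (In s2 # w2) t ds"
      and c3: "cong R I J ((post @ cT) @ Mc e y t # c2 @ cP @ pre) ((post @ cT) @ ds @ cP @ pre)"
      using mult_strand[OF R assms(2)[folded True], of I J "post @ cT" e t "cP @ pre"] n2 en by auto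
    have "strand s1 (P @ (In s2 # w2) @ T) f ((cT @ ds) @ cP)"
      by (rule strandI[OF a(1) strandI[OF ds a(2)]])
    moreover have "mset (wins (P @ (In s2 # w2) @ T)) = mset (s2 # wins w1 @ wins w2)"
      using a(3)[symmetric] by simp
    moreover have "cong R I J (post @ Mc x y z # c1 @ c2 @ pre) (post @ ((cT @ ds) @ cP) @ pre)"
      using cong_trans[OF c1, of "post @ cT @ ds @ cP @ pre"] cong_trans[OF c2, of "post @ cT @ ds @ cP @ pre"] c3
      by simp
    ultimately show ?thesis by blast
  next
    case False
    then obtain Q S where w: "w2 = Q @ Out y # S" using assms(4) wouts_split by blast
    obtain h h' cQ cS where cs: "c2 = cS @ Dc h h' y # cQ" "strand s2 Q h cQ" "strand h' S f2 cS"
      using strand_split_out[OF assms(2)[unfolded w]] .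
    have wQS: "set (wins Q) \<subseteq> set I" "set (wins S) \<subseteq> set I" using I(4) w by auto
    note n2' = n2[unfolded cs(1), simplified]
    have "y \<notin> set (outl cS)" "e \<notin> set (outl cS)" using netD(4)[OF n2'] en cs(1) by auto
    then have c3: "cong R I J ((post @ cT) @ [Mc e y t] @ cS @ Dc h h' y # cQ @ cP @ pre)
      ((post @ cT) @ cS @ [Mc e y t] @ Dc h h' y # cQ @ cP @ pre)"
      by (intro cong_swap_blocks) (use n2' in auto)
    have "e \<noteq> h'" using en cs(1) by auto
    then have c4: "cong R I J ((post @ cT @ cS) @ Mc e y t # Dc h h' y # cQ @ cP @ pre)
      ((post @ cT @ cS) @ Mc y h t # Dc e y h' # cQ @ cP @ pre)"
      by (intro cong_balance_turn[OF R]) (use cong_net(2)[OF c3] in simp_all)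
    have "e \<notin> set (outl cQ)" using en cs(1) by auto
    then have c5: "cong R I J ((post @ cT @ cS @ [Mc y h t]) @ [Dc e y h'] @ cQ @ cP @ pre)
      ((post @ cT @ cS @ [Mc y h t]) @ cQ @ [Dc e y h'] @ cP @ pre)"
      by (intro cong_swap_blocks) (use cong_net(2)[OF c4] in auto)
    note n5 = cong_net(2)[OF c5]
    have "y \<notin> set (outl cQ)" using netD(4)[OF n5] by auto
    then obtain cL where L: "strand y (In s2 # Q) t cL"
      and c6: "cong R I J ((post @ cT @ cS) @ Mc y h t # cQ @ Dc e y h' # cP @ pre)
        ((post @ cT @ cS) @ cL @ Dc e y h' # cP @ pre)"
      using mult_strand[OF R cs(2), of I J "post @ cT @ cS" y t "Dc e y h' # cP @ pre"] n5 by auto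
    note n6 = cong_net(2)[OF c6]
    have "set (inl cS) \<subseteq> {h'} \<union> set I \<union> set (outl cS)" using strand_names(1)[OF cs(3)] wQS(2) by auto
    moreover have "({h'} \<union> set I \<union> set (outl cS)) \<inter> set (outl cL) = {}" using netD(4,5)[OF n6] by auto
    ultimately have c7: "cong R I J ((post @ cT) @ cS @ cL @ Dc e y h' # cP @ pre) ((post @ cT) @ cL @ cS @ Dc e y h' # cP @ pre)"
      by (intro cong_swap_blocks) (use n6 in auto)
    note n7 = cong_net(2)[OF c7]
    have "y \<notin> set (wins S)" using wQS(2) netD(5)[OF n7] by auto
    then obtain g ds where g: "strand e S g ds"
      and c8: "cong R I J ((post @ cT @ cL) @ cS @ Dc e y h' # cP @ pre) ((post @ cT @ cL) @ Dc g y f2 # ds @ cP @ pre)"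
      using strand_cop[OF R cs(3), of I J "post @ cT @ cL" e y "cP @ pre"] n7 by auto
    have "strand g [Out f2] y [Dc g y f2]" by simp
    from strandI[OF a(1) strandI[OF g strandI[OF this strandI[OF L a(2)]]]]
    have "strand s1 (P @ S @ [Out f2] @ (In s2 # Q) @ T) f ((((cT @ cL) @ [Dc g y f2]) @ ds) @ cP)" .
    moreover have "mset (wins (P @ S @ [Out f2] @ (In s2 # Q) @ T)) = mset (s2 # wins w1 @ wins w2)"
      using a(3)[symmetric] by (simp add: w)
    moreover have "cong R I J (post @ Mc x y z # c1 @ c2 @ pre) (post @ ((((cT @ cL) @ [Dc g y f2]) @ ds) @ cP) @ pre)"
    proof -
      let ?z = "post @ cT @ cL @ Dc g y f2 # ds @ cP @ pre"
      have "cong R I J (post @ Mc x y z # c1 @ c2 @ pre) ?z"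
        using cong_trans[OF c1, of ?z] cong_trans[OF c2, of ?z] cong_trans[OF c3, of ?z] cong_trans[OF c4, of ?z]
          cong_trans[OF c5, of ?z] cong_trans[OF c6, of ?z] cong_trans[OF c7, of ?z] c8 by (simp add: cs(1))
      then show ?thesis by simp
    qed
    ultimately show ?thesis by blast
  qed
qed

end

type_synonym comb = "nat \<times> letter list \<times> nat"

fun comb_ins :: "comb \<Rightarrow> nat list" where "comb_ins (s, w, f) = s # wins w"
fun comb_outs :: "comb \<Rightarrow> nat set" where "comb_outs (s, w, f) = outs_of w f"

text \<open>
  A list of disjoint strands, the inputs of which are among the global inputs \<open>A\<close>.
\<close>

fun forest :: "nat set \<Rightarrow> comb list \<Rightarrow> cell list \<Rightarrow> bool" where
  "forest A [] ds \<longleftrightarrow> ds = []"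
| "forest A ((s, w, f) # Ws) ds \<longleftrightarrow>
     (\<exists>cs ds'. ds = cs @ ds' \<and> strand s w f cs \<and> set (s # wins w) \<subseteq> A \<and> forest A Ws ds')"

lemma forest_append:
  "forest A (U @ V) ds \<longleftrightarrow> (\<exists>du dv. ds = du @ dv \<and> forest A U du \<and> forest A V dv)"
proof (induction U arbitrary: ds)
  case (Cons C U)
  obtain s w f where C: "C = (s, w, f)" by (cases C)
  show ?case unfolding C append_Cons forest.simps(2) Cons.IH
    by (metis append.assoc)
qed simp

lemma forest_inl: "forest A Ws ds \<Longrightarrow> set (inl ds) \<subseteq> A \<union> set (outl ds)"
proof (induction A Ws ds rule: forest.induct)
  case (2 A s w f Ws ds)
  then obtain cs ds' where "ds = cs @ ds'" "strand s w f cs" "set (s # wins w) \<subseteq> A" "forest A Ws ds'" by auto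
  then show ?case using 2(1) strand_names(1)[of s w f cs] by fastforce
qed simp

lemma forest_front:
  assumes "forest (set I) (U @ C # V) ds" "net I J (post @ ds)"
  shows "\<exists>ds'. forest (set I) (C # U @ V) ds' \<and> cong R I J (post @ ds) (post @ ds')"
proof -
  from assms(1) obtain du dc dv where d: "ds = du @ dc @ dv" "forest (set I) U du" "forest (set I) [C] dc" "forest (set I) V dv"
    unfolding forest_append[of _ U] using forest_append[of _ "[C]" V] by (metis append_Cons append_Nil)
  have "forest (set I) ([C] @ U @ V) (dc @ du @ dv)" unfolding forest_append using d by blast
  moreover have "(set I \<union> set (outl du)) \<inter> set (outl dc) = {}"
    using netD(4,5)[OF assms(2)] d(1) by auto
  then have "cong R I J (post @ du @ dc @ dv) (post @ dc @ du @ dv)"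
    by (intro cong_swap_blocks) (use assms(2) d(1) forest_inl[OF d(2)] in auto)
  ultimately show ?thesis using d(1) by auto
qed

text \<open>
  An edge that is not consumed is the end of a strand or has been emitted by one; the set
  \<open>B\<close> of inputs without strand serves the induction.
\<close>

lemma forest_output:
  assumes "forest (set I) Ws ds" "x \<in> set I \<union> set (outl ds)" "x \<notin> set (inl ds)"
    "set I \<subseteq> set (concat (map comb_ins Ws)) \<union> B" "x \<notin> B"
  shows "\<exists>C\<in>set Ws. x \<in> comb_outs C"
  using assms
proof (induction "set I" Ws ds arbitrary: B rule: forest.induct)
  case (2 s w f Ws ds)
  then obtain cs ds' where d: "ds = cs @ ds'" "strand s w f cs" "set (s # wins w) \<subseteq> set I" "forest (set I) Ws ds'" by auto
  note sn = strand_names[OF d(2)]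
  show ?case
  proof (cases "x \<in> outs_of w f")
    case True
    then show ?thesis by auto
  next
    case False
    have "x \<noteq> s" using sn(6) False 2(4) d(1) by auto
    moreover have "x \<notin> set (wins w)" using sn(4) 2(4) d(1) by auto
    moreover have "x \<notin> set (outl cs)" using sn(5) False 2(4) d(1) by auto
    ultimately have "\<exists>C\<in>set Ws. x \<in> comb_outs C"
      by (intro 2(1)[OF d(4), of "B \<union> set (s # wins w)"]) (use 2(3-6) d(1) in auto)
    then show ?thesis by auto
  qed
qed auto

section \<open>Every connected net vanishes or is a strand\<close>

context
  fixes R :: "'k::field_char_0 lin set"
  assumes R: "R = bib_rels"
begin

lemma forest_apply_cop:
  assumes "forest (set I) Ws ds" "mset (concat (map comb_ins Ws)) = mset I" "net I J (post @ Dc x p q # ds)"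
  shows "\<exists>Vs es. forest (set I) Vs es \<and> mset (concat (map comb_ins Vs)) = mset I \<and>
    cong R I J (post @ Dc x p q # ds) (post @ es)"
proof -
  have "x \<in> set I \<union> set (outl ds)" using netD(8)[OF assms(3)] by (simp add: ordered_append)
  moreover have "x \<notin> set (inl ds)" using netD(3)[OF assms(3)] by simp
  moreover have "set I \<subseteq> set (concat (map comb_ins Ws)) \<union> {}" using assms(2) by (metis Un_empty_right order_refl set_mset_mset)
  ultimately obtain C where C: "C \<in> set Ws" "x \<in> comb_outs C" using forest_output[OF assms(1)] by blast
  obtain s w f where Cf: "C = (s, w, f)" by (cases C)
  obtain U V where W: "Ws = U @ C # V" using split_list[OF C(1)] by blast
  obtain ds' where f: "forest (set I) (C # U @ V) ds'"
    and c1: "cong R I J ((post @ [Dc x p q]) @ ds) ((post @ [Dc x p q]) @ ds')"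
    using forest_front[of I U C V ds J "post @ [Dc x p q]"] assms(1,3) W by auto
  obtain cs es where d: "ds' = cs @ es" "strand s w f cs" "set (s # wins w) \<subseteq> set I" "forest (set I) (U @ V) es"
    using f unfolding Cf by auto
  obtain w' f' cs' where s: "strand s w' f' cs'" "wins w' = wins w"
    and c2: "cong R I J (post @ Dc x p q # cs @ es) (post @ cs' @ es)"
    using cop_on_strand[OF R d(2), of x I J post p q es] C(2) Cf cong_net(2)[OF c1] d(1) by auto
  have "forest (set I) ((s, w', f') # U @ V) (cs' @ es)" using s d by auto
  moreover have "mset (concat (map comb_ins ((s, w', f') # U @ V))) = mset I"
    using assms(2) by (simp add: W Cf s(2) ac_simps)
  moreover have "cong R I J (post @ Dc x p q # ds) (post @ cs' @ es)"
    using cong_trans[OF c1] c2 d(1) by simp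
  ultimately show ?thesis by blast
qed

lemma forest_apply_mul:
  assumes "forest (set I) Ws ds" "mset (concat (map comb_ins Ws)) = mset I" "net I J (post @ Mc x y z # ds)"
  shows "vanishes R I J (post @ Mc x y z # ds) \<or>
    (\<exists>Vs es. forest (set I) Vs es \<and> mset (concat (map comb_ins Vs)) = mset I \<and>
      cong R I J (post @ Mc x y z # ds) (post @ es))"
proof -
  have xy: "x \<in> set I \<union> set (outl ds)" "y \<in> set I \<union> set (outl ds)"
    using netD(8)[OF assms(3)] by (simp_all add: ordered_append)
  have nxy: "x \<notin> set (inl ds)" "y \<notin> set (inl ds)" using netD(3)[OF assms(3)] by simp_all
  have W: "set I \<subseteq> set (concat (map comb_ins Ws)) \<union> {}" using assms(2) by (metis Un_empty_right order_refl set_mset_mset)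
  obtain C where C: "C \<in> set Ws" "x \<in> comb_outs C" using forest_output[OF assms(1) xy(1) nxy(1) W] by blast
  obtain s w f where Cf: "C = (s, w, f)" by (cases C)
  obtain U V where UV: "Ws = U @ C # V" using split_list[OF C(1)] by blast
  obtain ds' where f: "forest (set I) (C # U @ V) ds'"
    and c1: "cong R I J ((post @ [Mc x y z]) @ ds) ((post @ [Mc x y z]) @ ds')"
    using forest_front[of I U C V ds J "post @ [Mc x y z]"] assms(1,3) UV by auto
  obtain cs es where d: "ds' = cs @ es" "strand s w f cs" "set (s # wins w) \<subseteq> set I" "forest (set I) (U @ V) es"
    using f unfolding Cf by auto
  note n1 = cong_net(2)[OF c1, unfolded d(1), simplified]
  show ?thesis
  proof (cases "y \<in> outs_of w f")
    case True
    then have "vanishes R I J (post @ Mc x y z # cs @ es)"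
      using mul_same_strand_vanishes[OF R d(2), of x y I J post z es] C(2) Cf d(3) n1 by auto
    then show ?thesis using vanishes_cong[OF c1] d(1) by simp
  next
    case False
    have "y \<in> set I \<union> (set (outl cs) \<union> set (outl es))" "y \<notin> set (inl cs)" "y \<notin> set (inl es)"
      using netD(3,8)[OF n1] by (auto simp: ordered_append)
    moreover have "y \<notin> set (outl cs)" using strand_names(5)[OF d(2)] calculation(2) False by auto
    moreover have "y \<notin> set (s # wins w)" using strand_names(4,6)[OF d(2)] calculation(2) False by auto
    moreover have "set I \<subseteq> set (concat (map comb_ins (U @ V))) \<union> set (s # wins w)" using W UV Cf by auto
    ultimately obtain C' where C': "C' \<in> set (U @ V)" "y \<in> comb_outs C'"
      using forest_output[OF d(4), of y "set (s # wins w)"] by auto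
    obtain s2 w2 f2 where Cf': "C' = (s2, w2, f2)" by (cases C')
    obtain U' V' where UV': "U @ V = U' @ C' # V'" using split_list[OF C'(1)] by blast
    obtain es' where f': "forest (set I) (C' # U' @ V') es'"
      and c2: "cong R I J ((post @ Mc x y z # cs) @ es) ((post @ Mc x y z # cs) @ es')"
      using forest_front[of I U' C' V' es J "post @ Mc x y z # cs"] d(4) n1 UV' by auto
    obtain cs2 fs where d': "es' = cs2 @ fs" "strand s2 w2 f2 cs2" "set (s2 # wins w2) \<subseteq> set I" "forest (set I) (U' @ V') fs"
      using f' unfolding Cf' by auto
    note n2 = cong_net(2)[OF c2, unfolded d'(1), simplified]
    obtain w' f' gs where m: "strand s w' f' gs" "mset (wins w') = mset (s2 # wins w @ wins w2)"
      and c3: "cong R I J (post @ Mc x y z # cs @ cs2 @ fs) (post @ gs @ fs)"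
      using merge_strands[OF R d(2) d'(2), of x y I J post z fs] C(2) Cf C'(2) Cf' d(3) d'(3) n2 by auto
    have "set (wins w') = set (s2 # wins w @ wins w2)" using m(2) by (metis set_mset_mset)
    then have "forest (set I) ((s, w', f') # U' @ V') (gs @ fs)" using m d d' by auto
    moreover have "mset (concat (map comb_ins ((s, w', f') # U' @ V'))) = mset I"
    proof -
      have "mset (concat (map comb_ins (U @ V))) = mset (comb_ins C') + mset (concat (map comb_ins (U' @ V')))"
        unfolding UV' by simp
      moreover have "mset I = mset (comb_ins C) + mset (concat (map comb_ins (U @ V)))"
        unfolding assms(2)[symmetric] UV by simp
      ultimately show ?thesis using m(2) by (simp add: Cf Cf')
    qed
    moreover have "cong R I J (post @ Mc x y z # ds) (post @ gs @ fs)"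
      using cong_trans[OF c1, of "post @ gs @ fs"] cong_trans[OF c2, of "post @ gs @ fs"] c3 d(1) d'(1) by simp
    ultimately show ?thesis by blast
  qed
qed

text \<open>
  Cells are absorbed one by one, beginning with the first applied one; \<open>post\<close> holds
  those that are still to come.
\<close>

lemma net_to_forest:
  assumes "net I J (post @ cs)"
  shows "vanishes R I J (post @ cs) \<or>
    (\<exists>Ws ds. forest (set I) Ws ds \<and> mset (concat (map comb_ins Ws)) = mset I \<and> cong R I J (post @ cs) (post @ ds))"
  using assms
proof (induction cs arbitrary: post)
  case Nil
  have "forest (set I) (map (\<lambda>x. (x, [], x)) K) []" if "set K \<subseteq> set I" for K
    using that by (induction K) auto
  moreover have "concat (map comb_ins (map (\<lambda>x. (x, [], x)) K)) = K" for K by (induction K) auto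
  ultimately show ?case using cong_refl[OF Nil] by (metis order_refl)
next
  case (Cons c cs)
  have IH: "vanishes R I J ((post @ [c]) @ cs) \<or>
    (\<exists>Ws ds. forest (set I) Ws ds \<and> mset (concat (map comb_ins Ws)) = mset I \<and>
      cong R I J ((post @ [c]) @ cs) ((post @ [c]) @ ds))"
    by (rule Cons.IH) (use Cons.prems in simp)
  show ?case
  proof (cases "vanishes R I J (post @ c # cs)")
    case False
    then obtain Ws ds where f: "forest (set I) Ws ds" "mset (concat (map comb_ins Ws)) = mset I"
      and c: "cong R I J (post @ c # cs) (post @ c # ds)" using IH by auto
    have n: "net I J (post @ c # ds)" using cong_net(2)[OF c] .
    have "wf_cell c" using netD(9)[OF n, of c] by simp
    then consider x y z where "c = Mc x y z" | x y z where "c = Dc x y z" by (auto simp: wf_cell_iff)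
    then show ?thesis
    proof cases
      case 1
      then consider "vanishes R I J (post @ c # ds)"
        | Vs es where "forest (set I) Vs es" "mset (concat (map comb_ins Vs)) = mset I" "cong R I J (post @ c # ds) (post @ es)"
        using forest_apply_mul[OF f] n by blast
      then show ?thesis using vanishes_cong[OF c] cong_trans[OF c] by cases blast+
    next
      case 2
      then show ?thesis using forest_apply_cop[OF f] n cong_trans[OF c] by blast
    qed
  qed simp
qed

text \<open>
  In the connected case the edges of one strand form a closed set, so there is only one strand.
\<close>

lemma net_to_comb:
  assumes "net I J cs" "net_connected I cs"
  shows "vanishes R I J cs \<or> (\<exists>s w f ds. strand s w f ds \<and> mset (s # wins w) = mset I \<and>
    set (f # wouts w) = set J \<and> distinct (f # wouts w) \<and> cong R I J cs ds)"
proof (rule disjCI)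
  assume "\<not> (\<exists>s w f ds. strand s w f ds \<and> mset (s # wins w) = mset I \<and>
    set (f # wouts w) = set J \<and> distinct (f # wouts w) \<and> cong R I J cs ds)"
  then have none: "\<not> (strand s w f ds \<and> mset (s # wins w) = mset I \<and>
    set (f # wouts w) = set J \<and> distinct (f # wouts w) \<and> cong R I J cs ds)" for s w f ds by blast
  show "vanishes R I J cs"
  proof (rule ccontr)
    assume "\<not> vanishes R I J cs"
    then obtain Ws ds where f: "forest (set I) Ws ds" "mset (concat (map comb_ins Ws)) = mset I"
      and c: "cong R I J cs ds"
      using net_to_forest[of I J "[]" cs] assms(1) by auto
    note n = cong_net(2)[OF c]
    have conn: "net_connected I ds" using c assms(2) by (simp add: cong_def)
    have "set I \<noteq> {}"
    proof
      assume e: "set I = {}"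
      then have "Ws = []" using f(2) by (cases Ws) auto
      then have "ds = []" using f(1) by simp
      then show False using conn e by (simp add: net_connected_def)
    qed
    then obtain C Vs where W: "Ws = C # Vs" using f(2) by (cases Ws) auto
    obtain s w fi where C: "C = (s, w, fi)" by (cases C)
    obtain es fs where d: "ds = es @ fs" "strand s w fi es" "set (s # wins w) \<subseteq> set I" "forest (set I) Vs fs"
      using f(1) unfolding W C by auto
    \<comment> \<open>The edges of the first strand.\<close>
    let ?A = "insert s (set (inl es) \<union> set (outl es))"
    have dI: "distinct I" using netD(1)[OF n] .
    have sI: "s \<notin> set (inl fs)"
    proof
      assume "s \<in> set (inl fs)"
      have "distinct (s # wins w @ concat (map comb_ins Vs))"
        using f(2) dI unfolding W C by (metis append_Cons comb_ins.simps concat.simps(2) list.simps(9) mset_eq_imp_distinct_iff)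
      then have "s \<notin> set (concat (map comb_ins Vs))" by simp
      moreover have "set (inl fs) \<subseteq> set (concat (map comb_ins Vs)) \<union> set (outl fs)"
        using d(4)
      proof (induction "set I" Vs fs rule: forest.induct)
        case (2 s w f Ws ds)
        then obtain cs ds' where d: "ds = cs @ ds'" "strand s w f cs" "forest (set I) Ws ds'" by auto
        then show ?case using 2(1)[OF d(3)] strand_names(1)[OF d(2)] by auto
      qed simp
      ultimately have "s \<in> set (outl fs)" using \<open>s \<in> set (inl fs)\<close> by blast
      then show False using netD(5)[OF n] d(1,3) by auto
    qed
    have nfs: "(set (cin c) \<union> set (cout c)) \<inter> ?A = {}" if "c \<in> set fs" for c
    proof -
      have i: "set (cin c) \<subseteq> set (inl fs)" "set (cout c) \<subseteq> set (outl fs)" using in_cells[OF that] by auto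
      have "set (inl fs) \<inter> set (outl es) = {}" using forest_inl[OF d(4)] netD(4,5)[OF n] d(1) by auto
      moreover have "set (inl fs) \<inter> set (inl es) = {}" "set (outl fs) \<inter> set (outl es) = {}" "set I \<inter> set (outl fs) = {}"
        using netD(3-5)[OF n] d(1) by auto
      moreover have "set (inl es) \<subseteq> set I \<union> set (outl es)" using strand_names(1)[OF d(2)] d(3) by auto
      moreover have "s \<in> set I" using d(3) by simp
      ultimately show ?thesis using i sI by blast
    qed
    have "\<forall>c\<in>set ds. set (cin c) \<union> set (cout c) \<subseteq> ?A \<or> (set (cin c) \<union> set (cout c)) \<inter> ?A = {}"
      using nfs in_cells[of _ es] d(1) by fastforce
    moreover have "s \<in> ?A \<inter> (set I \<union> set (outl ds))" using d(3) by simp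
    then have "?A \<inter> (set I \<union> set (outl ds)) \<noteq> {}" by blast
    ultimately have sub: "set I \<union> set (outl ds) \<subseteq> ?A"
      using conn[unfolded net_connected_def, THEN conjunct2, THEN spec[of _ ?A]] by blast
    have "fs = []"
    proof (cases fs)
      case (Cons c gs)
      then have c: "c \<in> set fs" by simp
      then have "wf_cell c" using netD(9)[OF n, of c] d(1) by simp
      then have "set (cout c) \<noteq> {}" by (auto simp: wf_cell_iff)
      then obtain x where "x \<in> set (cout c)" by (metis ex_in_conv)
      then have "x \<in> ?A" using in_cells[OF c] sub d(1) by auto
      then show ?thesis using nfs[OF c] \<open>x \<in> set (cout c)\<close> by blast
    qed
    moreover have "Vs = []"
    proof (cases Vs)
      case (Cons D Us)
      obtain s2 w2 f2 where D: "D = (s2, w2, f2)" by (cases D)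
      have st: "strand s2 w2 f2 []" using d(4) \<open>fs = []\<close> Cons D by auto
      then have w2: "w2 = []" by (cases w2) auto
      have "distinct (concat (map comb_ins Ws))" using f(2) dI mset_eq_imp_distinct_iff by blast
      then have "s2 \<notin> set (s # wins w)" by (auto simp: W C Cons D w2)
      moreover have "s2 \<in> set I" using d(4) Cons D by auto
      ultimately have "s2 \<in> set (inl es) \<union> set (outl es)" "s2 \<notin> set (outl es)" using sub netD(5)[OF n] d(1) by auto
      then show ?thesis using strand_names(1)[OF d(2)] \<open>s2 \<notin> set (s # wins w)\<close> by auto
    qed
    ultimately have e: "ds = es" "mset (s # wins w) = mset I" using d(1) f(2) by (simp_all add: W C)
    have so: "s \<notin> set (outl es)" "distinct (outl es)" "set (wins w) \<inter> set (outl es) = {}"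
      using netD(4,5)[OF n] d(3) e(1) by auto
    note o = strand_outs[OF d(2) so(2,1)] and sn = strand_names[OF d(2)]
    have setI: "set I = set (s # wins w)" using e(2) by (metis set_mset_mset)
    have "set (fi # wouts w) = set J"
    proof -
      have J: "set J = (set I \<union> set (outl es)) - set (inl es)" using netD(6,7)[OF n] e(1) by auto
      have "outs_of w fi \<inter> set (inl es) = {}"
      proof -
        have "set (wins w) \<inter> set (wouts w) = {}" using sn(3) so(3) by auto
        moreover have "fi \<in> set (inl es) \<Longrightarrow> fi \<notin> set (wins w)"
        proof -
          assume "fi \<in> set (inl es)"
          show "fi \<notin> set (wins w)"
          proof
            assume fw: "fi \<in> set (wins w)"
            then have "fi = s" using sn(2) so(3) by auto
            moreover have "distinct (s # wins w)" using e(2) dI mset_eq_imp_distinct_iff by blast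
            ultimately show False using fw by simp
          qed
        qed
        ultimately show ?thesis using o(2) by blast
      qed
      moreover have "outs_of w fi \<subseteq> set I \<union> set (outl es)" using sn(2,3) d(3) by auto
      moreover have "set I \<union> set (outl es) \<subseteq> set (inl es) \<union> outs_of w fi" using sn(4-6) setI by auto
      ultimately show ?thesis unfolding J by auto
    qed
    then show False using none[of s w fi es] d(2) e o(1) c by blast
  qed
qed

end

section \<open>The state sum\<close>

instance port :: countable by countable_datatype

text \<open>
  The encoding into natural numbers only serves to list every unordered pair once; all functions
  used here are symmetric on the sets in question.
\<close>

definition upairs :: "('a::countable \<Rightarrow> 'a \<Rightarrow> int) \<Rightarrow> 'a set \<Rightarrow> int" where
  "upairs f S = (\<Prod>(s, t)\<in>{(s, t). s \<in> S \<and> t \<in> S \<and> to_nat s < to_nat t}. f s t)"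

lemma upairs_empty [simp]: "upairs f {} = 1"
  by (simp add: upairs_def)

lemma upairs_cong:
  assumes "\<And>s t. s \<in> S \<Longrightarrow> t \<in> S \<Longrightarrow> s \<noteq> t \<Longrightarrow> f s t = g s t"
  shows "upairs f S = upairs g S"
  unfolding upairs_def using assms by (intro prod.cong) auto

lemma upairs_insert:
  assumes "finite S" "a \<notin> S" "\<And>s. s \<in> S \<Longrightarrow> f s a = f a s"
  shows "upairs f (insert a S) = upairs f S * (\<Prod>s\<in>S. f a s)"
proof -
  let ?P = "{(s, t). s \<in> S \<and> t \<in> S \<and> to_nat s < to_nat t}"
  let ?L = "{s \<in> S. to_nat s < to_nat a}" and ?U = "{s \<in> S. to_nat a < to_nat s}"
  have inj: "to_nat s = to_nat a \<longleftrightarrow> s = a" for s by simp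
  have eq: "{(s, t). s \<in> insert a S \<and> t \<in> insert a S \<and> to_nat s < to_nat t} =
    ?P \<union> ((\<lambda>s. (s, a)) ` ?L \<union> (\<lambda>s. (a, s)) ` ?U)" by auto
  have fin: "finite ?P" by (rule finite_subset[of _ "S \<times> S"]) (use assms(1) in auto)
  have "upairs f (insert a S) = upairs f S * ((\<Prod>s\<in>?L. f s a) * (\<Prod>s\<in>?U. f a s))"
    unfolding upairs_def eq using assms(1,2) fin
    by (subst prod.union_disjoint, simp, simp, force)
      (subst prod.union_disjoint, simp, simp, force, simp add: prod.reindex inj_on_def)
  also have "(\<Prod>s\<in>?L. f s a) = (\<Prod>s\<in>?L. f a s)" using assms(3) by (intro prod.cong) auto
  also have "(\<Prod>s\<in>?L. f a s) * (\<Prod>s\<in>?U. f a s) = (\<Prod>s\<in>?L \<union> ?U. f a s)"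
    using assms(1) by (subst prod.union_disjoint) auto
  also have "?L \<union> ?U = S" using assms(2) inj by (auto, metis linorder_neqE_nat)
  finally show ?thesis .
qed

lemma upairs_union:
  assumes "finite S" "finite T" "S \<inter> T = {}"
    "\<And>s t. s \<in> S \<union> T \<Longrightarrow> t \<in> S \<union> T \<Longrightarrow> f s t = f t s"
  shows "upairs f (S \<union> T) = upairs f S * upairs f T * (\<Prod>s\<in>S. \<Prod>t\<in>T. f s t)"
  using assms(1,3,4)
proof (induction S rule: finite_induct)
  case (insert a S)
  have "upairs f (insert a (S \<union> T)) = upairs f (S \<union> T) * (\<Prod>s\<in>S \<union> T. f a s)"
    using insert assms(2) by (intro upairs_insert) auto
  also have "(\<Prod>s\<in>S \<union> T. f a s) = (\<Prod>s\<in>S. f a s) * (\<Prod>s\<in>T. f a s)"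
    using insert assms(2) by (intro prod.union_disjoint) auto
  also have "upairs f (S \<union> T) = upairs f S * upairs f T * (\<Prod>s\<in>S. \<Prod>t\<in>T. f s t)"
    using insert by auto
  moreover have "upairs f (insert a S) = upairs f S * (\<Prod>s\<in>S. f a s)"
    using insert by (intro upairs_insert) auto
  ultimately show ?case using insert by simp
qed simp

lemma upairs_image:
  assumes "finite S" "inj_on h S" "\<And>s t. s \<in> S \<Longrightarrow> t \<in> S \<Longrightarrow> f (h s) (h t) = f (h t) (h s)"
  shows "upairs f (h ` S) = upairs (\<lambda>s t. f (h s) (h t)) S"
  using assms
proof (induction S rule: finite_induct)
  case (insert a S)
  have "upairs f (insert (h a) (h ` S)) = upairs f (h ` S) * (\<Prod>s\<in>h ` S. f (h a) s)"
    using insert by (intro upairs_insert) auto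
  moreover have "(\<Prod>s\<in>h ` S. f (h a) s) = (\<Prod>s\<in>S. f (h a) (h s))"
    using insert by (simp add: prod.reindex)
  moreover have "upairs (\<lambda>s t. f (h s) (h t)) (insert a S) = upairs (\<lambda>s t. f (h s) (h t)) S * (\<Prod>s\<in>S. f (h a) (h s))"
    using insert by (intro upairs_insert) auto
  ultimately show ?case using insert by auto
qed simp

lemma upairs_mult: "upairs (\<lambda>s t. f s t * g s t) S = upairs f S * upairs g S"
  unfolding upairs_def by (simp add: prod.distrib[symmetric] split_def)

definition kap :: "int \<Rightarrow> int \<Rightarrow> int" where "kap p q = (if p < q then 1 else -1)"

text \<open>
  Two arcs with disjoint endpoints cross iff an odd number of the four comparisons (an end of
  the first against an end of the second) come out as less; so this is \<open>-1\<close> for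
  crossing arcs and \<open>1\<close> otherwise.
\<close>

definition crossing :: "('a \<Rightarrow> int) \<Rightarrow> ('a \<Rightarrow> int) \<Rightarrow> 'a \<Rightarrow> 'a \<Rightarrow> int" where
  "crossing p q s t = kap (p s) (p t) * kap (p s) (q t) * kap (q s) (p t) * kap (q s) (q t)"

text \<open>
  The sign of a family of arcs \<open>s\<close> from \<open>q s\<close> to \<open>p s\<close> on
  a line: one sign for each crossing, and one for each arc that points to the right.
\<close>

definition arcs_sign :: "('a::countable \<Rightarrow> int) \<Rightarrow> ('a \<Rightarrow> int) \<Rightarrow> 'a set \<Rightarrow> int" where
  "arcs_sign p q S = (\<Prod>s\<in>S. kap (p s) (q s)) * upairs (crossing p q) S"

lemma kap_square: "kap p q * kap p q = 1" by (simp add: kap_def)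

lemma crossing_sym:
  assumes "inj_on p S" "inj_on q S" "p ` S \<inter> q ` S = {}" "s \<in> S" "t \<in> S"
  shows "crossing p q s t = crossing p q t s"
proof (cases "s = t")
  case False
  then have "p s \<noteq> p t" "q s \<noteq> q t" "p s \<noteq> q t" "q s \<noteq> p t" using assms by (auto dest: inj_onD)
  then show ?thesis unfolding crossing_def kap_def by auto
qed simp

lemma arcs_sign_image:
  assumes "finite S" "inj_on h S" "inj_on p S" "inj_on q S" "p ` S \<inter> q ` S = {}"
    "\<And>s t. s \<in> S \<Longrightarrow> t \<in> S \<Longrightarrow> p' (h s) < p' (h t) \<longleftrightarrow> p s < p t"
    "\<And>s t. s \<in> S \<Longrightarrow> t \<in> S \<Longrightarrow> p' (h s) < q' (h t) \<longleftrightarrow> p s < q t"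
    "\<And>s t. s \<in> S \<Longrightarrow> t \<in> S \<Longrightarrow> q' (h s) < p' (h t) \<longleftrightarrow> q s < p t"
    "\<And>s t. s \<in> S \<Longrightarrow> t \<in> S \<Longrightarrow> q' (h s) < q' (h t) \<longleftrightarrow> q s < q t"
  shows "arcs_sign p' q' (h ` S) = arcs_sign p q S"
proof -
  have c: "crossing p' q' (h s) (h t) = crossing p q s t" if "s \<in> S" "t \<in> S" for s t
    using assms(6-9) that by (simp add: crossing_def kap_def)
  have "upairs (crossing p' q') (h ` S) = upairs (\<lambda>s t. crossing p' q' (h s) (h t)) S"
    using assms(1,2) c crossing_sym[OF assms(3-5)] by (intro upairs_image) auto
  also have "\<dots> = upairs (crossing p q) S" using c by (intro upairs_cong) auto
  finally show ?thesis using assms(2,7) by (simp add: arcs_sign_def prod.reindex kap_def)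
qed

lemma arcs_sign_union:
  assumes "finite S" "finite T" "S \<inter> T = {}" "inj_on p (S \<union> T)" "inj_on q (S \<union> T)" "p ` (S \<union> T) \<inter> q ` (S \<union> T) = {}"
  shows "arcs_sign p q (S \<union> T) = arcs_sign p q S * arcs_sign p q T * (\<Prod>s\<in>S. \<Prod>t\<in>T. crossing p q s t)"
  unfolding arcs_sign_def
  using upairs_union[OF assms(1-3), of "crossing p q"] crossing_sym[OF assms(4-6)]
    prod.union_disjoint[OF assms(1-3), of "\<lambda>s. kap (p s) (q s)"] by simp

text \<open>
  A basis vector: a matrix position together with a parity. The edges of odd colour are called
  occupied.
\<close>

type_synonym color = "nat \<times> nat \<times> bool"
abbreviation occ :: "color \<Rightarrow> bool" where "occ c \<equiv> snd (snd c)"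

definition colors :: "nat \<Rightarrow> color set" where "colors N = {..<N} \<times> {..<N} \<times> UNIV"

lemma finite_colors [simp]: "finite (colors N)" by (simp add: colors_def)

text \<open>
  The matrix coefficients of the generators. The positions compose like matrix units: a product
  joins \<open>(i, j)\<close> and \<open>(j, k)\<close> to \<open>(i, k)\<close>, a coproduct
  inserts an arbitrary middle index, the unit is a multiple of the sum of the diagonal matrix
  units. In the parities, the product is supported on triples of odd total parity, the coproduct
  on triples of even one, in accordance with their degrees.
\<close>

fun weight :: "generator \<Rightarrow> (nat \<Rightarrow> color) \<Rightarrow> (nat \<Rightarrow> color) \<Rightarrow> int" where
  "weight Mult a b =
    (if fst (a 0) = fst (b 0) \<and> fst (snd (a 0)) = fst (a 1) \<and> fst (snd (a 1)) = fst (snd (b 0))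
     then (if occ (a 0) = occ (a 1) then (if occ (a 0) \<and> occ (b 0) then -1 else 0)
           else if occ (b 0) then 0 else if occ (a 0) then 1 else -1)
     else 0)"
| "weight Comult a b =
    (if fst (a 0) = fst (b 0) \<and> fst (snd (b 0)) = fst (b 1) \<and> fst (snd (b 1)) = fst (snd (a 0))
     then (if occ (b 0) \<and> occ (b 1) \<or> occ (a 0) \<noteq> (occ (b 0) \<or> occ (b 1)) then 0 else if occ (a 0) then -1 else 1)
     else 0)"
| "weight Unit a b = (if fst (b 0) = fst (snd (b 0)) \<and> occ (b 0) then -1 else 0)"

text \<open>
  The ends of edges on the line, in the order in which a composite is written: outputs of the
  graph, then the vertices with four places each (two for inputs, two for outputs), then the
  inputs of the graph. The outputs of the graph are placed in reverse order, which makes an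
  identity graph free of crossings.
\<close>

fun tpos :: "port \<Rightarrow> int" where
  "tpos (Ext i) = - 1 - int i" | "tpos (Vtx v j) = 4 * int v + int j"

fun spos :: "nat \<Rightarrow> port \<Rightarrow> int" where
  "spos n (Ext i) = 4 * int n + int i" | "spos n (Vtx v j) = 4 * int v + 2 + int j"

definition src :: "graph \<Rightarrow> port \<Rightarrow> port" where "src G t = inv_into (sources G) (wire G) t"

text \<open>
  The sign of moving the odd vectors along the edges: the arcs are the occupied edges.
\<close>

definition colour_sign :: "graph \<Rightarrow> (port \<Rightarrow> color) \<Rightarrow> int" where
  "colour_sign G c = arcs_sign (\<lambda>s. tpos (wire G s)) (spos (length (verts G))) {s \<in> sources G. occ (c s)}"

definition colour_term :: "graph \<Rightarrow> (port \<Rightarrow> color) \<Rightarrow> int" where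
  "colour_term G c = colour_sign G c *
     (\<Prod>v<length (verts G). weight (verts G ! v) (\<lambda>j. c (src G (Vtx v j))) (\<lambda>j. c (Vtx v j)))"

text \<open>
  Extensionality makes a colouring a function on the edges, and the set finite.
\<close>

definition colourings :: "nat \<Rightarrow> graph \<Rightarrow> (nat \<Rightarrow> color) \<Rightarrow> (nat \<Rightarrow> color) \<Rightarrow> (port \<Rightarrow> color) set" where
  "colourings N G y x = {c \<in> sources G \<rightarrow>\<^sub>E colors N.
     (\<forall>j<ins G. c (Ext j) = x j) \<and> (\<forall>p<outs G. c (src G (Ext p)) = y p)}"

text \<open>
  The coefficient of the basis vector \<open>y\<close> in the value of the graph on the basis
  vector \<open>x\<close>.
\<close>

definition Z :: "nat \<Rightarrow> graph \<Rightarrow> (nat \<Rightarrow> color) \<Rightarrow> (nat \<Rightarrow> color) \<Rightarrow> int" where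
  "Z N G y x = (\<Sum>c\<in>colourings N G y x. colour_term G c)"

lemma src:
  assumes "dag G"
  shows "t \<in> targets G \<Longrightarrow> src G t \<in> sources G" "t \<in> targets G \<Longrightarrow> wire G (src G t) = t"
    "s \<in> sources G \<Longrightarrow> src G (wire G s) = s"
proof -
  have b: "bij_betw (wire G) (sources G) (targets G)" using assms by (simp add: dag_def)
  show "t \<in> targets G \<Longrightarrow> src G t \<in> sources G"
    unfolding src_def using b by (metis bij_betw_imp_surj_on inv_into_into)
  show "t \<in> targets G \<Longrightarrow> wire G (src G t) = t"
    unfolding src_def using b by (metis bij_betw_imp_surj_on f_inv_into_f)
  show "s \<in> sources G \<Longrightarrow> src G (wire G s) = s"
    unfolding src_def using b by (metis bij_betw_imp_inj_on inv_into_f_f)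
qed

lemma n_in_le: "n_in g \<le> 2" and n_out_le: "n_out g \<le> 2" by (cases g; simp)+

lemma port_bounds:
  "Vtx v j \<in> targets G \<Longrightarrow> v < length (verts G) \<and> j < 2"
  "Vtx v j \<in> sources G \<Longrightarrow> v < length (verts G) \<and> j < 2"
  using n_in_le[of "verts G ! v"] n_out_le[of "verts G ! v"] by auto

lemma finite_sources [simp]: "finite (sources G)"
proof (rule finite_subset)
  show "sources G \<subseteq> Ext ` {..<ins G} \<union> (\<Union>v<length (verts G). Vtx v ` {..<n_out (verts G ! v)})"
    unfolding sources_def by auto
qed simp

lemma tpos_inj:
  assumes "t \<in> targets G" "t' \<in> targets G" "tpos t = tpos t'" shows "t = t'"
proof (cases t)
  case t: (Ext i)
  then show ?thesis using assms(3) by (cases t') auto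
next
  case t: (Vtx v j)
  then have j: "j < 2" using port_bounds assms(1) by blast
  show ?thesis
  proof (cases t')
    case (Ext i)
    then show ?thesis using t assms(3) by simp
  next
    case (Vtx v' j')
    then have "j' < 2" using port_bounds assms(2) by blast
    moreover have "4 * v + j = 4 * v' + j'" using assms(3) t Vtx by simp
    ultimately show ?thesis using j t Vtx by simp presburger
  qed
qed

lemma spos_inj:
  assumes "s \<in> sources G" "s' \<in> sources G" "spos (length (verts G)) s = spos (length (verts G)) s'"
  shows "s = s'"
proof -
  have b: "spos (length (verts G)) (Vtx v j) < 4 * int (length (verts G))" if "Vtx v j \<in> sources G" for v j
    using port_bounds(2)[OF that] by auto
  show ?thesis
  proof (cases s)
    case s: (Ext i)
    then show ?thesis using assms b by (cases s') force+
  next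
    case s: (Vtx v j)
    show ?thesis
    proof (cases s')
      case (Ext i)
      then show ?thesis using s assms b by force
    next
      case (Vtx v' j')
      have "j < 2" "j' < 2" using port_bounds(2) assms(1,2) s Vtx by blast+
      moreover have "4 * v + j = 4 * v' + j'" using assms(3) s Vtx by simp
      ultimately show ?thesis using s Vtx by simp presburger
    qed
  qed
qed

lemma pos_disjoint:
  assumes "t \<in> targets G" "s \<in> sources G"
  shows "tpos t \<noteq> spos (length (verts G)) s"
proof (cases t)
  case (Ext i)
  then show ?thesis by (cases s) auto
next
  case t: (Vtx v j)
  have j: "v < length (verts G)" "j < 2" using port_bounds(1) assms(1) t by blast+
  show ?thesis
  proof (cases s)
    case (Ext i)
    then show ?thesis using t j by simp
  next
    case (Vtx v' j')
    have "j' < 2" using port_bounds(2) assms(2) Vtx by blast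
    then show ?thesis using t Vtx j by simp presburger
  qed
qed

lemma pos_facts:
  assumes "dag G" "S \<subseteq> sources G"
  shows "finite S" "inj_on (\<lambda>s. tpos (wire G s)) S" "inj_on (spos (length (verts G))) S"
    "(\<lambda>s. tpos (wire G s)) ` S \<inter> spos (length (verts G)) ` S = {}"
proof -
  show "finite S" using assms(2) finite_sources by (rule finite_subset)
  show "inj_on (\<lambda>s. tpos (wire G s)) S"
    using tpos_inj dagD(1,2)[OF assms(1)] assms(2) unfolding inj_on_def by (metis subsetD)
  show "inj_on (spos (length (verts G))) S" using spos_inj assms(2) unfolding inj_on_def by blast
  show "(\<lambda>s. tpos (wire G s)) ` S \<inter> spos (length (verts G)) ` S = {}"
    using pos_disjoint dagD(1)[OF assms(1)] assms(2) by fastforce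
qed

section \<open>State sums of composites\<close>

lemma spos_shift: "spos (n + k) (shift n 0 t) = spos k t + 4 * int n"
  by (cases t) auto

lemma tpos_less: "t \<in> targets G \<Longrightarrow> tpos t < 4 * int (length (verts G))"
  using port_bounds(1) by (cases t) fastforce+

lemma spos_less: "Vtx v j \<in> sources G \<Longrightarrow> spos k (Vtx v j) < 4 * int (length (verts G))"
  using port_bounds(2)[of v j G] by auto

lemma spos_nonneg: "0 \<le> spos k s" by (cases s) auto

text \<open>
  An edge of the composite that passes through the interface is cut into an edge of each factor.
  In the line for the composite the vertices of \<open>G\<close> lie to the left of those of
  \<open>H\<close>, and the interface becomes a pair of mirrored sets of ends between them.
  Hence two such edges cross in the composite iff their parts cross in exactly one of the
  factors. Edges inside different factors never cross, and all other crossings take place in one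
  factor.
\<close>

lemma arcs_sign_gcomp:
  assumes G: "dag G" and H: "dag H" and e: "outs H = ins G"
    and SA: "SA \<subseteq> {s \<in> sources G. \<exists>v j. s = Vtx v j}"
    and SH: "SH \<subseteq> sources H"
  defines "n \<equiv> length (verts G)" and "k \<equiv> length (verts H)" and "K \<equiv> gcomp G H"
  defines "T \<equiv> {t \<in> SH. \<exists>m. wire H t = Ext m}"
  shows "arcs_sign (\<lambda>s. tpos (wire K s)) (spos (n + k)) (SA \<union> shift n 0 ` SH) =
    arcs_sign (\<lambda>s. tpos (wire G s)) (spos n) (SA \<union> wire H ` T) *
    arcs_sign (\<lambda>s. tpos (wire H s)) (spos k) SH"
proof -
  define B where "B = SH - T"
  let ?sh = "shift n 0"
  let ?pK = "\<lambda>s. tpos (wire K s)" and ?pG = "\<lambda>s. tpos (wire G s)" and ?pH = "\<lambda>s. tpos (wire H s)"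
  let ?qK = "spos (n + k)" and ?qG = "spos n" and ?qH = "spos k"
  have K: "dag K" "length (verts K) = n + k" unfolding K_def n_def k_def using dag_gcomp[OF G H e] by simp_all
  have SHd: "SH = B \<union> T" "B \<inter> T = {}" by (auto simp: B_def T_def)
  have sub: "SA \<subseteq> sources G" "T \<subseteq> sources H" "B \<subseteq> sources H" using SA SH by (auto simp: B_def T_def)
  have wT: "wire H t \<in> sources G" "\<exists>m. wire H t = Ext m" if "t \<in> T" for t
    using that dagD(1)[OF H, of t] e sub by (auto simp: T_def)
  have TG: "wire H ` T \<subseteq> sources G" using wT by blast
  have injT: "inj_on (wire H) T" using dagD(2)[OF H] sub(2) by (auto simp: inj_on_def)
  have SAK: "SA \<subseteq> sources K"
  proof
    fix s assume "s \<in> SA"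
    then obtain v j where "s = Vtx v j" "Vtx v j \<in> sources G" using SA by blast
    then show "s \<in> sources K" using sources_gcompI(1) unfolding K_def by blast
  qed
  have shK: "?sh ` SH \<subseteq> sources K"
    using sources_gcompI(2)[of _ H G] SH unfolding K_def n_def by blast
  have disj: "SA \<inter> ?sh ` SH = {}"
  proof -
    have "?sh t \<noteq> s" if s: "s \<in> SA" for s t
    proof -
      obtain v j where "s = Vtx v j" "Vtx v j \<in> sources G" using s SA by blast
      then show ?thesis using port_bounds(2)[of v j G] by (cases t) (auto simp: n_def)
    qed
    then show ?thesis by blast
  qed
  \<comment> \<open>Positions of the three kinds of edges: inside \<open>G\<close>, inside \<open>H\<close>, and through the interface.\<close>
  have A: "?pK s = ?pG s" "?qK s = ?qG s" "?pG s < 4 * int n" "?qG s < 4 * int n" if sSA: "s \<in> SA" for s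
  proof -
    obtain v j where s: "s = Vtx v j" "Vtx v j \<in> sources G" using sSA SA by blast
    have "v < n" using port_bounds(2)[OF s(2)] by (simp add: n_def)
    then show "?pK s = ?pG s" "?qK s = ?qG s" using s(1) by (simp_all add: K_def n_def)
    show "?pG s < 4 * int n" using tpos_less[OF dagD(1)[OF G]] sub sSA by (auto simp: n_def)
    show "?qG s < 4 * int n" using spos_less[OF s(2)] s(1) by (simp add: n_def)
  qed
  have Bp: "?pK (?sh t) = ?pH t + 4 * int n" "0 \<le> ?pH t" if t: "t \<in> B" for t
  proof -
    obtain v j where v: "wire H t = Vtx v j" using t by (cases "wire H t") (auto simp: B_def T_def)
    have "wire K (?sh t) = Vtx (v + n) j" unfolding K_def n_def wire_gcomp_right v by simp
    then show "?pK (?sh t) = ?pH t + 4 * int n" "0 \<le> ?pH t" using v by simp_all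
  qed
  have Tp: "?pK (?sh t) = ?pG (wire H t)" "?pG (wire H t) < 4 * int n" "?pH t < 0"
    "4 * int n \<le> ?qG (wire H t)" "?qG (wire H t) = 4 * int n - 1 - ?pH t" if t: "t \<in> T" for t
  proof -
    obtain m where m: "wire H t = Ext m" using wT t by blast
    show "?pK (?sh t) = ?pG (wire H t)" unfolding K_def n_def wire_gcomp_right m by simp
    show "?pG (wire H t) < 4 * int n" using tpos_less[OF dagD(1)[OF G wT(1)[OF t]]] by (simp add: n_def)
    show "?pH t < 0" "4 * int n \<le> ?qG (wire H t)" "?qG (wire H t) = 4 * int n - 1 - ?pH t" by (simp_all add: m)
  qed
  have q: "?qK (?sh t) = ?qH t + 4 * int n" "0 \<le> ?qH t" for t by (simp_all add: spos_shift spos_nonneg)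
  note fK = pos_facts[OF K(1), unfolded K(2)] and fG = pos_facts[OF G, folded n_def] and fH = pos_facts[OF H, folded k_def]
  have e1: "arcs_sign ?pK ?qK SA = arcs_sign ?pG ?qG SA"
    using arcs_sign_image[of SA "\<lambda>s. s" ?pG ?qG ?pK ?qK] fG[OF sub(1)] A(1,2) by simp
  have e2: "arcs_sign ?pK ?qK (?sh ` B) = arcs_sign ?pH ?qH B"
    by (rule arcs_sign_image) (use fH[OF sub(3)] Bp(1) q in \<open>auto simp: inj_on_def\<close>)
  have e3: "(\<Prod>s\<in>SA. \<Prod>t\<in>?sh ` B. crossing ?pK ?qK s t) = 1"
  proof (intro prod.neutral ballI)
    fix s t assume s: "s \<in> SA" and "t \<in> ?sh ` B"
    then obtain u where u: "u \<in> B" "t = ?sh u" by blast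
    then show "crossing ?pK ?qK s t = 1"
      using A[OF s] Bp[OF u(1)] q[of u] by (simp add: crossing_def kap_def)
  qed
  \<comment> \<open>Two edges through the interface: the mirrored positions on both sides of it cancel.\<close>
  have e4: "arcs_sign ?pK ?qK (?sh ` T) = arcs_sign ?pG ?qG (wire H ` T) * arcs_sign ?pH ?qH T"
  proof -
    have k1: "(\<Prod>s\<in>?sh ` T. kap (?pK s) (?qK s)) = 1"
    proof (intro prod.neutral ballI)
      fix s assume "s \<in> ?sh ` T"
      then obtain u where u: "u \<in> T" "s = ?sh u" by blast
      then show "kap (?pK s) (?qK s) = 1" using Tp[OF u(1)] q[of u] by (simp add: kap_def)
    qed
    have k2: "(\<Prod>s\<in>wire H ` T. kap (?pG s) (?qG s)) = 1"
    proof (intro prod.neutral ballI)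
      fix s assume "s \<in> wire H ` T"
      then obtain u where u: "u \<in> T" "s = wire H u" by blast
      then show "kap (?pG s) (?qG s) = 1" using Tp[OF u(1)] by (simp add: kap_def)
    qed
    have k3: "(\<Prod>s\<in>T. kap (?pH s) (?qH s)) = 1"
    proof (intro prod.neutral ballI)
      fix s assume "s \<in> T"
      from Tp(3)[OF this] q(2)[of s] show "kap (?pH s) (?qH s) = 1" by (simp add: kap_def)
    qed
    have symK: "crossing ?pK ?qK s t = crossing ?pK ?qK t s" if "s \<in> ?sh ` T" "t \<in> ?sh ` T" for s t
      using crossing_sym[OF fK(2-4)[OF shK]] that SHd by blast
    have symG: "crossing ?pG ?qG s t = crossing ?pG ?qG t s" if "s \<in> wire H ` T" "t \<in> wire H ` T" for s t
      using crossing_sym[OF fG(2-4)[OF TG]] that by blast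
    have "upairs (crossing ?pK ?qK) (?sh ` T) = upairs (\<lambda>s t. crossing ?pK ?qK (?sh s) (?sh t)) T"
      by (rule upairs_image) (use fH(1)[OF sub(2)] symK in \<open>auto simp: inj_on_def\<close>)
    also have "\<dots> = upairs (\<lambda>s t. crossing ?pG ?qG (wire H s) (wire H t) * crossing ?pH ?qH s t) T"
    proof (rule upairs_cong)
      fix s t assume st: "s \<in> T" "t \<in> T" "s \<noteq> t"
      have "?pH s \<noteq> ?pH t" using fH(2)[OF sub(2)] st by (auto dest: inj_onD)
      then show "crossing ?pK ?qK (?sh s) (?sh t) = crossing ?pG ?qG (wire H s) (wire H t) * crossing ?pH ?qH s t"
        using Tp[OF st(1)] Tp[OF st(2)] q[of s] q[of t] unfolding crossing_def kap_def by auto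
    qed
    also have "\<dots> = upairs (\<lambda>s t. crossing ?pG ?qG (wire H s) (wire H t)) T * upairs (crossing ?pH ?qH) T"
      by (rule upairs_mult)
    also have "upairs (\<lambda>s t. crossing ?pG ?qG (wire H s) (wire H t)) T = upairs (crossing ?pG ?qG) (wire H ` T)"
      by (rule upairs_image[symmetric]) (use fH(1)[OF sub(2)] injT symG in auto)
    finally show ?thesis by (simp add: arcs_sign_def k1 k2 k3)
  qed
  have e5: "(\<Prod>s\<in>SA. \<Prod>t\<in>?sh ` T. crossing ?pK ?qK s t) = (\<Prod>s\<in>SA. \<Prod>t\<in>wire H ` T. crossing ?pG ?qG s t)"
  proof (rule prod.cong[OF refl])
    fix s assume s: "s \<in> SA"
    have "(\<Prod>t\<in>?sh ` T. crossing ?pK ?qK s t) = (\<Prod>t\<in>T. crossing ?pK ?qK s (?sh t))"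
      by (subst prod.reindex) (auto simp: inj_on_def)
    also have "\<dots> = (\<Prod>t\<in>T. crossing ?pG ?qG s (wire H t))"
    proof (rule prod.cong[OF refl])
      fix t assume t: "t \<in> T"
      show "crossing ?pK ?qK s (?sh t) = crossing ?pG ?qG s (wire H t)"
        using A[OF s] Tp[OF t] q[of t] by (simp add: crossing_def kap_def)
    qed
    also have "\<dots> = (\<Prod>t\<in>wire H ` T. crossing ?pG ?qG s t)" by (simp add: prod.reindex injT)
    finally show "(\<Prod>t\<in>?sh ` T. crossing ?pK ?qK s t) = (\<Prod>t\<in>wire H ` T. crossing ?pG ?qG s t)" .
  qed
  have e6: "(\<Prod>s\<in>?sh ` B. \<Prod>t\<in>?sh ` T. crossing ?pK ?qK s t) = (\<Prod>s\<in>B. \<Prod>t\<in>T. crossing ?pH ?qH s t)"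
  proof -
    have "(\<Prod>s\<in>?sh ` B. \<Prod>t\<in>?sh ` T. crossing ?pK ?qK s t) = (\<Prod>s\<in>B. \<Prod>t\<in>T. crossing ?pK ?qK (?sh s) (?sh t))"
      by (simp add: prod.reindex inj_on_def)
    also have "\<dots> = (\<Prod>s\<in>B. \<Prod>t\<in>T. crossing ?pH ?qH s t)"
    proof (intro prod.cong refl)
      fix s t assume s: "s \<in> B" and t: "t \<in> T"
      show "crossing ?pK ?qK (?sh s) (?sh t) = crossing ?pH ?qH s t"
        using Bp[OF s] Tp[OF t] q[of t] q[of s] by (simp add: crossing_def kap_def)
    qed
    finally show ?thesis .
  qed
  have shu: "?sh ` SH = ?sh ` B \<union> ?sh ` T" "?sh ` B \<inter> ?sh ` T = {}" using SHd by auto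
  have all: "SA \<union> ?sh ` SH \<subseteq> sources K" using SAK shK by blast
  have fin: "finite SA" "finite (?sh ` B)" "finite (?sh ` T)" "finite T" "finite B" "finite (wire H ` T)"
    using fK(1)[OF SAK] fH(1)[OF sub(2)] fH(1)[OF sub(3)] by auto
  have SAT: "SA \<inter> wire H ` T = {}" using SA wT(2) by fastforce
  have "arcs_sign ?pK ?qK (SA \<union> ?sh ` SH) =
    arcs_sign ?pK ?qK SA * arcs_sign ?pK ?qK (?sh ` SH) * (\<Prod>s\<in>SA. \<Prod>t\<in>?sh ` SH. crossing ?pK ?qK s t)"
    by (rule arcs_sign_union) (use fin shu disj fK(2-4)[OF all] in auto)
  also have "arcs_sign ?pK ?qK (?sh ` SH) = arcs_sign ?pK ?qK (?sh ` B) * arcs_sign ?pK ?qK (?sh ` T) *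
      (\<Prod>s\<in>?sh ` B. \<Prod>t\<in>?sh ` T. crossing ?pK ?qK s t)"
    unfolding shu(1) by (rule arcs_sign_union) (use fin shu(2) fK(2-4)[OF shK] in \<open>auto simp: shu(1)\<close>)
  also have "(\<Prod>s\<in>SA. \<Prod>t\<in>?sh ` SH. crossing ?pK ?qK s t) =
    (\<Prod>s\<in>SA. \<Prod>t\<in>?sh ` B. crossing ?pK ?qK s t) * (\<Prod>s\<in>SA. \<Prod>t\<in>?sh ` T. crossing ?pK ?qK s t)"
    unfolding shu(1) prod.union_disjoint[OF fin(2,3) shu(2)] by (rule prod.distrib)
  finally have L: "arcs_sign ?pK ?qK (SA \<union> ?sh ` SH) =
    arcs_sign ?pG ?qG SA * (arcs_sign ?pH ?qH B * (arcs_sign ?pG ?qG (wire H ` T) * arcs_sign ?pH ?qH T) *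
      (\<Prod>s\<in>B. \<Prod>t\<in>T. crossing ?pH ?qH s t)) * (\<Prod>s\<in>SA. \<Prod>t\<in>wire H ` T. crossing ?pG ?qG s t)"
    unfolding e1 e2 e3 e4 e5 e6 by simp
  have "SA \<union> wire H ` T \<subseteq> sources G" using sub(1) TG by blast
  then have R1: "arcs_sign ?pG ?qG (SA \<union> wire H ` T) = arcs_sign ?pG ?qG SA * arcs_sign ?pG ?qG (wire H ` T) *
    (\<Prod>s\<in>SA. \<Prod>t\<in>wire H ` T. crossing ?pG ?qG s t)"
    by (intro arcs_sign_union fin SAT fG)
  have R2: "arcs_sign ?pH ?qH SH = arcs_sign ?pH ?qH B * arcs_sign ?pH ?qH T * (\<Prod>s\<in>B. \<Prod>t\<in>T. crossing ?pH ?qH s t)"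
    unfolding SHd(1) by (intro arcs_sign_union fin SHd(2) fH) (use sub in auto)
  show ?thesis unfolding L R1 R2 by (simp only: ac_simps)
qed


lemma colour_term_cong:
  assumes "dag G" "\<And>s. s \<in> sources G \<Longrightarrow> c s = c' s"
  shows "colour_term G c = colour_term G c'"
proof -
  have "{s \<in> sources G. occ (c s)} = {s \<in> sources G. occ (c' s)}" using assms(2) by auto
  moreover have "weight (verts G ! v) (\<lambda>j. c (src G (Vtx v j))) (\<lambda>j. c (Vtx v j)) =
      weight (verts G ! v) (\<lambda>j. c' (src G (Vtx v j))) (\<lambda>j. c' (Vtx v j))" if v: "v < length (verts G)" for v
  proof -
    have "c (src G (Vtx v j)) = c' (src G (Vtx v j))" if "j < n_in (verts G ! v)" for j
      using assms(2) src(1)[OF assms(1), of "Vtx v j"] that v by simp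
    moreover have "c (Vtx v j) = c' (Vtx v j)" if "j < n_out (verts G ! v)" for j
      using assms(2) that v by simp
    ultimately show ?thesis by (cases "verts G ! v") simp_all
  qed
  ultimately show ?thesis by (simp add: colour_term_def colour_sign_def)
qed

lemma lift_left_Ext': "lift_left G H (Ext m) = shift (length (verts G)) 0 (src H (Ext m))"
  by (simp add: lift_left_def src_def)

text \<open>
  An input of a vertex of \<open>G\<close> that is fed by the interface is fed by a source of
  \<open>H\<close> in the composite.
\<close>

lemma src_gcomp:
  assumes G: "dag G" and H: "dag H" and e: "outs H = ins G"
  shows "t \<in> targets G \<Longrightarrow> src (gcomp G H) t = lift_left G H (src G t)"
    "Vtx v j \<in> targets H \<Longrightarrow> src (gcomp G H) (Vtx (v + length (verts G)) j) =
       shift (length (verts G)) 0 (src H (Vtx v j))"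
proof -
  note K = dag_gcomp[OF G H e]
  show "src (gcomp G H) t = lift_left G H (src G t)" if "t \<in> targets G"
    using lift_left[OF H e src(1)[OF G that]] src(2)[OF G that] src(3)[OF K] by metis
  show "src (gcomp G H) (Vtx (v + length (verts G)) j) = shift (length (verts G)) 0 (src H (Vtx v j))"
    if "Vtx v j \<in> targets H"
  proof -
    have "wire (gcomp G H) (shift (length (verts G)) 0 (src H (Vtx v j))) = Vtx (v + length (verts G)) j"
      using src(2)[OF H that] by simp
    then show ?thesis using src(3)[OF K sources_gcompI(2)[OF src(1)[OF H that], of G]] by metis
  qed
qed

lemma prod_lessThan_add: "(\<Prod>v<m + k. f v) = (\<Prod>v<m. f v) * (\<Prod>v<k. f (v + m))" for f :: "nat \<Rightarrow> int"
proof (induction k)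
  case (Suc k)
  then show ?case by (simp add: add.commute mult.assoc)
qed simp

lemma colour_term_gcomp:
  assumes G: "dag G" and H: "dag H" and e: "outs H = ins G"
  shows "colour_term (gcomp G H) c =
    colour_term G (c \<circ> lift_left G H) * colour_term H (c \<circ> shift (length (verts G)) 0)"
proof -
  let ?n = "length (verts G)" and ?k = "length (verts H)" and ?K = "gcomp G H"
  let ?sh = "shift ?n 0" and ?l = "lift_left G H"
  define SA where "SA = {s \<in> sources G. (\<exists>v j. s = Vtx v j) \<and> occ (c s)}"
  define SH where "SH = {t \<in> sources H. occ (c (?sh t))}"
  have SK: "{s \<in> sources ?K. occ (c s)} = SA \<union> ?sh ` SH"
  proof (intro equalityI subsetI)
    fix s assume s: "s \<in> {s \<in> sources ?K. occ (c s)}"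
    then have "s \<in> sources ?K" by simp
    then show "s \<in> SA \<union> ?sh ` SH"
      by (cases rule: sources_gcomp_cases) (use s in \<open>auto simp: SA_def SH_def simp del: sources_iff\<close>)
  next
    fix s assume "s \<in> SA \<union> ?sh ` SH"
    then show "s \<in> {s \<in> sources ?K. occ (c s)}"
      using sources_gcompI(1)[of _ _ G H] sources_gcompI(2)[of _ H G]
      by (auto simp: SA_def SH_def simp del: sources_iff)
  qed
  have SG: "{s \<in> sources G. occ (c (?l s))} = SA \<union> wire H ` {t \<in> SH. \<exists>m. wire H t = Ext m}"
  proof (intro equalityI subsetI)
    fix s assume s: "s \<in> {s \<in> sources G. occ (c (?l s))}"
    show "s \<in> SA \<union> wire H ` {t \<in> SH. \<exists>m. wire H t = Ext m}"
    proof (cases s)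
      case (Ext m)
      then have m: "Ext m \<in> targets H" using s e by simp
      then have "wire H (src H (Ext m)) = s" "src H (Ext m) \<in> SH"
        using src(1,2)[OF H m] s Ext by (simp_all add: SH_def lift_left_Ext')
      then show ?thesis using Ext by blast
    qed (use s in \<open>auto simp: SA_def\<close>)
  next
    fix s assume "s \<in> SA \<union> wire H ` {t \<in> SH. \<exists>m. wire H t = Ext m}"
    then consider "s \<in> SA" | t m where "t \<in> SH" "wire H t = Ext m" "s = Ext m" by force
    then show "s \<in> {s \<in> sources G. occ (c (?l s))}"
    proof cases
      case 1
      then show ?thesis by (auto simp: SA_def)
    next
      case 2
      then have t: "t \<in> sources H" "src H (Ext m) = t" using src(3)[OF H, of t] by (simp_all add: SH_def)
      then have "m < ins G" using dagD(1)[OF H t(1)] 2 e by simp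
      then show ?thesis using 2 t by (simp add: SH_def lift_left_Ext')
    qed
  qed
  have sign: "colour_sign ?K c = colour_sign G (c \<circ> ?l) * colour_sign H (c \<circ> ?sh)"
    unfolding colour_sign_def comp_apply SK SG
    using arcs_sign_gcomp[OF G H e, of SA SH] by (simp add: SA_def SH_def subset_iff)
  have w1: "weight (verts ?K ! v) (\<lambda>j. c (src ?K (Vtx v j))) (\<lambda>j. c (Vtx v j)) =
      weight (verts G ! v) (\<lambda>j. (c \<circ> ?l) (src G (Vtx v j))) (\<lambda>j. (c \<circ> ?l) (Vtx v j))" if v: "v < ?n" for v
  proof -
    have "c (src ?K (Vtx v j)) = c (?l (src G (Vtx v j)))" if "j < n_in (verts G ! v)" for j
      using src_gcomp(1)[OF G H e, of "Vtx v j"] that v by simp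
    then show ?thesis using v by (cases "verts G ! v") (simp_all add: nth_append)
  qed
  have w2: "weight (verts ?K ! (v + ?n)) (\<lambda>j. c (src ?K (Vtx (v + ?n) j))) (\<lambda>j. c (Vtx (v + ?n) j)) =
      weight (verts H ! v) (\<lambda>j. (c \<circ> ?sh) (src H (Vtx v j))) (\<lambda>j. (c \<circ> ?sh) (Vtx v j))" if v: "v < ?k" for v
  proof -
    have "c (src ?K (Vtx (v + ?n) j)) = c (?sh (src H (Vtx v j)))" if "j < n_in (verts H ! v)" for j
      using src_gcomp(2)[OF G H e, of v j] that v by simp
    then show ?thesis using v by (cases "verts H ! v") (simp_all add: nth_append)
  qed
  show ?thesis unfolding colour_term_def sign
    using w1 w2 by (simp add: prod_lessThan_add)
qed

text \<open>
  A colouring of the composite is a pair of colourings that agree on the interface, and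
  \<open>z\<close> is their common restriction to it.
\<close>

lemma Z_gcomp:
  assumes G: "dag G" and H: "dag H" and e: "outs H = ins G"
  shows "Z N (gcomp G H) y x = (\<Sum>z\<in>{..<ins G} \<rightarrow>\<^sub>E colors N. Z N G y z * Z N H z x)"
proof -
  let ?n = "length (verts G)" and ?K = "gcomp G H"
  let ?sh = "shift ?n 0" and ?l = "lift_left G H"
  let ?M = "{..<ins G} \<rightarrow>\<^sub>E colors N"
  define \<Phi> where "\<Phi> = (\<lambda>c :: port \<Rightarrow> color. (restrict (\<lambda>m. c (?l (Ext m))) {..<ins G}, restrict (c \<circ> ?l) (sources G), restrict (c \<circ> ?sh) (sources H)))"
  define \<Psi> where "\<Psi> = (\<lambda>(z :: nat \<Rightarrow> color, a :: port \<Rightarrow> color, b :: port \<Rightarrow> color).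
     restrict (\<lambda>s. case s of Ext i \<Rightarrow> b (Ext i) | Vtx v j \<Rightarrow> if v < ?n then a s else b (Vtx (v - ?n) j)) (sources ?K))"
  let ?D = "Sigma ?M (\<lambda>z. colourings N G y z \<times> colourings N H z x)"
  have srcH: "src H (Ext m) \<in> sources H" if "m < ins G" for m
    using src(1)[OF H, of "Ext m"] that e by simp
  have shK: "?sh t \<in> sources ?K" if "t \<in> sources H" for t using sources_gcompI(2)[OF that] .
  have lK: "?l s \<in> sources ?K" if "s \<in> sources G" for s using lift_left(1)[OF H e that] .
  have psi_sh: "\<Psi> (z, a, b) (?sh t) = b t" if "t \<in> sources H" for z a b t
    using shK[OF that] by (cases t) (simp_all add: \<Psi>_def)
  have psi_v: "\<Psi> (z, a, b) (Vtx v j) = a (Vtx v j)" if "Vtx v j \<in> sources G" for z a b v j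
    using sources_gcompI(1)[OF that, of H] that by (simp add: \<Psi>_def)
  have Phi: "\<Phi> c \<in> ?D" if c: "c \<in> colourings N ?K y x" for c
  proof -
    have cc: "c s \<in> colors N" if "s \<in> sources ?K" for s using c that by (auto simp: colourings_def)
    have "c (?l (src G (Ext p))) = y p" if "p < outs G" for p
    proof -
      have "c (src ?K (Ext p)) = y p" using c that by (simp add: colourings_def)
      then show ?thesis using src_gcomp(1)[OF G H e, of "Ext p"] that by simp
    qed
    moreover have "c (?sh (Ext j)) = x j" if "j < ins H" for j using c that by (simp add: colourings_def)
    moreover have "src G (Ext p) \<in> sources G" if "p < outs G" for p using src(1)[OF G, of "Ext p"] that by simp
    ultimately show ?thesis
      using cc lK shK srcH e by (auto simp: \<Phi>_def colourings_def lift_left_Ext' simp del: shift.simps sources_iff(2))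
  qed
  have Psi: "\<Psi> d \<in> colourings N ?K y x" if d: "d \<in> ?D" for d
  proof -
    obtain z a b where zab: "d = (z, a, b)" "a \<in> colourings N G y z" "b \<in> colourings N H z x" using d by auto
    have "\<Psi> d s \<in> colors N" if s: "s \<in> sources ?K" for s
      using s
    proof (cases rule: sources_gcomp_cases)
      case (left v j)
      then show ?thesis using zab psi_v[of v j z a b] by (auto simp: colourings_def simp del: sources_iff)
    next
      case (right t)
      then show ?thesis using zab psi_sh[of t z a b] by (auto simp: colourings_def simp del: sources_iff)
    qed
    moreover have "\<Psi> d \<in> extensional (sources ?K)" by (simp add: \<Psi>_def zab)
    moreover have "\<Psi> d (Ext j) = x j" if "j < ins ?K" for j
      using psi_sh[of "Ext j" z a b] that zab by (simp add: colourings_def)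
    moreover have "\<Psi> d (src ?K (Ext p)) = y p" if p: "p < outs ?K" for p
    proof -
      have t: "Ext p \<in> targets G" using p by simp
      have "\<Psi> d (?l (src G (Ext p))) = a (src G (Ext p))"
      proof (cases "src G (Ext p)")
        case (Ext m)
        then have m: "m < ins G" using src(1)[OF G t] by simp
        then show ?thesis using Ext psi_sh[OF srcH[OF m]] zab e by (simp add: colourings_def lift_left_Ext')
      next
        case (Vtx v j)
        then show ?thesis using psi_v src(1)[OF G t] zab by simp
      qed
      then show ?thesis using src_gcomp(1)[OF G H e t] zab p by (simp add: colourings_def)
    qed
    ultimately show ?thesis by (auto simp: colourings_def PiE_def)
  qed
  have PsiPhi: "\<Psi> (\<Phi> c) = c" if c: "c \<in> colourings N ?K y x" for c
  proof
    fix s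
    show "\<Psi> (\<Phi> c) s = c s"
    proof (cases "s \<in> sources ?K")
      case True
      then show ?thesis
      proof (cases rule: sources_gcomp_cases)
        case (left v j)
        then show ?thesis using psi_v[of v j] by (simp add: \<Phi>_def del: sources_iff)
      next
        case (right t)
        then show ?thesis using psi_sh[of t] by (simp add: \<Phi>_def del: sources_iff)
      qed
    next
      case False
      then show ?thesis using c by (auto simp: \<Psi>_def \<Phi>_def colourings_def PiE_def extensional_def)
    qed
  qed
  have PhiPsi: "\<Phi> (\<Psi> d) = d" if d: "d \<in> ?D" for d
  proof -
    obtain z a b where zab: "d = (z, a, b)" "z \<in> ?M" "a \<in> colourings N G y z" "b \<in> colourings N H z x" using d by auto
    have la: "\<Psi> d (?l s) = a s" if s: "s \<in> sources G" for s
    proof (cases s)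
      case (Ext m)
      then have m: "m < ins G" using s by simp
      then show ?thesis using Ext psi_sh[OF srcH[OF m]] zab e by (simp add: colourings_def lift_left_Ext')
    next
      case (Vtx v j)
      then show ?thesis using psi_v s zab by simp
    qed
    have "restrict (\<lambda>m. \<Psi> d (?l (Ext m))) {..<ins G} = z"
      using la zab by (intro ext) (auto simp: colourings_def PiE_def extensional_def)
    moreover have "restrict (\<Psi> d \<circ> ?l) (sources G) = a"
      using la zab(3) by (intro ext) (auto simp: colourings_def PiE_def extensional_def simp del: sources_iff)
    moreover have "restrict (\<Psi> d \<circ> ?sh) (sources H) = b"
      using psi_sh zab(1,4) by (intro ext) (auto simp: colourings_def PiE_def extensional_def simp del: sources_iff)
    ultimately show ?thesis by (simp add: \<Phi>_def zab(1))
  qed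
  have tm: "(case \<Phi> c of (z, a, b) \<Rightarrow> colour_term G a * colour_term H b) = colour_term ?K c" for c
    unfolding \<Phi>_def prod.case colour_term_gcomp[OF G H e]
    using colour_term_cong[OF G, of "restrict (c \<circ> ?l) (sources G)" "c \<circ> ?l"]
      colour_term_cong[OF H, of "restrict (c \<circ> ?sh) (sources H)" "c \<circ> ?sh"] by simp
  have "Z N ?K y x = (\<Sum>d\<in>?D. case d of (z, a, b) \<Rightarrow> colour_term G a * colour_term H b)"
    unfolding Z_def by (rule sum.reindex_bij_witness[of _ \<Psi> \<Phi>]) (use PsiPhi PhiPsi Phi Psi tm in auto)
  also have "\<dots> = (\<Sum>z\<in>?M. \<Sum>(a, b)\<in>colourings N G y z \<times> colourings N H z x. colour_term G a * colour_term H b)"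
  proof (rule sum.Sigma[symmetric])
    show "finite ?M" by (intro finite_PiE) auto
    have "finite (colourings N G' y' x')" for G' y' x'
      by (rule finite_subset[of _ "sources G' \<rightarrow>\<^sub>E colors N"]) (auto simp: colourings_def intro!: finite_PiE)
    then show "\<forall>z\<in>?M. finite (colourings N G y z \<times> colourings N H z x)" by blast
  qed
  also have "\<dots> = (\<Sum>z\<in>?M. Z N G y z * Z N H z x)"
    by (simp add: Z_def sum_product sum.cartesian_product)
  finally show ?thesis .
qed

section \<open>State sums of tensor products\<close>

definition occ_count :: "nat \<Rightarrow> (nat \<Rightarrow> color) \<Rightarrow> nat" where
  "occ_count n x = card {j. j < n \<and> occ (x j)}"

lemma prod_sign: "finite S \<Longrightarrow> (\<Prod>t\<in>S. if P t then -1 else 1 :: int) = (-1) ^ card {t \<in> S. P t}"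
  by (simp add: prod.If_cases Int_def)

text \<open>
  An arc with ends \<open>a\<close>, \<open>b\<close> of the left factor and one with ends
  \<open>c\<close>, \<open>d\<close> of the right factor: primes denote positions before the
  shift into the tensor product. They cross iff the first starts at an input of the graph
  (\<open>B\<close>) and exactly one end of the second is an outer one (\<open>C\<close> for an
  output, \<open>D\<close> for an input).
\<close>

lemma crossing_blocks:
  assumes "a < 4 * n" "- 1 - e < a"
    "b' < 4 * n \<and> b = b' \<and> \<not> B \<or> 4 * n \<le> b' \<and> b' < 4 * n + i \<and> b = b' + 4 * k \<and> B"
    "c' < 0 \<and> c = c' - e \<and> C \<or> 0 \<le> c' \<and> c' < 4 * k \<and> c = c' + 4 * n \<and> \<not> C"
    "0 \<le> d' \<and> d' < 4 * k \<and> d = d' + 4 * n \<and> \<not> D \<or> 4 * k \<le> d' \<and> d = d' + 4 * n + i \<and> D"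
    "0 \<le> b'" "0 \<le> e" "0 \<le> i" "0 \<le> k"
  shows "kap a c * kap a d * kap b c * kap b d =
    (if B then (if C then -1 else 1) * (if D then -1 else 1) else 1)"
  using assms unfolding kap_def by (cases B; cases C; cases D) auto

lemma arcs_sign_gtensor:
  assumes G: "dag G" and H: "dag H" and SG: "SG \<subseteq> sources G" and SH: "SH \<subseteq> sources H"
  defines "n \<equiv> length (verts G)" and "k \<equiv> length (verts H)" and "K \<equiv> gtensor G H"
  shows "arcs_sign (\<lambda>s. tpos (wire K s)) (spos (n + k)) (SG \<union> shift n (ins G) ` SH) =
    (-1) ^ (card {s \<in> SG. \<exists>i. s = Ext i} *
      (card {t \<in> SH. \<exists>i. wire H t = Ext i} + card {t \<in> SH. \<exists>i. t = Ext i})) *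
    arcs_sign (\<lambda>s. tpos (wire G s)) (spos n) SG * arcs_sign (\<lambda>s. tpos (wire H s)) (spos k) SH"
proof -
  let ?sh = "shift n (ins G)"
  let ?pK = "\<lambda>s. tpos (wire K s)" and ?pG = "\<lambda>s. tpos (wire G s)" and ?pH = "\<lambda>s. tpos (wire H s)"
  let ?qK = "spos (n + k)" and ?qG = "spos n" and ?qH = "spos k"
  have K: "dag K" "length (verts K) = n + k" unfolding K_def n_def k_def using dag_gtensor[OF G H] by simp_all
  have subK: "SG \<subseteq> sources K" "?sh ` SH \<subseteq> sources K"
    using sources_gtensorI[of _ G H] sources_gtensorI(2)[of _ H G] SG SH unfolding K_def n_def by blast+
  have disj: "SG \<inter> ?sh ` SH = {}"
  proof -
    have "?sh t \<noteq> s" if s: "s \<in> sources G" for s t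
      using s by (cases s; cases t) (auto simp: n_def)
    then show ?thesis using SG by blast
  qed
  note fK = pos_facts[OF K(1), unfolded K(2)] and fG = pos_facts[OF G SG, folded n_def] and fH = pos_facts[OF H SH, folded k_def]
  have pG: "?pK s = ?pG s" "?pG s < 4 * int n" "- 1 - int (outs G) < ?pG s" if s: "s \<in> SG" for s
  proof -
    have t: "wire G s \<in> targets G" using dagD(1)[OF G] SG s by blast
    show "?pK s = ?pG s" unfolding K_def using SG s by (simp add: subset_iff)
    show "?pG s < 4 * int n" using tpos_less[OF t] by (simp add: n_def)
    show "- 1 - int (outs G) < ?pG s" using t by (cases "wire G s") auto
  qed
  have qG: "?qG s < 4 * int n \<and> ?qK s = ?qG s \<and> (\<nexists>i. s = Ext i) \<or>
      4 * int n \<le> ?qG s \<and> ?qG s < 4 * int n + int (ins G) \<and> ?qK s = ?qG s + 4 * int k \<and> (\<exists>i. s = Ext i)" if s: "s \<in> SG" for s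
  proof (cases s)
    case (Vtx v j)
    then have "Vtx v j \<in> sources G" using SG s by blast
    then show ?thesis using Vtx spos_less[of v j G n] by (simp add: n_def)
  next
    case (Ext i)
    then have "Ext i \<in> sources G" using SG s by blast
    then show ?thesis using Ext by simp
  qed
  have pH: "?pH t < 0 \<and> ?pK (?sh t) = ?pH t - int (outs G) \<and> (\<exists>i. wire H t = Ext i) \<or>
      0 \<le> ?pH t \<and> ?pH t < 4 * int k \<and> ?pK (?sh t) = ?pH t + 4 * int n \<and> (\<nexists>i. wire H t = Ext i)" if t: "t \<in> SH" for t
  proof -
    have w: "wire K (?sh t) = shift n (outs G) (wire H t)" unfolding K_def n_def by simp
    have u: "wire H t \<in> targets H" using dagD(1)[OF H] SH t by blast
    show ?thesis using w tpos_less[OF u] by (cases "wire H t") (auto simp: k_def)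
  qed
  have qH: "0 \<le> ?qH t \<and> ?qH t < 4 * int k \<and> ?qK (?sh t) = ?qH t + 4 * int n \<and> (\<nexists>i. t = Ext i) \<or>
      4 * int k \<le> ?qH t \<and> ?qK (?sh t) = ?qH t + 4 * int n + int (ins G) \<and> (\<exists>i. t = Ext i)" if t: "t \<in> SH" for t
  proof (cases t)
    case (Vtx v j)
    then have "Vtx v j \<in> sources H" using SH t by blast
    then show ?thesis using Vtx spos_less[of v j H k] by (simp add: k_def)
  qed simp
  have e1: "arcs_sign ?pK ?qK SG = arcs_sign ?pG ?qG SG"
  proof -
    have "arcs_sign ?pK ?qK ((\<lambda>s. s) ` SG) = arcs_sign ?pG ?qG SG"
    proof (rule arcs_sign_image[OF fG(1) _ fG(2-4)])
      fix s t assume st: "s \<in> SG" "t \<in> SG"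
      show "(?pK s < ?pK t) = (?pG s < ?pG t)" "(?pK s < ?qK t) = (?pG s < ?qG t)"
        "(?qK s < ?pK t) = (?qG s < ?pG t)" "(?qK s < ?qK t) = (?qG s < ?qG t)"
        using pG(1,2)[OF st(1)] pG(1,2)[OF st(2)] qG[OF st(1)] qG[OF st(2)] by auto
    qed simp
    then show ?thesis by simp
  qed
  have e2: "arcs_sign ?pK ?qK (?sh ` SH) = arcs_sign ?pH ?qH SH"
  proof (rule arcs_sign_image[OF fH(1) _ fH(2-4)])
    fix s t assume st: "s \<in> SH" "t \<in> SH"
    show "(?pK (?sh s) < ?pK (?sh t)) = (?pH s < ?pH t)" using pH[OF st(1)] pH[OF st(2)] by auto
    show "(?pK (?sh s) < ?qK (?sh t)) = (?pH s < ?qH t)" using pH[OF st(1)] qH[OF st(2)] by auto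
    show "(?qK (?sh s) < ?pK (?sh t)) = (?qH s < ?pH t)" using qH[OF st(1)] pH[OF st(2)] by auto
    show "(?qK (?sh s) < ?qK (?sh t)) = (?qH s < ?qH t)" using qH[OF st(1)] qH[OF st(2)] by auto
  qed (simp add: inj_on_def)
  let ?\<eta> = "\<lambda>t. (if \<exists>i. wire H t = Ext i then -1 else 1) * (if \<exists>i. t = Ext i then -1 else 1 :: int)"
  have cr: "crossing ?pK ?qK s (?sh t) = (if \<exists>i. s = Ext i then ?\<eta> t else 1)" if s: "s \<in> SG" and t: "t \<in> SH" for s t
    unfolding crossing_def
    by (rule crossing_blocks[OF _ _ qG[OF s] pH[OF t] qH[OF t]]) (use pG[OF s] in \<open>simp_all add: spos_nonneg\<close>)
  have "(\<Prod>s\<in>SG. \<Prod>t\<in>?sh ` SH. crossing ?pK ?qK s t) = (\<Prod>s\<in>SG. \<Prod>t\<in>SH. crossing ?pK ?qK s (?sh t))"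
    by (simp add: prod.reindex inj_on_def)
  also have "\<dots> = (\<Prod>s\<in>SG. if \<exists>i. s = Ext i then (\<Prod>t\<in>SH. ?\<eta> t) else 1)"
    using cr by (intro prod.cong) auto
  also have "\<dots> = (\<Prod>t\<in>SH. ?\<eta> t) ^ card {s \<in> SG. \<exists>i. s = Ext i}"
    using fG(1) by (simp add: prod.If_cases Int_def)
  also have "(\<Prod>t\<in>SH. ?\<eta> t) = (-1) ^ (card {t \<in> SH. \<exists>i. wire H t = Ext i} + card {t \<in> SH. \<exists>i. t = Ext i})"
    unfolding prod.distrib prod_sign[OF fH(1)] by (simp add: power_add)
  finally have e3: "(\<Prod>s\<in>SG. \<Prod>t\<in>?sh ` SH. crossing ?pK ?qK s t) =
    (-1) ^ (card {s \<in> SG. \<exists>i. s = Ext i} * (card {t \<in> SH. \<exists>i. wire H t = Ext i} + card {t \<in> SH. \<exists>i. t = Ext i}))"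
    by (simp add: power_mult[symmetric] mult.commute)
  have "SG \<union> ?sh ` SH \<subseteq> sources K" using subK by blast
  then have "arcs_sign ?pK ?qK (SG \<union> ?sh ` SH) =
    arcs_sign ?pK ?qK SG * arcs_sign ?pK ?qK (?sh ` SH) * (\<Prod>s\<in>SG. \<Prod>t\<in>?sh ` SH. crossing ?pK ?qK s t)"
    by (intro arcs_sign_union fK disj) (use fG(1) fH(1) in auto)
  then show ?thesis unfolding e1 e2 e3 by (simp only: ac_simps)
qed

lemma src_gtensor:
  assumes G: "dag G" and H: "dag H"
  shows "t \<in> targets G \<Longrightarrow> src (gtensor G H) t = src G t"
    "u \<in> targets H \<Longrightarrow> src (gtensor G H) (shift (length (verts G)) (outs G) u) =
       shift (length (verts G)) (ins G) (src H u)"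
proof -
  note K = dag_gtensor[OF G H]
  show "src (gtensor G H) t = src G t" if "t \<in> targets G"
    using src(1,2)[OF G that] src(3)[OF K sources_gtensorI(1)] wire_gtensor_left by metis
  show "src (gtensor G H) (shift (length (verts G)) (outs G) u) = shift (length (verts G)) (ins G) (src H u)"
    if "u \<in> targets H"
    using src(1,2)[OF H that] src(3)[OF K sources_gtensorI(2)] wire_gtensor_right by metis
qed

lemma occ_count_ins:
  assumes "c \<in> colourings N G y x"
  shows "card {s \<in> {s \<in> sources G. occ (c s)}. \<exists>i. s = Ext i} = occ_count (ins G) x"
proof -
  have "{s \<in> {s \<in> sources G. occ (c s)}. \<exists>i. s = Ext i} = Ext ` {j. j < ins G \<and> occ (x j)}"
    using assms by (auto simp: colourings_def)
  then show ?thesis by (simp add: occ_count_def card_image inj_on_def)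
qed

lemma occ_count_outs:
  assumes "dag G" "c \<in> colourings N G y x"
  shows "card {s \<in> {s \<in> sources G. occ (c s)}. \<exists>i. wire G s = Ext i} = occ_count (outs G) y"
proof -
  have *: "src G (Ext p) \<in> sources G" "wire G (src G (Ext p)) = Ext p" "c (src G (Ext p)) = y p" if "p < outs G" for p
    using src(1,2)[OF assms(1), of "Ext p"] assms(2) that by (auto simp: colourings_def)
  have "{s \<in> {s \<in> sources G. occ (c s)}. \<exists>i. wire G s = Ext i} = (\<lambda>p. src G (Ext p)) ` {p. p < outs G \<and> occ (y p)}"
  proof (intro equalityI subsetI)
    fix s assume "s \<in> {s \<in> {s \<in> sources G. occ (c s)}. \<exists>i. wire G s = Ext i}"
    then obtain p where p: "s \<in> sources G" "occ (c s)" "wire G s = Ext p" by blast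
    then have "p < outs G" using dagD(1)[OF assms(1) p(1)] by simp
    moreover have "s = src G (Ext p)" using src(3)[OF assms(1) p(1)] p(3) by simp
    ultimately have "p \<in> {p. p < outs G \<and> occ (y p)}" "s = src G (Ext p)" using p(2) *(3)[of p] by auto
    then show "s \<in> (\<lambda>p. src G (Ext p)) ` {p. p < outs G \<and> occ (y p)}" by (rule rev_image_eqI)
  next
    fix s assume "s \<in> (\<lambda>p. src G (Ext p)) ` {p. p < outs G \<and> occ (y p)}"
    then obtain p where p: "p < outs G" "occ (y p)" "s = src G (Ext p)" by blast
    show "s \<in> {s \<in> {s \<in> sources G. occ (c s)}. \<exists>i. wire G s = Ext i}"
      unfolding p(3) using *[OF p(1)] p(2) by simp
  qed
  moreover have "inj_on (\<lambda>p. src G (Ext p)) {p. p < outs G \<and> occ (y p)}"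
  proof (rule inj_onI)
    fix p q assume pq: "p \<in> {p. p < outs G \<and> occ (y p)}" "q \<in> {p. p < outs G \<and> occ (y p)}"
      "src G (Ext p) = src G (Ext q)"
    have "wire G (src G (Ext p)) = Ext p" "wire G (src G (Ext q)) = Ext q"
      by (rule *(2); use pq in simp)+
    then show "p = q" unfolding pq(3) by simp
  qed
  ultimately show ?thesis by (simp add: occ_count_def card_image)
qed

text \<open>
  The sign of moving the right factor past the odd inputs of the left one: the degree of an
  operation has the parity of the number of its occupied legs.
\<close>

lemma Z_gtensor:
  assumes G: "dag G" and H: "dag H"
  shows "Z N (gtensor G H) y x =
    (-1) ^ (occ_count (ins G) x * (occ_count (outs H) (\<lambda>p. y (p + outs G)) + occ_count (ins H) (\<lambda>j. x (j + ins G)))) *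
    (Z N G y x * Z N H (\<lambda>p. y (p + outs G)) (\<lambda>j. x (j + ins G)))"
proof -
  let ?n = "length (verts G)" and ?k = "length (verts H)" and ?K = "gtensor G H"
  let ?sh = "shift ?n (ins G)" and ?y = "\<lambda>p. y (p + outs G)" and ?x = "\<lambda>j. x (j + ins G)"
  let ?D = "colourings N G y x \<times> colourings N H ?y ?x"
  define e where "e = (-1 :: int) ^ (occ_count (ins G) x * (occ_count (outs H) ?y + occ_count (ins H) ?x))"
  define \<Phi> where "\<Phi> = (\<lambda>c :: port \<Rightarrow> color. (restrict c (sources G), restrict (c \<circ> ?sh) (sources H)))"
  define \<Psi> where "\<Psi> = (\<lambda>(a :: port \<Rightarrow> color, b :: port \<Rightarrow> color).
     restrict (\<lambda>s. case s of Ext i \<Rightarrow> if i < ins G then a s else b (Ext (i - ins G))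
       | Vtx v j \<Rightarrow> if v < ?n then a s else b (Vtx (v - ?n) j)) (sources ?K))"
  have GK: "s \<in> sources ?K" if "s \<in> sources G" for s using sources_gtensorI(1)[OF that] .
  have shK: "?sh t \<in> sources ?K" if "t \<in> sources H" for t using sources_gtensorI(2)[OF that] .
  have psi_sh: "\<Psi> (a, b) (?sh t) = b t" if "t \<in> sources H" for a b t
    using shK[OF that] by (cases t) (simp_all add: \<Psi>_def)
  have psi_G: "\<Psi> (a, b) s = a s" if "s \<in> sources G" for a b s
    using GK[OF that] that by (cases s) (simp_all add: \<Psi>_def)
  have srcK: "src ?K (Ext p) = src G (Ext p)" if "p < outs G" for p
    using src_gtensor(1)[OF G H, of "Ext p"] that by simp
  have srcK': "src ?K (Ext (p + outs G)) = ?sh (src H (Ext p))" if "p < outs H" for p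
    using src_gtensor(2)[OF G H, of "Ext p"] that by simp
  have sG: "src G (Ext p) \<in> sources G" if "p < outs G" for p using src(1)[OF G, of "Ext p"] that by simp
  have sH: "src H (Ext p) \<in> sources H" if "p < outs H" for p using src(1)[OF H, of "Ext p"] that by simp
  have Phi: "\<Phi> c \<in> ?D" if c: "c \<in> colourings N ?K y x" for c
  proof -
    have cc: "c s \<in> colors N" if "s \<in> sources ?K" for s using c that by (auto simp: colourings_def)
    have 1: "c (src G (Ext p)) = y p" if "p < outs G" for p
    proof -
      have "c (src ?K (Ext p)) = y p" using c that by (simp add: colourings_def)
      then show ?thesis using srcK[OF that] by simp
    qed
    have 2: "c (?sh (src H (Ext p))) = ?y p" if "p < outs H" for p
    proof -
      have "c (src ?K (Ext (p + outs G))) = ?y p" using c that by (simp add: colourings_def)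
      then show ?thesis using srcK'[OF that] by simp
    qed
    have 3: "c (Ext j) = x j" if "j < ins G" for j using c that by (simp add: colourings_def)
    have 4: "c (?sh (Ext j)) = ?x j" if "j < ins H" for j using c that by (simp add: colourings_def)
    show ?thesis unfolding \<Phi>_def colourings_def
      using cc GK shK 1 2 3 4 sG sH by (auto simp del: shift.simps sources_iff(2))
  qed
  have Psi: "\<Psi> d \<in> colourings N ?K y x" if d: "d \<in> ?D" for d
  proof -
    obtain a b where ab: "d = (a, b)" "a \<in> colourings N G y x" "b \<in> colourings N H ?y ?x" using d by auto
    have "\<Psi> d s \<in> colors N" if s: "s \<in> sources ?K" for s
      using s
    proof (cases rule: sources_gtensor_cases)
      case left
      then show ?thesis using ab psi_G[of s a b] by (auto simp: colourings_def simp del: sources_iff)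
    next
      case (right t)
      then show ?thesis using ab psi_sh[of t a b] by (auto simp: colourings_def simp del: sources_iff)
    qed
    moreover have "\<Psi> d \<in> extensional (sources ?K)" by (simp add: \<Psi>_def ab)
    moreover have "\<Psi> d (Ext j) = x j" if "j < ins ?K" for j
    proof (cases "j < ins G")
      case True
      then show ?thesis using psi_G[of "Ext j" a b] ab by (simp add: colourings_def)
    next
      case False
      then show ?thesis using psi_sh[of "Ext (j - ins G)" a b] ab that by (simp add: colourings_def)
    qed
    moreover have "\<Psi> d (src ?K (Ext p)) = y p" if p: "p < outs ?K" for p
    proof (cases "p < outs G")
      case True
      then show ?thesis using srcK psi_G[OF sG] ab by (simp add: colourings_def)
    next
      case False
      then have q: "p - outs G < outs H" using p by simp
      have "\<Psi> d (src ?K (Ext (p - outs G + outs G))) = ?y (p - outs G)"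
        unfolding srcK'[OF q] using psi_sh[OF sH[OF q]] ab q by (simp add: colourings_def)
      then show ?thesis using False by simp
    qed
    ultimately show ?thesis by (auto simp: colourings_def PiE_def)
  qed
  have PsiPhi: "\<Psi> (\<Phi> c) = c" if c: "c \<in> colourings N ?K y x" for c
  proof
    fix s
    show "\<Psi> (\<Phi> c) s = c s"
    proof (cases "s \<in> sources ?K")
      case True
      then show ?thesis
      proof (cases rule: sources_gtensor_cases)
        case left
        then show ?thesis using psi_G[of s] by (simp add: \<Phi>_def del: sources_iff)
      next
        case (right t)
        then show ?thesis using psi_sh[of t] by (simp add: \<Phi>_def del: sources_iff)
      qed
    next
      case False
      then show ?thesis using c by (auto simp: \<Psi>_def \<Phi>_def colourings_def PiE_def extensional_def)
    qed
  qed
  have PhiPsi: "\<Phi> (\<Psi> d) = d" if d: "d \<in> ?D" for d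
  proof -
    obtain a b where ab: "d = (a, b)" "a \<in> colourings N G y x" "b \<in> colourings N H ?y ?x" using d by auto
    have "restrict (\<Psi> d) (sources G) = a"
      using psi_G ab by (intro ext) (auto simp: colourings_def PiE_def extensional_def simp del: sources_iff)
    moreover have "restrict (\<Psi> d \<circ> ?sh) (sources H) = b"
      using psi_sh ab by (intro ext) (auto simp: colourings_def PiE_def extensional_def simp del: sources_iff)
    ultimately show ?thesis by (simp add: \<Phi>_def ab(1))
  qed
  have tm: "(case \<Phi> c of (a, b) \<Rightarrow> e * (colour_term G a * colour_term H b)) = colour_term ?K c"
    if c: "c \<in> colourings N ?K y x" for c
  proof -
    let ?SG = "{s \<in> sources G. occ (c s)}" and ?SH = "{t \<in> sources H. occ ((c \<circ> ?sh) t)}"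
    have a: "restrict c (sources G) \<in> colourings N G y x" "restrict (c \<circ> ?sh) (sources H) \<in> colourings N H ?y ?x"
      using Phi[OF c] by (simp_all add: \<Phi>_def)
    have r: "{s \<in> sources G. occ (restrict c (sources G) s)} = ?SG"
      "{t \<in> sources H. occ (restrict (c \<circ> ?sh) (sources H) t)} = ?SH" by auto
    note oc = occ_count_ins[OF a(1), unfolded r] occ_count_ins[OF a(2), unfolded r] occ_count_outs[OF H a(2), unfolded r]
    have SK: "{s \<in> sources ?K. occ (c s)} = ?SG \<union> ?sh ` ?SH"
    proof (intro equalityI subsetI)
      fix s assume s: "s \<in> {s \<in> sources ?K. occ (c s)}"
      then have "s \<in> sources ?K" by simp
      then show "s \<in> ?SG \<union> ?sh ` ?SH"
        by (cases rule: sources_gtensor_cases) (use s in \<open>auto simp del: sources_iff\<close>)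
    qed (use GK shK in \<open>auto simp del: sources_iff\<close>)
    have sign: "colour_sign ?K c = e * (colour_sign G c * colour_sign H (c \<circ> ?sh))"
    proof -
      have "?SG \<subseteq> sources G" "?SH \<subseteq> sources H" by auto
      from arcs_sign_gtensor[OF G H this] show ?thesis
        unfolding colour_sign_def SK oc e_def by (simp only: gtensor_simps length_append mult.assoc)
    qed
    have w1: "weight (verts ?K ! v) (\<lambda>j. c (src ?K (Vtx v j))) (\<lambda>j. c (Vtx v j)) =
        weight (verts G ! v) (\<lambda>j. c (src G (Vtx v j))) (\<lambda>j. c (Vtx v j))" if v: "v < ?n" for v
    proof -
      have "c (src ?K (Vtx v j)) = c (src G (Vtx v j))" if "j < n_in (verts G ! v)" for j
        using src_gtensor(1)[OF G H, of "Vtx v j"] that v by simp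
      then show ?thesis using v by (cases "verts G ! v") (simp_all add: nth_append)
    qed
    have w2: "weight (verts ?K ! (v + ?n)) (\<lambda>j. c (src ?K (Vtx (v + ?n) j))) (\<lambda>j. c (Vtx (v + ?n) j)) =
        weight (verts H ! v) (\<lambda>j. (c \<circ> ?sh) (src H (Vtx v j))) (\<lambda>j. (c \<circ> ?sh) (Vtx v j))" if v: "v < ?k" for v
    proof -
      have "c (src ?K (Vtx (v + ?n) j)) = c (?sh (src H (Vtx v j)))" if "j < n_in (verts H ! v)" for j
        using src_gtensor(2)[OF G H, of "Vtx v j"] that v by simp
      then show ?thesis using v by (cases "verts H ! v") (simp_all add: nth_append)
    qed
    have "colour_term ?K c = e * (colour_term G c * colour_term H (c \<circ> ?sh))"
      unfolding colour_term_def sign using w1 w2 by (simp add: prod_lessThan_add)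
    also have "colour_term G c = colour_term G (restrict c (sources G))"
      by (rule colour_term_cong[OF G]) simp
    also have "colour_term H (c \<circ> ?sh) = colour_term H (restrict (c \<circ> ?sh) (sources H))"
      by (rule colour_term_cong[OF H]) simp
    finally show ?thesis by (simp only: \<Phi>_def prod.case)
  qed
  have "Z N ?K y x = (\<Sum>d\<in>?D. case d of (a, b) \<Rightarrow> e * (colour_term G a * colour_term H b))"
    unfolding Z_def by (rule sum.reindex_bij_witness[of _ \<Psi> \<Phi>]) (use PsiPhi PhiPsi Phi Psi tm in auto)
  also have "\<dots> = e * (\<Sum>(a, b)\<in>?D. colour_term G a * colour_term H b)"
    by (simp add: sum_distrib_left split_def)
  also have "\<dots> = e * (Z N G y x * Z N H ?y ?x)"
    by (simp add: Z_def sum_product sum.cartesian_product)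
  finally show ?thesis by (simp add: e_def)
qed

section \<open>Reordering the vertices\<close>

text \<open>
  Both ends of every arc, as points that can be moved independently of each other.
\<close>

definition half_edges :: "'a set \<Rightarrow> ('a + 'a) set" where
  "half_edges S = Inl ` S \<union> Inr ` S"

text \<open>
  This is \<open>-1\<close> iff the two points change their order.
\<close>

definition reversal :: "('b \<Rightarrow> int) \<Rightarrow> ('b \<Rightarrow> int) \<Rightarrow> 'b \<Rightarrow> 'b \<Rightarrow> int" where
  "reversal P P' h h' = kap (P h) (P h') * kap (P' h) (P' h')"

lemma reversal_sym:
  assumes "inj_on P S" "inj_on P' S" "h \<in> S" "h' \<in> S"
  shows "reversal P P' h h' = reversal P P' h' h"
proof (cases "h = h'")
  case False
  then have "P h \<noteq> P h'" "P' h \<noteq> P' h'" using assms by (auto dest: inj_onD)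
  then show ?thesis by (auto simp: reversal_def kap_def)
qed simp

lemma case_sum_inj_on:
  assumes "inj_on (case_sum p q) (half_edges S)"
  shows "inj_on p S" "inj_on q S" "p ` S \<inter> q ` S = {}"
proof -
  have *: "Inl s \<in> half_edges S" "Inr s \<in> half_edges S" if "s \<in> S" for s using that by (simp_all add: half_edges_def)
  show "inj_on p S" using inj_onD[OF assms _ *(1) *(1)] by (intro inj_onI) fastforce
  show "inj_on q S" using inj_onD[OF assms _ *(2) *(2)] by (intro inj_onI) fastforce
  show "p ` S \<inter> q ` S = {}" using inj_onD[OF assms _ *(1) *(2)] by fastforce
qed

text \<open>
  Moving the ends on the line multiplies the sign by one factor \<open>-1\<close> for every pair
  of ends that changes its order, as for a product of anticommuting elements.
\<close>

lemma arcs_sign_change: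
  fixes p q p' q' :: "'a::countable \<Rightarrow> int"
  assumes "finite S" "inj_on (case_sum p q) (half_edges S)" "inj_on (case_sum p' q') (half_edges S)"
  shows "arcs_sign p q S * arcs_sign p' q' S = upairs (reversal (case_sum p q) (case_sum p' q')) (half_edges S)"
  using assms
proof (induction S rule: finite_induct)
  case (insert a S)
  let ?r = "reversal (case_sum p q) (case_sum p' q')" and ?H = "half_edges S"
  have he: "half_edges (insert a S) = insert (Inl a) (insert (Inr a) ?H)" by (auto simp: half_edges_def)
  have fin: "finite ?H" "Inr a \<notin> ?H" "Inl a \<notin> insert (Inr a) ?H"
    using insert by (auto simp: half_edges_def)
  note sym = reversal_sym[OF insert.prems]
  have e1: "upairs ?r (half_edges (insert a S)) = upairs ?r (insert (Inr a) ?H) * (\<Prod>h\<in>insert (Inr a) ?H. ?r (Inl a) h)"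
    unfolding he by (rule upairs_insert) (use fin sym he in auto)
  have e2: "upairs ?r (insert (Inr a) ?H) = upairs ?r ?H * (\<Prod>h\<in>?H. ?r (Inr a) h)"
    by (rule upairs_insert) (use fin sym he in auto)
  have e3: "(\<Prod>h\<in>insert (Inr a) ?H. ?r (Inl a) h) = ?r (Inl a) (Inr a) * (\<Prod>h\<in>?H. ?r (Inl a) h)"
    using fin by simp
  have sub: "?H \<subseteq> half_edges (insert a S)" by (auto simp: he)
  have e4: "upairs ?r ?H = arcs_sign p q S * arcs_sign p' q' S"
    using insert.IH[OF inj_on_subset[OF insert.prems(1) sub] inj_on_subset[OF insert.prems(2) sub]] by simp
  have R: "upairs ?r (half_edges (insert a S)) = arcs_sign p q S * arcs_sign p' q' S *
    ((\<Prod>h\<in>?H. ?r (Inr a) h) * (\<Prod>h\<in>?H. ?r (Inl a) h)) * ?r (Inl a) (Inr a)"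
    unfolding e1 e2 e3 e4 by (simp only: ac_simps)
  have H: "(\<Prod>h\<in>?H. f h) = (\<Prod>s\<in>S. f (Inl s) * f (Inr s))" for f :: "'a + 'a \<Rightarrow> int"
    unfolding half_edges_def using insert.hyps(1)
    by (subst prod.union_disjoint) (auto simp: prod.reindex prod.distrib)
  have cs: "crossing p q s a = crossing p q a s" "crossing p' q' s a = crossing p' q' a s" if s: "s \<in> S" for s
    using crossing_sym[OF case_sum_inj_on[OF insert.prems(1)], of s a]
      crossing_sym[OF case_sum_inj_on[OF insert.prems(2)], of s a] s by simp_all
  have L: "arcs_sign p q (insert a S) = arcs_sign p q S * (kap (p a) (q a) * (\<Prod>s\<in>S. crossing p q a s))"
    "arcs_sign p' q' (insert a S) = arcs_sign p' q' S * (kap (p' a) (q' a) * (\<Prod>s\<in>S. crossing p' q' a s))"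
    using upairs_insert[OF insert.hyps, of "crossing p q"] upairs_insert[OF insert.hyps, of "crossing p' q'"] cs insert.hyps
    by (simp_all add: arcs_sign_def)
  have "(\<Prod>h\<in>?H. ?r (Inr a) h) * (\<Prod>h\<in>?H. ?r (Inl a) h) = (\<Prod>s\<in>S. crossing p q a s) * (\<Prod>s\<in>S. crossing p' q' a s)"
    unfolding H prod.distrib[symmetric] by (intro prod.cong) (simp_all add: reversal_def crossing_def)
  then show ?case unfolding R L by (simp add: reversal_def)
qed (simp add: arcs_sign_def half_edges_def)

text \<open>
  Rearranging whole blocks \<open>B v\<close> while keeping the order inside them: pairs of
  blocks are reversed as a whole, hence only the parities of their sizes matter.
\<close>

lemma upairs_blocks:
  fixes m :: nat
  assumes "finite E" "\<And>v. v < m \<Longrightarrow> finite (B v)" "\<And>v. v < m \<Longrightarrow> E \<inter> B v = {}"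
    "\<And>v w. v < w \<Longrightarrow> w < m \<Longrightarrow> B v \<inter> B w = {}"
    and sym: "\<And>h h'. h \<in> E \<union> (\<Union>v<m. B v) \<Longrightarrow> h' \<in> E \<union> (\<Union>v<m. B v) \<Longrightarrow> f h h' = f h' h"
    and E: "\<And>h h'. h \<in> E \<Longrightarrow> h' \<in> E \<union> (\<Union>v<m. B v) \<Longrightarrow> h \<noteq> h' \<Longrightarrow> f h h' = 1"
    and same: "\<And>v h h'. v < m \<Longrightarrow> h \<in> B v \<Longrightarrow> h' \<in> B v \<Longrightarrow> h \<noteq> h' \<Longrightarrow> f h h' = 1"
    and diff: "\<And>v w h h'. v < w \<Longrightarrow> w < m \<Longrightarrow> h \<in> B v \<Longrightarrow> h' \<in> B w \<Longrightarrow> f h h' = g v w"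
  shows "upairs f (E \<union> (\<Union>v<m. B v)) = (\<Prod>w<m. \<Prod>v<w. g v w ^ (card (B v) * card (B w)))"
  using assms
proof (induction m)
  case 0
  have "upairs f E = upairs (\<lambda>_ _. 1) E" using 0 by (intro upairs_cong) auto
  then show ?case by (simp add: upairs_def)
next
  case (Suc m)
  let ?U = "E \<union> (\<Union>v<m. B v)"
  have eq: "E \<union> (\<Union>v<Suc m. B v) = ?U \<union> B m" by (auto simp: less_Suc_eq)
  note sym = Suc.prems(5)[unfolded eq] and one = Suc.prems(6)[unfolded eq]
  have EB: "E \<inter> B v = {}" if "v < m" for v using Suc.prems(3)[OF less_SucI[OF that]] .
  have BB: "B v \<inter> B w = {}" if "v < w" "w < m" for v w using Suc.prems(4)[OF that(1) less_SucI[OF that(2)]] .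
  have fB: "finite (B v)" if "v < m" for v using Suc.prems(2)[OF less_SucI[OF that]] .
  have fin: "finite ?U" "finite (B m)" using Suc.prems(1,2) fB by auto
  have Bm: "B v \<inter> B m = {}" if "v < m" for v using Suc.prems(4)[OF that] by simp
  then have disj: "?U \<inter> B m = {}" using Suc.prems(3)[of m] by blast
  have "upairs f (?U \<union> B m) = upairs f ?U * upairs f (B m) * (\<Prod>h\<in>?U. \<Prod>h'\<in>B m. f h h')"
    by (rule upairs_union[OF fin disj sym])
  also have "upairs f ?U = (\<Prod>w<m. \<Prod>v<w. g v w ^ (card (B v) * card (B w)))"
  proof (rule Suc.IH[OF Suc.prems(1) fB EB BB])
    show "f h h' = f h' h" if "h \<in> ?U" "h' \<in> ?U" for h h' using that by (intro sym) blast+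
    show "f h h' = 1" if "h \<in> E" "h' \<in> ?U" "h \<noteq> h'" for h h' using that by (intro one) blast+
    show "f h h' = 1" if "v < m" "h \<in> B v" "h' \<in> B v" "h \<noteq> h'" for v h h'
      using that by (intro Suc.prems(7)[of v]) simp_all
    show "f h h' = g v w" if "v < w" "w < m" "h \<in> B v" "h' \<in> B w" for v w h h'
      using that by (intro Suc.prems(8)) simp_all
  qed
  also have "upairs f (B m) = 1"
  proof -
    have "upairs f (B m) = upairs (\<lambda>_ _. 1) (B m)" using Suc.prems(7)[of m] by (intro upairs_cong) auto
    then show ?thesis by (simp add: upairs_def)
  qed
  also have "(\<Prod>h\<in>?U. \<Prod>h'\<in>B m. f h h') = (\<Prod>v<m. g v m ^ (card (B v) * card (B m)))"
  proof -
    have dE: "E \<inter> (\<Union>v<m. B v) = {}" using EB by blast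
    have dB: "\<forall>v\<in>{..<m}. \<forall>w\<in>{..<m}. v \<noteq> w \<longrightarrow> B v \<inter> B w = {}"
      using BB by (metis inf_commute lessThan_iff linorder_neqE_nat)
    have "(\<Prod>h\<in>?U. \<Prod>h'\<in>B m. f h h') = (\<Prod>h\<in>E. \<Prod>h'\<in>B m. f h h') * (\<Prod>h\<in>(\<Union>v<m. B v). \<Prod>h'\<in>B m. f h h')"
      by (rule prod.union_disjoint[OF _ _ dE]) (use Suc.prems(1) fB in auto)
    also have "(\<Prod>h\<in>E. \<Prod>h'\<in>B m. f h h') = 1"
    proof (intro prod.neutral ballI)
      fix h h' assume h: "h \<in> E" "h' \<in> B m"
      then have "h \<noteq> h'" using Suc.prems(3)[of m] by auto
      with h show "f h h' = 1" by (intro one) simp_all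
    qed
    also have "(\<Prod>h\<in>(\<Union>v<m. B v). \<Prod>h'\<in>B m. f h h') = (\<Prod>v<m. \<Prod>h\<in>B v. \<Prod>h'\<in>B m. f h h')"
      by (rule prod.UNION_disjoint[OF _ _ dB]) (use fB in auto)
    also have "\<dots> = (\<Prod>v<m. \<Prod>h\<in>B v. \<Prod>h'\<in>B m. g v m)"
      by (intro prod.cong refl Suc.prems(8)) simp_all
    finally show ?thesis by (simp add: power_mult[symmetric] mult.commute)
  qed
  finally show ?case unfolding eq by simp
qed

lemma card_less_2: "card {j. j < (2::nat) \<and> P j} = (if P 0 then 1 else 0) + (if P 1 then 1 else 0)"
  and card_less_1: "card {j. j < Suc 0 \<and> P j} = (if P 0 then 1 else 0)"
proof -
  have *: "card {j. j < n \<and> P j} = (\<Sum>j<n. if P j then 1 else (0::nat))" for n :: nat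
    by (induction n) (simp_all add: less_Suc_eq conj_disj_distribR Collect_disj_eq Collect_conv_if card_insert_if)
  show "card {j. j < (2::nat) \<and> P j} = (if P 0 then 1 else 0) + (if P 1 then 1 else 0)"
    unfolding * by (simp add: numeral_2_eq_2)
  show "card {j. j < Suc 0 \<and> P j} = (if P 0 then 1 else 0)" unfolding * by simp
qed

text \<open>
  A vertex of nonzero weight has as many occupied flags as its degree, modulo two. This is what
  links crossings to the Koszul rule.
\<close>

lemma weight_parity:
  assumes "weight g a b \<noteq> 0"
  shows "odd (card {j. j < n_in g \<and> occ (a j)} + card {j. j < n_out g \<and> occ (b j)}) \<longleftrightarrow> odd (deg g)"
  using assms card_less_1[of "\<lambda>j. occ (a j)"] card_less_1[of "\<lambda>j. occ (b j)"]
  by (cases g) (auto simp: card_less_2 split: if_splits)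

lemma relabel_inj: "\<pi> permutes A \<Longrightarrow> relabel \<pi> s = relabel \<pi> t \<longleftrightarrow> s = t"
  by (cases s; cases t) (auto dest: permutes_inj injD)

lemma relabel_image:
  assumes "graph_iso \<pi> G H" "dag G"
  shows "relabel \<pi> ` sources G = sources H" "t \<in> targets G \<Longrightarrow> relabel \<pi> t \<in> targets H"
proof -
  have p: "\<pi> permutes {..<length (verts G)}" using assms by (simp add: graph_iso_def)
  have lt: "\<pi> v < length (verts G) \<longleftrightarrow> v < length (verts G)" for v using permutes_in_image[OF p, of v] by simp
  have vt: "verts H ! \<pi> v = verts G ! v" if "v < length (verts G)" for v using assms that by (simp add: graph_iso_def)
  have io: "ins H = ins G" "outs H = outs G" "length (verts H) = length (verts G)" using assms by (simp_all add: graph_iso_def)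
  show "relabel \<pi> t \<in> targets H" if "t \<in> targets G" using that lt vt io by (cases t) auto
  show "relabel \<pi> ` sources G = sources H"
  proof (intro equalityI subsetI)
    fix s assume "s \<in> relabel \<pi> ` sources G"
    then obtain u where "u \<in> sources G" "s = relabel \<pi> u" by blast
    then show "s \<in> sources H" using lt vt io by (cases u) auto
  next
    fix s assume s: "s \<in> sources H"
    show "s \<in> relabel \<pi> ` sources G"
    proof (cases s)
      case (Ext i)
      then show ?thesis using s io by (intro image_eqI[of _ _ "Ext i"]) auto
    next
      case (Vtx w j)
      then obtain v where v: "w = \<pi> v" using permutes_surj[OF p] by (metis surjD)
      then show ?thesis using s Vtx io lt vt by (intro image_eqI[of _ _ "Vtx v j"]) auto
    qed
  qed
qed

text \<open>
  The exponent of \<open>koszul_sign\<close>, over the integers.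
\<close>

definition inversions :: "(nat \<Rightarrow> nat) \<Rightarrow> graph \<Rightarrow> nat" where
  "inversions \<pi> G = card {(v, w). v < w \<and> w < length (verts G) \<and> \<pi> w < \<pi> v \<and>
     odd (deg (verts G ! v)) \<and> odd (deg (verts G ! w))}"

lemma arcs_sign_square: "arcs_sign p q S * arcs_sign p q S = 1"
proof -
  have c: "crossing p q s t * crossing p q s t = 1" for s t by (simp add: crossing_def kap_def)
  have "upairs (crossing p q) S * upairs (crossing p q) S = 1"
    unfolding upairs_mult[symmetric] c by (simp add: upairs_def)
  moreover have "(\<Prod>s\<in>S. kap (p s) (q s)) * (\<Prod>s\<in>S. kap (p s) (q s)) = 1"
    unfolding prod.distrib[symmetric] kap_square by simp
  ultimately show ?thesis unfolding arcs_sign_def by (simp add: ac_simps)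
qed

lemma prod_pairs_sign:
  fixes n :: nat
  shows "(\<Prod>w<n. \<Prod>v<w. if Q v w then -1 else 1 :: int) = (-1) ^ card {(v, w). v < w \<and> w < n \<and> Q v w}"
proof -
  let ?S = "Sigma {..<n} (\<lambda>w. {..<w})"
  have "(\<Prod>w<n. \<Prod>v<w. if Q v w then -1 else 1 :: int) = (\<Prod>(w, v)\<in>?S. if Q v w then -1 else 1)"
    by (rule prod.Sigma) simp_all
  also have "\<dots> = (\<Prod>p\<in>?S. if (case p of (w, v) \<Rightarrow> Q v w) then -1 else 1)"
    by (intro prod.cong) auto
  also have "\<dots> = (-1) ^ card {p \<in> ?S. case p of (w, v) \<Rightarrow> Q v w}" by (rule prod_sign) simp
  also have "card {p \<in> ?S. case p of (w, v) \<Rightarrow> Q v w} = card {(v, w). v < w \<and> w < n \<and> Q v w}"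
    by (rule bij_betw_same_card[of prod.swap]) (rule bij_betw_byWitness[of _ prod.swap], auto)
  finally show ?thesis .
qed

text \<open>
  Relabelling the vertices permutes the blocks of four places on the line, and the number of
  occupied ends in a block is odd iff the vertex has odd degree.
\<close>

lemma arcs_sign_iso:
  assumes G: "dag G" and H: "dag H" and iso: "graph_iso \<pi> G H" and S: "S \<subseteq> sources G"
    and par: "\<And>v. v < length (verts G) \<Longrightarrow>
      odd (card {j. j < n_in (verts G ! v) \<and> src G (Vtx v j) \<in> S} + card {j. j < n_out (verts G ! v) \<and> Vtx v j \<in> S})
        \<longleftrightarrow> odd (deg (verts G ! v))"
  shows "arcs_sign (\<lambda>s. tpos (wire H s)) (spos (length (verts H))) (relabel \<pi> ` S) =
    (-1) ^ inversions \<pi> G * arcs_sign (\<lambda>s. tpos (wire G s)) (spos (length (verts G))) S"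
proof -
  define n where "n = length (verts G)"
  have p: "\<pi> permutes {..<n}" and len: "length (verts H) = n"
    and w: "\<And>s. s \<in> sources G \<Longrightarrow> wire H (relabel \<pi> s) = relabel \<pi> (wire G s)"
    using iso by (auto simp: graph_iso_def n_def simp del: sources_iff)
  have pi_lt: "\<pi> v < n \<longleftrightarrow> v < n" for v using permutes_in_image[OF p, of v] by simp
  have pi_inj: "\<pi> v = \<pi> w \<longleftrightarrow> v = w" for v w using permutes_inj[OF p] by (auto dest: injD)
  let ?r = "relabel \<pi>"
  let ?p = "\<lambda>s. tpos (wire G s)" and ?q = "spos n" and ?p' = "\<lambda>s. tpos (?r (wire G s))" and ?q' = "\<lambda>s. spos n (?r s)"
  let ?P = "case_sum ?p ?q" and ?P' = "case_sum ?p' ?q'"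
  let ?HE = "half_edges S"
  define E where "E = Inl ` {s \<in> S. \<exists>i. wire G s = Ext i} \<union> Inr ` {s \<in> S. \<exists>i. s = Ext i}"
  define B where "B = (\<lambda>v. Inl ` {s \<in> S. \<exists>j. wire G s = Vtx v j} \<union> Inr ` {s \<in> S. \<exists>j. s = Vtx v j})"
  have rS: "?r ` S \<subseteq> sources H" using relabel_image(1)[OF iso G] S by blast
  note fG = pos_facts[OF G S, folded n_def] and fH = pos_facts[OF H rS, unfolded len]
  have rinj: "?r s = ?r t \<longleftrightarrow> s = t" for s t using relabel_inj[OF p] .
  have pq': "inj_on ?p' S" "inj_on ?q' S" "?p' ` S \<inter> ?q' ` S = {}"
  proof -
    have e: "tpos (wire H (?r s)) = ?p' s" if "s \<in> S" for s using w that S by auto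
    show "inj_on ?p' S" using inj_onD[OF fH(2)] e rinj by (intro inj_onI) (metis imageI)
    show "inj_on ?q' S" using inj_onD[OF fH(3)] rinj by (intro inj_onI) (metis imageI)
    show "?p' ` S \<inter> ?q' ` S = {}" using fH(4) e by fastforce
  qed
  have injP: "inj_on (case_sum a b) ?HE" if "inj_on a S" "inj_on b S" "a ` S \<inter> b ` S = {}" for a b :: "port \<Rightarrow> int"
  proof (rule inj_onI)
    fix h h' assume h: "h \<in> ?HE" "h' \<in> ?HE" "case_sum a b h = case_sum a b h'"
    have d: "a s \<noteq> b t" if "s \<in> S" "t \<in> S" for s t
      using \<open>a ` S \<inter> b ` S = {}\<close> that by blast
    have m: "s \<in> S" if "Inl s \<in> ?HE \<or> Inr s \<in> ?HE" for s using that by (auto simp: half_edges_def)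
    show "h = h'"
    proof (cases h)
      case l: (Inl s)
      show ?thesis
      proof (cases h')
        case (Inl t)
        then show ?thesis using l h m inj_onD[OF that(1), of s t] by simp
      next
        case (Inr t)
        then show ?thesis using l h m d[of s t] by simp
      qed
    next
      case r: (Inr s)
      show ?thesis
      proof (cases h')
        case (Inl t)
        then show ?thesis using r h m d[of t s] by simp
      next
        case (Inr t)
        then show ?thesis using r h m inj_onD[OF that(2), of s t] by simp
      qed
    qed
  qed
  have c1: "arcs_sign ?p ?q S * arcs_sign ?p' ?q' S = upairs (reversal ?P ?P') ?HE"
    by (rule arcs_sign_change[OF fG(1) injP[OF fG(2-4)] injP[OF pq']])
  have HE: "?HE = E \<union> (\<Union>v<n. B v)"
  proof (rule equalityI)
    show "?HE \<subseteq> E \<union> (\<Union>v<n. B v)"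
    proof
      fix h assume "h \<in> ?HE"
      then consider s where "s \<in> S" "h = Inl s" | s where "s \<in> S" "h = Inr s" by (auto simp: half_edges_def)
      then show "h \<in> E \<union> (\<Union>v<n. B v)"
      proof cases
        case 1
        have t: "wire G s \<in> targets G" using dagD(1)[OF G] S 1(1) by blast
        show ?thesis
        proof (cases "wire G s")
          case (Ext i)
          then show ?thesis using 1 unfolding E_def by blast
        next
          case (Vtx v j)
          then have "v < n" using port_bounds(1)[of v j G] t by (simp add: n_def)
          moreover have "h \<in> B v" using 1 Vtx unfolding B_def by blast
          ultimately show ?thesis by blast
        qed
      next
        case 2
        have t: "s \<in> sources G" using S 2(1) by blast
        show ?thesis
        proof (cases s)
          case (Ext i)
          then show ?thesis using 2 unfolding E_def by blast
        next
          case (Vtx v j)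
          then have "v < n" using port_bounds(2)[of v j G] t by (simp add: n_def)
          moreover have "h \<in> B v" using 2 Vtx unfolding B_def by blast
          ultimately show ?thesis by blast
        qed
      qed
    qed
    show "E \<union> (\<Union>v<n. B v) \<subseteq> ?HE" unfolding E_def B_def half_edges_def by blast
  qed
  have c2: "upairs (reversal ?P ?P') (E \<union> (\<Union>v<n. B v)) =
    (\<Prod>w<n. \<Prod>v<w. (if \<pi> w < \<pi> v then -1 else 1) ^ (card (B v) * card (B w)))"
  proof -
    have Bpos: "\<exists>k. 0 \<le> k \<and> k < 4 \<and> ?P h = 4 * int v + k \<and> ?P' h = 4 * int (\<pi> v) + k" if h: "h \<in> B v" for v h
    proof -
      from h consider s j where "s \<in> S" "wire G s = Vtx v j" "h = Inl s" | s j where "s \<in> S" "s = Vtx v j" "h = Inr s"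
        by (auto simp: B_def)
      then show ?thesis
      proof cases
        case 1
        have "wire G s \<in> targets G" using dagD(1)[OF G] S 1(1) by blast
        then have "j < 2" using port_bounds(1) 1(2) by metis
        then show ?thesis using 1 by (intro exI[of _ "int j"]) simp
      next
        case 2
        then have "Vtx v j \<in> sources G" using S by blast
        then have "j < 2" using port_bounds(2) by blast
        then show ?thesis using 2 by (intro exI[of _ "2 + int j"]) simp
      qed
    qed
    have Epos: "?P' h = ?P h \<and> (?P h < 0 \<or> 4 * int n \<le> ?P h)" if h: "h \<in> E" for h
      using h by (auto simp: E_def)
    have fin: "finite E" "finite (B v)" for v using fG(1) by (auto simp: E_def B_def)
    have dB: "B v \<inter> B w = {}" if "v < w" for v w
    proof (rule ccontr)
      assume "B v \<inter> B w \<noteq> {}"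
      then obtain h where "h \<in> B v" "h \<in> B w" by blast
      then show False using Bpos[of h v] Bpos[of h w] that by auto
    qed
    have dE: "E \<inter> B v = {}" if "v < n" for v
    proof (rule ccontr)
      assume "E \<inter> B v \<noteq> {}"
      then obtain h where "h \<in> E" "h \<in> B v" by blast
      then show False using Bpos[of h v] Epos[of h] that by auto
    qed
    have symr: "reversal ?P ?P' h h' = reversal ?P ?P' h' h" if "h \<in> E \<union> (\<Union>v<n. B v)" "h' \<in> E \<union> (\<Union>v<n. B v)" for h h'
      using reversal_sym[OF injP[OF fG(2-4)] injP[OF pq']] that unfolding HE by blast
    show ?thesis
    proof (rule upairs_blocks[OF fin(1) fin(2) dE dB symr])
      fix h h' assume h: "h \<in> E" "h' \<in> E \<union> (\<Union>v<n. B v)"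
      show "reversal ?P ?P' h h' = 1"
      proof (cases "h' \<in> E")
        case True
        then show ?thesis using Epos[OF h(1)] Epos[OF True] by (simp add: reversal_def kap_def)
      next
        case False
        then obtain v where v: "v < n" "h' \<in> B v" using h(2) by blast
        have "\<pi> v < n" using v(1) pi_lt by simp
        then show ?thesis using Epos[OF h(1)] Bpos[OF v(2)] v(1) by (auto simp: reversal_def kap_def)
      qed
    next
      fix v h h' assume h: "h \<in> B v" "h' \<in> B v"
      show "reversal ?P ?P' h h' = 1"
        using Bpos[OF h(1)] Bpos[OF h(2)] by (auto simp: reversal_def kap_def)
    next
      fix v w h h' assume vw: "v < w" and h: "h \<in> B v" "h' \<in> B w"
      have "\<pi> v \<noteq> \<pi> w" using vw pi_inj by simp
      then show "reversal ?P ?P' h h' = (if \<pi> w < \<pi> v then -1 else 1)"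
        using Bpos[OF h(1)] Bpos[OF h(2)] vw by (auto simp: reversal_def kap_def)
    qed
  qed
  have c3: "(\<Prod>w<n. \<Prod>v<w. (if \<pi> w < \<pi> v then -1 else 1 :: int) ^ (card (B v) * card (B w))) = (\<Prod>w<n. \<Prod>v<w. if \<pi> w < \<pi> v \<and> odd (deg (verts G ! v)) \<and> odd (deg (verts G ! w)) then -1 else 1)"
  proof (intro prod.cong refl)
    fix w v assume "w \<in> {..<n}" "v \<in> {..<w}"
    then have vw: "v < n" "w < n" by auto
    have cB: "odd (card (B v)) \<longleftrightarrow> odd (deg (verts G ! v))" if v: "v < n" for v
    proof -
      have sv: "src G (Vtx v j) \<in> sources G" "wire G (src G (Vtx v j)) = Vtx v j" if "j < n_in (verts G ! v)" for j
        using src(1,2)[OF G, of "Vtx v j"] that v by (auto simp: n_def)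
      have "{s \<in> S. \<exists>j. wire G s = Vtx v j} = (\<lambda>j. src G (Vtx v j)) ` {j. j < n_in (verts G ! v) \<and> src G (Vtx v j) \<in> S}"
      proof (intro equalityI subsetI)
        fix s assume "s \<in> {s \<in> S. \<exists>j. wire G s = Vtx v j}"
        then obtain j where s: "s \<in> S" "wire G s = Vtx v j" by blast
        then have sG: "s \<in> sources G" using S by blast
        then have "Vtx v j \<in> targets G" using dagD(1)[OF G sG] s(2) by simp
        moreover have "src G (Vtx v j) = s" using src(3)[OF G sG] s(2) by simp
        ultimately show "s \<in> (\<lambda>j. src G (Vtx v j)) ` {j. j < n_in (verts G ! v) \<and> src G (Vtx v j) \<in> S}"
          using s(1) by (intro image_eqI[of _ _ j]) auto
      next
        fix s assume "s \<in> (\<lambda>j. src G (Vtx v j)) ` {j. j < n_in (verts G ! v) \<and> src G (Vtx v j) \<in> S}"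
        then show "s \<in> {s \<in> S. \<exists>j. wire G s = Vtx v j}" using sv(2) by blast
      qed
      moreover have "inj_on (\<lambda>j. src G (Vtx v j)) {j. j < n_in (verts G ! v) \<and> src G (Vtx v j) \<in> S}"
      proof (rule inj_onI)
        fix i j assume ij: "i \<in> {j. j < n_in (verts G ! v) \<and> src G (Vtx v j) \<in> S}"
          "j \<in> {j. j < n_in (verts G ! v) \<and> src G (Vtx v j) \<in> S}" "src G (Vtx v i) = src G (Vtx v j)"
        have "wire G (src G (Vtx v i)) = Vtx v i" "wire G (src G (Vtx v j)) = Vtx v j"
          by (rule sv(2); use ij in simp)+
        then show "i = j" unfolding ij(3) by simp
      qed
      ultimately have c1: "card {s \<in> S. \<exists>j. wire G s = Vtx v j} = card {j. j < n_in (verts G ! v) \<and> src G (Vtx v j) \<in> S}"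
        by (simp add: card_image)
      have "{s \<in> S. \<exists>j. s = Vtx v j} = Vtx v ` {j. j < n_out (verts G ! v) \<and> Vtx v j \<in> S}"
        using S by (auto simp: subset_iff)
      then have c2: "card {s \<in> S. \<exists>j. s = Vtx v j} = card {j. j < n_out (verts G ! v) \<and> Vtx v j \<in> S}"
        by (simp add: card_image inj_on_def)
      have "card (B v) = card (Inl ` {s \<in> S. \<exists>j. wire G s = Vtx v j} :: (port + port) set) + card (Inr ` {s \<in> S. \<exists>j. s = Vtx v j} :: (port + port) set)"
        unfolding B_def using fG(1) by (intro card_Un_disjoint) auto
      then have "card (B v) = card {s \<in> S. \<exists>j. wire G s = Vtx v j} + card {s \<in> S. \<exists>j. s = Vtx v j}"
        by (simp add: card_image)
      then show ?thesis using par[of v] v unfolding c1 c2 n_def by simp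
    qed
    show "(if \<pi> w < \<pi> v then -1 else 1 :: int) ^ (card (B v) * card (B w)) =
      (if \<pi> w < \<pi> v \<and> odd (deg (verts G ! v)) \<and> odd (deg (verts G ! w)) then -1 else 1)"
      using cB[OF vw(1)] cB[OF vw(2)] by (auto simp: uminus_power_if)
  qed
  have R: "arcs_sign ?p ?q S * arcs_sign ?p' ?q' S = (-1) ^ inversions \<pi> G"
    unfolding c1 HE c2 c3 prod_pairs_sign by (simp add: inversions_def n_def)
  have m: "arcs_sign (\<lambda>s. tpos (wire H s)) ?q (?r ` S) = arcs_sign ?p' ?q' S"
  proof (rule arcs_sign_image[OF fG(1) _ pq'])
    show "inj_on ?r S" using rinj by (auto simp: inj_on_def)
  qed (use w subsetD[OF S] in simp_all)
  have "arcs_sign ?p' ?q' S = (arcs_sign ?p ?q S * arcs_sign ?p ?q S) * arcs_sign ?p' ?q' S"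
    by (simp add: arcs_sign_square)
  then have "arcs_sign ?p' ?q' S = (-1) ^ inversions \<pi> G * arcs_sign ?p ?q S"
    unfolding R[symmetric] by (simp only: ac_simps)
  then show ?thesis unfolding m[symmetric] by (simp add: len n_def)
qed

lemma weight_cong':
  assumes "\<And>j. j < n_in g \<Longrightarrow> a j = a' j" "\<And>j. j < n_out g \<Longrightarrow> b j = b' j" "g = g'"
  shows "weight g a b = weight g' a' b'"
  using assms(1)[of 0] assms(1)[of 1] assms(2)[of 0] assms(2)[of 1] assms(3) by (cases g) auto

lemma Z_iso:
  assumes G: "dag G" and H: "dag H" and iso: "graph_iso \<pi> G H"
  shows "Z N G y x = (-1) ^ inversions \<pi> G * Z N H y x"
proof -
  let ?r = "relabel \<pi>" and ?n = "length (verts G)"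
  have p: "\<pi> permutes {..<?n}" and len: "length (verts H) = ?n"
    and io: "ins H = ins G" "outs H = outs G"
    and ve: "\<And>v. v < ?n \<Longrightarrow> verts H ! \<pi> v = verts G ! v"
    and w: "\<And>s. s \<in> sources G \<Longrightarrow> wire H (?r s) = ?r (wire G s)"
    using iso by (auto simp: graph_iso_def simp del: sources_iff)
  have rinj: "?r s = ?r t \<longleftrightarrow> s = t" for s t using relabel_inj[OF p] .
  have im: "?r ` sources G = sources H" using relabel_image(1)[OF iso G] .
  have sH: "src H (?r t) = ?r (src G t)" if "t \<in> targets G" for t
  proof -
    have "src G t \<in> sources G" "wire G (src G t) = t" using src(1,2)[OF G that] .
    then have "wire H (?r (src G t)) = ?r t" "?r (src G t) \<in> sources H" using w im by auto
    then show ?thesis using src(3)[OF H] by metis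
  qed
  let ?f = "\<lambda>c. restrict (c \<circ> ?r) (sources G)"
  define g where "g = (\<lambda>c :: port \<Rightarrow> color. restrict (\<lambda>s. c (inv_into (sources G) ?r s)) (sources H))"
  have inv: "inv_into (sources G) ?r (?r s) = s" if "s \<in> sources G" for s
    using that rinj by (intro inv_into_f_f) (auto simp: inj_on_def)
  have T: "Ext p' \<in> targets G \<longleftrightarrow> p' < outs G" for p' by simp
  have bij: "bij_betw ?f (colourings N H y x) (colourings N G y x)"
  proof (rule bij_betw_byWitness[where f' = g])
    have e: "c \<in> extensional (sources H)" if "c \<in> colourings N H y x" for c
      using that by (auto simp: colourings_def PiE_def)
    show "\<forall>c\<in>colourings N H y x. g (?f c) = c"
    proof (intro ballI extensionalityI[OF _ e])
      fix c s assume c: "c \<in> colourings N H y x" and s: "s \<in> sources H"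
      then obtain u where "u \<in> sources G" "s = ?r u" using im by blast
      then show "g (?f c) s = c s" using inv s by (simp add: g_def del: sources_iff)
    qed (simp_all add: g_def)
    show "\<forall>c\<in>colourings N G y x. ?f (g c) = c"
    proof (intro ballI extensionalityI)
      fix c s assume c: "c \<in> colourings N G y x" and s: "s \<in> sources G"
      then have "?r s \<in> sources H" using im by blast
      then show "?f (g c) s = c s" using inv s by (simp add: g_def del: sources_iff)
    qed (auto simp: g_def colourings_def PiE_def)
    show "?f ` colourings N H y x \<subseteq> colourings N G y x"
    proof (rule image_subsetI)
      fix c assume c: "c \<in> colourings N H y x"
      have "?r s \<in> sources H" if "s \<in> sources G" for s using that im by blast
      moreover have "src G (Ext q) \<in> sources G" "?r (src G (Ext q)) = src H (Ext q)" if "q < outs G" for q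
        using sH[of "Ext q"] src(1)[OF G, of "Ext q"] that by auto
      ultimately show "?f c \<in> colourings N G y x"
        using c io by (simp add: colourings_def PiE_iff del: sources_iff) (simp del: sources_iff(2))
    qed
    show "g ` colourings N G y x \<subseteq> colourings N H y x"
    proof (rule image_subsetI)
      fix c assume c: "c \<in> colourings N G y x"
      have 1: "g c s \<in> colors N" if "s \<in> sources H" for s
      proof -
        have "s \<in> ?r ` sources G" unfolding im by (rule that)
        then obtain u where "u \<in> sources G" "s = ?r u" by (rule imageE) simp
        moreover have "g c s = c (inv_into (sources G) ?r s)" using that by (simp add: g_def del: sources_iff)
        ultimately have "g c s = c u" using inv by simp
        moreover have "c u \<in> colors N" using c \<open>u \<in> sources G\<close> unfolding colourings_def by blast
        ultimately show ?thesis by simp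
      qed
      have gr: "g c (?r s) = c s" if "s \<in> sources G" for s
        using that inv im by (auto simp: g_def simp del: sources_iff)
      have 2: "g c (Ext j) = x j" if "j < ins H" for j
        using gr[of "Ext j"] that io c by (simp add: colourings_def)
      have 3: "g c (src H (Ext q)) = y q" if "q < outs H" for q
        using gr[of "src G (Ext q)"] sH[of "Ext q"] src(1)[OF G, of "Ext q"] that io c by (simp add: colourings_def)
      show "g c \<in> colourings N H y x"
        unfolding colourings_def using 1 2 3 by (auto simp: PiE_iff g_def simp del: sources_iff)
    qed
  qed
  have tm: "colour_term G (?f c) = (-1) ^ inversions \<pi> G * colour_term H c" for c
  proof -
    let ?wG = "\<lambda>v. weight (verts G ! v) (\<lambda>j. ?f c (src G (Vtx v j))) (\<lambda>j. ?f c (Vtx v j))"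
    let ?wH = "\<lambda>v. weight (verts H ! v) (\<lambda>j. c (src H (Vtx v j))) (\<lambda>j. c (Vtx v j))"
    have wt: "?wG v = ?wH (\<pi> v)" if v: "v < ?n" for v
    proof -
      have a: "?f c (src G (Vtx v j)) = c (src H (Vtx (\<pi> v) j))" if "j < n_in (verts G ! v)" for j
        using sH[of "Vtx v j"] src(1)[OF G, of "Vtx v j"] that v by simp
      have b: "?f c (Vtx v j) = c (Vtx (\<pi> v) j)" if "j < n_out (verts G ! v)" for j
        using that v by simp
      show ?thesis using a b ve[OF v, symmetric] by (intro weight_cong') simp_all
    qed
    have pr: "(\<Prod>v<?n. ?wG v) = (\<Prod>v<length (verts H). ?wH v)"
    proof -
      have "(\<Prod>v<?n. ?wG v) = (\<Prod>v<?n. ?wH (\<pi> v))" using wt by (intro prod.cong) simp_all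
      then show ?thesis using prod.permute[OF p, of ?wH] by (simp add: len comp_def)
    qed
    show ?thesis
    proof (cases "(\<Prod>v<?n. ?wG v) = 0")
      case True
      have "(\<Prod>v<length (verts H). ?wH v) = 0" using pr True by (simp only:)
      then show ?thesis unfolding colour_term_def using True by (simp only: mult_zero_right)
    next
      case False
      let ?S = "{s \<in> sources G. occ (?f c s)}"
      have "{s \<in> sources H. occ (c s)} = ?r ` ?S" using im by (auto simp del: sources_iff)
      moreover have "arcs_sign (\<lambda>s. tpos (wire H s)) (spos (length (verts H))) (?r ` ?S) =
        (-1) ^ inversions \<pi> G * arcs_sign (\<lambda>s. tpos (wire G s)) (spos ?n) ?S"
      proof (rule arcs_sign_iso[OF G H iso])
        fix v assume v: "v < ?n"
        then have "?wG v \<noteq> 0" using False by simp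
        note nz = weight_parity[OF this]
        show "odd (card {j. j < n_in (verts G ! v) \<and> src G (Vtx v j) \<in> ?S} +
          card {j. j < n_out (verts G ! v) \<and> Vtx v j \<in> ?S}) \<longleftrightarrow> odd (deg (verts G ! v))"
        proof -
          have "{j. j < n_in (verts G ! v) \<and> src G (Vtx v j) \<in> ?S} = {j. j < n_in (verts G ! v) \<and> occ (?f c (src G (Vtx v j)))}"
            using src(1)[OF G] v by auto
          moreover have "{j. j < n_out (verts G ! v) \<and> Vtx v j \<in> ?S} = {j. j < n_out (verts G ! v) \<and> occ (?f c (Vtx v j))}"
            using v by auto
          ultimately show ?thesis using nz by simp
        qed
      qed auto
      ultimately show ?thesis using pr unfolding colour_term_def colour_sign_def
        by (simp add: mult.assoc[symmetric] power_add[symmetric] mult_2[symmetric])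
    qed
  qed
  have "Z N G y x = (\<Sum>c\<in>colourings N H y x. colour_term G (?f c))"
    unfolding Z_def by (rule sum.reindex_bij_betw[OF bij, symmetric])
  then show ?thesis unfolding Z_def tm sum_distrib_left .
qed

section \<open>State sums of the relations\<close>

text \<open>
  The colours of the outer edges are dictated by the states, so the sum runs over the colours of
  the set \<open>I\<close> of inner edges only.
\<close>

lemma Z_internal:
  assumes K: "dag K" and I: "I \<subseteq> sources K"
    and ext: "\<And>s. s \<in> sources K \<Longrightarrow> s \<notin> I \<Longrightarrow> (\<exists>j. s = Ext j) \<noteq> (\<exists>p. wire K s = Ext p)"
    and int: "\<And>s. s \<in> I \<Longrightarrow> (\<nexists>j. s = Ext j) \<and> (\<nexists>p. wire K s = Ext p)"
    and x: "\<And>j. x j \<in> colors N" and y: "\<And>p. y p \<in> colors N"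
  defines "cf \<equiv> \<lambda>f s. if s \<in> I then f s else case s of Ext j \<Rightarrow> x j | Vtx v i \<Rightarrow> (case wire K s of Ext p \<Rightarrow> y p | Vtx _ _ \<Rightarrow> y 0)"
  shows "Z N K y x = (\<Sum>f\<in>I \<rightarrow>\<^sub>E colors N. colour_term K (cf f))"
proof -
  let ?h = "\<lambda>f. restrict (cf f) (sources K)"
  have cI: "cf f s = f s" if "s \<in> I" for f s using that by (simp add: cf_def)
  have cE: "cf f (Ext j) = x j" if "j < ins K" for f j
    using int[of "Ext j"] by (auto simp: cf_def)
  have cO: "cf f s = y p" if "s \<in> sources K" "wire K s = Ext p" for f s p
  proof -
    have "s \<notin> I" using int that(2) by blast
    moreover have "\<nexists>j. s = Ext j" using ext[OF that(1) calculation] that(2) by blast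
    ultimately show ?thesis using that(2) by (cases s) (auto simp: cf_def)
  qed
  have cX: "c s = cf c s" if c: "c \<in> colourings N K y x" and s: "s \<in> sources K" for c s
  proof (cases "s \<in> I")
    case False
    show ?thesis
    proof (cases "\<exists>j. s = Ext j")
      case True
      then show ?thesis using cE c s by (auto simp: colourings_def)
    next
      case n: False
      then obtain p where p: "wire K s = Ext p" using ext[OF s False] by blast
      then have "Ext p \<in> targets K" using dagD(1)[OF K s] by simp
      then have "p < outs K" by simp
      moreover have "src K (Ext p) = s" using src(3)[OF K s] p by simp
      ultimately show ?thesis using cO[OF s p] c by (auto simp: colourings_def)
    qed
  qed (simp add: cI)
  have cc: "cf f = cf (restrict f I)" for f by (auto simp: cf_def fun_eq_iff)
  have bij: "bij_betw ?h (I \<rightarrow>\<^sub>E colors N) (colourings N K y x)"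
  proof (rule bij_betw_byWitness[where f' = "\<lambda>c. restrict c I"])
    show "\<forall>f\<in>I \<rightarrow>\<^sub>E colors N. restrict (?h f) I = f"
    proof (intro ballI extensionalityI[of _ I])
      fix f s assume "f \<in> I \<rightarrow>\<^sub>E colors N" "s \<in> I"
      then show "restrict (?h f) I s = f s" using cI subsetD[OF I, of s] by (simp del: sources_iff)
    qed (auto simp: PiE_def)
    show "\<forall>c\<in>colourings N K y x. ?h (restrict c I) = c"
    proof (intro ballI extensionalityI[of _ "sources K"])
      fix c s assume "c \<in> colourings N K y x" "s \<in> sources K"
      then show "?h (restrict c I) s = c s" using cX[of c s] cc[of c] by (simp del: sources_iff)
    qed (auto simp: PiE_def colourings_def)
    show "?h ` (I \<rightarrow>\<^sub>E colors N) \<subseteq> colourings N K y x"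
    proof (rule image_subsetI)
      fix f assume f: "f \<in> I \<rightarrow>\<^sub>E colors N"
      have "cf f s \<in> colors N" for s
        using f x y by (auto simp: cf_def split: port.split)
      moreover have "src K (Ext p) \<in> sources K" "cf f (src K (Ext p)) = y p" if "p < outs K" for p
        using src(1,2)[OF K, of "Ext p"] cO[of "src K (Ext p)" p] that by simp_all
      ultimately show "?h f \<in> colourings N K y x"
        using cE by (simp add: colourings_def)
    qed
    show "(\<lambda>c. restrict c I) ` colourings N K y x \<subseteq> I \<rightarrow>\<^sub>E colors N"
    proof (rule image_subsetI)
      fix c assume "c \<in> colourings N K y x"
      then have "c s \<in> colors N" if "s \<in> sources K" for s using that unfolding colourings_def by blast
      then show "restrict c I \<in> I \<rightarrow>\<^sub>E colors N" using I by auto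
    qed
  qed
  have "Z N K y x = (\<Sum>f\<in>I \<rightarrow>\<^sub>E colors N. colour_term K (?h f))"
    unfolding Z_def by (rule sum.reindex_bij_betw[OF bij, symmetric])
  also have "\<dots> = (\<Sum>f\<in>I \<rightarrow>\<^sub>E colors N. colour_term K (cf f))"
    by (intro sum.cong refl colour_term_cong[OF K]) simp
  finally show ?thesis .
qed

text \<open>
  A conditional sign that the simplifier does not split; this keeps the computed signs in the
  form of products.
\<close>

definition sel :: "bool \<Rightarrow> int \<Rightarrow> int" where "sel b c = (if b then c else 1)"

fun sign_row :: "('a \<Rightarrow> int) \<Rightarrow> ('a \<Rightarrow> int) \<Rightarrow> ('a \<Rightarrow> bool) \<Rightarrow> 'a \<Rightarrow> 'a list \<Rightarrow> int" where
  "sign_row p q P s [] = 1"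
| "sign_row p q P s (t # L) = sel (P s \<and> P t) (crossing p q s t) * sign_row p q P s L"

fun sign_list :: "('a \<Rightarrow> int) \<Rightarrow> ('a \<Rightarrow> int) \<Rightarrow> ('a \<Rightarrow> bool) \<Rightarrow> 'a list \<Rightarrow> int" where
  "sign_list p q P [] = 1"
| "sign_list p q P (s # L) = sel (P s) (kap (p s) (q s)) * sign_row p q P s L * sign_list p q P L"

lemma sign_row_prod: "P s \<Longrightarrow> distinct L \<Longrightarrow> sign_row p q P s L = (\<Prod>t\<in>{t \<in> set L. P t}. crossing p q s t)"
  "\<not> P s \<Longrightarrow> sign_row p q P s L = 1"
proof -
  show "P s \<Longrightarrow> distinct L \<Longrightarrow> sign_row p q P s L = (\<Prod>t\<in>{t \<in> set L. P t}. crossing p q s t)"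
  proof (induction L)
    case (Cons t L)
    have "{u \<in> set (t # L). P u} = (if P t then insert t {u \<in> set L. P u} else {u \<in> set L. P u})" by auto
    then show ?case using Cons by (simp add: sel_def)
  qed simp
  show "\<not> P s \<Longrightarrow> sign_row p q P s L = 1" by (induction L) (auto simp: sel_def)
qed

lemma arcs_sign_list:
  assumes "distinct L" "inj_on p (set L)" "inj_on q (set L)" "p ` set L \<inter> q ` set L = {}"
  shows "arcs_sign p q {s \<in> set L. P s} = sign_list p q P L"
  using assms
proof (induction L)
  case (Cons s L)
  let ?S = "{t \<in> set L. P t}"
  have IH: "arcs_sign p q ?S = sign_list p q P L" using Cons by auto
  show ?case
  proof (cases "P s")
    case True
    have eq: "{t \<in> set (s # L). P t} = insert s ?S" using True by auto
    have "upairs (crossing p q) (insert s ?S) = upairs (crossing p q) ?S * (\<Prod>t\<in>?S. crossing p q s t)"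
      by (rule upairs_insert) (use Cons.prems crossing_sym[OF Cons.prems(2-4)] in auto)
    then show ?thesis using True Cons.prems IH unfolding eq
      by (simp add: arcs_sign_def sign_row_prod(1) sel_def)
  next
    case False
    then have eq: "{t \<in> set (s # L). P t} = ?S" by auto
    then show ?thesis using False IH sign_row_prod(2)[of P s] by (simp add: sel_def)
  qed
qed (simp add: arcs_sign_def)

lemma colour_term_list:
  assumes "dag G" "distinct L" "sources G = set L"
  shows "colour_term G c = sign_list (\<lambda>s. tpos (wire G s)) (spos (length (verts G))) (\<lambda>s. occ (c s)) L *
    (\<Prod>v<length (verts G). weight (verts G ! v) (\<lambda>j. c (src G (Vtx v j))) (\<lambda>j. c (Vtx v j)))"
  using arcs_sign_list[OF assms(2)] pos_facts[OF assms(1) order.refl] assms(3)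
  by (simp add: colour_term_def colour_sign_def)

lemma srcI: "dag G \<Longrightarrow> s \<in> sources G \<Longrightarrow> wire G s = t \<Longrightarrow> src G t = s"
  using src(3) by blast

lemma sum_colors_support:
  assumes "i < N" "j < N" "\<And>k l p. k < N \<Longrightarrow> l < N \<Longrightarrow> k \<noteq> i \<or> l \<noteq> j \<Longrightarrow> f (k, l, p) = 0"
  shows "(\<Sum>a\<in>colors N. f a) = f (i, j, True) + (f (i, j, False) :: int)"
proof -
  have "(\<Sum>a\<in>colors N. f a) = (\<Sum>a\<in>{(i, j, True), (i, j, False)}. f a)"
  proof (rule sum.mono_neutral_right)
    show "\<forall>a\<in>colors N - {(i, j, True), (i, j, False)}. f a = 0"
    proof
      fix a assume a: "a \<in> colors N - {(i, j, True), (i, j, False)}"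
      obtain k l p where "a = (k, l, p)" by (cases a) auto
      then show "f a = 0" using a assms(3)[of k l p] by (cases p) (auto simp: colors_def)
    qed
  qed (use assms in \<open>auto simp: colors_def\<close>)
  then show ?thesis by simp
qed

lemma sum_single_PiE: "(\<Sum>f\<in>{s} \<rightarrow>\<^sub>E A. g f) = (\<Sum>a\<in>A. g (\<lambda>t. if t = s then a else undefined))"
proof (rule sum.reindex_bij_witness[of _ "\<lambda>a t. if t = s then a else undefined" "\<lambda>f. f s"])
  fix f assume "f \<in> {s} \<rightarrow>\<^sub>E A"
  then show e: "(\<lambda>t. if t = s then f s else undefined) = f" by (auto simp: PiE_iff extensional_def fun_eq_iff)
  show "g (\<lambda>t. if t = s then f s else undefined) = g f" unfolding e ..
qed (auto simp: PiE_iff extensional_def)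

text \<open>
  The summand of the state sum of a graph with one inner edge \<open>s\<close>, as a function of
  the colour of \<open>s\<close>.
\<close>

definition edge_term :: "graph \<Rightarrow> port list \<Rightarrow> port \<Rightarrow> (nat \<Rightarrow> color) \<Rightarrow> (nat \<Rightarrow> color) \<Rightarrow> color \<Rightarrow> int" where
  "edge_term K L s y x a = (let c = \<lambda>t. if t = s then a else case t of Ext j \<Rightarrow> x j
       | Vtx v i \<Rightarrow> (case wire K t of Ext p \<Rightarrow> y p | Vtx _ _ \<Rightarrow> y 0) in
     sign_list (\<lambda>s. tpos (wire K s)) (spos (length (verts K))) (\<lambda>s. occ (c s)) L *
     (\<Prod>v<length (verts K). weight (verts K ! v) (\<lambda>j. c (src K (Vtx v j))) (\<lambda>j. c (Vtx v j))))"

definition edge_sum :: "graph \<Rightarrow> port list \<Rightarrow> port \<Rightarrow> (nat \<Rightarrow> color) \<Rightarrow> (nat \<Rightarrow> color) \<Rightarrow> nat \<Rightarrow> nat \<Rightarrow> int" where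
  "edge_sum K L s y x i j = edge_term K L s y x (i, j, True) + edge_term K L s y x (i, j, False)"

text \<open>
  Both indices of the colour of the inner edge are determined by the other flags at one of its
  vertices, so only its parity is summed over.
\<close>

lemma Z_one_internal:
  assumes K: "dag K" and L: "distinct L" "sources K = set L" and s: "s \<in> set L"
    and ext: "\<forall>t\<in>set L. t \<noteq> s \<longrightarrow> (\<exists>j. t = Ext j) \<noteq> (\<exists>p. wire K t = Ext p)"
    and int: "(\<nexists>j. s = Ext j) \<and> (\<nexists>p. wire K s = Ext p)"
    and x: "\<And>j. x j \<in> colors N" and y: "\<And>p. y p \<in> colors N" and ij: "i < N" "j < N"
    and supp: "\<And>k l p. k \<noteq> i \<or> l \<noteq> j \<Longrightarrow> edge_term K L s y x (k, l, p) = 0"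
  shows "Z N K y x = edge_sum K L s y x i j"
proof -
  let ?cf = "\<lambda>a t. if t = s then a else case t of Ext j \<Rightarrow> x j | Vtx v i \<Rightarrow> (case wire K t of Ext p \<Rightarrow> y p | Vtx _ _ \<Rightarrow> y 0)"
  have "Z N K y x = (\<Sum>f\<in>{s} \<rightarrow>\<^sub>E colors N. colour_term K (\<lambda>t. if t \<in> {s} then f t else case t of Ext j \<Rightarrow> x j | Vtx v i \<Rightarrow> (case wire K t of Ext p \<Rightarrow> y p | Vtx _ _ \<Rightarrow> y 0)))"
    by (rule Z_internal[OF K _ _ _ x y]) (use L s ext int in auto)
  also have "\<dots> = (\<Sum>a\<in>colors N. colour_term K (?cf a))"
    unfolding sum_single_PiE by (intro sum.cong refl arg_cong[of _ _ "colour_term K"]) auto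
  also have "\<dots> = (\<Sum>a\<in>colors N. edge_term K L s y x a)"
    unfolding colour_term_list[OF K L] edge_term_def Let_def ..
  also have "\<dots> = edge_sum K L s y x i j"
    unfolding edge_sum_def
    by (rule sum_colors_support[OF ij]) (rule supp)
  finally show ?thesis .
qed

lemma sum_two_PiE:
  assumes "s \<noteq> s'"
  shows "(\<Sum>f\<in>{s, s'} \<rightarrow>\<^sub>E A. g f) = (\<Sum>a\<in>A. \<Sum>b\<in>A. g (\<lambda>t. if t = s then a else if t = s' then b else undefined))"
  unfolding sum.cartesian_product
proof (rule sum.reindex_bij_witness[of _ "\<lambda>(a, b) t. if t = s then a else if t = s' then b else undefined" "\<lambda>f. (f s, f s')"])
  fix f assume "f \<in> {s, s'} \<rightarrow>\<^sub>E A"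
  then have e: "(\<lambda>t. if t = s then f s else if t = s' then f s' else undefined) = f" by (auto simp: PiE_iff extensional_def fun_eq_iff)
  then show "(case (f s, f s') of (a, b) \<Rightarrow> \<lambda>t. if t = s then a else if t = s' then b else undefined) = f" by simp
  show "(case (f s, f s') of (a, b) \<Rightarrow> g (\<lambda>t. if t = s then a else if t = s' then b else undefined)) = g f"
    using e by simp
qed (use assms in \<open>auto simp: PiE_iff extensional_def\<close>)

definition two_edge_term :: "graph \<Rightarrow> port list \<Rightarrow> port \<Rightarrow> port \<Rightarrow> (nat \<Rightarrow> color) \<Rightarrow> (nat \<Rightarrow> color) \<Rightarrow> color \<Rightarrow> color \<Rightarrow> int" where
  "two_edge_term K L s s' y x a b = (let c = \<lambda>t. if t = s then a else if t = s' then b else case t of Ext j \<Rightarrow> x j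
       | Vtx v i \<Rightarrow> (case wire K t of Ext p \<Rightarrow> y p | Vtx _ _ \<Rightarrow> y 0) in
     sign_list (\<lambda>s. tpos (wire K s)) (spos (length (verts K))) (\<lambda>s. occ (c s)) L *
     (\<Prod>v<length (verts K). weight (verts K ! v) (\<lambda>j. c (src K (Vtx v j))) (\<lambda>j. c (Vtx v j))))"

lemma sum_colors: "(\<Sum>a\<in>colors N. f a) = (\<Sum>i<N. \<Sum>j<N. f (i, j, True) + (f (i, j, False) :: int))"
proof -
  have "(\<Sum>a\<in>colors N. f a) = (\<Sum>i<N. \<Sum>j<N. \<Sum>p\<in>UNIV. f (i, j, p))"
    by (simp only: colors_def sum.cartesian_product split_def prod.collapse)
  then show ?thesis by (simp add: UNIV_bool add.commute)
qed

text \<open>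
  For the two graphs with a loop: the terms cancel for every choice of the indices, already in
  the sum over the parities of the two inner edges.
\<close>

lemma Z_two_internal:
  assumes K: "dag K" and L: "distinct L" "sources K = set L" and s: "s \<in> set L" "s' \<in> set L" "s \<noteq> s'"
    and ext: "(\<forall>t\<in>set L. t \<noteq> s \<longrightarrow> t \<noteq> s' \<longrightarrow> (\<exists>j. t = Ext j) \<noteq> (\<exists>p. wire K t = Ext p)) \<and>
      (\<nexists>j. s = Ext j) \<and> (\<nexists>p. wire K s = Ext p) \<and> (\<nexists>j. s' = Ext j) \<and> (\<nexists>p. wire K s' = Ext p)"
    and x: "\<And>j. x j \<in> colors N" and y: "\<And>p. y p \<in> colors N"
    and cancel: "\<And>i j k l. two_edge_term K L s s' y x (i, j, True) (k, l, True) + two_edge_term K L s s' y x (i, j, True) (k, l, False) +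
      two_edge_term K L s s' y x (i, j, False) (k, l, True) + two_edge_term K L s s' y x (i, j, False) (k, l, False) = 0"
  shows "Z N K y x = 0"
proof -
  let ?cf = "\<lambda>a b t. if t = s then a else if t = s' then b else case t of Ext j \<Rightarrow> x j | Vtx v i \<Rightarrow> (case wire K t of Ext p \<Rightarrow> y p | Vtx _ _ \<Rightarrow> y 0)"
  have "Z N K y x = (\<Sum>f\<in>{s, s'} \<rightarrow>\<^sub>E colors N. colour_term K (\<lambda>t. if t \<in> {s, s'} then f t else case t of Ext j \<Rightarrow> x j | Vtx v i \<Rightarrow> (case wire K t of Ext p \<Rightarrow> y p | Vtx _ _ \<Rightarrow> y 0)))"
    by (rule Z_internal[OF K _ _ _ x y]) (use L s ext in auto)
  also have "\<dots> = (\<Sum>a\<in>colors N. \<Sum>b\<in>colors N. colour_term K (?cf a b))"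
    unfolding sum_two_PiE[OF s(3)] by (intro sum.cong refl arg_cong[of _ _ "colour_term K"]) auto
  also have "\<dots> = (\<Sum>a\<in>colors N. \<Sum>b\<in>colors N. two_edge_term K L s s' y x a b)"
    unfolding colour_term_list[OF K L] two_edge_term_def Let_def ..
  also have "\<dots> = (\<Sum>i<N. \<Sum>j<N. \<Sum>k<N. \<Sum>l<N. 0)"
    unfolding sum_colors sum.distrib[symmetric] using cancel by (intro sum.cong refl) (simp add: add.assoc)
  finally show ?thesis by simp
qed

lemmas dag_intros = dag_gcomp dag_gtensor dag_gen dag_id dag_perm swap_permutes


lemma sel_one: "sel b 1 = 1" by (simp add: sel_def)

lemmas edge_simps = wire_eval numeral_2_eq_2 crossing_def kap_def sel_one


lemma state_bounds: "c \<in> colors N \<Longrightarrow> fst c < N" "c \<in> colors N \<Longrightarrow> fst (snd c) < N"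
  by (auto simp: colors_def)

abbreviation (input) "untG \<equiv> gen_graph Unit"

abbreviation (input) "assocRG \<equiv> gcomp mulG (gtensor idG mulG)"
abbreviation (input) "assocLG \<equiv> gcomp mulG (gtensor mulG idG)"
abbreviation (input) "coassocRG \<equiv> gcomp (gtensor idG copG) copG"
abbreviation (input) "coassocLG \<equiv> gcomp (gtensor copG idG) copG"
abbreviation (input) "mulcopG \<equiv> gcomp copG mulG"
abbreviation (input) "frobRG \<equiv> gcomp (gtensor mulG idG) (gtensor idG copG)"
abbreviation (input) "frobLG \<equiv> gcomp (gtensor idG mulG) (gtensor copG idG)"
abbreviation (input) "swappedBG \<equiv> gcomp swpG (gcomp BG swpG)"
abbreviation (input) "DswapG \<equiv> gcomp DG swpG"
abbreviation (input) "unitLG \<equiv> gcomp mulG (gtensor untG idG)"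
abbreviation (input) "unitRG \<equiv> gcomp mulG (gtensor idG untG)"

context
  fixes x y :: "nat \<Rightarrow> color" and N :: nat
  assumes x: "\<And>j. x j \<in> colors N" and y: "\<And>p. y p \<in> colors N"
begin

text \<open>
  The graphs of the relations are evaluated one at a time. The inner edge is always an output of
  the second vertex, which is the one applied first.
\<close>

lemma src_assoc_right:
  "src assocRG (Vtx 0 0) = Ext 0"
  "src assocRG (Vtx 0 1) = Vtx 1 0"
  "src assocRG (Vtx 1 0) = Ext 1"
  "src assocRG (Vtx 1 1) = Ext 2"
  by (rule srcI, intro dag_intros; simp add: wire_eval)+

lemma Z_assoc_right: "Z N assocRG y x =
    edge_sum assocRG [Ext 0, Ext 1, Ext 2, Vtx 0 0, Vtx 1 0] (Vtx 1 0) y x (fst (x 1)) (fst (snd (x 2)))"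
  (is "_ = edge_sum ?K ?L ?s _ _ ?i ?j")
proof (rule Z_one_internal[OF _ _ _ _ _ _ x y])
  show "dag ?K" by (intro dag_intros; simp)
  show "sources ?K = set ?L"
    by (auto simp: set_eq_iff port_all less_two_three less_Suc_eq nth_append)
  show "?i < N" "?j < N" by (intro state_bounds x y)+
  show "edge_term ?K ?L ?s y x (k, l, p) = 0" if "k \<noteq> ?i \<or> l \<noteq> ?j" for k l p
    using src_assoc_right that by (auto simp: edge_term_def numeral_2_eq_2 wire_eval)
qed (auto simp: wire_eval)

lemma src_assoc_left:
  "src assocLG (Vtx 0 0) = Vtx 1 0"
  "src assocLG (Vtx 0 1) = Ext 2"
  "src assocLG (Vtx 1 0) = Ext 0"
  "src assocLG (Vtx 1 1) = Ext 1"
  by (rule srcI, intro dag_intros; simp add: wire_eval)+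

lemma Z_assoc_left: "Z N assocLG y x =
    edge_sum assocLG [Ext 0, Ext 1, Ext 2, Vtx 0 0, Vtx 1 0] (Vtx 1 0) y x (fst (x 0)) (fst (snd (x 1)))"
  (is "_ = edge_sum ?K ?L ?s _ _ ?i ?j")
proof (rule Z_one_internal[OF _ _ _ _ _ _ x y])
  show "dag ?K" by (intro dag_intros; simp)
  show "sources ?K = set ?L"
    by (auto simp: set_eq_iff port_all less_two_three less_Suc_eq nth_append)
  show "?i < N" "?j < N" by (intro state_bounds x y)+
  show "edge_term ?K ?L ?s y x (k, l, p) = 0" if "k \<noteq> ?i \<or> l \<noteq> ?j" for k l p
    using src_assoc_left that by (auto simp: edge_term_def numeral_2_eq_2 wire_eval)
qed (auto simp: wire_eval)

lemma src_coassoc_right: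
  "src coassocRG (Vtx 0 0) = Vtx 1 1"
  "src coassocRG (Vtx 1 0) = Ext 0"
  by (rule srcI, intro dag_intros; simp add: wire_eval)+

lemma Z_coassoc_right: "Z N coassocRG y x =
    edge_sum coassocRG [Ext 0, Vtx 0 0, Vtx 0 1, Vtx 1 0, Vtx 1 1] (Vtx 1 1) y x (fst (y 1)) (fst (snd (y 2)))"
  (is "_ = edge_sum ?K ?L ?s _ _ ?i ?j")
proof (rule Z_one_internal[OF _ _ _ _ _ _ x y])
  show "dag ?K" by (intro dag_intros; simp)
  show "sources ?K = set ?L"
    by (auto simp: set_eq_iff port_all less_two_three less_Suc_eq nth_append)
  show "?i < N" "?j < N" by (intro state_bounds x y)+
  show "edge_term ?K ?L ?s y x (k, l, p) = 0" if "k \<noteq> ?i \<or> l \<noteq> ?j" for k l p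
    using src_coassoc_right that by (auto simp: edge_term_def numeral_2_eq_2 wire_eval)
qed (auto simp: wire_eval)

lemma src_coassoc_left:
  "src coassocLG (Vtx 0 0) = Vtx 1 0"
  "src coassocLG (Vtx 1 0) = Ext 0"
  by (rule srcI, intro dag_intros; simp add: wire_eval)+

lemma Z_coassoc_left: "Z N coassocLG y x =
    edge_sum coassocLG [Ext 0, Vtx 0 0, Vtx 0 1, Vtx 1 0, Vtx 1 1] (Vtx 1 0) y x (fst (y 0)) (fst (snd (y 1)))"
  (is "_ = edge_sum ?K ?L ?s _ _ ?i ?j")
proof (rule Z_one_internal[OF _ _ _ _ _ _ x y])
  show "dag ?K" by (intro dag_intros; simp)
  show "sources ?K = set ?L"
    by (auto simp: set_eq_iff port_all less_two_three less_Suc_eq nth_append)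
  show "?i < N" "?j < N" by (intro state_bounds x y)+
  show "edge_term ?K ?L ?s y x (k, l, p) = 0" if "k \<noteq> ?i \<or> l \<noteq> ?j" for k l p
    using src_coassoc_left that by (auto simp: edge_term_def numeral_2_eq_2 wire_eval)
qed (auto simp: wire_eval)

lemma src_mul_cop:
  "src mulcopG (Vtx 0 0) = Vtx 1 0"
  "src mulcopG (Vtx 1 0) = Ext 0"
  "src mulcopG (Vtx 1 1) = Ext 1"
  by (rule srcI, intro dag_intros; simp add: wire_eval)+

lemma Z_mul_cop: "Z N mulcopG y x =
    edge_sum mulcopG [Ext 0, Ext 1, Vtx 0 0, Vtx 0 1, Vtx 1 0] (Vtx 1 0) y x (fst (x 0)) (fst (snd (x 1)))"
  (is "_ = edge_sum ?K ?L ?s _ _ ?i ?j")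
proof (rule Z_one_internal[OF _ _ _ _ _ _ x y])
  show "dag ?K" by (intro dag_intros; simp)
  show "sources ?K = set ?L"
    by (auto simp: set_eq_iff port_all less_two_three less_Suc_eq nth_append)
  show "?i < N" "?j < N" by (intro state_bounds x y)+
  show "edge_term ?K ?L ?s y x (k, l, p) = 0" if "k \<noteq> ?i \<or> l \<noteq> ?j" for k l p
    using src_mul_cop that by (auto simp: edge_term_def numeral_2_eq_2 wire_eval)
qed (auto simp: wire_eval)

lemma src_frob_right:
  "src frobRG (Vtx 0 0) = Ext 0"
  "src frobRG (Vtx 0 1) = Vtx 1 0"
  "src frobRG (Vtx 1 0) = Ext 1"
  by (rule srcI, intro dag_intros; simp add: wire_eval)+

lemma Z_frob_right: "Z N frobRG y x =
    edge_sum frobRG [Ext 0, Ext 1, Vtx 0 0, Vtx 1 0, Vtx 1 1] (Vtx 1 0) y x (fst (snd (x 0))) (fst (snd (y 0)))"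
  (is "_ = edge_sum ?K ?L ?s _ _ ?i ?j")
proof (rule Z_one_internal[OF _ _ _ _ _ _ x y])
  show "dag ?K" by (intro dag_intros; simp)
  show "sources ?K = set ?L"
    by (auto simp: set_eq_iff port_all less_two_three less_Suc_eq nth_append)
  show "?i < N" "?j < N" by (intro state_bounds x y)+
  show "edge_term ?K ?L ?s y x (k, l, p) = 0" if "k \<noteq> ?i \<or> l \<noteq> ?j" for k l p
    using src_frob_right that by (auto simp: edge_term_def numeral_2_eq_2 wire_eval)
qed (auto simp: wire_eval)

lemma src_frob_left:
  "src frobLG (Vtx 0 0) = Vtx 1 1"
  "src frobLG (Vtx 0 1) = Ext 1"
  "src frobLG (Vtx 1 0) = Ext 0"
  by (rule srcI, intro dag_intros; simp add: wire_eval)+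

lemma Z_frob_left: "Z N frobLG y x =
    edge_sum frobLG [Ext 0, Ext 1, Vtx 0 0, Vtx 1 0, Vtx 1 1] (Vtx 1 1) y x (fst (y 1)) (fst (x 1))"
  (is "_ = edge_sum ?K ?L ?s _ _ ?i ?j")
proof (rule Z_one_internal[OF _ _ _ _ _ _ x y])
  show "dag ?K" by (intro dag_intros; simp)
  show "sources ?K = set ?L"
    by (auto simp: set_eq_iff port_all less_two_three less_Suc_eq nth_append)
  show "?i < N" "?j < N" by (intro state_bounds x y)+
  show "edge_term ?K ?L ?s y x (k, l, p) = 0" if "k \<noteq> ?i \<or> l \<noteq> ?j" for k l p
    using src_frob_left that by (auto simp: edge_term_def numeral_2_eq_2 wire_eval)
qed (auto simp: wire_eval)

lemma src_B:
  "src BG (Vtx 0 0) = Ext 0"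
  "src BG (Vtx 0 1) = Vtx 1 1"
  "src BG (Vtx 1 0) = Ext 1"
  by (rule srcI, intro dag_intros; simp add: wire_eval)+

lemma Z_B: "Z N BG y x =
    edge_sum BG [Ext 0, Ext 1, Vtx 0 0, Vtx 1 0, Vtx 1 1] (Vtx 1 1) y x (fst (snd (x 0))) (fst (snd (y 1)))"
  (is "_ = edge_sum ?K ?L ?s _ _ ?i ?j")
proof (rule Z_one_internal[OF _ _ _ _ _ _ x y])
  show "dag ?K" by (intro dag_intros; simp)
  show "sources ?K = set ?L"
    by (auto simp: set_eq_iff port_all less_two_three less_Suc_eq nth_append)
  show "?i < N" "?j < N" by (intro state_bounds x y)+
  show "edge_term ?K ?L ?s y x (k, l, p) = 0" if "k \<noteq> ?i \<or> l \<noteq> ?j" for k l p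
    using src_B that by (auto simp: edge_term_def numeral_2_eq_2 wire_eval)
qed (auto simp: wire_eval)

lemma src_swapped_B:
  "src swappedBG (Vtx 0 0) = Ext 1"
  "src swappedBG (Vtx 0 1) = Vtx 1 1"
  "src swappedBG (Vtx 1 0) = Ext 0"
  by (rule srcI, intro dag_intros; simp add: wire_eval)+

lemma Z_swapped_B: "Z N swappedBG y x =
    edge_sum swappedBG [Ext 0, Ext 1, Vtx 0 0, Vtx 1 0, Vtx 1 1] (Vtx 1 1) y x (fst (snd (x 1))) (fst (snd (y 0)))"
  (is "_ = edge_sum ?K ?L ?s _ _ ?i ?j")
proof (rule Z_one_internal[OF _ _ _ _ _ _ x y])
  show "dag ?K" by (intro dag_intros; simp)
  show "sources ?K = set ?L"
    by (auto simp: set_eq_iff port_all less_two_three less_Suc_eq nth_append)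
  show "?i < N" "?j < N" by (intro state_bounds x y)+
  show "edge_term ?K ?L ?s y x (k, l, p) = 0" if "k \<noteq> ?i \<or> l \<noteq> ?j" for k l p
    using src_swapped_B that by (auto simp: edge_term_def numeral_2_eq_2 wire_eval)
qed (auto simp: wire_eval)

lemma src_D_swap:
  "src DswapG (Vtx 0 0) = Vtx 1 0"
  "src DswapG (Vtx 0 1) = Ext 0"
  "src DswapG (Vtx 1 0) = Ext 1"
  by (rule srcI, intro dag_intros; simp add: wire_eval)+

lemma Z_D_swap: "Z N DswapG y x =
    edge_sum DswapG [Ext 0, Ext 1, Vtx 0 0, Vtx 1 0, Vtx 1 1] (Vtx 1 0) y x (fst (y 0)) (fst (x 0))"
  (is "_ = edge_sum ?K ?L ?s _ _ ?i ?j")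
proof (rule Z_one_internal[OF _ _ _ _ _ _ x y])
  show "dag ?K" by (intro dag_intros; simp)
  show "sources ?K = set ?L"
    by (auto simp: set_eq_iff port_all less_two_three less_Suc_eq nth_append)
  show "?i < N" "?j < N" by (intro state_bounds x y)+
  show "edge_term ?K ?L ?s y x (k, l, p) = 0" if "k \<noteq> ?i \<or> l \<noteq> ?j" for k l p
    using src_D_swap that by (auto simp: edge_term_def numeral_2_eq_2 wire_eval)
qed (auto simp: wire_eval)

lemma src_unit_left:
  "src unitLG (Vtx 0 0) = Vtx 1 0"
  "src unitLG (Vtx 0 1) = Ext 0"
  by (rule srcI, intro dag_intros; simp add: wire_eval)+

lemma Z_unit_left: "Z N unitLG y x =
    edge_sum unitLG [Ext 0, Vtx 0 0, Vtx 1 0] (Vtx 1 0) y x (fst (y 0)) (fst (x 0))"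
  (is "_ = edge_sum ?K ?L ?s _ _ ?i ?j")
proof (rule Z_one_internal[OF _ _ _ _ _ _ x y])
  show "dag ?K" by (intro dag_intros; simp)
  show "sources ?K = set ?L"
    by (auto simp: set_eq_iff port_all less_two_three less_Suc_eq nth_append)
  show "?i < N" "?j < N" by (intro state_bounds x y)+
  show "edge_term ?K ?L ?s y x (k, l, p) = 0" if "k \<noteq> ?i \<or> l \<noteq> ?j" for k l p
    using src_unit_left that by (auto simp: edge_term_def numeral_2_eq_2 wire_eval)
qed (auto simp: wire_eval)

lemma src_unit_right:
  "src unitRG (Vtx 0 0) = Ext 0"
  "src unitRG (Vtx 0 1) = Vtx 1 0"
  by (rule srcI, intro dag_intros; simp add: wire_eval)+

lemma Z_unit_right: "Z N unitRG y x =
    edge_sum unitRG [Ext 0, Vtx 0 0, Vtx 1 0] (Vtx 1 0) y x (fst (snd (x 0))) (fst (snd (y 0)))"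
  (is "_ = edge_sum ?K ?L ?s _ _ ?i ?j")
proof (rule Z_one_internal[OF _ _ _ _ _ _ x y])
  show "dag ?K" by (intro dag_intros; simp)
  show "sources ?K = set ?L"
    by (auto simp: set_eq_iff port_all less_two_three less_Suc_eq nth_append)
  show "?i < N" "?j < N" by (intro state_bounds x y)+
  show "edge_term ?K ?L ?s y x (k, l, p) = 0" if "k \<noteq> ?i \<or> l \<noteq> ?j" for k l p
    using src_unit_right that by (auto simp: edge_term_def numeral_2_eq_2 wire_eval)
qed (auto simp: wire_eval)

lemma Z_rel_assoc: "Z N assocRG y x + Z N assocLG y x = 0"
  unfolding Z_assoc_right Z_assoc_left edge_sum_def edge_term_def
  using src_assoc_right src_assoc_left by (auto simp: edge_simps sel_def)

lemma Z_rel_coassoc: "Z N coassocRG y x = Z N coassocLG y x"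
  unfolding Z_coassoc_right Z_coassoc_left edge_sum_def edge_term_def
  using src_coassoc_right src_coassoc_left by (auto simp: edge_simps sel_def)

lemma Z_rel_frob_right: "Z N frobRG y x = Z N mulcopG y x"
  unfolding Z_mul_cop Z_frob_right edge_sum_def edge_term_def
  using src_mul_cop src_frob_right by (auto simp: edge_simps sel_def)

lemma Z_rel_frob_left: "Z N frobLG y x = Z N mulcopG y x"
  unfolding Z_mul_cop Z_frob_left edge_sum_def edge_term_def
  using src_mul_cop src_frob_left by (auto simp: edge_simps sel_def)

lemma Z_rel_B: "Z N BG y x + Z N swappedBG y x = 0"
  unfolding Z_B Z_swapped_B edge_sum_def edge_term_def
  using src_B src_swapped_B by (auto simp: edge_simps sel_def)

lemma Z_rel_D: "Z N BG y x + Z N DswapG y x = 0"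
  unfolding Z_B Z_D_swap edge_sum_def edge_term_def
  using src_B src_D_swap by (auto simp: edge_simps sel_def)

lemma Z_id: "Z N idG y x = (if x 0 = y 0 then 1 else 0)"
proof -
  have d: "dag idG" by (rule dag_id)
  have s: "sources idG = {Ext 0}" by (auto simp: set_eq_iff port_all)
  have sr: "src idG (Ext 0) = Ext 0" by (rule srcI[OF d]) simp_all
  have e: "colourings N idG y x = (if x 0 = y 0 then {\<lambda>t. if t = Ext 0 then x 0 else undefined} else {})"
    unfolding colourings_def s using sr x y by (auto simp: PiE_iff extensional_def fun_eq_iff)
  have "colour_term idG c = 1" for c
  proof -
    have "sources idG = set [Ext 0]" using s by simp
    from colour_term_list[OF d _ this, of c] show ?thesis by (simp add: sel_def kap_def)
  qed
  then show ?thesis unfolding Z_def e by simp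
qed

lemma color_eq_iff: "c = d \<longleftrightarrow> fst c = fst d \<and> fst (snd c) = fst (snd d) \<and> (occ c \<longleftrightarrow> occ d)" for c d :: color
  by (cases c; cases d) auto

lemma Z_rel_unit_left: "Z N unitLG y x + Z N idG y x = 0"
  unfolding Z_unit_left Z_id color_eq_iff edge_sum_def edge_term_def
  using src_unit_left by (auto simp: edge_simps sel_def)

lemma Z_rel_unit_right: "Z N unitRG y x = Z N idG y x"
  unfolding Z_unit_right Z_id color_eq_iff edge_sum_def edge_term_def
  using src_unit_right by (auto simp: edge_simps sel_def)

lemma src_mul_cop_loop:
  "src (gcomp mulG copG) (Vtx 0 0) = Vtx 1 0"
  "src (gcomp mulG copG) (Vtx 0 1) = Vtx 1 1"
  "src (gcomp mulG copG) (Vtx 1 0) = Ext 0"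
  by (rule srcI, intro dag_intros; simp add: wire_eval)+

lemma Z_mul_cop_loop: "Z N (gcomp mulG copG) y x = 0"
proof -
  let ?K = "gcomp mulG copG" and ?L = "[Ext 0, Vtx 0 0, Vtx 1 0, Vtx 1 1]"
  let ?T = "two_edge_term ?K ?L (Vtx 1 0) (Vtx 1 1) y x"
  have d: "dag ?K" by (intro dag_intros; simp)
  have s: "sources ?K = set ?L"
    by (auto simp: set_eq_iff port_all less_two_three less_Suc_eq nth_append)
  have T: "?T (i, j, True) (k, l, True) + ?T (i, j, True) (k, l, False) +
      ?T (i, j, False) (k, l, True) + ?T (i, j, False) (k, l, False) = 0" for i j k l
    unfolding two_edge_term_def using src_mul_cop_loop by (auto simp: edge_simps sel_def)
  show ?thesis by (rule Z_two_internal[OF d _ s _ _ _ _ x y T]) (auto simp: wire_eval)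
qed

lemma src_mul_swap_cop_loop:
  "src (gcomp mulG (gcomp swpG copG)) (Vtx 0 0) = Vtx 1 1"
  "src (gcomp mulG (gcomp swpG copG)) (Vtx 0 1) = Vtx 1 0"
  "src (gcomp mulG (gcomp swpG copG)) (Vtx 1 0) = Ext 0"
  by (rule srcI, intro dag_intros; simp add: wire_eval)+

lemma Z_mul_swap_cop_loop: "Z N (gcomp mulG (gcomp swpG copG)) y x = 0"
proof -
  let ?K = "gcomp mulG (gcomp swpG copG)" and ?L = "[Ext 0, Vtx 0 0, Vtx 1 0, Vtx 1 1]"
  let ?T = "two_edge_term ?K ?L (Vtx 1 0) (Vtx 1 1) y x"
  have d: "dag ?K" by (intro dag_intros; simp)
  have s: "sources ?K = set ?L"
    by (auto simp: set_eq_iff port_all less_two_three less_Suc_eq nth_append)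
  have T: "?T (i, j, True) (k, l, True) + ?T (i, j, True) (k, l, False) +
      ?T (i, j, False) (k, l, True) + ?T (i, j, False) (k, l, False) = 0" for i j k l
    unfolding two_edge_term_def using src_mul_swap_cop_loop by (auto simp: edge_simps sel_def)
  show ?thesis by (rule Z_two_internal[OF d _ s _ _ _ _ x y T]) (auto simp: wire_eval)
qed

end

section \<open>The state sum of a null combination\<close>

definition Zlin :: "nat \<Rightarrow> 'k::field_char_0 lin \<Rightarrow> (nat \<Rightarrow> color) \<Rightarrow> (nat \<Rightarrow> color) \<Rightarrow> 'k" where
  "Zlin N X y x = (\<Sum>G\<in>Poly_Mapping.keys X. Poly_Mapping.lookup X G * of_int (Z N G y x))"

lemma Zlin_superset: "finite A \<Longrightarrow> Poly_Mapping.keys X \<subseteq> A \<Longrightarrow>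
    Zlin N X y x = (\<Sum>G\<in>A. Poly_Mapping.lookup X G * of_int (Z N G y x))"
  unfolding Zlin_def by (rule sum.mono_neutral_left) (auto simp: in_keys_iff)

lemma Zlin_add: "Zlin N (X + Y) y x = Zlin N X y x + Zlin N Y y x"
proof -
  let ?A = "Poly_Mapping.keys X \<union> Poly_Mapping.keys Y"
  have "Zlin N W y x = (\<Sum>G\<in>?A. Poly_Mapping.lookup W G * of_int (Z N G y x))" if "W \<in> {X, Y, X + Y}" for W
    using that Poly_Mapping.keys_add[of X Y] by (intro Zlin_superset) auto
  then show ?thesis by (simp add: lookup_add distrib_right sum.distrib)
qed

lemma Zlin_scale: "Zlin N (scale c X) y x = c * Zlin N X y x"
  using Zlin_superset[of "Poly_Mapping.keys X" "scale c X"] keys_scale[of c X]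
  by (simp add: Zlin_def sum_distrib_left mult.assoc)

lemma Zlin_zero [simp]: "Zlin N 0 y x = 0" by (simp add: Zlin_def)

lemma Zlin_minus: "Zlin N (- X) y x = - Zlin N X y x"
  using Zlin_scale[of N "-1" X] by (simp add: scale_minus)

lemma Zlin_diff: "Zlin N (X - Y) y x = Zlin N X y x - Zlin N Y y x"
  using Zlin_add[of N X "- Y"] by (simp add: Zlin_minus)

lemma Zlin_sum: "Zlin N (\<Sum>i\<in>A. f i) y x = (\<Sum>i\<in>A. Zlin N (f i) y x)"
  by (induction A rule: infinite_finite_induct) (simp_all add: Zlin_add)

lemma Zlin_single: "Zlin N (Poly_Mapping.single G c) y x = c * of_int (Z N G y x)"
  by (simp add: Zlin_def)

lemma Zlin_single1: "Zlin N (single1 G) y x = of_int (Z N G y x)"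
  by (simp add: single1_def Zlin_single)

lemma Zlin_bilin: "Zlin N (bilin f X Y) y x = (\<Sum>G\<in>Poly_Mapping.keys X. \<Sum>H\<in>Poly_Mapping.keys Y.
    Poly_Mapping.lookup X G * Poly_Mapping.lookup Y H * of_int (Z N (f G H) y x))"
  by (simp add: bilin_def Zlin_sum Zlin_single)

text \<open>
  If a bilinear operation acts on state sums by a kernel that does not depend on the graphs,
  then it does so on linear combinations.
\<close>

lemma Zlin_bilin_states:
  assumes "\<And>G H. G \<in> Poly_Mapping.keys X \<Longrightarrow> H \<in> Poly_Mapping.keys Y \<Longrightarrow>
    Z N (f G H) y x = (\<Sum>z\<in>A. \<alpha> z * (Z N G (p z) (q z) * Z N H (r z) (s z)))"
  shows "Zlin N (bilin f X Y) y x = (\<Sum>z\<in>A. of_int (\<alpha> z) * (Zlin N X (p z) (q z) * Zlin N Y (r z) (s z)))"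
proof -
  have "Zlin N (bilin f X Y) y x = (\<Sum>G\<in>Poly_Mapping.keys X. \<Sum>H\<in>Poly_Mapping.keys Y. \<Sum>z\<in>A.
    of_int (\<alpha> z) * ((Poly_Mapping.lookup X G * of_int (Z N G (p z) (q z))) * (Poly_Mapping.lookup Y H * of_int (Z N H (r z) (s z)))))"
    unfolding Zlin_bilin by (intro sum.cong refl) (simp add: assms sum_distrib_left algebra_simps)
  also have "\<dots> = (\<Sum>G\<in>Poly_Mapping.keys X. \<Sum>z\<in>A. \<Sum>H\<in>Poly_Mapping.keys Y. of_int (\<alpha> z) * ((Poly_Mapping.lookup X G * of_int (Z N G (p z) (q z))) * (Poly_Mapping.lookup Y H * of_int (Z N H (r z) (s z)))))"
    by (intro sum.cong refl sum.swap)
  also have "\<dots> = (\<Sum>z\<in>A. \<Sum>G\<in>Poly_Mapping.keys X. \<Sum>H\<in>Poly_Mapping.keys Y. of_int (\<alpha> z) * ((Poly_Mapping.lookup X G * of_int (Z N G (p z) (q z))) * (Poly_Mapping.lookup Y H * of_int (Z N H (r z) (s z)))))" by (rule sum.swap)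
  also have "\<dots> = (\<Sum>z\<in>A. of_int (\<alpha> z) * (Zlin N X (p z) (q z) * Zlin N Y (r z) (s z)))"
    unfolding Zlin_def sum_product by (simp only: sum_distrib_left)
  finally show ?thesis .
qed

text \<open>
  In the expansion of a join into a composite of tensor products all signs depend on the states
  and the arities only.
\<close>

lemma Z_gjoin:
  assumes G: "G \<in> cgraphs S a b" and H: "H \<in> cgraphs S c d" and k: "k \<le> b" "k \<le> c"
  shows "Z N (gjoin k G H) y x = (\<Sum>z\<in>{..<b + (c - k)} \<rightarrow>\<^sub>E colors N.
    ((-1) ^ (occ_count b z * (occ_count (c - k) (\<lambda>p. y (p + a)) + occ_count (c - k) (\<lambda>j. z (j + b)))) *
     Z N (id_graph (c - k)) (\<lambda>p. y (p + a)) (\<lambda>j. z (j + b)) *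
     ((-1) ^ (occ_count (b - k) x * (occ_count c (\<lambda>p. z (p + (b - k))) + occ_count d (\<lambda>j. x (j + (b - k))))) *
      Z N (id_graph (b - k)) z x)) *
    (Z N G y z * Z N H (\<lambda>p. z (p + (b - k))) (\<lambda>j. x (j + (b - k)))))"
proof -
  note G' = cgraphsD[OF G] and H' = cgraphsD[OF H]
  have d: "dag (gtensor G (id_graph (c - k)))" "dag (gtensor (id_graph (b - k)) H)"
    using G' H' by (intro dag_gtensor dag_id; simp)+
  have e: "outs (gtensor (id_graph (b - k)) H) = ins (gtensor G (id_graph (c - k)))"
    using G' H' k by simp
  have i: "ins (gtensor G (id_graph (c - k))) = b + (c - k)" using G' by simp
  show ?thesis
    unfolding gjoin_def G'(2) H'(1) Z_gcomp[OF d e] i Z_gtensor[OF G'(4) dag_id] Z_gtensor[OF dag_id H'(4)]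
    using G' H' by (intro sum.cong refl) (simp add: mult_ac)
qed

lemma Z_state_cong:
  assumes "\<And>p. p < outs G \<Longrightarrow> y p = y' p" "\<And>j. j < ins G \<Longrightarrow> x j = x' j"
  shows "Z N G y x = Z N G y' x'"
  unfolding Z_def colourings_def using assms by simp

lemma Z_relations:
  assumes x: "\<And>j. x j \<in> colors N" and y: "\<And>p. y p \<in> colors N" and r: "r \<in> bib_rels \<union> unit_rels"
  shows "Zlin N r y x = (0 :: 'k::field_char_0)"
proof -
  note Z = Z_rel_assoc Z_rel_coassoc Z_rel_frob_right Z_rel_frob_left Z_rel_B Z_rel_D Z_mul_cop_loop Z_mul_swap_cop_loop
    Z_rel_unit_left Z_rel_unit_right
  note Zk = Z[OF x y, THEN arg_cong[of _ _ "of_int :: int \<Rightarrow> 'k"], unfolded of_int_add of_int_0]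
  show ?thesis
    using r unfolding bib_rels_def unit_rels_def rel_B_def rel_D_def comp_lin_def tensor_lin_def bilin_single1
      bilin_diff_left bilin_diff_right
    by (elim UnE insertE emptyE; simp add: Zlin_add Zlin_diff Zlin_minus Zlin_single1 Zk del: One_nat_def)
qed

lemma Zlin_free_cong:
  assumes "X \<in> free S a b" "\<And>p. p < a \<Longrightarrow> y p = y' p" "\<And>j. j < b \<Longrightarrow> x j = x' j"
  shows "Zlin N X y x = Zlin N X y' x'"
  unfolding Zlin_def
proof (intro sum.cong refl arg_cong2[of _ _ _ _ "(*)"] arg_cong[of _ _ of_int] Z_state_cong)
  fix G assume "G \<in> Poly_Mapping.keys X"
  then have "G \<in> cgraphs S a b" using assms(1) by (auto simp: free_def)
  then have G: "outs G = a" "ins G = b" using cgraphsD by blast+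
  show "y p = y' p" if "p < outs G" for p using assms(2) that G by simp
  show "x p = x' p" if "p < ins G" for p using assms(3) that G by simp
qed

text \<open>
  Each step that generates null combinations acts linearly on state sums: isomorphisms by the
  Koszul sign, permutations and joins by kernels that depend on the states only.
\<close>

theorem null_state_sum:
  assumes "null ubib_gens (bib_rels \<union> unit_rels) a b X" and N: "N > 0"
    and "\<And>p. p < a \<Longrightarrow> y p \<in> colors N" "\<And>j. j < b \<Longrightarrow> x j \<in> colors N"
  shows "Zlin N X y x = (0 :: 'k::field_char_0)"
proof -
  let ?S = ubib_gens
  have "X \<in> free ?S a b \<and> (\<forall>y x. (\<forall>p<a. y p \<in> colors N) \<longrightarrow> (\<forall>j<b. x j \<in> colors N) \<longrightarrow> Zlin N X y x = 0)"
    using assms(1)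
  proof (induction rule: null.induct)
    case (null_iso G a b H \<pi>)
    have d: "dag G" "dag H" using null_iso.hyps(1,2) cgraphsD(4) by blast+
    have ks: "(koszul_sign \<pi> G :: 'k) = of_int ((-1) ^ inversions \<pi> G)"
      by (simp add: koszul_sign_def inversions_def)
    have "Zlin N (single1 G - scale (koszul_sign \<pi> G) (single1 H)) y x = (0 :: 'k)" for y x
    proof -
      have "(of_int (Z N G y x) :: 'k) = of_int ((-1) ^ inversions \<pi> G) * of_int (Z N H y x)"
        unfolding Z_iso[OF d null_iso.hyps(3), of N y x] by (rule of_int_mult)
      then show ?thesis by (simp add: Zlin_diff Zlin_scale Zlin_single1 ks)
    qed
    then show ?case using free_single1[OF null_iso.hyps(1)] free_single1[OF null_iso.hyps(2)]
      by (auto intro: free_minus free_scale)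
  next
    case (null_rel r a b)
    have "Zlin N r y x = 0" if y: "\<forall>p<a. y p \<in> colors N" and x: "\<forall>j<b. x j \<in> colors N" for y x
    proof -
      \<comment> \<open>Any colour may be used at the legs that do not exist.\<close>
      define e :: color where "e = (0, 0, False)"
      have e: "e \<in> colors N" using N by (simp add: e_def colors_def)
      have "Zlin N r y x = Zlin N r (\<lambda>p. if p < a then y p else e) (\<lambda>j. if j < b then x j else e)"
        by (rule Zlin_free_cong[OF null_rel.hyps(2)]) simp_all
      also have "\<dots> = 0" by (rule Z_relations) (use x y e null_rel.hyps in auto)
      finally show ?thesis .
    qed
    then show ?case using null_rel by blast
  next
    case (null_zero a b)
    then show ?case by (simp add: free_def)
  next
    case (null_add a b X Y)
    then show ?case by (simp add: Zlin_add free_add)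
  next
    case (null_scale a b X c)
    then show ?case by (simp add: Zlin_scale free_scale)
  next
    case (null_act a b X \<sigma> \<rho>)
    have X: "X \<in> free ?S a b" using null_act by blast
    let ?P = "perm_graph a \<sigma>" and ?Q = "perm_graph b \<rho>"
    have dP: "dag ?P" "dag ?Q" using null_act.hyps dag_perm by blast+
    have XG: "G \<in> cgraphs ?S a b" if "G \<in> Poly_Mapping.keys X" for G using X that by (auto simp: free_def)
    have 1: "Zlin N (bilin gcomp X (single1 ?Q)) y x = (\<Sum>z\<in>{..<b} \<rightarrow>\<^sub>E colors N. of_int 1 * (Zlin N X y z * Zlin N (single1 ?Q) z x))" for y x
    proof (rule Zlin_bilin_states)
      fix G H assume "G \<in> Poly_Mapping.keys X" "H \<in> Poly_Mapping.keys (single1 ?Q :: 'k lin)"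
      then have "dag G" "ins G = b" "H = ?Q" using XG cgraphsD by (fastforce simp: single1_def)+
      then show "Z N (gcomp G H) y x = (\<Sum>z\<in>{..<b} \<rightarrow>\<^sub>E colors N. 1 * (Z N G y z * Z N H z x))"
        using Z_gcomp[of G ?Q] dP by simp
    qed
    have v: "Zlin N (bilin gcomp X (single1 ?Q)) y x = 0" if "\<forall>p<a. y p \<in> colors N" for y x
      unfolding 1 using null_act.IH that by (intro sum.neutral) (auto simp: PiE_iff)
    have XQ: "G \<in> cgraphs ?S a b" if "G \<in> Poly_Mapping.keys (bilin gcomp X (single1 ?Q))" for G
      using keys_bilin[of gcomp X "single1 ?Q"] that XG cgraphs_perm_right[OF _ null_act.hyps(3)]
      by (fastforce simp: single1_def)
    have 2: "Zlin N (bilin gcomp (single1 ?P) (bilin gcomp X (single1 ?Q))) y x =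
      (\<Sum>z\<in>{..<a} \<rightarrow>\<^sub>E colors N. of_int 1 * (Zlin N (single1 ?P) y z * Zlin N (bilin gcomp X (single1 ?Q)) z x))" for y x
    proof (rule Zlin_bilin_states)
      fix H G assume "G \<in> Poly_Mapping.keys (bilin gcomp X (single1 ?Q))" "H \<in> Poly_Mapping.keys (single1 ?P :: 'k lin)"
      then have "dag G" "outs G = a" "H = ?P" using XQ cgraphsD by (fastforce simp: single1_def)+
      then show "Z N (gcomp H G) y x = (\<Sum>z\<in>{..<a} \<rightarrow>\<^sub>E colors N. 1 * (Z N H y z * Z N G z x))"
        using Z_gcomp[of ?P G] dP by simp
    qed
    have "Zlin N (act_lin a b \<sigma> \<rho> X) y x = 0" for y x
      unfolding act_lin_def comp_lin_def 2 by (intro sum.neutral) (auto simp: v PiE_iff)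
    then show ?case using free_act[OF X null_act.hyps(2,3)] by blast
  next
    case (null_join_left a b X Y c d k)
    have X: "X \<in> free ?S a b" using null_join_left by blast
    have "Zlin N (bilin (gjoin k) X Y) y x = 0" if y: "\<forall>p<a + c - k. y p \<in> colors N" for y x
    proof -
      have y': "\<forall>p<a. y p \<in> colors N" using y null_join_left.hyps by simp
      have "Zlin N (bilin (gjoin k) X Y) y x = (\<Sum>z\<in>{..<b + (c - k)} \<rightarrow>\<^sub>E colors N. of_int
        ((-1) ^ (occ_count b z * (occ_count (c - k) (\<lambda>p. y (p + a)) + occ_count (c - k) (\<lambda>j. z (j + b)))) *
     Z N (id_graph (c - k)) (\<lambda>p. y (p + a)) (\<lambda>j. z (j + b)) *
     ((-1) ^ (occ_count (b - k) x * (occ_count c (\<lambda>p. z (p + (b - k))) + occ_count d (\<lambda>j. x (j + (b - k))))) *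
      Z N (id_graph (b - k)) z x)) * (Zlin N X y z * Zlin N Y (\<lambda>p. z (p + (b - k))) (\<lambda>j. x (j + (b - k)))))"
        by (rule Zlin_bilin_states, rule Z_gjoin[of _ ?S a b _ c d]) (use X null_join_left.hyps in \<open>auto simp: free_def\<close>)
      also have "\<dots> = 0" using null_join_left.IH y' by (intro sum.neutral) (auto simp: PiE_iff)
      finally show ?thesis .
    qed
    then show ?case using free_join[OF X null_join_left.hyps(2-)] by blast
  next
    case (null_join_right X a b c d Y k)
    have Y: "Y \<in> free ?S c d" using null_join_right by blast
    have "Zlin N (bilin (gjoin k) X Y) y x = 0" if x: "\<forall>p<b + d - k. x p \<in> colors N" for y x
    proof -
      have "Zlin N (bilin (gjoin k) X Y) y x = (\<Sum>z\<in>{..<b + (c - k)} \<rightarrow>\<^sub>E colors N. of_int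
        ((-1) ^ (occ_count b z * (occ_count (c - k) (\<lambda>p. y (p + a)) + occ_count (c - k) (\<lambda>j. z (j + b)))) *
     Z N (id_graph (c - k)) (\<lambda>p. y (p + a)) (\<lambda>j. z (j + b)) *
     ((-1) ^ (occ_count (b - k) x * (occ_count c (\<lambda>p. z (p + (b - k))) + occ_count d (\<lambda>j. x (j + (b - k))))) *
      Z N (id_graph (b - k)) z x)) * (Zlin N X y z * Zlin N Y (\<lambda>p. z (p + (b - k))) (\<lambda>j. x (j + (b - k)))))"
        by (rule Zlin_bilin_states, rule Z_gjoin[of _ ?S a b _ c d]) (use Y null_join_right.hyps in \<open>auto simp: free_def\<close>)
      also have "\<dots> = 0"
      proof (intro sum.neutral ballI)
        fix z assume z: "z \<in> {..<b + (c - k)} \<rightarrow>\<^sub>E colors N"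
        have "Zlin N Y (\<lambda>p. z (p + (b - k))) (\<lambda>j. x (j + (b - k))) = 0"
        proof -
          have "\<forall>p<c. z (p + (b - k)) \<in> colors N" using z null_join_right.hyps by (auto simp: PiE_iff)
          moreover have "\<forall>j<d. x (j + (b - k)) \<in> colors N" using x null_join_right.hyps by auto
          ultimately show ?thesis
            by (intro null_join_right.IH[THEN conjunct2, THEN spec, THEN spec, THEN mp, THEN mp])
        qed
        then show "of_int (\<alpha> z) * (Zlin N X y z * Zlin N Y (\<lambda>p. z (p + (b - k))) (\<lambda>j. x (j + (b - k)))) = 0" for \<alpha> by simp
      qed
      finally show ?thesis .
    qed
    then show ?case using free_join[OF null_join_right.hyps(1) Y null_join_right.hyps(3-)] by blast
  qed
  then show ?thesis using assms(3,4) by blast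
qed

section \<open>Combs of cyclic words\<close>

text \<open>
  Words of combs use the positions of the legs, so that they do not depend on names.
\<close>

fun leg_name :: "nat list \<Rightarrow> nat list \<Rightarrow> letter \<Rightarrow> letter" where
  "leg_name I J (In i) = In (I ! i)"
| "leg_name I J (Out p) = Out (J ! p)"

fun map_letter :: "(nat \<Rightarrow> nat) \<Rightarrow> letter \<Rightarrow> letter" where
  "map_letter \<phi> (In x) = In (\<phi> x)"
| "map_letter \<phi> (Out x) = Out (\<phi> x)"

definition map_cell :: "(nat \<Rightarrow> nat) \<Rightarrow> cell \<Rightarrow> cell" where
  "map_cell \<phi> c = (fst c, map \<phi> (cin c), map \<phi> (cout c))"

text \<open>
  The word lists all legs: the input at which the strand starts, the letters along it, and the
  output at which it ends.
\<close>

definition comb_graph :: "nat \<Rightarrow> nat \<Rightarrow> letter list \<Rightarrow> graph \<Rightarrow> bool" where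
  "comb_graph a b L G \<longleftrightarrow> distinct L \<and> set L = In ` {..<b} \<union> Out ` {..<a} \<and>
     (\<exists>I J cs s w f. length I = b \<and> length J = a \<and> lab G I J cs \<and> net I J cs \<and> net_connected I cs \<and>
        strand s w f cs \<and> In s # w @ [Out f] = map (leg_name I J) L)"

lemma comb_graph_cgraphs: "comb_graph a b L G \<Longrightarrow> G \<in> cgraphs bib_gens a b"
  unfolding comb_graph_def using cgraphs_lab by blast

lemma comb_graphE:
  assumes "comb_graph a b L G"
  obtains I J cs s w f where "length I = b" "length J = a" "lab G I J cs" "net I J cs" "net_connected I cs"
    "strand s w f cs" "In s # w @ [Out f] = map (leg_name I J) L"
  using assms unfolding comb_graph_def by (elim conjE exE) (rule that; assumption)

lemma set_wins: "set (wins w) = {x. In x \<in> set w}" and set_wouts: "set (wouts w) = {x. Out x \<in> set w}"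
  by (induction w rule: wins.induct) auto

lemma distinct_wins: "distinct w \<Longrightarrow> distinct (wins w)"
  by (induction w rule: wins.induct) (auto simp: set_wins)

lemma leg_name_inj:
  assumes "distinct I" "distinct J" "set L \<subseteq> In ` {..<length I} \<union> Out ` {..<length J}"
  shows "inj_on (leg_name I J) (set L)"
proof (rule inj_onI)
  fix l m assume "l \<in> set L" "m \<in> set L" and e: "leg_name I J l = leg_name I J m"
  then have "l \<in> In ` {..<length I} \<union> Out ` {..<length J}" "m \<in> In ` {..<length I} \<union> Out ` {..<length J}"
    using assms(3) by blast+
  then show "l = m" using e assms(1,2) by (cases l; cases m) (auto simp: nth_eq_iff_index_eq)
qed

text \<open>
  Two strands with the same word differ by a renaming, which is built along the strand; all
  names on a strand are distinct.
\<close>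

lemma strand_renaming:
  assumes "strand s (map (leg_name I J) M) f cs" "strand s' (map (leg_name I' J') M) f' cs'"
    "distinct (s # wins (map (leg_name I J) M) @ outl cs)"
  shows "\<exists>\<phi>. \<phi> s = s' \<and> \<phi> f = f' \<and> (\<forall>l\<in>set M. map_letter \<phi> (leg_name I J l) = leg_name I' J' l) \<and> cs' = map (map_cell \<phi>) cs"
  using assms
proof (induction M arbitrary: f f' cs cs' rule: rev_induct)
  case Nil
  then show ?case by (intro exI[of _ "\<lambda>_. s'"]) auto
next
  case (snoc l M)
  let ?l = "leg_name I J l" and ?l' = "leg_name I' J' l"
  obtain e ds where c: "cs = lcell e ?l f # ds" "strand s (map (leg_name I J) M) e ds"
    using snoc.prems(1) by (auto simp: strand_snoc)
  obtain e' ds' where c': "cs' = lcell e' ?l' f' # ds'" "strand s' (map (leg_name I' J') M) e' ds'"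
    using snoc.prems(2) by (auto simp: strand_snoc)
  have d: "distinct (s # wins (map (leg_name I J) M) @ outl ds)"
    using snoc.prems(3) unfolding c(1) by (cases ?l) auto
  from snoc.IH[OF c(2) c'(2) d] obtain \<phi> where p: "\<phi> s = s'" "\<phi> e = e'"
    "\<And>m. m \<in> set M \<Longrightarrow> map_letter \<phi> (leg_name I J m) = leg_name I' J' m" "ds' = map (map_cell \<phi>) ds" by blast
  let ?old = "{s} \<union> set (wins (map (leg_name I J) M)) \<union> set (outl ds)"
  note nm = strand_names[OF c(2)]
  have io: "set (inl ds) \<subseteq> ?old" "e \<in> ?old" using nm(1,2) by auto
  obtain t t' where tt: "?l = In t \<and> ?l' = In t' \<or> ?l = Out t \<and> ?l' = Out t'" by (cases l) auto
  have fresh: "f \<notin> ?old" "t \<notin> ?old" "f \<noteq> t" using snoc.prems(3) tt unfolding c(1) by auto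
  define \<psi> where "\<psi> = \<phi>(f := f', t := t')"
  have eq: "\<psi> x = \<phi> x" if "x \<in> ?old" for x using that fresh by (auto simp: \<psi>_def)
  have nt: "\<psi> f = f'" "\<psi> t = t'" using fresh(3) by (simp_all add: \<psi>_def)
  have M: "map_letter \<psi> (leg_name I J m) = leg_name I' J' m" if m: "m \<in> set M" for m
  proof -
    have "map_letter \<psi> (leg_name I J m) = map_letter \<phi> (leg_name I J m)"
    proof (cases "leg_name I J m")
      case (In x)
      then have "x \<in> set (wins (map (leg_name I J) M))" using m by (force simp: set_wins)
      then show ?thesis using eq In by simp
    next
      case (Out x)
      then have "x \<in> set (wouts (map (leg_name I J) M))" using m by (force simp: set_wouts)
      then show ?thesis using eq nm(3) Out by auto
    qed
    then show ?thesis using p(3)[OF m] by simp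
  qed
  have cells: "map (map_cell \<psi>) ds = map (map_cell \<phi>) ds"
  proof (rule map_cong[OF refl])
    fix c assume "c \<in> set ds"
    then have "set (cin c) \<subseteq> ?old" "set (cout c) \<subseteq> ?old" using io by (auto simp: inl_def outl_def)
    then show "map_cell \<psi> c = map_cell \<phi> c" using eq by (auto simp: map_cell_def subset_iff)
  qed
  have "map_cell \<psi> (lcell e ?l f) = lcell e' ?l' f'"
    using tt nt eq[OF io(2)] p(2) by (auto simp: map_cell_def)
  moreover have "map_letter \<psi> ?l = ?l'" using tt nt by auto
  ultimately show ?case
    using M nt p(1,4) eq[of s] cells by (intro exI[of _ \<psi>]) (auto simp: c(1) c'(1))
qed

text \<open>
  The renaming matches the legs, and wires are determined by names, so the graphs have the same
  wiring.
\<close>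

lemma comb_graph_iso:
  assumes "comb_graph a b L G" "comb_graph a b L H"
  shows "graph_iso id G H"
proof -
  obtain I J cs s w f where g: "length I = b" "length J = a" "lab G I J cs" "net I J cs" "strand s w f cs"
    "In s # w @ [Out f] = map (leg_name I J) L" using assms(1) by (rule comb_graphE)
  obtain I' J' cs' s' w' f' where h: "length I' = b" "length J' = a" "lab H I' J' cs'" "net I' J' cs'" "strand s' w' f' cs'"
    "In s' # w' @ [Out f'] = map (leg_name I' J') L" using assms(2) by (rule comb_graphE)
  have L: "distinct L" "set L = In ` {..<b} \<union> Out ` {..<a}" using assms(1) by (simp_all add: comb_graph_def)
  have d: "distinct I" "distinct J" "set I \<inter> set (outl cs) = {}" "distinct (outl cs)" using g(4) by (auto simp: net_def)
  define M where "M = butlast (tl L)"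
  have len: "length L = length w + 2" using arg_cong[OF g(6), of length] by simp
  obtain l0 l1 where L': "L = l0 # M @ [l1]"
  proof (cases L)
    case (Cons l0 T)
    then have "T \<noteq> []" using len by auto
    then show ?thesis using that[of l0 "last T"] Cons by (simp add: M_def)
  qed (use len in simp)
  have w: "w = map (leg_name I J) M" "leg_name I J l0 = In s" "leg_name I J l1 = Out f" using g(6) L' by auto
  have w': "w' = map (leg_name I' J') M" "leg_name I' J' l0 = In s'" "leg_name I' J' l1 = Out f'" using h(6) L' by auto
  have dist: "distinct (In s # w @ [Out f])"
    unfolding g(6) using L leg_name_inj[OF d(1,2), of L] g(1,2) by (simp add: distinct_map)
  have "set (wins (In s # w @ [Out f])) \<subseteq> set I"
  proof
    fix x assume "x \<in> set (wins (In s # w @ [Out f]))"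
    then have "In x \<in> leg_name I J ` set L" unfolding set_wins g(6) by simp
    then show "x \<in> set I" using L(2) g(1) by auto
  qed
  then have wi: "insert s (set (wins w)) \<subseteq> set I" by simp
  have "distinct (s # wins w)" using distinct_wins[OF dist] by simp
  then have "distinct (s # wins w @ outl cs)" using wi d(3,4) by auto
  with strand_renaming[of s I J M f cs s' I' J' f' cs'] obtain \<phi> where p: "\<phi> s = s'" "\<phi> f = f'"
    "\<And>l. l \<in> set M \<Longrightarrow> map_letter \<phi> (leg_name I J l) = leg_name I' J' l" "cs' = map (map_cell \<phi>) cs"
    using g(5) h(5) unfolding w(1) w'(1) by blast
  have all: "map_letter \<phi> (leg_name I J l) = leg_name I' J' l" if "l \<in> set L" for l
    using that p w w' unfolding L' by auto
  have pI: "\<phi> (I ! i) = I' ! i" if "i < b" for i using all[of "In i"] L(2) that by simp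
  have pJ: "\<phi> (J ! i) = J' ! i" if "i < a" for i using all[of "Out i"] L(2) that by simp
  note nG = lab_simps[OF g(3)] and nH = lab_simps[OF h(3)]
  have vs: "verts H = verts G" by (simp add: nG(3) nH(3) p(4) map_cell_def)
  have io: "ins H = ins G" "outs H = outs G" using nG(1,2) nH(1,2) g h by simp_all
  have st: "sources H = sources G" "targets H = targets G" by (simp_all add: sources_def targets_def vs io)
  have sn: "sname I' cs' u = \<phi> (sname I cs u)" if "u \<in> sources G" for u
    using that pI g(1) by (cases u) (auto simp: lab_sources[OF g(3)] p(4) map_cell_def simp del: sources_iff)
  have tn: "tname J' cs' u = \<phi> (tname J cs u)" if "u \<in> targets G" for u
    using that pJ g(2) by (cases u) (auto simp: lab_sources[OF g(3)] p(4) map_cell_def simp del: targets_iff)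
  have "wire H u = wire G u" if u: "u \<in> sources G" for u
  proof (rule tname_inj[OF h(4,3)])
    have uH: "u \<in> sources H" using u by (simp only: st)
    show "wire H u \<in> targets H" using nH(6)[OF uH] .
    show "wire G u \<in> targets H" using nG(6)[OF u] by (simp only: st)
    show "tname J' cs' (wire H u) = tname J' cs' (wire G u)"
      using nH(7)[OF uH] nG(7)[OF u] sn[OF u] tn[OF nG(6)[OF u]] by simp
  qed
  moreover have "relabel id t = t" for t by (cases t) auto
  ultimately show ?thesis by (simp add: graph_iso_def vs io permutes_id del: sources_iff)
qed

lemma topological_order:
  assumes "acyclic r" "finite A"
  shows "\<exists>vs. distinct vs \<and> set vs = A \<and> sorted_wrt (\<lambda>v w. (v, w) \<notin> r) vs"
  using assms(2)
proof (induction "card A" arbitrary: A)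
  case (Suc n)
  let ?r = "r \<inter> A \<times> A"
  have "finite ?r" using Suc.prems by (simp add: finite_Int)
  moreover have "acyclic ?r" using assms(1) by (rule acyclic_subset) simp
  ultimately have "wf (?r\<inverse>)" by (rule finite_acyclic_wf_converse)
  moreover have "A \<noteq> {}" using Suc.hyps(2) by auto
  ultimately obtain v where v: "v \<in> A" "\<And>w. (w, v) \<in> ?r\<inverse> \<Longrightarrow> w \<notin> A"
    by (metis equals0I wfE_min)
  have "n = card (A - {v})" using Suc v(1) by simp
  then obtain vs where vs: "distinct vs" "set vs = A - {v}" "sorted_wrt (\<lambda>v w. (v, w) \<notin> r) vs"
    using Suc.hyps(1)[of "A - {v}"] Suc.prems by blast
  have "(v, w) \<notin> r" if "w \<in> set vs" for w using v(1) v(2)[of w] that vs(2) by blast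
  then show ?case using vs v(1) by (intro exI[of _ "v # vs"]) auto
qed simp

lemma connected_graph_iso:
  assumes "graph_iso \<pi> G H" "dag G" "connected_graph G"
  shows "connected_graph H"
proof -
  note im = relabel_image(1)[OF assms(1,2)]
  have p: "\<pi> permutes {..<length (verts G)}" and len: "length (verts H) = length (verts G)"
    and w: "\<And>s. s \<in> sources G \<Longrightarrow> wire H (relabel \<pi> s) = relabel \<pi> (wire G s)"
    using assms(1) by (auto simp: graph_iso_def simp del: sources_iff)
  have path: "(relabel \<pi> s, relabel \<pi> t) \<in> (edge_adj H)\<^sup>*" if "(s, t) \<in> (edge_adj G)\<^sup>*" for s t
  proof (rule path_transport[OF _ that, where h = \<pi>])
    fix v s assume v: "v < length (verts G)" and s: "s \<in> incident G v"
    then have sG: "s \<in> sources G" by (simp add: incident_iff)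
    then have "relabel \<pi> s \<in> sources H" unfolding im[symmetric] by (rule imageI)
    moreover have "(\<exists>j. relabel \<pi> s = Vtx (\<pi> v) j) \<or> (\<exists>j. wire H (relabel \<pi> s) = Vtx (\<pi> v) j)"
      using s w[OF sG] by (auto simp: incident_iff)
    moreover have "\<pi> v < length (verts H)" using permutes_in_image[OF p, of v] v len by simp
    ultimately show "\<pi> v < length (verts H) \<and> relabel \<pi> s \<in> incident H (\<pi> v)" by (simp add: incident_iff del: sources_iff)
  qed
  obtain s0 where s0: "s0 \<in> sources G" using assms(3) by (auto simp: connected_graph_def)
  show ?thesis
  proof (rule connected_graphI[of "relabel \<pi> s0"])
    show "relabel \<pi> s0 \<in> sources H" unfolding im[symmetric] using s0 by (rule imageI)
    fix t assume "t \<in> sources H"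
    then obtain s where "s \<in> sources G" "t = relabel \<pi> s" unfolding im[symmetric] by blast
    then show "(relabel \<pi> s0, t) \<in> (edge_adj H)\<^sup>*" using path connected_graphD[OF assms(3) s0] by blast
  qed
qed

text \<open>
  Every edge is named by the encoding of its source, and the vertices are sorted topologically.
\<close>

lemma cgraph_net:
  assumes "G \<in> cgraphs bib_gens a b"
  shows "\<exists>I J cs H \<pi>. net I J cs \<and> lab H I J cs \<and> net_connected I cs \<and> length I = b \<and> length J = a \<and> graph_iso \<pi> G H"
proof -
  note G = cgraphsD[OF assms]
  let ?n = "length (verts G)"
  define cell_of :: "nat \<Rightarrow> cell" where "cell_of v = (verts G ! v, map (\<lambda>j. to_nat (src G (Vtx v j))) [0..<n_in (verts G ! v)],
    map (\<lambda>j. to_nat (Vtx v j)) [0..<n_out (verts G ! v)])" for v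
  define I where "I = map (\<lambda>i. to_nat (Ext i)) [0..<b]"
  define J where "J = map (\<lambda>p. to_nat (src G (Ext p))) [0..<a]"
  have len: "length I = b" "length J = a" by (simp_all add: I_def J_def)
  have "acyclic (vertex_rel G)" using G(4) by (simp add: dag_def)
  then obtain vs where vs: "distinct vs" "set vs = {..<?n}" "sorted_wrt (\<lambda>v w. (v, w) \<notin> vertex_rel G) vs"
    using topological_order[of "vertex_rel G" "{..<?n}"] by auto
  define cs where "cs = map cell_of vs"
  define ds where "ds = map cell_of [0..<?n]"
  have ms: "mset ds = mset cs" unfolding cs_def ds_def mset_map
    using vs by (metis atLeast_upt distinct_upt mset_eq_setD set_eq_iff_mset_eq_distinct)
  have lab: "lab G I J ds" unfolding lab_def
  proof (intro conjI ballI)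
    show "ins G = length I" "outs G = length J" using G(1,2) len by simp_all
    show "verts G = map fst ds" by (simp add: ds_def cell_of_def map_nth comp_def)
    show "length (cin c) = n_in (fst c)" "length (cout c) = n_out (fst c)" if "c \<in> set ds" for c
      using that by (auto simp: ds_def cell_of_def)
    fix s assume s: "s \<in> sources G"
    show "wire G s \<in> targets G" using dagD(1)[OF G(4) s] .
    then have "tname J ds (wire G s) = to_nat (src G (wire G s))"
      using G(1) by (cases "wire G s") (auto simp: J_def ds_def cell_of_def)
    also have "\<dots> = sname I ds s" using s G(2) src(3)[OF G(4) s] by (cases s) (auto simp: I_def ds_def cell_of_def)
    finally show "tname J ds (wire G s) = sname I ds s" .
  qed
  have outl: "set I \<union> set (outl cs) = to_nat ` sources G"
    unfolding I_def outl_def cs_def cell_of_def using vs(2) G(2)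
    by (auto simp: sources_def image_iff) 
  have inl: "set J \<union> set (inl cs) = (\<lambda>t. to_nat (src G t)) ` targets G"
  proof -
    have "targets G = Ext ` {..<a} \<union> (\<Union>v\<in>set vs. Vtx v ` {..<n_in (verts G ! v)})"
      using vs(2) G(1) by (auto simp: targets_def)
    then show ?thesis
      by (simp add: J_def inl_def cs_def cell_of_def image_Un image_UN image_image atLeast0LessThan)
  qed
  have ts: "(\<lambda>t. to_nat (src G t)) ` targets G = to_nat ` sources G"
    using src[OF G(4)] dagD(1)[OF G(4)] by (auto simp: image_iff simp del: sources_iff targets_iff) metis
  have dv: "distinct (concat (map (\<lambda>v. map (\<lambda>j. h (Vtx v j)) [0..<k v]) us))"
    if "distinct us" "inj_on h {Vtx v j |v j. v \<in> set us \<and> j < k v}" for us and h :: "port \<Rightarrow> nat" and k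
    using that
  proof (induction us)
    case (Cons u us)
    have 1: "inj_on h {Vtx v j |v j. v \<in> set us \<and> j < k v}" by (rule inj_on_subset[OF Cons.prems(2)]) auto
    have 2: "h (Vtx u i) = h (Vtx v j) \<longleftrightarrow> u = v \<and> i = j" if "i < k u" "v \<in> set (u # us)" "j < k v" for i v j
      using inj_onD[OF Cons.prems(2), of "Vtx u i" "Vtx v j"] that by auto
    have "distinct (map (\<lambda>j. h (Vtx u j)) [0..<k u])"
      using 2 by (auto simp: distinct_map inj_on_def)
    moreover have "set (map (\<lambda>j. h (Vtx u j)) [0..<k u]) \<inter> set (concat (map (\<lambda>v. map (\<lambda>j. h (Vtx v j)) [0..<k v]) us)) = {}"
      using 2 Cons.prems(1) by fastforce
    ultimately show ?case using Cons.IH[OF _ 1] Cons.prems(1) by simp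
  qed simp
  have iT: "inj_on (\<lambda>t. to_nat (src G t)) (targets G)"
    using src(2)[OF G(4)] by (intro inj_onI) (metis to_nat_split inj_to_nat injD)
  have net: "net I J cs" unfolding net_def
  proof (intro conjI ballI)
    show "wf_cell c" if "c \<in> set cs" for c
      using that vs(2) G(3) by (auto simp: cs_def cell_of_def wf_cell_def subset_iff)
    show "distinct (I @ outl cs)"
    proof -
      have "distinct (outl cs)" unfolding outl_def cs_def using dv[OF vs(1), of to_nat "\<lambda>v. n_out (verts G ! v)"]
        by (simp add: cell_of_def comp_def inj_on_def)
      moreover have "distinct I" by (simp add: I_def distinct_map inj_on_def)
      moreover have "set I \<inter> set (outl cs) = {}" by (auto simp: I_def outl_def cs_def cell_of_def)
      ultimately show ?thesis by simp
    qed
    show "distinct (J @ inl cs)"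
    proof -
      have i: "inj_on (\<lambda>t. to_nat (src G t)) {Vtx v j |v j. v \<in> set vs \<and> j < n_in (verts G ! v)}"
      proof (rule inj_on_subset[OF iT], rule subsetI)
        fix t assume "t \<in> {Vtx v j |v j. v \<in> set vs \<and> j < n_in (verts G ! v)}"
        then obtain v j where t: "t = Vtx v j" "v \<in> set vs" "j < n_in (verts G ! v)" by (elim CollectE exE conjE) (rule that)
        then show "t \<in> targets G" using vs(2) by simp
      qed
      have "distinct (inl cs)" unfolding inl_def cs_def map_map comp_def cell_of_def snd_conv fst_conv by (rule dv[OF vs(1) i])
      moreover have "distinct J" using inj_onD[OF iT, of "Ext i" "Ext j" for i j] G(1) by (auto simp: J_def distinct_map inj_on_def)
      moreover have "set J \<inter> set (inl cs) = {}"
      proof -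
        have "src G (Ext i) \<noteq> src G (Vtx v j)" if "i < a" "v < ?n" "j < n_in (verts G ! v)" for i v j
          using inj_onD[OF iT, of "Ext i" "Vtx v j"] that G(1) by auto
        then show ?thesis using vs(2) by (auto simp: J_def inl_def cs_def cell_of_def)
      qed
      ultimately show ?thesis by simp
    qed
    show "set I \<union> set (outl cs) = set J \<union> set (inl cs)" using outl inl ts by simp
    show "ordered (set I) cs"
      unfolding cs_def using vs(3)
    proof -
      have "ordered (set I) (map cell_of us)" if "\<exists>ts. vs = ts @ us" for us
        using that
      proof (induction us)
        case (Cons u us)
        then obtain ts where t: "vs = ts @ u # us" by blast
        have "set (cin (cell_of u)) \<subseteq> set I \<union> set (outl (map cell_of us))"
        proof
          fix x assume "x \<in> set (cin (cell_of u))"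
          then obtain j where j: "j < n_in (verts G ! u)" "x = to_nat (src G (Vtx u j))" by (auto simp: cell_of_def)
          have u: "u < ?n" using t vs(2) by auto
          then have sr: "src G (Vtx u j) \<in> sources G" "wire G (src G (Vtx u j)) = Vtx u j"
            using src(1,2)[OF G(4), of "Vtx u j"] j by simp_all
          show "x \<in> set I \<union> set (outl (map cell_of us))"
          proof (cases "src G (Vtx u j)")
            case (Ext i)
            then show ?thesis using sr j G(2) by (auto simp: I_def)
          next
            case (Vtx v k)
            then have vr: "(v, u) \<in> vertex_rel G" using sr by (auto simp: vertex_rel_def simp del: sources_iff)
            have v: "v < ?n" "k < n_out (verts G ! v)" using sr(1) Vtx by simp_all
            have "v \<in> set vs" using v(1) vs(2) by simp
            moreover have "v \<notin> set ts" using vs(3) vr unfolding t by (auto simp: sorted_wrt_append)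
            moreover have "v \<noteq> u" using vr \<open>acyclic (vertex_rel G)\<close> by (auto simp: acyclic_def)
            ultimately have "v \<in> set us" unfolding t by auto
            then show ?thesis using v(2) j(2) Vtx by (auto simp: outl_def cell_of_def intro!: bexI[of _ v])
          qed
        qed
        moreover have "ordered (set I) (map cell_of us)" using Cons.IH t by (metis append.assoc append_Cons append_Nil)
        ultimately show ?case by simp
      qed simp
      then show "ordered (set I) (map cell_of vs)" by blast
    qed
  qed
  obtain H where H: "lab H I J cs" using lab_exists[OF net] .
  obtain \<pi> where pi: "graph_iso \<pi> G H" using lab_iso[OF net ms lab H] .
  have "net_connected I cs"
  proof -
    have "connected_graph H" using connected_graph_iso[OF pi G(4,5)] .
    then show ?thesis using connected_lab[OF net H] by simp
  qed
  then show ?thesis using net H pi len by blast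
qed

section \<open>Combs span\<close>

lemma comb_graph_shape:
  assumes "comb_graph a b L G"
  shows "\<exists>i M p. L = In i # M @ [Out p]"
proof -
  obtain I J cs s w f where g: "In s # w @ [Out f] = map (leg_name I J) L" using assms by (rule comb_graphE)
  have len: "length L = length w + 2" using arg_cong[OF g, of length] by simp
  then obtain l0 T where T: "L = l0 # T" by (cases L) auto
  then obtain M l1 where M: "T = M @ [l1]" using len by (cases T rule: rev_cases) auto
  have "leg_name I J l0 = In s" "leg_name I J l1 = Out f" using g T M by auto
  then show ?thesis using T M by (cases l0; cases l1) auto
qed

lemma comb_graph_of_strand:
  assumes "comb_graph a b L G" "lab G I J cs" "net I J cs" "net_connected I cs" "length I = b" "length J = a"
    and c: "cong (bib_rels :: 'k::field_char_0 lin set) I J cs ds" and s: "strand s w f ds" "In s # w @ [Out f] = map (leg_name I J) L'"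
    and L': "distinct L'" "set L' = set L"
  shows "\<exists>H. comb_graph a b L' H \<and> prop_to (bib_rels :: 'k lin set) False a b G H"
proof -
  obtain H where H: "lab H I J ds" using lab_exists[OF cong_net(2)[OF c]] .
  have "pnet (bib_rels :: 'k lin set) False I J cs ds" "net_connected I ds" using c assms(4) by (simp_all add: cong_def)
  then have "prop_to (bib_rels :: 'k lin set) False a b G H" using pnetD[OF _ assms(2) H] assms(5,6) by simp
  moreover have "comb_graph a b L' H"
    unfolding comb_graph_def
    using assms(1,5,6) H cong_net(2)[OF c] \<open>net_connected I ds\<close> s L' unfolding comb_graph_def by auto
  ultimately show ?thesis by blast
qed

text \<open>
  A rotation whose result begins with an input and ends with an output cuts the word between an
  output and an input.
\<close>

lemma comb_graph_rotate:
  assumes G: "comb_graph a b L G" and "rotate k L = In i # M @ [Out p]"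
  shows "\<exists>H. comb_graph a b (rotate k L) H \<and> prop_to (bib_rels :: 'k::field_char_0 lin set) False a b G H"
proof -
  define m where "m = k mod length L"
  have rot: "rotate k L = drop m L @ take m L" by (simp add: rotate_drop_take m_def)
  show ?thesis
  proof (cases "m = 0")
    case True
    then have "rotate k L = L" using rot by simp
    then show ?thesis using G prop_to_refl[of bib_rels a b G] by (intro exI[of _ G]) simp
  next
    case False
    obtain i0 M0 p0 where L: "L = In i0 # M0 @ [Out p0]" using comb_graph_shape[OF G] by blast
    have mL: "m < length L" using L by (simp add: m_def)
    have "last (take m L) = last (drop m L @ take m L)" using False L by simp
    also have "\<dots> = Out p" using assms(2) rot by (metis last_ConsR last_snoc snoc_eq_iff_butlast)
    finally have 1: "last (take m L) = Out p" .
    have "hd (drop m L) = hd (drop m L @ take m L)" using mL by simp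
    then have 2: "hd (drop m L) = In i" using assms(2) rot by simp
    obtain P where P: "take m L = In i0 # P @ [Out p]"
    proof -
      obtain T where T: "take m L = In i0 # T" using False L by (cases m) auto
      then have "T \<noteq> []" using 1 by auto
      then have "T = butlast T @ [Out p]" using 1 T by (metis append_butlast_last_id last_ConsR)
      then show ?thesis using that[of "butlast T"] T by simp
    qed
    obtain Q where Q: "drop m L = In i # Q @ [Out p0]"
    proof -
      have "last (drop m L) = Out p0" using mL L by (metis last_ConsR last_drop last_snoc snoc_eq_iff_butlast)
      moreover obtain T where T: "drop m L = In i # T" using 2 mL by (cases "drop m L") auto
      ultimately have "T \<noteq> []" "last T = Out p0" by (auto split: if_splits)
      then have "T = butlast T @ [Out p0]" by (metis append_butlast_last_id)
      then show ?thesis using that[of "butlast T"] T by simp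
    qed
    have LPQ: "L = In i0 # P @ [Out p, In i] @ Q @ [Out p0]"
      using append_take_drop_id[of m L] unfolding P Q by simp
    have R: "rotate k L = In i # (Q @ [Out p0, In i0] @ P) @ [Out p]" using rot P Q by simp
    obtain I J cs s w f where g: "length I = b" "length J = a" "lab G I J cs" "net I J cs" "net_connected I cs"
      "strand s w f cs" "In s # w @ [Out f] = map (leg_name I J) L" using G by (rule comb_graphE)
    let ?n = "map (leg_name I J)"
    have w: "s = I ! i0" "f = J ! p0" "w = ?n P @ [Out (J ! p), In (I ! i)] @ ?n Q" using g(7) unfolding LPQ by auto
    have Lset: "set L = In ` {..<b} \<union> Out ` {..<a}" "distinct L" using G by (simp_all add: comb_graph_def)
    have wi: "set (wins (In s # w @ [Out f])) \<subseteq> set I"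
    proof
      fix x assume "x \<in> set (wins (In s # w @ [Out f]))"
      then have "In x \<in> leg_name I J ` set L" unfolding set_wins g(7) by simp
      then show "x \<in> set I" using Lset(1) g(1) by auto
    qed
    obtain ds where d: "strand (I ! i) (?n Q @ [Out f, In s] @ ?n P) (J ! p) ds" "cong (bib_rels :: 'k lin set) I J ([] @ cs @ []) ([] @ ds @ [])"
      using strand_rotate[OF refl, of s "?n P" "J ! p" "I ! i" "?n Q" f cs I J "[]" "[]"] g(4,6) wi unfolding w(3) by auto
    show ?thesis
    proof (rule comb_graph_of_strand[OF G g(3-5,1,2) _ d(1)])
      show "cong (bib_rels :: 'k lin set) I J cs ds" using d(2) by simp
      show "In (I ! i) # (?n Q @ [Out f, In s] @ ?n P) @ [Out (J ! p)] = ?n (rotate k L)"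
        unfolding R by (simp add: w)
    qed (use Lset in auto)
  qed
qed

lemma distinct_word: "distinct (wins w) \<Longrightarrow> distinct (wouts w) \<Longrightarrow> distinct w"
  by (induction w rule: wins.induct) (auto simp: set_wins set_wouts)

text \<open>
  The legs of the strand exhaust the inputs and outputs by \<open>net_to_comb\<close>, so they
  form a word.
\<close>

lemma cgraph_comb:
  assumes G: "G \<in> cgraphs bib_gens a b"
  shows "null bib_gens (bib_rels :: 'k::field_char_0 lin set) a b (single1 G) \<or>
    (\<exists>L H. comb_graph a b L H \<and> prop_to (bib_rels :: 'k lin set) False a b G H)"
proof -
  let ?R = "bib_rels :: 'k lin set"
  obtain I J cs H \<pi> where h: "net I J cs" "lab H I J cs" "net_connected I cs" "length I = b" "length J = a" "graph_iso \<pi> G H"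
    using cgraph_net[OF G] by (elim exE conjE) (rule that)
  have HG: "H \<in> cgraphs bib_gens a b" using cgraphs_lab[OF h(1,2)] h(3-5) by simp
  have GH: "prop_to ?R False a b G H" by (rule prop_to_iso[OF G HG h(6)])
  from net_to_comb[OF refl h(1,3)] consider (v) "vanishes ?R I J cs"
    | (c) s w f ds where "strand s w f ds" "mset (s # wins w) = mset I" "set (f # wouts w) = set J"
      "distinct (f # wouts w)" "cong ?R I J cs ds" by blast
  then show ?thesis
  proof cases
    case v
    then have "pnet ?R True I J cs cs" using h(3) by (simp add: vanishes_def)
    from prop_to_trans[OF GH pnetD[OF this h(2,2), unfolded h(4,5)]] show ?thesis by (simp add: prop_to_zero)
  next
    case c
    obtain K where K: "lab K I J ds" using lab_exists[OF cong_net(2)[OF c(5)]] .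
    have cc: "pnet ?R False I J cs ds" "net_connected I ds" using c(5) h(3) by (simp_all add: cong_def)
    have "prop_to ?R False a b G K"
      using prop_to_trans[OF GH pnetD[OF cc(1) h(2) K, unfolded h(4,5)]] by simp
    moreover have "\<exists>L. comb_graph a b L K"
    proof -
      let ?W = "In s # w @ [Out f]" and ?legs = "In ` {..<b} \<union> Out ` {..<a}" and ?g = "leg_name I J"
      have d: "distinct I" "distinct J" using h(1) by (auto simp: net_def)
      obtain L0 where L0: "set L0 = ?legs" using finite_list[of ?legs] by auto
      have inj: "inj_on ?g ?legs" using leg_name_inj[OF d, of L0] L0 h(4,5) by simp
      have sI: "insert s (set (wins w)) = set I" using arg_cong[OF c(2), of set_mset] by simp
      have W: "set ?W = ?g ` ?legs"
      proof (rule set_eqI)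
        fix l
        show "l \<in> set ?W \<longleftrightarrow> l \<in> ?g ` ?legs"
        proof (cases l)
          case (In x)
          have "l \<in> set ?W \<longleftrightarrow> x \<in> set I" using In sI by (auto simp: set_wins)
          also have "\<dots> \<longleftrightarrow> l \<in> ?g ` ?legs" 
          proof
            assume "x \<in> set I"
            then obtain i where "i < b" "x = I ! i" using h(4) by (auto simp: in_set_conv_nth)
            then show "l \<in> ?g ` ?legs" using In by (intro image_eqI[of _ _ "In i"]) auto
          qed (use In h(4) in auto)
          finally show ?thesis .
        next
          case (Out x)
          have "l \<in> set ?W \<longleftrightarrow> x \<in> set J" using Out c(3) by (auto simp: set_wouts)
          also have "\<dots> \<longleftrightarrow> l \<in> ?g ` ?legs" 
          proof
            assume "x \<in> set J"
            then obtain i where "i < a" "x = J ! i" using h(5) by (auto simp: in_set_conv_nth)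
            then show "l \<in> ?g ` ?legs" using Out by (intro image_eqI[of _ _ "Out i"]) auto
          qed (use Out h(5) in auto)
          finally show ?thesis .
        qed
      qed
      have "distinct (s # wins w)" using c(2) d(1) mset_eq_imp_distinct_iff by blast
      then have dW: "distinct ?W" using c(4) by (intro distinct_word) auto
      define L where "L = map (inv_into ?legs ?g) ?W"
      have "map ?g L = ?W" unfolding L_def map_map
        by (rule map_idI) (metis W comp_apply f_inv_into_f)
      moreover have "set L = ?legs"
        unfolding L_def set_map W using inj by (simp add: image_comp inv_into_image_cancel[OF inj order.refl, unfolded image_comp])
      moreover have "distinct L" using dW \<open>map ?g L = ?W\<close> by (metis distinct_map)
      ultimately show ?thesis unfolding comb_graph_def using h(4,5) K cong_net(2)[OF c(5)] cc(2) c(1) by metis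
    qed
    ultimately show ?thesis by blast
  qed
qed

text \<open>
  The colours are attached to names here; only colourings without a vertex of weight zero
  contribute to the state sum.
\<close>

definition good :: "(nat \<Rightarrow> color) \<Rightarrow> cell list \<Rightarrow> bool" where
  "good \<gamma> cs \<longleftrightarrow> (\<forall>c\<in>set cs. weight (fst c) (\<lambda>j. \<gamma> (cin c ! j)) (\<lambda>j. \<gamma> (cout c ! j)) \<noteq> 0)"

lemma colouring_weights:
  assumes n: "net I J cs" and l: "lab G I J cs" and named: "\<forall>s\<in>sources G. c s = \<gamma> (sname I cs s)"
  shows "(\<Prod>v<length (verts G). weight (verts G ! v) (\<lambda>j. c (src G (Vtx v j))) (\<lambda>j. c (Vtx v j))) \<noteq> 0 \<longleftrightarrow> good \<gamma> cs"
proof -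
  note nG = lab_simps[OF l] and d = dag_lab[OF n l] and \<gamma> = bspec[OF named]
  have e: "weight (verts G ! v) (\<lambda>j. c (src G (Vtx v j))) (\<lambda>j. c (Vtx v j)) =
    weight (fst (cs ! v)) (\<lambda>j. \<gamma> (cin (cs ! v) ! j)) (\<lambda>j. \<gamma> (cout (cs ! v) ! j))" if v: "v < length cs" for v
  proof (rule weight_cong')
    show "c (src G (Vtx v j)) = \<gamma> (cin (cs ! v) ! j)" if "j < n_in (verts G ! v)" for j
    proof -
      have t: "Vtx v j \<in> targets G" using v that nG(3) by simp
      from nG(7)[OF src(1)[OF d t]] have "sname I cs (src G (Vtx v j)) = cin (cs ! v) ! j" using src(2)[OF d t] by simp
      then show ?thesis using \<gamma>[OF src(1)[OF d t]] by simp
    qed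
    show "c (Vtx v j) = \<gamma> (cout (cs ! v) ! j)" if "j < n_out (verts G ! v)" for j
      using \<gamma>[of "Vtx v j"] v that nG(3) by simp
  qed (use v nG(3) in simp)
  show ?thesis using e by (auto simp: good_def nG(3) all_set_conv_all_nth)
qed

lemma boundary_names:
  assumes n: "net I J cs" and l: "lab G I J cs" and named: "\<forall>s\<in>sources G. c s = \<gamma> (sname I cs s)"
  shows "j < length I \<Longrightarrow> \<gamma> (I ! j) = c (Ext j)" "p < length J \<Longrightarrow> \<gamma> (J ! p) = c (src G (Ext p))"
proof -
  note nG = lab_simps[OF l] and d = dag_lab[OF n l] and \<gamma> = bspec[OF named]
  show "j < length I \<Longrightarrow> \<gamma> (I ! j) = c (Ext j)" using \<gamma>[of "Ext j"] nG(1) by simp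
  assume "p < length J"
  then have t: "Ext p \<in> targets G" using nG(2) by simp
  from nG(7)[OF src(1)[OF d t]] have "sname I cs (src G (Ext p)) = J ! p" using src(2)[OF d t] by simp
  then show "\<gamma> (J ! p) = c (src G (Ext p))" using \<gamma>[OF src(1)[OF d t]] by simp
qed

lemma Z_good:
  assumes n: "net I J cs" and l: "lab G I J cs" and "Z N G y x \<noteq> 0"
  shows "\<exists>\<gamma>. good \<gamma> cs \<and> (\<forall>j<length I. \<gamma> (I ! j) = x j) \<and> (\<forall>p<length J. \<gamma> (J ! p) = y p)"
proof -
  obtain c where c: "c \<in> colourings N G y x" "colour_term G c \<noteq> 0"
    using assms(3) unfolding Z_def by (meson sum.neutral)
  define \<gamma> where "\<gamma> x = c (inv_into (sources G) (sname I cs) x)" for x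
  have inj: "inj_on (sname I cs) (sources G)" using sname_inj[OF n l] by (intro inj_onI) blast
  have named: "\<forall>s\<in>sources G. c s = \<gamma> (sname I cs s)" using inv_into_f_f[OF inj] by (simp add: \<gamma>_def del: sources_iff)
  have "good \<gamma> cs" using colouring_weights[OF n l named] c(2) by (simp add: colour_term_def)
  moreover have "\<gamma> (I ! j) = x j" if "j < length I" for j
    using boundary_names(1)[OF n l named that] c(1) that lab_simps(1)[OF l] by (simp add: colourings_def)
  moreover have "\<gamma> (J ! p) = y p" if "p < length J" for p
    using boundary_names(2)[OF n l named that] c(1) that lab_simps(2)[OF l] by (simp add: colourings_def)
  ultimately show ?thesis by blast
qed

text \<open>
  A single nonzero summand cannot be cancelled.
\<close>

lemma Z_unique_good:
  assumes n: "net I J cs" and l: "lab G I J cs"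
    and g: "good \<gamma> cs" "\<And>x. x \<in> set I \<union> set (outl cs) \<Longrightarrow> \<gamma> x \<in> colors N"
    and x: "\<And>j. j < length I \<Longrightarrow> \<gamma> (I ! j) = x j" and y: "\<And>p. p < length J \<Longrightarrow> \<gamma> (J ! p) = y p"
    and u: "\<And>\<gamma>'. good \<gamma>' cs \<Longrightarrow> (\<And>j. j < length I \<Longrightarrow> \<gamma>' (I ! j) = x j) \<Longrightarrow> (\<And>p. p < length J \<Longrightarrow> \<gamma>' (J ! p) = y p) \<Longrightarrow>
      \<forall>x\<in>set I \<union> set (outl cs). \<gamma>' x = \<gamma> x"
  shows "Z N G y x \<noteq> 0"
proof -
  note nG = lab_simps[OF l] and d = dag_lab[OF n l]
  have im: "sname I cs ` sources G = set I \<union> set (outl cs)" by (rule sname_image[OF l])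
  define c0 where "c0 = restrict (\<lambda>s. \<gamma> (sname I cs s)) (sources G)"
  have named: "\<forall>s\<in>sources G. c0 s = \<gamma> (sname I cs s)" by (simp add: c0_def del: sources_iff)
  note \<gamma> = bspec[OF named]
  have c0: "c0 \<in> colourings N G y x"
  proof -
    have "c0 s \<in> colors N" if "s \<in> sources G" for s using \<gamma>[OF that] g(2) im that by auto
    moreover have "c0 (Ext j) = x j" if "j < ins G" for j using boundary_names(1)[OF n l named, of j] x that nG(1) by simp
    moreover have "c0 (src G (Ext p)) = y p" if "p < outs G" for p
      using boundary_names(2)[OF n l named, of p] y that nG(2) by simp
    moreover have "c0 \<in> extensional (sources G)" by (simp add: c0_def)
    ultimately show ?thesis by (simp add: colourings_def PiE_iff del: sources_iff)
  qed
  have other: "colour_term G c = 0" if c: "c \<in> colourings N G y x" "c \<noteq> c0" for c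
  proof (rule ccontr)
    assume nz: "colour_term G c \<noteq> 0"
    define \<gamma>' where "\<gamma>' x = c (inv_into (sources G) (sname I cs) x)" for x
    have inj: "inj_on (sname I cs) (sources G)" using sname_inj[OF n l] by (intro inj_onI) blast
    have named': "\<forall>s\<in>sources G. c s = \<gamma>' (sname I cs s)" using inv_into_f_f[OF inj] by (simp add: \<gamma>'_def del: sources_iff)
    note g' = bspec[OF named']
    have "good \<gamma>' cs" using colouring_weights[OF n l named'] nz by (simp add: colour_term_def)
    then have "\<forall>x\<in>set I \<union> set (outl cs). \<gamma>' x = \<gamma> x"
    proof (rule u)
      show "\<gamma>' (I ! j) = x j" if "j < length I" for j
        using boundary_names(1)[OF n l named' that] c(1) that nG(1) by (simp add: colourings_def)
      show "\<gamma>' (J ! p) = y p" if "p < length J" for p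
        using boundary_names(2)[OF n l named' that] c(1) that nG(2) by (simp add: colourings_def)
    qed
    then have "c s = c0 s" if "s \<in> sources G" for s using g'[OF that] \<gamma>[OF that] im that by auto
    moreover have "c \<in> extensional (sources G)" "c0 \<in> extensional (sources G)"
      using c(1) by (simp_all add: colourings_def PiE_iff c0_def del: sources_iff)
    ultimately have "c = c0" by (intro extensionalityI) auto
    then show False using c(2) by simp
  qed
  have fin: "finite (colourings N G y x)"
    by (rule finite_subset[of _ "sources G \<rightarrow>\<^sub>E colors N"]) (auto simp: colourings_def intro: finite_PiE)
  have "Z N G y x = colour_term G c0"
    unfolding Z_def using sum.remove[OF fin c0, of "colour_term G"] other by simp
  moreover have "colour_sign G c0 \<noteq> 0"
    unfolding colour_sign_def using arcs_sign_square by (metis mult_zero_left zero_neq_one)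
  ultimately show ?thesis using colouring_weights[OF n l named] g(1) by (simp add: colour_term_def)
qed

section \<open>Colourings of a strand\<close>

lemma good_simps: "good \<gamma> [] \<longleftrightarrow> True"
  "good \<gamma> (c # cs) \<longleftrightarrow> weight (fst c) (\<lambda>j. \<gamma> (cin c ! j)) (\<lambda>j. \<gamma> (cout c ! j)) \<noteq> 0 \<and> good \<gamma> cs"
  "good \<gamma> (cs @ ds) \<longleftrightarrow> good \<gamma> cs \<and> good \<gamma> ds"
  by (auto simp: good_def)

lemma strand_wf: "strand s w f cs \<Longrightarrow> c \<in> set cs \<Longrightarrow> wf_cell c"
  by (induction w arbitrary: s cs) (auto simp: lcell_net)

lemma weight_Mult_forced: "weight Mult a b \<noteq> 0 \<Longrightarrow> \<not> occ (a 0) \<Longrightarrow> occ (a 1) \<Longrightarrow> b 0 = (fst (a 0), fst (snd (a 1)), False)"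
  by (simp add: prod_eq_iff split: if_splits)

lemma weight_Comult_forced: "weight Comult a b \<noteq> 0 \<Longrightarrow> \<not> occ (a 0) \<Longrightarrow> \<not> occ (b 1) \<Longrightarrow> b 0 = (fst (a 0), fst (b 1), False)"
  by (simp add: prod_eq_iff split: if_splits)

lemma good_cong: "good \<gamma> cs \<Longrightarrow> (\<And>c. c \<in> set cs \<Longrightarrow> wf_cell c) \<Longrightarrow> (\<And>x. x \<in> set (inl cs) \<union> set (outl cs) \<Longrightarrow> \<gamma>' x = \<gamma> x) \<Longrightarrow> good \<gamma>' cs"
  unfolding good_def
proof (intro ballI)
  fix c assume a: "\<forall>c\<in>set cs. weight (fst c) (\<lambda>j. \<gamma> (cin c ! j)) (\<lambda>j. \<gamma> (cout c ! j)) \<noteq> 0"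
    "\<And>c. c \<in> set cs \<Longrightarrow> wf_cell c" "\<And>x. x \<in> set (inl cs) \<union> set (outl cs) \<Longrightarrow> \<gamma>' x = \<gamma> x" "c \<in> set cs"
  show "weight (fst c) (\<lambda>j. \<gamma>' (cin c ! j)) (\<lambda>j. \<gamma>' (cout c ! j)) \<noteq> 0"
  proof -
    have len: "length (cin c) = n_in (fst c)" "length (cout c) = n_out (fst c)" using a(2)[OF a(4)] by (simp_all add: wf_cell_def)
    have "set (cin c) \<subseteq> set (inl cs)" "set (cout c) \<subseteq> set (outl cs)" using a(4) by (auto simp: inl_def outl_def)
    then have "\<gamma>' x = \<gamma> x" if "x \<in> set (cin c) \<union> set (cout c)" for x using a(3) that by blast
    then have "weight (fst c) (\<lambda>j. \<gamma>' (cin c ! j)) (\<lambda>j. \<gamma>' (cout c ! j)) = weight (fst c) (\<lambda>j. \<gamma> (cin c ! j)) (\<lambda>j. \<gamma> (cout c ! j))"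
      using len by (intro weight_cong') simp_all
    then show ?thesis using a(1,4) by simp
  qed
qed

text \<open>
  The matrix position of a leg whose letter has index \<open>\<kappa>\<close> in a cyclic word
  of length \<open>n\<close>; for outputs it is transposed, as a coproduct requires.
\<close>

fun leg_arc :: "(letter \<Rightarrow> nat) \<Rightarrow> nat \<Rightarrow> letter \<Rightarrow> nat \<times> nat" where
  "leg_arc \<kappa> n (In y) = (\<kappa> (In y), (\<kappa> (In y) + 1) mod n)"
| "leg_arc \<kappa> n (Out y) = ((\<kappa> (Out y) + 1) mod n, \<kappa> (Out y))"

fun leg_id :: "letter \<Rightarrow> nat" where "leg_id (In x) = x" | "leg_id (Out x) = x"

text \<open>
  Along the strand the first index is constant. The second index must match the index of the
  next letter, and is increased by one when that letter is absorbed or emitted. Hence the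
  letters have consecutive indices.
\<close>

lemma good_strand_indices:
  assumes "strand s w f cs" "good \<gamma> cs"
    "\<And>l. l \<in> set w \<Longrightarrow> (fst (\<gamma> (leg_id l)), fst (snd (\<gamma> (leg_id l)))) = leg_arc \<kappa> n l"
    "fst (snd (\<gamma> s)) = \<beta> mod n"
  shows "(\<forall>k<length w. \<kappa> (w ! k) = (\<beta> + k) mod n) \<and> fst (\<gamma> f) = fst (\<gamma> s) \<and> fst (snd (\<gamma> f)) = (\<beta> + length w) mod n"
  using assms
proof (induction w arbitrary: s \<beta> cs)
  case (Cons l w)
  then obtain e ds where c: "cs = ds @ [lcell s l e]" "strand e w f ds" by auto
  have w: "weight (fst (lcell s l e)) (\<lambda>j. \<gamma> (cin (lcell s l e) ! j)) (\<lambda>j. \<gamma> (cout (lcell s l e) ! j)) \<noteq> 0" "good \<gamma> ds"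
    using Cons.prems(2) by (auto simp: c(1) good_simps)
  have l: "(fst (\<gamma> (leg_id l)), fst (snd (\<gamma> (leg_id l)))) = leg_arc \<kappa> n l" using Cons.prems(3) by simp
  have 0: "\<kappa> l = \<beta> mod n \<and> fst (\<gamma> e) = fst (\<gamma> s) \<and> fst (snd (\<gamma> e)) = (\<kappa> l + 1) mod n"
    using w(1) l Cons.prems(4) by (cases l) (auto split: if_splits)
  then have 1: "\<kappa> l = \<beta> mod n \<and> fst (\<gamma> e) = fst (\<gamma> s) \<and> fst (snd (\<gamma> e)) = (\<beta> + 1) mod n"
    by (simp add: mod_Suc_eq)
  have 2: "(\<forall>k<length w. \<kappa> (w ! k) = ((\<beta> + 1) + k) mod n) \<and> fst (\<gamma> f) = fst (\<gamma> e) \<and> fst (snd (\<gamma> f)) = ((\<beta> + 1) + length w) mod n"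
    by (rule Cons.IH[OF c(2) w(2)]) (use 1 Cons.prems(3) in auto)
  then show ?case using 1 by (auto simp: nth_Cons split: nat.split)
qed simp

text \<open>
  An even strand that absorbs an odd input or emits an even output remains even, and its indices
  are determined.
\<close>

lemma good_strand_unique:
  assumes "strand s w f cs" "good \<gamma> cs" "good \<gamma>' cs" "\<gamma>' s = \<gamma> s" "\<not> occ (\<gamma> s)"
    "\<And>x. In x \<in> set w \<Longrightarrow> \<gamma>' x = \<gamma> x \<and> occ (\<gamma> x)" "\<And>x. Out x \<in> set w \<Longrightarrow> \<gamma>' x = \<gamma> x \<and> \<not> occ (\<gamma> x)"
  shows "\<forall>x\<in>set (outl cs). \<gamma>' x = \<gamma> x"
  using assms
proof (induction w arbitrary: s cs)
  case (Cons l w)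
  then obtain e ds where c: "cs = ds @ [lcell s l e]" "strand e w f ds" by auto
  have g: "good \<gamma> ds" "good \<gamma>' ds" using Cons.prems(2,3) by (simp_all add: c(1) good_simps)
  have e: "\<gamma>' e = \<gamma> e \<and> \<not> occ (\<gamma> e)"
  proof -
    have w: "weight (fst (lcell s l e)) (\<lambda>j. \<gamma> (cin (lcell s l e) ! j)) (\<lambda>j. \<gamma> (cout (lcell s l e) ! j)) \<noteq> 0"
      "weight (fst (lcell s l e)) (\<lambda>j. \<gamma>' (cin (lcell s l e) ! j)) (\<lambda>j. \<gamma>' (cout (lcell s l e) ! j)) \<noteq> 0"
      using Cons.prems(2,3) unfolding c(1) good_simps by blast+
    show ?thesis
    proof (cases l)
      case (In y)
      have y: "\<gamma>' y = \<gamma> y" "occ (\<gamma> y)" using Cons.prems(6)[of y] In by simp_all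
      show ?thesis using weight_Mult_forced[of "\<lambda>j. \<gamma> ([s, y] ! j)" "\<lambda>j. \<gamma> ([e] ! j)"]
          weight_Mult_forced[of "\<lambda>j. \<gamma>' ([s, y] ! j)" "\<lambda>j. \<gamma>' ([e] ! j)"] w y Cons.prems(4,5) unfolding In
        by (simp del: weight.simps)
    next
      case (Out y)
      have y: "\<gamma>' y = \<gamma> y" "\<not> occ (\<gamma> y)" using Cons.prems(7)[of y] Out by simp_all
      show ?thesis using weight_Comult_forced[of "\<lambda>j. \<gamma> ([s] ! j)" "\<lambda>j. \<gamma> ([e, y] ! j)"]
          weight_Comult_forced[of "\<lambda>j. \<gamma>' ([s] ! j)" "\<lambda>j. \<gamma>' ([e, y] ! j)"] w y Cons.prems(4,5) unfolding Out
        by (simp del: weight.simps)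
    qed
  qed
  have "\<forall>x\<in>set (outl ds). \<gamma>' x = \<gamma> x"
    by (rule Cons.IH[OF c(2) g]) (use e Cons.prems(6,7) in auto)
  then show ?case using e Cons.prems(7) by (cases l) (auto simp: c(1))
qed simp

lemma good_strand_exists:
  assumes "strand s w f cs" "distinct (s # wins w @ outl cs)" "\<delta> s = (\<alpha>, \<beta> mod n, False)" "n > 0" "\<alpha> < n"
    "\<And>k y. k < length w \<Longrightarrow> w ! k = In y \<Longrightarrow> \<delta> y = ((\<beta> + k) mod n, (\<beta> + k + 1) mod n, True)"
    "\<And>k y. k < length w \<Longrightarrow> w ! k = Out y \<Longrightarrow> \<delta> y = ((\<beta> + k + 1) mod n, (\<beta> + k) mod n, False)"
  shows "\<exists>\<gamma>. good \<gamma> cs \<and> (\<forall>x. x \<notin> set (outl cs) \<or> x \<in> set (wouts w) \<longrightarrow> \<gamma> x = \<delta> x) \<and>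
    \<gamma> f = (\<alpha>, (\<beta> + length w) mod n, False) \<and> (\<forall>x\<in>set (outl cs). \<gamma> x \<in> colors n)"
  using assms
proof (induction w arbitrary: f cs rule: rev_induct)
  case Nil
  then show ?case by (intro exI[of _ \<delta>]) (auto simp: good_simps)
next
  case (snoc l w)
  obtain e ds where c: "cs = lcell e l f # ds" "strand s w e ds" using snoc.prems(1) by (auto simp: strand_snoc)
  have d: "distinct (s # wins w @ outl ds)" using snoc.prems(2) unfolding c(1) by (cases l) auto
  have old: "\<delta> y = ((\<beta> + k) mod n, (\<beta> + k + 1) mod n, True)" if "k < length w" "w ! k = In y" for k y
    using snoc.prems(6)[of k y] that by (simp add: nth_append)
  have old': "\<delta> y = ((\<beta> + k + 1) mod n, (\<beta> + k) mod n, False)" if "k < length w" "w ! k = Out y" for k y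
    using snoc.prems(7)[of k y] that by (simp add: nth_append)
  obtain \<gamma> where g: "good \<gamma> ds" "\<forall>x. x \<notin> set (outl ds) \<or> x \<in> set (wouts w) \<longrightarrow> \<gamma> x = \<delta> x"
    "\<gamma> e = (\<alpha>, (\<beta> + length w) mod n, False)" "\<forall>x\<in>set (outl ds). \<gamma> x \<in> colors n"
    using snoc.IH[OF c(2) d snoc.prems(3-5) old old'] by blast
  define \<gamma>' where "\<gamma>' = \<gamma>(f := (\<alpha>, (\<beta> + length (w @ [l])) mod n, False))"
  note nm = strand_names[OF c(2)]
  have fresh: "f \<notin> set (outl ds)" "f \<notin> set (wins w)" "f \<noteq> s" using snoc.prems(2) unfolding c(1) by (cases l; auto)+
  have fe: "f \<noteq> e" "f \<notin> set (inl ds)" using fresh nm(1,2) by auto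
  have same: "\<gamma>' x = \<gamma> x" if "x \<noteq> f" for x using that by (simp add: \<gamma>'_def)
  have f1: "\<gamma>' f = (\<alpha>, (\<beta> + length w + 1) mod n, False)" by (simp add: \<gamma>'_def)
  have gds: "good \<gamma>' ds"
  proof (rule good_cong[OF g(1) strand_wf[OF c(2)]])
    fix x assume "x \<in> set (inl ds) \<union> set (outl ds)"
    then have "x \<noteq> f" using fe(2) fresh(1) by blast
    then show "\<gamma>' x = \<gamma> x" by (rule same)
  qed
  have leg: "leg_id l \<notin> set (outl ds)" "leg_id l \<noteq> f" using snoc.prems(2) unfolding c(1) by (cases l; auto)+
  have lg: "\<gamma>' (leg_id l) = \<delta> (leg_id l)" using same[OF leg(2)] g(2) leg(1) by simp
  have cell: "weight (fst (lcell e l f)) (\<lambda>j. \<gamma>' (cin (lcell e l f) ! j)) (\<lambda>j. \<gamma>' (cout (lcell e l f) ! j)) \<noteq> 0"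
  proof (cases l)
    case (In y)
    then show ?thesis using lg g(3) same[OF fe(1)[symmetric]] f1 snoc.prems(6)[of "length w" y] by simp
  next
    case (Out y)
    then show ?thesis using lg g(3) same[OF fe(1)[symmetric]] f1 snoc.prems(7)[of "length w" y] by simp
  qed
  have "\<gamma>' x \<in> colors n" if "x \<in> set (outl cs)" for x
  proof (cases "x = f \<or> x = leg_id l")
    case True
    then show ?thesis using lg snoc.prems(4-5) snoc.prems(6)[of "length w"] snoc.prems(7)[of "length w"] leg(2)
      by (cases l) (auto simp: \<gamma>'_def colors_def)
  next
    case False
    then have "x \<in> set (outl ds)" using that unfolding c(1) by (cases l) auto
    then show ?thesis using g(4) same False by simp
  qed
  moreover have "\<gamma>' x = \<delta> x" if "x \<notin> set (outl cs) \<or> x \<in> set (wouts (w @ [l]))" for x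
  proof (cases "x = leg_id l")
    case False
    have "f \<notin> set (wouts w)" using fresh(1) nm(3) by blast
    moreover have "x \<notin> set (outl cs) \<or> x \<in> set (wouts w)" using that False by (cases l) auto
    moreover have "f \<in> set (outl cs)" "set (outl ds) \<subseteq> set (outl cs)" unfolding c(1) by (cases l; auto)+
    ultimately have "x \<noteq> f" "x \<notin> set (outl ds) \<or> x \<in> set (wouts w)" by blast+
    then show ?thesis using same[of x] g(2) by simp
  qed (use lg in simp)
  ultimately show ?case
    using gds cell by (intro exI[of _ \<gamma>']) (simp add: c(1) good_simps f1 del: outl_simps)
qed


section \<open>State sums of words\<close>

definition pos :: "letter list \<Rightarrow> letter \<Rightarrow> nat" where
  "pos L l = (THE t. t < length L \<and> L ! t = l)"

lemma pos_nth: "distinct L \<Longrightarrow> t < length L \<Longrightarrow> pos L (L ! t) = t"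
  unfolding pos_def by (rule the_equality) (auto simp: nth_eq_iff_index_eq)

lemma pos_less: "distinct L \<Longrightarrow> l \<in> set L \<Longrightarrow> pos L l < length L \<and> L ! pos L l = l"
  by (metis in_set_conv_nth pos_nth)

text \<open>
  All inputs except the start of the strand are odd, all outputs are even: then exactly one
  parity is possible for each edge of the strand.
\<close>

fun leg_color :: "letter list \<Rightarrow> letter \<Rightarrow> color" where
  "leg_color L (In i) = (pos L (In i), (pos L (In i) + 1) mod length L, pos L (In i) \<noteq> 0)"
| "leg_color L (Out p) = ((pos L (Out p) + 1) mod length L, pos L (Out p), False)"

lemma leg_color_in: "distinct L \<Longrightarrow> l \<in> set L \<Longrightarrow> leg_color L l \<in> colors (length L)"
  using pos_less[of L l] by (cases l) (auto simp: colors_def intro!: mod_less_divisor)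

abbreviation "word_sum L G \<equiv> Z (length L) G (\<lambda>p. leg_color L (Out p)) (\<lambda>i. leg_color L (In i))"

text \<open>
  The start of the strand of \<open>L'\<close> fixes its index in \<open>L\<close>, and from
  there on the indices are consecutive modulo the length.
\<close>

lemma word_sum_rotation:
  assumes L: "distinct L" and G: "comb_graph a b L' G" "set L' = set L" and nz: "word_sum L G \<noteq> 0"
  shows "\<exists>k. L' = rotate k L"
proof -
  obtain I J cs s w f where g: "length I = b" "length J = a" "lab G I J cs" "net I J cs" "net_connected I cs"
    "strand s w f cs" "In s # w @ [Out f] = map (leg_name I J) L'" using G(1) by (rule comb_graphE)
  let ?n = "length L" and ?g = "leg_name I J"
  have L': "distinct L'" "set L' = In ` {..<b} \<union> Out ` {..<a}" using G(1) by (simp_all add: comb_graph_def)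
  have n: "length L' = ?n" using L L'(1) G(2) by (metis distinct_card)
  have lw: "?n = length w + 2" using arg_cong[OF g(7), of length] n by simp
  obtain \<gamma> where \<gamma>: "good \<gamma> cs" "\<And>j. j < b \<Longrightarrow> \<gamma> (I ! j) = leg_color L (In j)" "\<And>p. p < a \<Longrightarrow> \<gamma> (J ! p) = leg_color L (Out p)"
    using Z_good[OF g(4,3) nz] g(1,2) by blast
  have d: "distinct I" "distinct J" using g(4) by (auto simp: net_def)
  have inj: "inj_on ?g (set L')" using leg_name_inj[OF d, of L'] L'(2) g(1,2) by simp
  have legs: "\<gamma> (leg_id (?g l)) = leg_color L l" if "l \<in> set L'" for l
    using that \<gamma>(2,3) unfolding L'(2) by (cases l) auto
  \<comment> \<open>The index in \<open>L\<close> of a leg, as a function of its name.\<close>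
  define \<kappa> where "\<kappa> m = pos L (inv_into (set L') ?g m)" for m
  have kap: "\<kappa> (?g l) = pos L l" if "l \<in> set L'" for l using inv_into_f_f[OF inj that] by (simp add: \<kappa>_def)
  have nth: "(In s # w @ [Out f]) ! k = ?g (L' ! k)" if "k < ?n" for k using g(7) that n by simp
  have arc: "(fst (\<gamma> (leg_id m)), fst (snd (\<gamma> (leg_id m)))) = leg_arc \<kappa> ?n m" if m: "m \<in> set w" for m
  proof -
    have "m \<in> set (In s # w @ [Out f])" using m by simp
    then obtain l where l: "l \<in> set L'" "m = ?g l" unfolding g(7) by auto
    note e = legs[OF l(1)] kap[OF l(1)]
    show ?thesis
    proof (cases l)
      case (In i)
      then show ?thesis using e l(2) by simp
    next
      case (Out p)
      then show ?thesis using e l(2) by simp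
    qed
  qed
  have mem: "L' ! k \<in> set L'" if "k < ?n" for k using that n by simp
  define t where "t = pos L (L' ! 0)"
  have g0: "?g (L' ! 0) = In s" using nth[of 0] lw by simp
  then have "\<exists>i. L' ! 0 = In i" by (cases "L' ! 0") auto
  then have s: "fst (\<gamma> s) = t" "fst (snd (\<gamma> s)) = (t + 1) mod ?n" using legs[OF mem, of 0] g0 lw by (auto simp: t_def)
  have idx: "(\<forall>k<length w. \<kappa> (w ! k) = ((t + 1) + k) mod ?n) \<and> fst (\<gamma> f) = fst (\<gamma> s) \<and> fst (snd (\<gamma> f)) = ((t + 1) + length w) mod ?n"
    by (rule good_strand_indices[OF g(6) \<gamma>(1) arc s(2)])
  have t: "t < ?n" using pos_less[OF L, of "L' ! 0"] mem[of 0] G(2) lw by (simp add: t_def)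
  have p: "pos L (L' ! k) = (t + k) mod ?n" if k: "k < ?n" for k
  proof -
    consider "k = 0" | k' where "k = Suc k'" "k' < length w" | "k = length w + 1" using k lw by (cases k) (auto, linarith)
    then show ?thesis
    proof cases
      case 1
      then show ?thesis using t by (simp add: t_def)
    next
      case 2
      then have "?g (L' ! k) = w ! k'" using nth[OF k] by (simp add: nth_append)
      then show ?thesis using idx kap[OF mem[OF k]] 2 by simp
    next
      case 3
      then have gf: "?g (L' ! k) = Out f" using nth[OF k] by (simp add: nth_append)
      then obtain q where "L' ! k = Out q" by (cases "L' ! k") auto
      then have "fst (snd (\<gamma> f)) = pos L (L' ! k)" using legs[OF mem[OF k]] gf by simp
      then show ?thesis using idx 3 by simp
    qed
  qed
  have "L' = rotate t L"
  proof (rule nth_equalityI)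
    fix k assume "k < length L'"
    then have k: "k < ?n" using n by simp
    then show "L' ! k = rotate t L ! k"
      using p[OF k] pos_less[OF L, of "L' ! k"] mem[OF k] G(2) by (simp add: nth_rotate)
  qed (simp add: n)
  then show ?thesis by blast
qed

text \<open>
  The colouring is forced edge by edge along the strand, and it exists because the indices of
  the last edge are those of the final output.
\<close>

lemma word_sum_nonzero:
  assumes G: "comb_graph a b L G"
  shows "word_sum L G \<noteq> 0"
proof -
  obtain I J cs s w f where g: "length I = b" "length J = a" "lab G I J cs" "net I J cs" "net_connected I cs"
    "strand s w f cs" "In s # w @ [Out f] = map (leg_name I J) L" using G by (rule comb_graphE)
  let ?n = "length L" and ?g = "leg_name I J"
  have L: "distinct L" "set L = In ` {..<b} \<union> Out ` {..<a}" using G by (simp_all add: comb_graph_def)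
  have lw: "?n = length w + 2" using arg_cong[OF g(7), of length] by simp
  have d: "distinct I" "distinct J" "set I \<inter> set (outl cs) = {}" "distinct (outl cs)" using g(4) by (auto simp: net_def)
  have inj: "inj_on ?g (set L)" using leg_name_inj[OF d(1,2), of L] L(2) g(1,2) by simp
  have W: "(In s # w @ [Out f]) ! k = ?g (L ! k)" if "k < ?n" for k using g(7) that by simp
  have dW: "distinct (In s # w @ [Out f])" unfolding g(7) using inj L(1) by (simp add: distinct_map)
  have wI: "insert s (set (wins w)) \<subseteq> set I"
  proof -
    have "set (wins (In s # w @ [Out f])) \<subseteq> set I"
    proof
      fix x assume "x \<in> set (wins (In s # w @ [Out f]))"
      then have "In x \<in> ?g ` set L" unfolding set_wins g(7) by simp
      then show "x \<in> set I" using L(2) g(1) by auto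
    qed
    then show ?thesis by simp
  qed
  have dist: "distinct (s # wins w @ outl cs)"
    using distinct_wins[OF dW] wI d(3,4) by auto
  note nm = strand_names[OF g(6)]
  \<comment> \<open>The prescribed colours of the legs; a name that is both an input and an output belongs to the comb without vertices, and its two colours agree.\<close>
  define \<gamma>0 where "\<gamma>0 x = (if x \<in> set I then leg_color L (inv_into (set L) ?g (In x)) else leg_color L (inv_into (set L) ?g (Out x)))" for x
  have gI: "\<gamma>0 x = leg_color L l" if "l \<in> set L" "?g l = In x" for x l
  proof -
    have "\<exists>i. l = In i" using that(2) by (cases l) simp_all
    then obtain i where "l = In i" by blast
    then have "x \<in> set I" using that L(2) g(1) by auto
    moreover have "inv_into (set L) ?g (In x) = l" using inv_into_f_f[OF inj that(1)] that(2) by simp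
    ultimately show ?thesis by (simp add: \<gamma>0_def)
  qed
  have gO: "\<gamma>0 x = leg_color L l" if "l \<in> set L" "?g l = Out x" "x \<notin> set I" for x l
    using inv_into_f_f[OF inj that(1)] that(2,3) by (simp add: \<gamma>0_def)
  have wl: "w ! k = ?g (L ! (k + 1))" "L ! (k + 1) \<in> set L" "pos L (L ! (k + 1)) = k + 1" if "k < length w" for k
    using W[of "k + 1"] that lw pos_nth[OF L(1), of "k + 1"] by (simp_all add: nth_append)
  have s0: "?g (L ! 0) = In s" "L ! 0 \<in> set L" "pos L (L ! 0) = 0" using W[of 0] lw pos_nth[OF L(1), of 0] by simp_all
  have fl: "?g (L ! (length w + 1)) = Out f" "L ! (length w + 1) \<in> set L" "pos L (L ! (length w + 1)) = length w + 1"
    using W[of "length w + 1"] lw pos_nth[OF L(1), of "length w + 1"] by (simp_all add: nth_append)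
  have gs: "\<gamma>0 s = (0, 1 mod ?n, False)"
    using gI[OF s0(2,1)] s0 by (cases "L ! 0") simp_all
  have wo: "x \<notin> set I" if "x \<in> set (wouts w)" for x using that nm(3) d(3) by blast
  have hI: "\<gamma>0 y = ((1 + k) mod ?n, (1 + k + 1) mod ?n, True)" if k: "k < length w" "w ! k = In y" for k y
  proof -
    have "\<gamma>0 y = leg_color L (L ! (k + 1))" using gI[OF wl(2)[OF k(1)]] wl(1)[OF k(1)] k(2) by simp
    moreover obtain i where "L ! (k + 1) = In i" using wl(1)[OF k(1)] k(2) by (cases "L ! (k + 1)") auto
    ultimately show ?thesis using wl(3)[OF k(1)] k(1) lw by simp
  qed
  have hO: "\<gamma>0 y = ((1 + k + 1) mod ?n, (1 + k) mod ?n, False)" if k: "k < length w" "w ! k = Out y" for k y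
  proof -
    have "y \<in> set (wouts w)" using k by (metis mem_Collect_eq nth_mem set_wouts)
    then have "\<gamma>0 y = leg_color L (L ! (k + 1))" using gO[OF wl(2)[OF k(1)]] wl(1)[OF k(1)] k(2) wo by simp
    moreover obtain i where "L ! (k + 1) = Out i" using wl(1)[OF k(1)] k(2) by (cases "L ! (k + 1)") auto
    ultimately show ?thesis using wl(3)[OF k(1)] k(1) lw by simp
  qed
  have n0: "?n > 0" using lw by simp
  obtain \<gamma> where \<gamma>: "good \<gamma> cs" "\<And>x. x \<notin> set (outl cs) \<or> x \<in> set (wouts w) \<Longrightarrow> \<gamma> x = \<gamma>0 x"
    "\<gamma> f = (0, (1 + length w) mod ?n, False)" "\<forall>x\<in>set (outl cs). \<gamma> x \<in> colors ?n"
    using good_strand_exists[where \<delta> = \<gamma>0 and \<alpha> = 0 and \<beta> = 1 and n = "?n", OF g(6) dist gs n0 n0 hI hO] by blast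
  have bI: "\<gamma> (I ! j) = leg_color L (In j)" if "j < b" for j
  proof -
    have "I ! j \<notin> set (outl cs)" using d(3) that g(1) nth_mem by blast
    then show ?thesis using \<gamma>(2)[of "I ! j"] gI[of "In j"] L(2) that by simp
  qed
  have bJ: "\<gamma> (J ! p) = leg_color L (Out p)" if p: "p < a" for p
  proof -
    have l: "Out p \<in> set L" using L(2) p by simp
    then have "?g (Out p) \<in> set (In s # w @ [Out f])" unfolding g(7) by (metis image_eqI set_map)
    then consider "Out (J ! p) \<in> set w" | "J ! p = f" by auto
    then show ?thesis
    proof cases
      case 1
      then have "J ! p \<in> set (wouts w)" by (simp add: set_wouts)
      then show ?thesis using \<gamma>(2)[of "J ! p"] gO[OF l, of "J ! p"] wo by simp
    next
      case 2
      then have "?g (Out p) = ?g (L ! (length w + 1))" using fl(1) by simp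
      then have "L ! (length w + 1) = Out p" using inj_onD[OF inj _ l fl(2)] by metis
      then have "pos L (Out p) = length w + 1" using fl(3) by simp
      then show ?thesis using \<gamma>(3) 2 lw by simp
    qed
  qed
  show ?thesis
  proof (rule Z_unique_good[OF g(4,3) \<gamma>(1)])
    show "\<gamma> x \<in> colors ?n" if "x \<in> set I \<union> set (outl cs)" for x
    proof (cases "x \<in> set (outl cs)")
      case False
      then have "x \<in> set I" using that by blast
      then obtain j where "j < b" "x = I ! j" using g(1) by (auto simp: in_set_conv_nth)
      then show ?thesis using bI[of j] leg_color_in[OF L(1), of "In j"] L(2) by simp
    qed (use \<gamma>(4) in blast)
    fix \<gamma>' assume g': "good \<gamma>' cs" "\<And>j. j < length I \<Longrightarrow> \<gamma>' (I ! j) = leg_color L (In j)" "\<And>p. p < length J \<Longrightarrow> \<gamma>' (J ! p) = leg_color L (Out p)"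
    have eI: "\<gamma>' x = \<gamma> x" if "x \<in> set I" for x
      using that g'(2) bI g(1) by (auto simp: in_set_conv_nth)
    have eJ: "\<gamma>' x = \<gamma> x" if "x \<in> set J" for x
      using that g'(3) bJ g(2) by (auto simp: in_set_conv_nth)
    have "\<forall>x\<in>set (outl cs). \<gamma>' x = \<gamma> x"
    proof (rule good_strand_unique[OF g(6) \<gamma>(1) g'(1)])
      show "\<gamma>' s = \<gamma> s" using eI wI by simp
      have "s \<notin> set (outl cs)" using wI d(3) by auto
      then show "\<not> occ (\<gamma> s)" using \<gamma>(2)[of s] gs by simp
      show "\<gamma>' x = \<gamma> x \<and> occ (\<gamma> x)" if x: "In x \<in> set w" for x
      proof -
        have xI: "x \<in> set I" using x wI by (auto simp: set_wins)
        then have "x \<notin> set (outl cs)" using d(3) by blast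
        moreover obtain k where "k < length w" "w ! k = In x" using x by (auto simp: in_set_conv_nth)
        ultimately show ?thesis using eI[OF xI] \<gamma>(2)[of x] hI by simp
      qed
      show "\<gamma>' x = \<gamma> x \<and> \<not> occ (\<gamma> x)" if x: "Out x \<in> set w" for x
      proof -
        have "Out x \<in> set (In s # w @ [Out f])" using x by simp
        then have "Out x \<in> ?g ` set L" unfolding g(7) by simp
        then have xJ: "x \<in> set J" using L(2) g(2) by auto
        obtain k where "k < length w" "w ! k = Out x" using x by (auto simp: in_set_conv_nth)
        then show ?thesis using eJ[OF xJ] \<gamma>(2)[of x] hO x by (simp add: set_wouts)
      qed
    qed
    then show "\<forall>x\<in>set I \<union> set (outl cs). \<gamma>' x = \<gamma> x" using eI by blast
  qed (use bI bJ g(1,2) in auto)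
qed

section \<open>Injectivity\<close>

text \<open>
  Only those rotations that are again words of combs, that is, begin with an input and end with
  an output.
\<close>

definition rotations :: "nat \<Rightarrow> nat \<Rightarrow> letter list \<Rightarrow> letter list set" where
  "rotations a b L = {L'. (\<exists>k. L' = rotate k L) \<and> (\<exists>H. comb_graph a b L' H)}"

definition representatives :: "nat \<Rightarrow> nat \<Rightarrow> letter list set" where
  "representatives a b = (\<lambda>L. SOME L'. L' \<in> rotations a b L) ` {L. \<exists>H. comb_graph a b L H}"

definition the_comb :: "nat \<Rightarrow> nat \<Rightarrow> letter list \<Rightarrow> graph" where
  "the_comb a b L = (SOME H. comb_graph a b L H)"

lemma rotations_rotate:
  assumes "L' = rotate k L"
  shows "rotations a b L' = rotations a b L"
proof -
  have "\<exists>m. L = rotate m L'"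
  proof (cases "L = []")
    case False
    let ?m = "k mod length L"
    have "rotate (length L - ?m) L' = rotate (length L - ?m) (rotate ?m L)"
      unfolding assms by (simp flip: rotate_conv_mod)
    also have "\<dots> = rotate (length L) L" using False by (simp add: rotate_rotate)
    finally show ?thesis by (intro exI[of _ "length L - ?m"]) simp
  qed (simp add: assms)
  then obtain m where "L = rotate m L'" by blast
  then have "(\<exists>i. M = rotate i L') \<longleftrightarrow> (\<exists>i. M = rotate i L)" for M
    using assms by (metis rotate_rotate)
  then show ?thesis by (simp add: rotations_def)
qed

lemma representative:
  assumes "comb_graph a b L H"
  shows "\<exists>k. rotate k L \<in> representatives a b"
proof -
  have "L \<in> rotations a b L" using assms by (auto simp: rotations_def intro: exI[of _ 0])
  then have "(SOME L'. L' \<in> rotations a b L) \<in> rotations a b L" by (rule someI)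
  then obtain k where "(SOME L'. L' \<in> rotations a b L) = rotate k L" by (auto simp: rotations_def)
  then show ?thesis using assms unfolding representatives_def by (metis (mono_tags, lifting) image_eqI mem_Collect_eq)
qed

lemma representatives_comb:
  assumes "r \<in> representatives a b"
  shows "comb_graph a b r (the_comb a b r)" "r = (SOME L'. L' \<in> rotations a b r)"
proof -
  obtain L H where L: "comb_graph a b L H" "r = (SOME L'. L' \<in> rotations a b L)"
    using assms by (auto simp: representatives_def)
  have "L \<in> rotations a b L" using L(1) by (auto simp: rotations_def intro: exI[of _ 0])
  then have "r \<in> rotations a b L" unfolding L(2) by (rule someI)
  then obtain k H' where k: "r = rotate k L" "comb_graph a b r H'" by (auto simp: rotations_def)
  show "comb_graph a b r (the_comb a b r)" unfolding the_comb_def using k(2) by (rule someI)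
  show "r = (SOME L'. L' \<in> rotations a b r)" using L(2) rotations_rotate[OF k(1)] by simp
qed

lemma representatives_rotate:
  assumes "r \<in> representatives a b" "r' \<in> representatives a b" "r' = rotate k r"
  shows "r' = r"
  using representatives_comb(2)[OF assms(1)] representatives_comb(2)[OF assms(2)] rotations_rotate[OF assms(3)] by metis

lemma finite_representatives: "finite (representatives a b)"
proof (rule finite_subset)
  let ?legs = "In ` {..<b} \<union> Out ` {..<a}"
  show "representatives a b \<subseteq> {L. set L \<subseteq> ?legs \<and> length L \<le> card ?legs}"
  proof
    fix L assume "L \<in> representatives a b"
    then have "distinct L" "set L = ?legs" using representatives_comb(1) unfolding comb_graph_def by blast+
    then show "L \<in> {L. set L \<subseteq> ?legs \<and> length L \<le> card ?legs}" using distinct_card[of L] by simp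
  qed
  show "finite {L. set L \<subseteq> ?legs \<and> length L \<le> card ?legs}" by (rule finite_lists_length_le) simp
qed

lemma graph_spanned:
  assumes "G \<in> cgraphs bib_gens a b"
  shows "\<exists>r c. (r \<in> representatives a b \<or> c = 0) \<and>
    null bib_gens (bib_rels :: 'k::field_char_0 lin set) a b (single1 G - scale c (single1 (the_comb a b r)))"
proof -
  let ?R = "bib_rels :: 'k lin set"
  from cgraph_comb[OF assms, where 'k = 'k] show ?thesis
  proof
    assume "null bib_gens ?R a b (single1 G)"
    moreover have "scale (0::'k) x = 0" for x by (intro poly_mapping_eqI) simp
    ultimately show ?thesis by (intro exI[of _ "[]"] exI[of _ 0]) simp
  next
    assume "\<exists>L H. comb_graph a b L H \<and> prop_to ?R False a b G H"
    then obtain L H where L: "comb_graph a b L H" "prop_to ?R False a b G H" by blast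
    obtain k where k: "rotate k L \<in> representatives a b" using representative[OF L(1)] by blast
    note rc = representatives_comb(1)[OF k]
    obtain i M p where "rotate k L = In i # M @ [Out p]" using comb_graph_shape[OF rc] by blast
    from comb_graph_rotate[OF L(1) this, where 'k = 'k] obtain H' where H': "comb_graph a b (rotate k L) H'" "prop_to ?R False a b H H'" by blast
    have "prop_to ?R False a b H' (the_comb a b (rotate k L))"
      by (rule prop_to_iso[OF comb_graph_cgraphs[OF H'(1)] comb_graph_cgraphs[OF rc] comb_graph_iso[OF H'(1) rc]])
    from prop_to_trans[OF prop_to_trans[OF L(2) H'(2)] this]
    show ?thesis using k unfolding prop_to_def by blast
  qed
qed

lemma spanned:
  assumes "x \<in> free bib_gens a b"
  shows "\<exists>d. null bib_gens (bib_rels :: 'k::field_char_0 lin set) a b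
    (x - (\<Sum>r\<in>representatives a b. scale (d r) (single1 (the_comb a b r))))"
proof -
  let ?T = "\<lambda>d. \<Sum>r\<in>representatives a b. scale (d r) (single1 (the_comb a b r)) :: 'k lin"
  let ?N = "null bib_gens (bib_rels :: 'k lin set) a b"
  note fin = finite_representatives[of a b]
  have lT: "Poly_Mapping.lookup (?T d) K = (\<Sum>r\<in>representatives a b. d r * Poly_Mapping.lookup (single1 (the_comb a b r)) K)" for d K
    by (simp add: lookup_sum)
  have T_add: "?T (\<lambda>r. d r + e r) = ?T d + ?T e" for d e
    by (intro poly_mapping_eqI) (simp add: lT lookup_add distrib_right sum.distrib)
  have T_scale: "?T (\<lambda>r. c * d r) = scale c (?T d)" for c d
    by (intro poly_mapping_eqI) (simp add: lT sum_distrib_left mult.assoc)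
  have T_zero: "?T (\<lambda>r. 0) = 0" by (intro poly_mapping_eqI) (simp add: lT)
  have single: "\<exists>d. ?N (single1 G - ?T d)" if G: "G \<in> cgraphs bib_gens a b" for G
  proof -
    obtain r c where rc: "r \<in> representatives a b \<or> c = 0" "?N (single1 G - scale c (single1 (the_comb a b r)))"
      using graph_spanned[OF G, where 'k = 'k] by blast
    have "?T (\<lambda>r'. if r' = r then c else 0) = scale c (single1 (the_comb a b r))"
      using rc(1) fin by (intro poly_mapping_eqI) (auto simp: lT if_distrib[of "\<lambda>u. u * _"] sum.delta cong: if_cong)
    then show ?thesis using rc(2) by metis
  qed
  have "\<exists>d. ?N ((\<Sum>G\<in>A. scale (Poly_Mapping.lookup x G) (single1 G)) - ?T d)" if "finite A" "A \<subseteq> Poly_Mapping.keys x" for A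
    using that
  proof (induction A rule: finite_induct)
    case empty
    then show ?case by (intro exI[of _ "\<lambda>_. 0"]) (simp only: T_zero sum.empty diff_self null_zero)
  next
    case (insert G A)
    then obtain d where d: "?N ((\<Sum>G\<in>A. scale (Poly_Mapping.lookup x G) (single1 G)) - ?T d)" by auto
    have "G \<in> cgraphs bib_gens a b" using insert.prems assms by (auto simp: free_def)
    then obtain e where e: "?N (single1 G - ?T e)" using single by blast
    let ?c = "Poly_Mapping.lookup x G"
    have "?N (scale ?c (single1 G - ?T e) + ((\<Sum>G\<in>A. scale (Poly_Mapping.lookup x G) (single1 G)) - ?T d))"
      by (rule null_add[OF null_scale[OF e] d])
    also have "scale ?c (single1 G - ?T e) + ((\<Sum>G\<in>A. scale (Poly_Mapping.lookup x G) (single1 G)) - ?T d) =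
      (\<Sum>G\<in>insert G A. scale (Poly_Mapping.lookup x G) (single1 G)) - ?T (\<lambda>r. ?c * e r + d r)"
      using insert.hyps by (simp add: T_add T_scale scale_diff)
    finally show ?case by (rule exI[where x = "\<lambda>r. ?c * e r + d r"])
  qed
  from this[OF finite_keys order.refl] obtain d where
    "?N ((\<Sum>G\<in>Poly_Mapping.keys x. scale (Poly_Mapping.lookup x G) (single1 G)) - ?T d)" by blast
  moreover have "(\<Sum>G\<in>Poly_Mapping.keys x. scale (Poly_Mapping.lookup x G) (single1 G)) = x"
  proof (rule poly_mapping_eqI)
    fix K
    have "(\<Sum>G\<in>Poly_Mapping.keys x. Poly_Mapping.lookup x G * Poly_Mapping.lookup (single1 G) K) =
      (\<Sum>G\<in>Poly_Mapping.keys x. if G = K then Poly_Mapping.lookup x G else 0)"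
      by (intro sum.cong refl) (simp add: single1_def lookup_single when_def)
    also have "\<dots> = Poly_Mapping.lookup x K" by (simp add: in_keys_iff)
    finally show "Poly_Mapping.lookup (\<Sum>G\<in>Poly_Mapping.keys x. scale (Poly_Mapping.lookup x G) (single1 G)) K = Poly_Mapping.lookup x K"
      by (simp add: lookup_sum)
  qed
  ultimately show ?thesis by auto
qed

text \<open>
  The state sum at the state of a representative \<open>r\<close> isolates the coefficient of
  the comb of \<open>r\<close>.
\<close>

theorem unital_null:
  assumes x: "x \<in> free bib_gens a b" and null: "null ubib_gens (bib_rels \<union> unit_rels) a b x"
  shows "null bib_gens (bib_rels :: 'k::field_char_0 lin set) a b x"
proof -
  let ?Reps = "representatives a b"
  obtain d where d: "null bib_gens (bib_rels :: 'k lin set) a b (x - (\<Sum>r\<in>?Reps. scale (d r) (single1 (the_comb a b r))))"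
    using spanned[OF x] by blast
  let ?T = "\<Sum>r\<in>?Reps. scale (d r) (single1 (the_comb a b r)) :: 'k lin"
  have "null ubib_gens (bib_rels \<union> unit_rels) a b (x - ?T)" by (rule null_mono[OF d gens_mono]) simp
  from null_minus[OF null this] have T: "null ubib_gens (bib_rels \<union> unit_rels) a b ?T" by simp
  have "d r = 0" if r: "r \<in> ?Reps" for r
  proof -
    note rc = representatives_comb(1)[OF r]
    have L: "distinct r" "set r = In ` {..<b} \<union> Out ` {..<a}" using rc by (simp_all add: comb_graph_def)
    have "length r > 0" using comb_graph_shape[OF rc] by auto
    then have "Zlin (length r) ?T (\<lambda>p. leg_color r (Out p)) (\<lambda>i. leg_color r (In i)) = 0"
      by (intro null_state_sum[OF T] leg_color_in[OF L(1)]) (simp_all add: L(2))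
    then have "(\<Sum>r'\<in>?Reps. d r' * of_int (word_sum r (the_comb a b r'))) = 0"
      by (simp only: Zlin_sum Zlin_scale Zlin_single1)
    moreover have "d r' * of_int (word_sum r (the_comb a b r')) = 0" if "r' \<in> ?Reps - {r}" for r'
    proof -
      have r': "comb_graph a b r' (the_comb a b r')" using representatives_comb(1) that by blast
      then have "set r' = set r" using L(2) by (simp add: comb_graph_def)
      then have "word_sum r (the_comb a b r') = 0"
        using word_sum_rotation[OF L(1) r'] representatives_rotate[OF r] that by blast
      then show ?thesis by simp
    qed
    then have "(\<Sum>r'\<in>?Reps - {r}. d r' * of_int (word_sum r (the_comb a b r'))) = 0" by (intro sum.neutral) blast
    ultimately have "d r * of_int (word_sum r (the_comb a b r)) = 0"
      unfolding sum.remove[OF finite_representatives r] by (simp only: add_0_right)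
    then show ?thesis using word_sum_nonzero[OF rc] by simp
  qed
  then have "?T = 0" by (intro sum.neutral poly_mapping_eqI ballI) simp
  then show ?thesis using d by simp
qed

theorem theorem22:
  shows "properad_hom (BIB :: ('k::field_char_0, 'k lin set) properad) uBIB iota \<and>
    (\<forall>g\<in>bib_gens. iota (n_out g) (n_in g) (gen_class bib_gens (bib_rels :: 'k lin set) g) =
       gen_class ubib_gens (bib_rels \<union> unit_rels) g) \<and>
    (\<forall>a b. inj_on (iota a b) (elems (BIB :: ('k, 'k lin set) properad) a b))"
proof (intro conjI allI ballI)
  show "properad_hom (BIB :: ('k, 'k lin set) properad) uBIB iota" by (rule iota_hom)
  show "iota (n_out g) (n_in g) (gen_class bib_gens (bib_rels :: 'k lin set) g) =
       gen_class ubib_gens (bib_rels \<union> unit_rels) g" if "g \<in> bib_gens" for g by (rule iota_gen_class[OF that])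
  show "inj_on (iota a b) (elems (BIB :: ('k, 'k lin set) properad) a b)" for a b
  proof (rule inj_onI)
    let ?C = "congr bib_gens (bib_rels :: 'k lin set) a b" and ?U = "congr ubib_gens (bib_rels \<union> unit_rels :: 'k lin set) a b"
    fix X Y assume "X \<in> elems (BIB :: ('k, 'k lin set) properad) a b" "Y \<in> elems (BIB :: ('k, 'k lin set) properad) a b"
      and e: "iota a b X = iota a b Y"
    then obtain x y where x: "x \<in> free bib_gens a b" "X = ?C `` {x}" and y: "y \<in> free bib_gens a b" "Y = ?C `` {y}"
      unfolding BIB_def elems_presented by blast
    have "?U `` {x} = ?U `` {y}" using e iota_class[OF x(1)] iota_class[OF y(1)] by (simp add: x y)
    moreover have "y \<in> ?U `` {y}" using y(1) free_mono[OF gens_mono] by (intro class_self) blast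
    ultimately have "null ubib_gens (bib_rels \<union> unit_rels) a b (x - y)" by (auto simp: congr_iff)
    then have "null bib_gens (bib_rels :: 'k lin set) a b (x - y)"
      by (rule unital_null[OF free_minus[OF x(1) y(1)]])
    then have "(x, y) \<in> ?C" using x(1) y(1) by (simp add: congr_iff)
    then show "X = Y" unfolding x(2) y(2) by (rule equiv_class_eq[OF equiv_congr])
  qed
qed

end
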